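(* Let $f\colon \mathbb{N} \to \mathbb{N}$ be monotone increasing (i.e. nondecreasing) with $1 \leq f(k) \leq (k-4)/2$ for all $k\ge 6$. Then $\#\mathrm{IndSub}(\Psi_f)$ can be solved in time $O(k\, n^{f(k) + 3})$, and, assuming the Exponential-Time Hypothesis, it cannot be solved in time $O(n^{\alpha \cdot f(k)})$ for a fixed constant $\alpha>0$.
   Context: Graphs are finite, simple and undirected; $\mathbb{N}=\{1,2,3,\dots\}$. For $\ell\in\mathbb{N}$, an $\ell$-scorpion is a graph $H$ with $|V(H)|\ge \ell+4$ that admits a tuple of pairwise distinct vertices $(b,t_1,\dots,t_\ell,s)\in V(H)^{\ell+2}$ such that, writing $Q=\{b,t_1,\dots,t_\ell,s\}$ and calling the vertices in $V(H)\setminus Q$ legs: (i) $H[Q]$ is an induced path from $b$ to $s$; (ii) $b$ is adjacent to all legs; (iii) $b$ is the only vertex in $Q$ adjacent to legs. $\Psi_f$ denotes the graph property containing, for each $k\in\mathbb{N}$, exactly the $k$-vertex $f(k)$-scorpions. $\#\mathrm{IndSub}(\Psi_f)$ is the problem: given an $n$-vertex graph $G$ and a parameter $k\in\mathbb{N}$, compute the number of $k$-element subsets $X\subseteq V(G)$ such that the induced subgraph $G[X]$ satisfies $\Psi_f$, i.e. is an $f(k)$-scorpion. The Exponential-Time Hypothesis (ETH) asserts that there is some $\varepsilon>0$ such that satisfiability of $n$-variable $3$-CNF formulas cannot be decided in time $O(2^{\varepsilon n})$.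
   Formalization: The upper bound is false for uncomputable f, since a solver on (G,k) determines f(k); it is stated with the number f(k) supplied along with k, and for input exactly (G,k) provided f(k) can be computed from k in time O(k·k^(f(k)+3)). *)

theory Defs
  imports Complex_Main
begin

section \<open>Graphs, scorpions and induced subgraph counts\<close>

type_synonym 'a graph = "'a set \<times> 'a set set"

abbreviation verts :: "'a graph \<Rightarrow> 'a set" where "verts \<equiv> fst"
abbreviation edges :: "'a graph \<Rightarrow> 'a set set" where "edges \<equiv> snd"

definition simple_graph :: "'a graph \<Rightarrow> bool" where
  "simple_graph G \<longleftrightarrow> finite (verts G) \<and> (\<forall>e\<in>edges G. e \<subseteq> verts G \<and> card e = 2)"

definition adj :: "'a graph \<Rightarrow> 'a \<Rightarrow> 'a \<Rightarrow> bool" where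
  "adj G u v \<longleftrightarrow> {u, v} \<in> edges G"

definition induced :: "'a graph \<Rightarrow> 'a set \<Rightarrow> 'a graph" where
  "induced G X = (X, {e \<in> edges G. e \<subseteq> X})"

text \<open>The list \<open>qs\<close> enumerates, without repetition, an induced path of \<open>G\<close> from its first to
  its last entry.\<close>
definition induced_path :: "'a graph \<Rightarrow> 'a list \<Rightarrow> bool" where
  "induced_path G qs \<longleftrightarrow> distinct qs \<and> set qs \<subseteq> verts G \<and>
     (\<forall>i j. i < j \<and> j < length qs \<longrightarrow> (adj G (qs ! i) (qs ! j) \<longleftrightarrow> j = Suc i))"

definition scorpion :: "nat \<Rightarrow> 'a graph \<Rightarrow> bool" where
  "scorpion l H \<longleftrightarrow> simple_graph H \<and> card (verts H) \<ge> l + 4 \<and>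
     (\<exists>b ts s. length ts = l \<and>
        (let Q = set (b # ts @ [s]); legs = verts H - Q in
           induced_path H (b # ts @ [s]) \<and>
           (\<forall>v\<in>legs. adj H b v) \<and>
           (\<forall>q\<in>Q. \<forall>v\<in>legs. adj H q v \<longrightarrow> q = b)))"

definition Psi :: "(nat \<Rightarrow> nat) \<Rightarrow> 'a graph \<Rightarrow> bool" where
  "Psi f H \<longleftrightarrow> scorpion (f (card (verts H))) H"

definition num_IndSub :: "('a graph \<Rightarrow> bool) \<Rightarrow> 'a graph \<Rightarrow> nat \<Rightarrow> nat" where
  "num_IndSub \<Phi> G k = card {X. X \<subseteq> verts G \<and> card X = k \<and> \<Phi> (induced G X)}"


section \<open>Random access machines\<close>

text \<open>
  Running times refer to the uniform-cost RAM with addition, truncated subtraction and halving,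
  but no multiplication. Apart from the constants of the program, no step makes the largest number
  more than one bit longer, so that the RAM and Turing machines simulate each other with polynomial
  overhead (with unit-cost multiplication this would not be expected, and the Exponential-Time
  Hypothesis would change its meaning). The memory maps addresses to natural numbers. In \<open>Load\<close> and \<open>Store\<close> the second,
  respectively first, argument is the register holding the address.
\<close>

datatype instr =
    Const nat nat
  | Add nat nat nat
  | Sub nat nat nat
  | Half nat nat
  | Load nat nat
  | Store nat nat
  | Jzero nat nat

type_synonym memory = "nat \<Rightarrow> nat"

fun exec :: "instr \<Rightarrow> nat \<times> memory \<Rightarrow> nat \<times> memory" where
  "exec (Const i c) (pc, m) = (Suc pc, m(i := c))"
| "exec (Add i j k) (pc, m) = (Suc pc, m(i := m j + m k))"
| "exec (Sub i j k) (pc, m) = (Suc pc, m(i := m j - m k))"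
| "exec (Half i j)  (pc, m) = (Suc pc, m(i := m j div 2))"
| "exec (Load i j)  (pc, m) = (Suc pc, m(i := m (m j)))"
| "exec (Store i j) (pc, m) = (Suc pc, m(m i := m j))"
| "exec (Jzero i l) (pc, m) = (if m i = 0 then l else Suc pc, m)"

definition step :: "instr list \<Rightarrow> nat \<times> memory \<Rightarrow> nat \<times> memory" where
  "step p c = (if fst c < length p then exec (p ! fst c) c else c)"

text \<open>Started at instruction 0 with the words \<open>xs\<close> at the addresses 0, 1, ... and all other cells
  zero, the program leaves its code within at most \<open>T\<close> steps, with \<open>y\<close> at address 0.\<close>
definition outputs_within :: "instr list \<Rightarrow> nat list \<Rightarrow> nat \<Rightarrow> real \<Rightarrow> bool" where
  "outputs_within p xs y T \<longleftrightarrow>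
     (\<exists>t. real t \<le> T \<and>
        (let (pc, m) = (step p ^^ t) (0, \<lambda>a. if a < length xs then xs ! a else 0)
         in length p \<le> pc \<and> m 0 = y))"

definition computable_in_time :: "(nat \<Rightarrow> nat) \<Rightarrow> (nat \<Rightarrow> real) \<Rightarrow> bool" where
  "computable_in_time f T \<longleftrightarrow>
     (\<exists>p C. \<forall>k\<ge>1. outputs_within p [k] (f k) (C * T k))"


section \<open>The problem \#IndSub\<close>

definition adj_matrix :: "nat \<Rightarrow> nat graph \<Rightarrow> nat list" where
  "adj_matrix n G =
     concat (map (\<lambda>u. map (\<lambda>v. if adj G u v then 1 else 0) [0..<n]) [0..<n])"

text \<open>
  One program and one constant \<open>C\<close> have to work for all parameters \<open>k \<in> K\<close> and all nonempty
  graphs; so \<open>K = {1..}\<close> is the full problem and \<open>K = {k}\<close> its restriction to a fixed \<open>k\<close>, where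
  program and constant may depend on \<open>k\<close>.

  The number \<open>h k\<close> is supplied to the program next to \<open>k\<close>. Taking \<open>h = (\<lambda>_. 0)\<close> gives
  the problem whose input is just \<open>(G, k)\<close>; taking \<open>h = f\<close> gives algorithms for \<open>Psi f\<close>
  that know the number \<open>f k\<close>. The latter is needed for \<open>f\<close> that are not (efficiently)
  computable: the number of sets counted in a \<open>k\<close>-vertex \<open>l\<close>-scorpion tells whether \<open>f k = l\<close>, so
  algorithms for the former can be used to compute \<open>f\<close>.
\<close>
definition IndSub_solvable ::
  "(nat \<Rightarrow> nat) \<Rightarrow> (nat graph \<Rightarrow> bool) \<Rightarrow> nat set \<Rightarrow> (nat \<Rightarrow> nat \<Rightarrow> real) \<Rightarrow> bool" where
  "IndSub_solvable h \<Phi> K T \<longleftrightarrow>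
     (\<exists>p C. \<forall>k\<in>K. \<forall>n\<ge>1. \<forall>G. simple_graph G \<and> verts G = {..<n} \<longrightarrow>
        outputs_within p ([n, k, h k] @ adj_matrix n G) (num_IndSub \<Phi> G k) (C * T n k))"


section \<open>The Exponential-Time Hypothesis\<close>

text \<open>A literal is a variable together with its sign. Repeated literals are allowed in a clause, so
  clauses have at most three literals. Formulas are lists of pairwise different clauses:
  if clauses could be repeated, the input length would not be bounded in terms of the number \<open>n\<close>
  of variables, and the hypothesis would hold for the wrong reason.\<close>

type_synonym literal = "nat \<times> bool"
type_synonym clause = "literal \<times> literal \<times> literal"

fun clause_lits :: "clause \<Rightarrow> literal list" where
  "clause_lits (x, y, z) = [x, y, z]"

definition cnf3 :: "nat \<Rightarrow> clause list \<Rightarrow> bool" where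
  "cnf3 n F \<longleftrightarrow> distinct F \<and> (\<forall>c\<in>set F. \<forall>x\<in>set (clause_lits c). fst x < n)"

definition satisfiable :: "clause list \<Rightarrow> bool" where
  "satisfiable F \<longleftrightarrow>
     (\<exists>\<beta> :: nat \<Rightarrow> bool. \<forall>c\<in>set F. \<exists>x\<in>set (clause_lits c). \<beta> (fst x) = snd x)"

definition cnf_code :: "nat \<Rightarrow> clause list \<Rightarrow> nat list" where
  "cnf_code n F = [n, length F] @
     concat (map (\<lambda>c. map (\<lambda>(v, sg). 2 * v + (if sg then 1 else 0)) (clause_lits c)) F)"

definition ETH :: bool where
  "ETH \<longleftrightarrow> (\<exists>\<epsilon>>0. \<not> (\<exists>p C. \<forall>n F. cnf3 n F \<longrightarrow>
     outputs_within p (cnf_code n F) (if satisfiable F then 1 else 0)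
       (C * 2 powr (\<epsilon> * real n))))"

end

theory Submission
  imports Defs
begin

text \<open>
  For \<open>l \<ge> 1\<close> the path of an \<open>l\<close>-scorpion is determined by its vertex set. So the number of induced
  scorpions is the sum, over all tuples of \<open>l + 2\<close> vertices that form an induced path, of the number of
  ways to choose the legs among the vertices that are adjacent to exactly the first vertex of the path.
  Enumerating the tuples gives the upper bound.

  For the lower bound let an algorithm with time \<open>n powr (\<alpha> * l)\<close> be given. If \<open>\<alpha> * l < 1\<close>, then it does
  not even read enough of the adjacency matrix. Otherwise it decides satisfiability as follows. Sparsification
  reduces a formula to \<open>2 powr (\<epsilon> * n)\<close> formulas with \<open>O(n)\<close> clauses. The clauses of such a formula are
  divided into \<open>g \<ge> l / 4\<close> groups. For each group there is a clique whose vertices choose a literal from every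
  clause of the group, and contradictory choices of different groups are adjacent. The graph is
  built such that it contains an induced scorpion if and only if its path can pass through one vertex of
  every clique, that is, if and only if there are choices without contradictions. It has
  \<open>2 powr O(n / l)\<close> vertices, so the algorithm takes time \<open>2 powr O(\<alpha> * n)\<close>.
\<close>

section \<open>A while language over infinitely many arrays and its compilation\<close>

text \<open>The danger in the construction is an induced path that cheats: it may take several
  vertices of a clique, skip positions, or jump along conflict edges. Since cliques are three
  positions apart, a second vertex of a clique blocks two positions that border no other clique, and
  a path of the required length has no position to spare. The exponents balance as follows. About
  \<open>l\<close> groups give \<open>2 powr O(n / l)\<close> vertices. The algorithm raises this to
  the power \<open>\<alpha> * l\<close>, which costs \<open>2 powr O(\<alpha> * n)\<close> uniformly
  in \<open>l\<close>; building the graph costs \<open>2 powr O(n / l)\<close>, which is affordable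
  once \<open>1 / l \<le> \<alpha>\<close>. All other \<open>l\<close> fall under the sublinear
  case, so a single \<alpha> serves all \<open>f\<close> and even every fixed \<open>k\<close>. Most
  of the length is due to the machine model. The upper bound tolerates only constant overhead, the
  input occupies the cells where a program would keep its registers, and there is no multiplication:
  products are tabulated, array strides are powers of two, and choices are coded in base 4.\<close>

text \<open>In a state \<open>s\<close>, cell \<open>i\<close> of array \<open>j\<close> has the value \<open>s j i\<close>. Registers are arrays of which only
  cell 0 is used.\<close>

type_synonym st = "nat \<Rightarrow> nat \<Rightarrow> nat"

datatype wexp = Cn nat | Rd nat wexp | Pl wexp wexp | Mi wexp wexp | Hf wexp

primrec wval :: "wexp \<Rightarrow> st \<Rightarrow> nat" where
  "wval (Cn c) s = c"
| "wval (Rd j e) s = s j (wval e s)"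
| "wval (Pl a b) s = wval a s + wval b s"
| "wval (Mi a b) s = wval a s - wval b s"
| "wval (Hf a) s = wval a s div 2"

datatype wcom = Skp | Wr nat wexp wexp | Sq wcom wcom (infixr ";;" 60)
  | IfC wexp wcom wcom | WhileC wexp wcom

abbreviation put :: "st \<Rightarrow> nat \<Rightarrow> nat \<Rightarrow> nat \<Rightarrow> st" where
  "put s j i v \<equiv> s(j := (s j)(i := v))"

text \<open>An assignment counts as one step however large its expressions are: these are fixed by
  the program, so compilation turns a step into boundedly many instructions.\<close>

inductive wexec :: "wcom \<Rightarrow> st \<Rightarrow> nat \<Rightarrow> st \<Rightarrow> bool" where
  wSkp: "wexec Skp s 0 s"
| wWr: "wexec (Wr j a e) s 1 (put s j (wval a s) (wval e s))"
| wSq: "wexec c1 s t1 s1 \<Longrightarrow> wexec c2 s1 t2 s2 \<Longrightarrow> wexec (c1 ;; c2) s (t1 + t2) s2"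
| wIfT: "wval e s \<noteq> 0 \<Longrightarrow> wexec c1 s t s1 \<Longrightarrow> wexec (IfC e c1 c2) s (Suc t) s1"
| wIfF: "wval e s = 0 \<Longrightarrow> wexec c2 s t s1 \<Longrightarrow> wexec (IfC e c1 c2) s (Suc t) s1"
| wWhileF: "wval e s = 0 \<Longrightarrow> wexec (WhileC e c) s 1 s"
| wWhileT: "wval e s \<noteq> 0 \<Longrightarrow> wexec c s t1 s1 \<Longrightarrow> wexec (WhileC e c) s1 t2 s2 \<Longrightarrow>
    wexec (WhileC e c) s (Suc (t1 + t2)) s2"

inductive_cases wSkpE: "wexec Skp s t s'"
inductive_cases wWrE: "wexec (Wr j a e) s t s'"
inductive_cases wSqE: "wexec (c1 ;; c2) s t s'"
inductive_cases wIfE: "wexec (IfC e c1 c2) s t s'"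

text \<open>Execution is deterministic, so the existence of a good run already amounts to total
  correctness. \<open>T\<close> is only an upper bound, so that budgets can be weakened
  freely.\<close>

definition run :: "wcom \<Rightarrow> st \<Rightarrow> nat \<Rightarrow> (st \<Rightarrow> bool) \<Rightarrow> bool" where
  "run c s T Q \<longleftrightarrow> (\<exists>t s'. wexec c s t s' \<and> t \<le> T \<and> Q s')"

lemma run_mono: "run c s T Q \<Longrightarrow> T \<le> T' \<Longrightarrow> (\<And>s'. Q s' \<Longrightarrow> Q' s') \<Longrightarrow> run c s T' Q'"
  unfolding run_def by (meson le_trans)

lemma run_Skp [simp]: "run Skp s T Q \<longleftrightarrow> Q s"
  unfolding run_def by (auto intro: wSkp elim: wSkpE)

lemma wexec_Wr: "wexec (Wr j a e) s t s' \<longleftrightarrow> t = 1 \<and> s' = put s j (wval a s) (wval e s)"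
  using wWr[of j a e s] by (auto elim: wWrE)

lemma wexec_Sq: "wexec (c1 ;; c2) s t s' \<longleftrightarrow> (\<exists>t1 t2 s1. wexec c1 s t1 s1 \<and> wexec c2 s1 t2 s' \<and> t = t1 + t2)"
  by (auto elim!: wSqE intro: wSq)

lemma run_Wr [simp]: "run (Wr j a e) s T Q \<longleftrightarrow> 1 \<le> T \<and> Q (put s j (wval a s) (wval e s))"
  unfolding run_def wexec_Wr by simp

lemma run_Sq: "run c1 s T1 (\<lambda>s1. run c2 s1 T2 Q) \<Longrightarrow> run (c1 ;; c2) s (T1 + T2) Q"
  unfolding run_def by (meson wSq add_mono)

text \<open>This and the following equations make the simplifier a symbolic evaluator that spends
  the time budget on the way.\<close>

lemma run_Wr_Sq [simp]: "run (Wr j a e ;; c) s T Q \<longleftrightarrow> 1 \<le> T \<and> run c (put s j (wval a s) (wval e s)) (T - 1) Q"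
proof -
  let ?s = "put s j (wval a s) (wval e s)"
  have "run (Wr j a e ;; c) s T Q \<longleftrightarrow> (\<exists>t s'. wexec c ?s t s' \<and> Suc t \<le> T \<and> Q s')"
    unfolding run_def wexec_Sq wexec_Wr by auto
  also have "\<dots> \<longleftrightarrow> 1 \<le> T \<and> run c ?s (T - 1) Q"
    unfolding run_def by (cases T) auto
  finally show ?thesis .
qed

lemma run_Sq_assoc [simp]: "run ((a ;; b) ;; c) s T Q \<longleftrightarrow> run (a ;; b ;; c) s T Q"
proof -
  have "wexec ((a ;; b) ;; c) s t s' \<longleftrightarrow> wexec (a ;; b ;; c) s t s'" for t s'
  proof
    assume "wexec ((a ;; b) ;; c) s t s'"
    then obtain t1 t2 t3 s1 s2 where "wexec a s t1 s1" "wexec b s1 t2 s2" "wexec c s2 t3 s'" "t = t1 + t2 + t3"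
      by (elim wSqE) blast
    then show "wexec (a ;; b ;; c) s t s'"
      using wSq[of a s t1 s1 "b ;; c" "t2 + t3" s'] wSq[of b s1 t2 s2 c t3 s'] by (simp add: add.assoc)
  next
    assume "wexec (a ;; b ;; c) s t s'"
    then obtain t1 t2 t3 s1 s2 where "wexec a s t1 s1" "wexec b s1 t2 s2" "wexec c s2 t3 s'" "t = t1 + (t2 + t3)"
      by (elim wSqE) blast
    then show "wexec ((a ;; b) ;; c) s t s'"
      using wSq[of "a ;; b" s "t1 + t2" s2 c t3 s'] wSq[of a s t1 s1 b t2 s2] by (simp add: add.assoc)
  qed
  then show ?thesis unfolding run_def by simp
qed

lemma run_Skp_Sq [simp]: "run (Skp ;; c) s T Q \<longleftrightarrow> run c s T Q"
proof -
  have "wexec (Skp ;; c) s t s' \<longleftrightarrow> wexec c s t s'" for t s'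
    using wSq[OF wSkp, of c s t s'] by (auto elim!: wSqE wSkpE)
  then show ?thesis unfolding run_def by simp
qed

lemma wexec_IfC: "wexec (IfC e c1 c2) s t s' \<longleftrightarrow> (\<exists>t'. t = Suc t' \<and> wexec (if wval e s \<noteq> 0 then c1 else c2) s t' s')"
  by (auto elim!: wIfE intro: wIfT wIfF)

lemma run_IfC [simp]: "run (IfC e c1 c2) s T Q \<longleftrightarrow>
    1 \<le> T \<and> (if wval e s \<noteq> 0 then run c1 s (T - 1) Q else run c2 s (T - 1) Q)"
proof -
  let ?c = "if wval e s \<noteq> 0 then c1 else c2"
  have "run (IfC e c1 c2) s T Q \<longleftrightarrow> (\<exists>t s'. wexec ?c s t s' \<and> Suc t \<le> T \<and> Q s')"
    unfolding run_def wexec_IfC by blast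
  also have "\<dots> \<longleftrightarrow> 1 \<le> T \<and> run ?c s (T - 1) Q"
    unfolding run_def by (cases T) auto
  finally show ?thesis by simp
qed

primrec mods :: "wcom \<Rightarrow> nat set" where
  "mods Skp = {}"
| "mods (Wr j a e) = {j}"
| "mods (c1 ;; c2) = mods c1 \<union> mods c2"
| "mods (IfC e c1 c2) = mods c1 \<union> mods c2"
| "mods (WhileC e c) = mods c"

lemma wexec_frame: "wexec c s t s' \<Longrightarrow> j \<notin> mods c \<Longrightarrow> s' j = s j"
  by (induction rule: wexec.induct) auto

lemma run_frame: "run c s T Q \<Longrightarrow> run c s T (\<lambda>s'. Q s' \<and> (\<forall>j. j \<notin> mods c \<longrightarrow> s' j = s j))"
  unfolding run_def using wexec_frame by blast

text \<open>The budget \<open>B\<close> is a time bound for the rest of the loop; it also ensures termination.\<close>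
lemma run_While:
  assumes "\<And>s. I s \<Longrightarrow> wval e s \<noteq> 0 \<Longrightarrow> \<exists>T. run c s T (\<lambda>s'. I s' \<and> B s' + T + 1 \<le> B s)"
    and "\<And>s. I s \<Longrightarrow> 1 \<le> B s" and "I s"
    and "\<And>s. I s \<Longrightarrow> wval e s = 0 \<Longrightarrow> Q s" and "B s \<le> T"
  shows "run (WhileC e c) s T Q"
proof -
  have "run (WhileC e c) s (B s) (\<lambda>s. I s \<and> wval e s = 0)"
    using assms(3)
  proof (induction "B s" arbitrary: s rule: less_induct)
    case less
    show ?case
    proof (cases "wval e s = 0")
      case True
      then show ?thesis
        unfolding run_def
        by (intro exI[of _ 1] exI[of _ s]) (use True less.prems assms(2) wWhileF in auto)
    next
      case False
      obtain T where "run c s T (\<lambda>s'. I s' \<and> B s' + T + 1 \<le> B s)"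
        using assms(1)[OF less.prems False] ..
      then obtain t1 s1 where 1: "wexec c s t1 s1" "t1 \<le> T" "I s1" "B s1 + T + 1 \<le> B s"
        unfolding run_def by blast
      then have "run (WhileC e c) s1 (B s1) (\<lambda>s. I s \<and> wval e s = 0)"
        by (intro less.hyps) auto
      then obtain t2 s2 where 2: "wexec (WhileC e c) s1 t2 s2" "t2 \<le> B s1" "I s2 \<and> wval e s2 = 0"
        unfolding run_def by blast
      have "wexec (WhileC e c) s (Suc (t1 + t2)) s2"
        using False 1(1) 2(1) by (rule wWhileT)
      moreover have "Suc (t1 + t2) \<le> B s" using 1 2 by linarith
      ultimately show ?thesis
        using 2 unfolding run_def by blast
    qed
  qed
  then show ?thesis
    by (rule run_mono) (use assms in auto)
qed

abbreviation V :: "nat \<Rightarrow> wexp" where "V x \<equiv> Rd x (Cn 0)"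

abbreviation Asg :: "nat \<Rightarrow> wexp \<Rightarrow> wcom" (infix "::=" 61) where "x ::= e \<equiv> Wr x (Cn 0) e"

text \<open>The bound is evaluated anew in every round, which is why the rules for this loop oblige
  the body to preserve its value as well as the counter.\<close>

definition For :: "nat \<Rightarrow> wexp \<Rightarrow> wcom \<Rightarrow> wcom" where
  "For x e c = (x ::= Cn 0 ;; WhileC (Mi e (V x)) (c ;; x ::= Pl (V x) (Cn 1)))"

lemma mods_For [simp]: "mods (For x e c) = insert x (mods c)"
  by (auto simp: For_def)

lemma run_For:
  assumes e: "wval e (put s x 0 0) = n"
    and I0: "I 0 (put s x 0 0)"
    and step: "\<And>i s. i < n \<Longrightarrow> I i s \<Longrightarrow> s x 0 = i \<Longrightarrow> wval e s = n \<Longrightarrow>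
      run c s T (\<lambda>s'. s' x 0 = i \<and> wval e (put s' x 0 (Suc i)) = n \<and> I (Suc i) (put s' x 0 (Suc i)))"
    and Q: "\<And>s. I n s \<Longrightarrow> s x 0 = n \<Longrightarrow> Q s"
    and T: "n * (T + 2) + 2 \<le> T'"
  shows "run (For x e c) s T' Q"
proof -
  \<comment> \<open>The budget charges each remaining round the time \<open>T\<close> of the body,
    one step for the test and one for the increment; the last 1 pays for the failing test.\<close>
  have "run (WhileC (Mi e (V x)) (c ;; x ::= Pl (V x) (Cn 1))) (put s x 0 0) (n * (T + 2) + 1) Q"
  proof (rule run_While[where I = "\<lambda>s. s x 0 \<le> n \<and> wval e s = n \<and> I (s x 0) s"
        and B = "\<lambda>s. (n - s x 0) * (T + 2) + 1"])
    fix s assume s: "s x 0 \<le> n \<and> wval e s = n \<and> I (s x 0) s" "wval (Mi e (V x)) s \<noteq> 0"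
    obtain i where i: "s x 0 = i" by simp
    then have lt: "i < n" and Ii: "I i s" and en: "wval e s = n" using s by auto
    have B: "(n - Suc i) * (T + 2) + 1 + (T + 1) + 1 = (n - i) * (T + 2) + 1"
    proof -
      have "n - i = Suc (n - Suc i)" using lt by simp
      then show ?thesis by simp
    qed
    show "\<exists>T'. run (c ;; x ::= Pl (V x) (Cn 1)) s T' (\<lambda>s'. (s' x 0 \<le> n \<and> wval e s' = n \<and> I (s' x 0) s')
        \<and> (n - s' x 0) * (T + 2) + 1 + T' + 1 \<le> (n - s x 0) * (T + 2) + 1)"
    proof (rule exI[of _ "T + 1"], rule run_Sq, rule run_mono[OF step[OF lt Ii i en]])
      fix s' assume s': "s' x 0 = i \<and> wval e (put s' x 0 (Suc i)) = n \<and> I (Suc i) (put s' x 0 (Suc i))"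
      show "run (x ::= Pl (V x) (Cn 1)) s' 1 (\<lambda>s'. (s' x 0 \<le> n \<and> wval e s' = n \<and> I (s' x 0) s')
        \<and> (n - s' x 0) * (T + 2) + 1 + (T + 1) + 1 \<le> (n - s x 0) * (T + 2) + 1)"
        using s' lt B i by simp
    qed simp
  next
    fix s assume "s x 0 \<le> n \<and> wval e s = n \<and> I (s x 0) s" "wval (Mi e (V x)) s = 0"
    moreover then have "s x 0 = n" by simp
    ultimately show "Q s" using Q by auto
  qed (use e I0 in auto)
  then have "run (For x e c) s (1 + (n * (T + 2) + 1)) Q"
    unfolding For_def by simp
  then show ?thesis
    by (rule run_mono) (use T in auto)
qed

subsection \<open>Straight-line code\<close>

fun straight :: "instr \<Rightarrow> bool" where
  "straight (Jzero i l) = False"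
| "straight _ = True"

primrec slrun :: "instr list \<Rightarrow> memory \<Rightarrow> memory" where
  "slrun [] m = m"
| "slrun (i # is) m = slrun is (snd (exec i (0, m)))"

lemma slrun_append [simp]: "slrun (xs @ ys) m = slrun ys (slrun xs m)"
  by (induction xs arbitrary: m) auto

lemma exec_straight: "straight i \<Longrightarrow> exec i (pc, m) = (Suc pc, snd (exec i (0, m)))"
  by (cases i) auto

definition code_at :: "instr list \<Rightarrow> nat \<Rightarrow> instr list \<Rightarrow> bool" where
  "code_at p a is \<longleftrightarrow> (\<exists>xs ys. p = xs @ is @ ys \<and> length xs = a)"

lemma code_at_append [simp]: "code_at p a (is @ js) \<longleftrightarrow> code_at p a is \<and> code_at p (a + length is) js"
proof
  assume "code_at p a (is @ js)"
  then obtain xs ys where "p = xs @ is @ js @ ys" "length xs = a"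
    unfolding code_at_def by auto
  then show "code_at p a is \<and> code_at p (a + length is) js"
    unfolding code_at_def by (metis append.assoc length_append)
next
  assume "code_at p a is \<and> code_at p (a + length is) js"
  then obtain xs ys xs' ys' where *: "p = xs @ is @ ys" "length xs = a"
      "p = xs' @ js @ ys'" "length xs' = a + length is"
    unfolding code_at_def by blast
  then have "(xs @ is) @ ys = xs' @ (js @ ys')" "length (xs @ is) = length xs'" by auto
  then have "xs' = xs @ is" "js @ ys' = ys"
    by (subst (asm) append_eq_append_conv; simp)+
  then show "code_at p a (is @ js)"
    unfolding code_at_def using * by auto
qed

lemma code_at_Cons: "code_at p a (i # is) \<longleftrightarrow> code_at p a [i] \<and> code_at p (Suc a) is"
  using code_at_append[of p a "[i]" "is"] by simp

lemma code_at_Cons2: "code_at p a (i # j # is) \<longleftrightarrow> code_at p a [i] \<and> code_at p (Suc a) (j # is)"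
  by (rule code_at_Cons)

lemma code_at_single: "code_at p a [i] \<Longrightarrow> a < length p \<and> p ! a = i"
  unfolding code_at_def by auto

lemma step_code: "code_at p a [i] \<Longrightarrow> step p (a, m) = exec i (a, m)"
  using code_at_single unfolding step_def by fastforce

lemma funpow_add_app: "(f ^^ (a + b)) x = (f ^^ b) ((f ^^ a) x)"
  by (metis add.commute comp_apply funpow_add)

lemma funpow_trans: "(f ^^ a) x = y \<Longrightarrow> (f ^^ b) y = z \<Longrightarrow> (f ^^ (a + b)) x = z"
  by (simp add: funpow_add_app)

lemma step_straight:
  "code_at p a is \<Longrightarrow> list_all straight is \<Longrightarrow> (step p ^^ length is) (a, m) = (a + length is, slrun is m)"
proof (induction "is" arbitrary: a m)
  case (Cons i "is")
  have c: "code_at p a [i]" "code_at p (Suc a) is"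
    using Cons.prems(1) code_at_Cons by blast+
  have "(step p ^^ length (i # is)) (a, m) = (step p ^^ length is) (step p (a, m))"
    by (simp add: funpow_swap1)
  also have "step p (a, m) = (Suc a, snd (exec i (0, m)))"
    unfolding step_code[OF c(1)] by (rule exec_straight) (use Cons.prems in simp)
  also have "(step p ^^ length is) (Suc a, snd (exec i (0, m))) = (Suc a + length is, slrun is (snd (exec i (0, m))))"
    using Cons.prems(2) by (intro Cons.IH c(2)) simp
  finally show ?case
    by simp
qed simp

subsection \<open>Compilation\<close>

text \<open>Cell \<open>i\<close> of array \<open>j\<close> is stored at address \<open>2 ^ u * i + j\<close>. A program uses the arrays below
  \<open>B\<close>; the addresses from \<open>B\<close> to \<open>2 ^ u\<close> are temporaries.\<close>

definition rep :: "nat \<Rightarrow> nat \<Rightarrow> st \<Rightarrow> memory \<Rightarrow> bool" where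
  "rep u B s m \<longleftrightarrow> (\<forall>j<B. \<forall>i. m (2 ^ u * i + j) = s j i)"

text \<open>The stride of the arrays is a power of two because the machine cannot multiply:
  \<open>u\<close> doublings compute the address. Cell \<open>t + 1\<close> is sacrificed for the
  offset.\<close>

definition scale :: "nat \<Rightarrow> nat \<Rightarrow> nat \<Rightarrow> instr list" where
  "scale u j t = replicate u (Add t t t) @ [Const (Suc t) j, Add t t (Suc t)]"

primrec cexp :: "nat \<Rightarrow> wexp \<Rightarrow> nat \<Rightarrow> instr list" where
  "cexp u (Cn c) t = [Const t c]"
| "cexp u (Rd j e) t = cexp u e t @ scale u j t @ [Load t t]"
| "cexp u (Pl a b) t = cexp u a t @ cexp u b (Suc t) @ [Add t t (Suc t)]"
| "cexp u (Mi a b) t = cexp u a t @ cexp u b (Suc t) @ [Sub t t (Suc t)]"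
| "cexp u (Hf a) t = cexp u a t @ [Half t t]"

primrec depth :: "wexp \<Rightarrow> nat" where
  "depth (Cn c) = 0"
| "depth (Rd j e) = Suc (depth e)"
| "depth (Pl a b) = Suc (max (depth a) (depth b))"
| "depth (Mi a b) = Suc (max (depth a) (depth b))"
| "depth (Hf a) = depth a"

primrec arrs :: "wexp \<Rightarrow> nat set" where
  "arrs (Cn c) = {}"
| "arrs (Rd j e) = insert j (arrs e)"
| "arrs (Pl a b) = arrs a \<union> arrs b"
| "arrs (Mi a b) = arrs a \<union> arrs b"
| "arrs (Hf a) = arrs a"

lemma straight_scale: "list_all straight (scale u j t)"
  by (auto simp: scale_def list_all_iff)

lemma straight_cexp: "list_all straight (cexp u e t)"
  by (induction e arbitrary: t) (auto simp: straight_scale)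

lemma slrun_doubling: "slrun (replicate u (Add t t t)) m = m(t := 2 ^ u * m t)"
  by (induction u arbitrary: m) auto

lemma slrun_scale: "slrun (scale u j t) m = m(Suc t := j, t := 2 ^ u * m t + j)"
  by (auto simp: scale_def slrun_doubling fun_eq_iff)

text \<open>Cell 0 of every array lies below \<open>B\<close> and all other cells lie at
  \<open>2 ^ u\<close> or above, so code that writes only in between cannot disturb the represented
  state.\<close>

lemma rep_cong:
  assumes "rep u B s m" "\<And>a. a < B \<or> 2 ^ u \<le> a \<Longrightarrow> m' a = m a"
  shows "rep u B s m'"
  unfolding rep_def
proof (intro allI impI)
  fix j i assume "j < B"
  then have "2 ^ u * i + j < B \<or> 2 ^ u \<le> 2 ^ u * i + j"
    by (cases i) auto
  then show "m' (2 ^ u * i + j) = s j i"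
    using assms \<open>j < B\<close> unfolding rep_def by metis
qed

text \<open>The cells from \<open>t\<close> on act as an evaluation stack; hence the depth of the
  expression must fit below \<open>2 ^ u\<close>.\<close>

lemma cexp_correct:
  assumes "rep u B s m" "\<forall>j\<in>arrs e. j < B" "B \<le> t" "t + depth e + 1 < 2 ^ u"
  shows "slrun (cexp u e t) m t = wval e s \<and>
    (\<forall>a. a < t \<or> 2 ^ u \<le> a \<longrightarrow> slrun (cexp u e t) m a = m a)"
  using assms
proof (induction e arbitrary: t m)
  case (Rd j e)
  let ?m = "slrun (cexp u e t) m"
  have *: "?m t = wval e s" "\<forall>a. a < t \<or> 2 ^ u \<le> a \<longrightarrow> ?m a = m a"
    using Rd.IH[of m t] Rd.prems by auto
  have "rep u B s ?m"
    by (rule rep_cong[OF Rd.prems(1)]) (use * Rd.prems in auto)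
  moreover have "2 ^ u * wval e s + j \<noteq> t" "2 ^ u * wval e s + j \<noteq> Suc t"
    using Rd.prems by (cases "wval e s"; auto)+
  ultimately show ?case
    using * Rd.prems by (auto simp: slrun_scale rep_def)
next
  case (Pl a b)
  let ?m = "slrun (cexp u a t) m"
  have *: "?m t = wval a s" "\<forall>x. x < t \<or> 2 ^ u \<le> x \<longrightarrow> ?m x = m x"
    using Pl.IH(1)[of m t] Pl.prems by auto
  have "rep u B s ?m"
    by (rule rep_cong[OF Pl.prems(1)]) (use * Pl.prems in auto)
  then show ?case
    using Pl.IH(2)[of ?m "Suc t"] Pl.prems * by auto
next
  case (Mi a b)
  let ?m = "slrun (cexp u a t) m"
  have *: "?m t = wval a s" "\<forall>x. x < t \<or> 2 ^ u \<le> x \<longrightarrow> ?m x = m x"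
    using Mi.IH(1)[of m t] Mi.prems by auto
  have "rep u B s ?m"
    by (rule rep_cong[OF Mi.prems(1)]) (use * Mi.prems in auto)
  then show ?case
    using Mi.IH(2)[of ?m "Suc t"] Mi.prems * by auto
qed auto

text \<open>Jump targets are absolute, so the code depends on its start address \<open>a\<close>.
  Clearing cell \<open>B\<close> and testing it gives an unconditional jump.\<close>

primrec ccom :: "nat \<Rightarrow> nat \<Rightarrow> wcom \<Rightarrow> nat \<Rightarrow> instr list" where
  "ccom u B Skp a = []"
| "ccom u B (Wr j d e) a = cexp u d B @ scale u j B @ cexp u e (Suc B) @ [Store B (Suc B)]"
| "ccom u B (c1 ;; c2) a = (let is1 = ccom u B c1 a in is1 @ ccom u B c2 (a + length is1))"
| "ccom u B (IfC e c1 c2) a =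
    (let ie = cexp u e B; is1 = ccom u B c1 (a + length ie + 1);
         a2 = a + length ie + 1 + length is1 + 2; is2 = ccom u B c2 a2
     in ie @ [Jzero B a2] @ is1 @ [Const B 0, Jzero B (a2 + length is2)] @ is2)"
| "ccom u B (WhileC e c) a =
    (let ie = cexp u e B; is1 = ccom u B c (a + length ie + 1)
     in ie @ [Jzero B (a + length ie + 1 + length is1 + 2)] @ is1 @ [Const B 0, Jzero B a])"

primrec fits :: "nat \<Rightarrow> nat \<Rightarrow> wcom \<Rightarrow> bool" where
  "fits u B Skp = True"
| "fits u B (Wr j d e) \<longleftrightarrow> j < B \<and> (\<forall>j\<in>arrs d \<union> arrs e. j < B) \<and> B + max (depth d) (depth e) + 2 < 2 ^ u"
| "fits u B (c1 ;; c2) \<longleftrightarrow> fits u B c1 \<and> fits u B c2"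
| "fits u B (IfC e c1 c2) \<longleftrightarrow> (\<forall>j\<in>arrs e. j < B) \<and> B + depth e + 1 < 2 ^ u \<and> fits u B c1 \<and> fits u B c2"
| "fits u B (WhileC e c) \<longleftrightarrow> (\<forall>j\<in>arrs e. j < B) \<and> B + depth e + 1 < 2 ^ u \<and> fits u B c"

text \<open>A larger \<open>B\<close> needs a larger stride, so \<open>u\<close> can only be fixed
  after \<open>B\<close>. The claim that for every large \<open>B\<close> all large \<open>u\<close>
  work is closed under taking maxima, which is what the induction over commands needs.\<close>

lemma fits_exists: "\<exists>u B. u \<ge> 4 \<and> b \<le> B \<and> B < 2 ^ u \<and> fits u B c"
proof -
  have ex: "\<exists>b. \<forall>j\<in>arrs e. j < b" for e
  proof -
    have "finite (arrs e)" by (induction e) auto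
    then show ?thesis using finite_nat_set_iff_bounded by auto
  qed
  have pw: "\<exists>u\<ge>4. \<forall>u'\<ge>u. (x::nat) < 2 ^ u'" for x
  proof -
    have "x < 2 ^ u'" if "u' \<ge> max 4 x" for u'
      using that by (meson less_exp max.boundedE order_less_le_trans power_increasing le_less_trans one_le_numeral)
    then show ?thesis by (meson max.cobounded1)
  qed
  have "\<exists>B0. \<forall>B\<ge>B0. \<exists>u0. \<forall>u\<ge>u0. fits u B c" for c
  proof (induction c)
    case Skp
    then show ?case by auto
  next
    case (Wr j d e)
    obtain b1 b2 where b: "\<forall>j\<in>arrs d. j < b1" "\<forall>j\<in>arrs e. j < b2" using ex by metis
    show ?case
    proof (rule exI[of _ "max (Suc j) (max b1 b2)"], intro allI impI)
      fix B assume "max (Suc j) (max b1 b2) \<le> B"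
      then have "j < B" "\<forall>j\<in>arrs d \<union> arrs e. j < B" using b by auto
      moreover obtain u0 where "\<forall>u\<ge>u0. B + max (depth d) (depth e) + 2 < 2 ^ u" using pw by metis
      ultimately show "\<exists>u0. \<forall>u\<ge>u0. fits u B (Wr j d e)" by auto
    qed
  next
    case (Sq c1 c2)
    then obtain B1 B2 where B: "\<forall>B\<ge>B1. \<exists>u0. \<forall>u\<ge>u0. fits u B c1" "\<forall>B\<ge>B2. \<exists>u0. \<forall>u\<ge>u0. fits u B c2" by auto
    show ?case
    proof (rule exI[of _ "max B1 B2"], intro allI impI)
      fix B assume "max B1 B2 \<le> B"
      then obtain u1 u2 where "\<forall>u\<ge>u1. fits u B c1" "\<forall>u\<ge>u2. fits u B c2" using B by (meson max.boundedE)
      then have "\<forall>u\<ge>max u1 u2. fits u B (c1 ;; c2)" by auto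
      then show "\<exists>u0. \<forall>u\<ge>u0. fits u B (c1 ;; c2)" by blast
    qed
  next
    case (IfC e c1 c2)
    obtain b where b: "\<forall>j\<in>arrs e. j < b" using ex by metis
    obtain B1 B2 where B: "\<forall>B\<ge>B1. \<exists>u0. \<forall>u\<ge>u0. fits u B c1" "\<forall>B\<ge>B2. \<exists>u0. \<forall>u\<ge>u0. fits u B c2" using IfC by auto
    show ?case
    proof (rule exI[of _ "max b (max B1 B2)"], intro allI impI)
      fix B assume BB: "max b (max B1 B2) \<le> B"
      then obtain u1 u2 where "\<forall>u\<ge>u1. fits u B c1" "\<forall>u\<ge>u2. fits u B c2" using B by (meson max.boundedE)
      moreover obtain u0 where "\<forall>u\<ge>u0. B + depth e + 1 < 2 ^ u" using pw by metis
      ultimately have "\<forall>u\<ge>max u0 (max u1 u2). fits u B (IfC e c1 c2)" using b BB by auto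
      then show "\<exists>u0. \<forall>u\<ge>u0. fits u B (IfC e c1 c2)" by blast
    qed
  next
    case (WhileC e c)
    obtain b where b: "\<forall>j\<in>arrs e. j < b" using ex by metis
    obtain B1 where B: "\<forall>B\<ge>B1. \<exists>u0. \<forall>u\<ge>u0. fits u B c" using WhileC by auto
    show ?case
    proof (rule exI[of _ "max b B1"], intro allI impI)
      fix B assume BB: "max b B1 \<le> B"
      then obtain u1 where "\<forall>u\<ge>u1. fits u B c" using B by (meson max.boundedE)
      moreover obtain u0 where "\<forall>u\<ge>u0. B + depth e + 1 < 2 ^ u" using pw by metis
      ultimately have "\<forall>u\<ge>max u0 u1. fits u B (WhileC e c)" using b BB by auto
      then show "\<exists>u0. \<forall>u\<ge>u0. fits u B (WhileC e c)" by blast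
    qed
  qed
  then obtain B0 where "\<forall>B\<ge>B0. \<exists>u0. \<forall>u\<ge>u0. fits u B c" by blast
  then obtain u0 where u0: "\<forall>u\<ge>u0. fits u (max b B0) c" by (meson max.cobounded2)
  obtain u1 where u1: "u1 \<ge> 4" "\<forall>u\<ge>u1. max b B0 < 2 ^ u" using pw by metis
  show ?thesis
    by (rule exI[of _ "max u0 u1"], rule exI[of _ "max b B0"]) (use u0 u1 in auto)
qed

lemma ccom_correct:
  assumes "wexec c s t s'" "fits u B c" "code_at p a (ccom u B c a)" "rep u B s m"
    "length (ccom u B c a) \<le> K"
  shows "\<exists>t' m'. t' \<le> K * t \<and> (step p ^^ t') (a, m) = (a + length (ccom u B c a), m') \<and> rep u B s' m'"
  using assms
proof (induction arbitrary: a m rule: wexec.induct)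
  case (wSkp s)
  then show ?case by (intro exI[of _ 0] exI[of _ m]) auto
next
  case (wWr j d e s)
  let ?c1 = "cexp u d B" and ?c2 = "cexp u e (Suc B)"
  let ?m1 = "slrun (scale u j B) (slrun ?c1 m)"
  let ?m2 = "slrun ?c2 ?m1"
  let ?x = "2 ^ u * wval d s + j"
  have 1: "slrun ?c1 m B = wval d s" "\<forall>a. a < B \<or> 2 ^ u \<le> a \<longrightarrow> slrun ?c1 m a = m a"
    using cexp_correct[of u B s m d B] wWr.prems by auto
  then have 2: "?m1 B = ?x" "\<forall>a. a < B \<or> 2 ^ u \<le> a \<longrightarrow> ?m1 a = m a"
    using wWr.prems by (auto simp: slrun_scale)
  have "rep u B s ?m1"
    by (rule rep_cong[OF wWr.prems(3)]) (use 2 in auto)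
  then have 3: "?m2 (Suc B) = wval e s" "\<forall>a. a < Suc B \<or> 2 ^ u \<le> a \<longrightarrow> ?m2 a = ?m1 a"
    using cexp_correct[of u B s ?m1 e "Suc B"] wWr.prems by auto
  let ?is = "ccom u B (Wr j d e) a"
  have "list_all straight ?is"
    by (auto simp: straight_scale straight_cexp)
  then have "(step p ^^ length ?is) (a, m) = (a + length ?is, slrun ?is m)"
    using step_straight wWr.prems by blast
  moreover have "slrun ?is m = ?m2(?x := wval e s)"
    using 2 3 by auto
  moreover have "rep u B (put s j (wval d s) (wval e s)) (?m2(?x := wval e s))"
    \<comment> \<open>Division with remainder by \<open>2 ^ u\<close> recovers array and cell from
      an address, so the write hits no other represented cell.\<close>
    unfolding rep_def
  proof (intro allI impI)
    fix j' i assume j': "j' < B"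
    have *: "j < 2 ^ u" "j' < 2 ^ u" using j' wWr.prems by auto
    have eq: "2 ^ u * i + j' = ?x \<longleftrightarrow> i = wval d s \<and> j' = j"
    proof
      assume h: "2 ^ u * i + j' = ?x"
      have "(2 ^ u * i + j') div 2 ^ u = i" "(2 ^ u * i + j') mod 2 ^ u = j'" using * by auto
      moreover have "?x div 2 ^ u = wval d s" "?x mod 2 ^ u = j" using * by auto
      ultimately show "i = wval d s \<and> j' = j" using h by metis
    qed auto
    have "?m2 (2 ^ u * i + j') = s j' i"
    proof -
      have "2 ^ u * i + j' < B \<or> 2 ^ u \<le> 2 ^ u * i + j'" using j' by (cases i) auto
      then have "?m2 (2 ^ u * i + j') = m (2 ^ u * i + j')" using 2 3 by auto
      then show ?thesis using wWr.prems(3) j' unfolding rep_def by auto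
    qed
    then show "(?m2(?x := wval e s)) (2 ^ u * i + j') = put s j (wval d s) (wval e s) j' i"
      using eq by auto
  qed
  ultimately show ?case
    using wWr.prems by (metis mult.right_neutral)
next
  case (wSq c1 s t1 s1 c2 t2 s2)
  let ?i1 = "ccom u B c1 a" let ?i2 = "ccom u B c2 (a + length ?i1)"
  obtain t' m' where 1: "t' \<le> K * t1" "(step p ^^ t') (a, m) = (a + length ?i1, m')" "rep u B s1 m'"
    using wSq.IH(1)[of a m] wSq.prems by (auto simp: Let_def)
  obtain t'' m'' where 2: "t'' \<le> K * t2" "(step p ^^ t'') (a + length ?i1, m') = (a + length ?i1 + length ?i2, m'')" "rep u B s2 m''"
    using wSq.IH(2)[of "a + length ?i1" m'] wSq.prems 1 by (auto simp: Let_def)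
  show ?case
    by (rule exI[of _ "t' + t''"], rule exI[of _ m'']) (use 1 2 in \<open>auto simp: Let_def funpow_add_app distrib_left\<close>)
next
  case (wIfT e s c1 t s1 c2)
  let ?ie = "cexp u e B"
  let ?i1 = "ccom u B c1 (a + length ?ie + 1)"
  let ?a2 = "a + length ?ie + 1 + length ?i1 + 2"
  let ?i2 = "ccom u B c2 ?a2"
  let ?m1 = "slrun ?ie m"
  have L: "a + length (ccom u B (IfC e c1 c2) a) = ?a2 + length ?i2"
    by (simp add: Let_def)
  have c: "code_at p a ?ie" "code_at p (a + length ?ie) [Jzero B ?a2]" "code_at p (a + length ?ie + 1) ?i1"
     "code_at p (a + length ?ie + 1 + length ?i1) [Const B 0]"
     "code_at p (Suc (a + length ?ie + 1 + length ?i1)) [Jzero B (?a2 + length ?i2)]"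
    using wIfT.prems by (auto simp: Let_def code_at_Cons2 code_at_Cons[of _ _ _ "_ @ _"] simp del: append.simps)
  have 1: "?m1 B = wval e s" "\<forall>a. a < B \<or> 2 ^ u \<le> a \<longrightarrow> ?m1 a = m a"
    using cexp_correct[of u B s m e B] wIfT.prems by auto
  have r1: "rep u B s ?m1"
    by (rule rep_cong[OF wIfT.prems(3)]) (use 1 in auto)
  have s1: "(step p ^^ (length ?ie + 1)) (a, m) = (a + length ?ie + 1, ?m1)"
    unfolding funpow_add_app using step_straight[OF c(1) straight_cexp] step_code[OF c(2)] 1 wIfT.hyps by simp
  obtain t' m' where 2: "t' \<le> K * t" "(step p ^^ t') (a + length ?ie + 1, ?m1) = (a + length ?ie + 1 + length ?i1, m')" "rep u B s1 m'"
    using wIfT.IH[of "a + length ?ie + 1" ?m1] wIfT.prems c r1 by (auto simp: Let_def)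
  have s3: "(step p ^^ 2) (a + length ?ie + 1 + length ?i1, m') = (?a2 + length ?i2, m'(B := 0))"
    using step_code[OF c(4)] step_code[OF c(5)] by (simp add: numeral_2_eq_2)
  have r3: "rep u B s1 (m'(B := 0))"
    by (rule rep_cong[OF 2(3)]) (use wIfT.prems in auto)
  have "(step p ^^ ((length ?ie + 1) + t' + 2)) (a, m) = (?a2 + length ?i2, m'(B := 0))"
    by (rule funpow_trans[OF funpow_trans[OF s1 2(2)] s3])
  moreover have "(length ?ie + 1) + t' + 2 \<le> K * Suc t"
    using 2(1) wIfT.prems(4) by (simp add: Let_def)
  ultimately show ?case
    using r3 unfolding L by blast
next
  case (wIfF e s c2 t s1 c1)
  let ?ie = "cexp u e B"
  let ?i1 = "ccom u B c1 (a + length ?ie + 1)"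
  let ?a2 = "a + length ?ie + 1 + length ?i1 + 2"
  let ?i2 = "ccom u B c2 ?a2"
  let ?m1 = "slrun ?ie m"
  have L: "a + length (ccom u B (IfC e c1 c2) a) = ?a2 + length ?i2"
    by (simp add: Let_def)
  have c: "code_at p a ?ie" "code_at p (a + length ?ie) [Jzero B ?a2]" "code_at p ?a2 ?i2"
    using wIfF.prems by (auto simp: Let_def code_at_Cons2 code_at_Cons[of _ _ _ "_ @ _"] simp del: append.simps)
  have 1: "?m1 B = wval e s" "\<forall>a. a < B \<or> 2 ^ u \<le> a \<longrightarrow> ?m1 a = m a"
    using cexp_correct[of u B s m e B] wIfF.prems by auto
  have r1: "rep u B s ?m1"
    by (rule rep_cong[OF wIfF.prems(3)]) (use 1 in auto)
  have s1: "(step p ^^ (length ?ie + 1)) (a, m) = (?a2, ?m1)"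
    unfolding funpow_add_app using step_straight[OF c(1) straight_cexp] step_code[OF c(2)] 1 wIfF.hyps by simp
  obtain t' m' where 2: "t' \<le> K * t" "(step p ^^ t') (?a2, ?m1) = (?a2 + length ?i2, m')" "rep u B s1 m'"
    using wIfF.IH[of ?a2 ?m1] wIfF.prems c r1 by (auto simp: Let_def)
  have "(step p ^^ ((length ?ie + 1) + t')) (a, m) = (?a2 + length ?i2, m')"
    by (rule funpow_trans[OF s1 2(2)])
  moreover have "(length ?ie + 1) + t' \<le> K * Suc t"
    using 2(1) wIfF.prems(4) by (simp add: Let_def)
  ultimately show ?case
    using 2(3) unfolding L by blast
next
  case (wWhileF e s c)
  let ?ie = "cexp u e B"
  let ?i1 = "ccom u B c (a + length ?ie + 1)"
  let ?a2 = "a + length ?ie + 1 + length ?i1 + 2"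
  let ?m1 = "slrun ?ie m"
  have L: "a + length (ccom u B (WhileC e c) a) = ?a2"
    by (simp add: Let_def)
  have c: "code_at p a ?ie" "code_at p (a + length ?ie) [Jzero B ?a2]"
    using wWhileF.prems by (auto simp: Let_def code_at_Cons2 code_at_Cons[of _ _ _ "_ @ _"] simp del: append.simps)
  have 1: "?m1 B = wval e s" "\<forall>a. a < B \<or> 2 ^ u \<le> a \<longrightarrow> ?m1 a = m a"
    using cexp_correct[of u B s m e B] wWhileF.prems by auto
  have r1: "rep u B s ?m1"
    by (rule rep_cong[OF wWhileF.prems(3)]) (use 1 in auto)
  have s1: "(step p ^^ (length ?ie + 1)) (a, m) = (?a2, ?m1)"
    unfolding funpow_add_app using step_straight[OF c(1) straight_cexp] step_code[OF c(2)] 1 wWhileF.hyps by simp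
  show ?case
    using r1 s1 wWhileF.prems(4) unfolding L by (intro exI[of _ "length ?ie + 1"] exI[of _ ?m1]) (auto simp: Let_def)
next
  case (wWhileT e s c t1 s1 t2 s2)
  let ?ie = "cexp u e B"
  let ?i1 = "ccom u B c (a + length ?ie + 1)"
  let ?a2 = "a + length ?ie + 1 + length ?i1 + 2"
  let ?m1 = "slrun ?ie m"
  have L: "a + length (ccom u B (WhileC e c) a) = ?a2"
    by (simp add: Let_def)
  have c: "code_at p a ?ie" "code_at p (a + length ?ie) [Jzero B ?a2]" "code_at p (a + length ?ie + 1) ?i1"
     "code_at p (a + length ?ie + 1 + length ?i1) [Const B 0]"
     "code_at p (Suc (a + length ?ie + 1 + length ?i1)) [Jzero B a]"
    using wWhileT.prems by (auto simp: Let_def code_at_Cons2 code_at_Cons[of _ _ _ "_ @ _"] simp del: append.simps)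
  have 1: "?m1 B = wval e s" "\<forall>a. a < B \<or> 2 ^ u \<le> a \<longrightarrow> ?m1 a = m a"
    using cexp_correct[of u B s m e B] wWhileT.prems by auto
  have r1: "rep u B s ?m1"
    by (rule rep_cong[OF wWhileT.prems(3)]) (use 1 in auto)
  have s1: "(step p ^^ (length ?ie + 1)) (a, m) = (a + length ?ie + 1, ?m1)"
    unfolding funpow_add_app using step_straight[OF c(1) straight_cexp] step_code[OF c(2)] 1 wWhileT.hyps by simp
  have len: "length ?ie + 1 + 2 + length ?i1 \<le> K"
    using wWhileT.prems(4) by (simp add: Let_def)
  obtain t' m' where 2: "t' \<le> K * t1" "(step p ^^ t') (a + length ?ie + 1, ?m1) = (a + length ?ie + 1 + length ?i1, m')" "rep u B s1 m'"
    using wWhileT.IH(1)[of "a + length ?ie + 1" ?m1] wWhileT.prems c r1 by (auto simp: Let_def)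
  have s3: "(step p ^^ 2) (a + length ?ie + 1 + length ?i1, m') = (a, m'(B := 0))"
    using step_code[OF c(4)] step_code[OF c(5)] by (simp add: numeral_2_eq_2)
  have r3: "rep u B s1 (m'(B := 0))"
    by (rule rep_cong[OF 2(3)]) (use wWhileT.prems in auto)
  obtain t'' m'' where 4: "t'' \<le> K * t2" "(step p ^^ t'') (a, m'(B := 0)) = (?a2, m'')" "rep u B s2 m''"
    using wWhileT.IH(2)[OF wWhileT.prems(1,2) r3 wWhileT.prems(4)] unfolding L by blast
  have "(step p ^^ ((length ?ie + 1) + t' + 2 + t'')) (a, m) = (?a2, m'')"
    by (rule funpow_trans[OF funpow_trans[OF funpow_trans[OF s1 2(2)] s3] 4(2)])
  moreover have "(length ?ie + 1) + t' + 2 + t'' \<le> K * Suc (t1 + t2)"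
    using 2(1) 4(1) len by (simp add: distrib_left)
  ultimately show ?case
    using 4(3) unfolding L by blast
qed

subsection \<open>Spreading the input over the arrays\<close>

text \<open>The input occupies the addresses that the compiled code uses as registers and temporaries.
  A prelude first copies the lowest cells behind the input, which makes the addresses below 8
  available as registers; then the loop \<open>reloc\<close> moves cell \<open>i\<close> to address \<open>2 ^ u * i\<close>,
  starting with the largest \<open>i\<close>.\<close>

definition reloc :: "nat \<Rightarrow> nat \<Rightarrow> instr list" where
  "reloc u a = [Sub 3 1 7, Jzero 3 (a + 8 + u), Sub 1 1 2, Load 4 1, Store 1 5, Add 3 1 5]
     @ replicate u (Add 3 3 3) @ [Store 3 4, Jzero 5 a]"

lemma length_reloc [simp]: "length (reloc u a) = 8 + u"
  by (simp add: reloc_def)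

text \<open>The memory in the middle of the relocation, when the cells from \<open>i\<close> on have
  already reached their targets.\<close>

definition spread :: "nat \<Rightarrow> nat \<Rightarrow> memory \<Rightarrow> nat \<Rightarrow> memory" where
  "spread u i m0 tp x = (if x < i then m0 x
     else if \<exists>y. i \<le> y \<and> y < tp \<and> x = 2 ^ u * y then m0 (x div 2 ^ u) else 0)"

text \<open>The target \<open>2 ^ u * i\<close> exceeds \<open>i\<close>, so if it lies inside the
  input, the cell that was stored there has been moved away before. This is why the loop runs
  downwards.\<close>

lemma spread_step:
  assumes "1 \<le> u" "8 \<le> i" "i < tp"
  shows "((\<lambda>x. spread u (Suc i) m0 tp x)(i := 0, 2 ^ u * i := m0 i)) x = spread u i m0 tp x"
proof -
  have lt: "i < 2 ^ u * i" using assms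
    by (metis One_nat_def Suc_le_lessD less_le_trans mult_1 mult_less_cancel2 nat_zero_less_power_iff one_less_power
        pos2 less_numeral_extra(1) not_less_eq_eq numeral_eq_Suc one_less_numeral_iff semiring_norm(76) zero_less_iff_neq_zero zero_order(1))
  show ?thesis
  proof (cases "x = 2 ^ u * i")
    case True
    then show ?thesis using lt assms by (auto simp: spread_def)
  next
    case False
    note F = False
    show ?thesis
    proof (cases "x = i")
      case True
      have n: "\<not> (\<exists>y. i \<le> y \<and> y < tp \<and> i = 2 ^ u * y)"
        using lt by (metis leD mult_le_mono2)
      have "spread u i m0 tp i = 0"
        unfolding spread_def if_not_P[OF n] by simp
      then show ?thesis using True F by simp
    next
      case False
      have "(\<exists>y. i \<le> y \<and> y < tp \<and> x = 2 ^ u * y) \<longleftrightarrow> (\<exists>y. Suc i \<le> y \<and> y < tp \<and> x = 2 ^ u * y)"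
        using F by (metis Suc_le_eq le_neq_implies_less less_imp_le_nat)
      then show ?thesis using False F unfolding spread_def by auto
    qed
  qed
qed

lemma reloc_correct:
  assumes "code_at p a (reloc u a)" "1 \<le> u" "8 \<le> i" "i \<le> tp"
    and "m 1 = i" "m 2 = 1" "m 5 = 0" "m 7 = 8"
    and "\<forall>x\<ge>8. m x = spread u i m0 tp x"
  shows "\<exists>m'. (step p ^^ ((i - 8) * (8 + u) + 2)) (a, m) = (a + 8 + u, m') \<and> m' 6 = m 6 \<and>
    (\<forall>x\<ge>8. m' x = spread u 8 m0 tp x)"
  using assms(3-)
proof (induction i arbitrary: m rule: less_induct)
  case (less i)
  have code: "code_at p a [Sub 3 1 7]" "code_at p (Suc a) [Jzero 3 (a + 8 + u)]"
      "code_at p (Suc (Suc a)) ([Sub 1 1 2, Load 4 1, Store 1 5, Add 3 1 5] @ replicate u (Add 3 3 3) @ [Store 3 4])"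
      "code_at p (a + 7 + u) [Jzero 5 a]"
  proof -
    have *: "reloc u a = [Sub 3 1 7] @ [Jzero 3 (a + 8 + u)] @
      ([Sub 1 1 2, Load 4 1, Store 1 5, Add 3 1 5] @ replicate u (Add 3 3 3) @ [Store 3 4]) @ [Jzero 5 a]"
      by (simp add: reloc_def)
    show "code_at p a [Sub 3 1 7]" "code_at p (Suc a) [Jzero 3 (a + 8 + u)]"
      "code_at p (Suc (Suc a)) ([Sub 1 1 2, Load 4 1, Store 1 5, Add 3 1 5] @ replicate u (Add 3 3 3) @ [Store 3 4])"
      "code_at p (a + 7 + u) [Jzero 5 a]"
      using assms(1) unfolding * by (simp_all only: code_at_append) (simp_all add: eval_nat_numeral)
  qed
  have s1: "(step p ^^ 1) (a, m) = (Suc a, m(3 := i - 8))"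
    using step_code[OF code(1)] less.prems by simp
  show ?case
  proof (cases "i = 8")
    case True
    have "(step p ^^ 1) (Suc a, m(3 := i - 8)) = (a + 8 + u, m(3 := i - 8))"
      using step_code[OF code(2)] True by simp
    then have "(step p ^^ (1 + 1)) (a, m) = (a + 8 + u, m(3 := i - 8))"
      by (rule funpow_trans[OF s1])
    then show ?thesis
      using True less.prems by (intro exI[of _ "m(3 := i - 8)"]) (auto simp: numeral_2_eq_2)
  next
    case False
    then obtain i' where i': "i = Suc i'" "8 \<le> i'" using less.prems(1) by (cases i) auto
    let ?is = "[Sub 1 1 2, Load 4 1, Store 1 5, Add 3 1 5] @ replicate u (Add 3 3 3) @ [Store 3 4]"
    let ?m2 = "slrun ?is (m(3 := i - 8))"
    have s2: "(step p ^^ 1) (Suc a, m(3 := i - 8)) = (Suc (Suc a), m(3 := i - 8))"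
      using step_code[OF code(2)] False less.prems by simp
    have s3: "(step p ^^ length ?is) (Suc (Suc a), m(3 := i - 8)) = (a + 7 + u, ?m2)"
      using step_straight[OF code(3), of "m(3 := i - 8)"] by (simp add: list_all_iff)
    have gt: "8 \<le> 2 ^ u * i'" using i' by (simp add: le_trans[OF i'(2)])
    have m2: "?m2 = m(1 := i', 4 := m i', i' := 0, 3 := 2 ^ u * i', 2 ^ u * i' := m i')"
      using i' less.prems gt by (auto simp: slrun_doubling fun_eq_iff)
    have s4: "(step p ^^ 1) (a + 7 + u, ?m2) = (a, ?m2)"
      using step_code[OF code(4)] less.prems i' gt unfolding m2 by simp
    have "(step p ^^ (1 + 1 + length ?is + 1)) (a, m) = (a, ?m2)"
      by (rule funpow_trans[OF funpow_trans[OF funpow_trans[OF s1 s2] s3] s4])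
    then have A: "(step p ^^ (8 + u)) (a, m) = (a, ?m2)" by (simp add: numeral_eq_Suc)
    have "\<exists>m'. (step p ^^ ((i' - 8) * (8 + u) + 2)) (a, ?m2) = (a + 8 + u, m') \<and> m' 6 = ?m2 6 \<and>
        (\<forall>x\<ge>8. m' x = spread u 8 m0 tp x)"
    proof (rule less.IH)
      show "\<forall>x\<ge>8. ?m2 x = spread u i' m0 tp x"
      proof (intro allI impI)
        fix x :: nat assume x: "8 \<le> x"
        have "m i' = m0 i'" using less.prems i' by (simp add: spread_def)
        then have "?m2 x = ((\<lambda>x. spread u (Suc i') m0 tp x)(i' := 0, 2 ^ u * i' := m0 i')) x"
          unfolding m2 using x less.prems i' by auto
        also have "\<dots> = spread u i' m0 tp x"
          by (rule spread_step) (use assms(2) i' less.prems in auto)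
        finally show "?m2 x = spread u i' m0 tp x" .
      qed
    qed (use i' less.prems gt in \<open>unfold m2, simp_all\<close>)
    then obtain m' where m': "(step p ^^ ((i' - 8) * (8 + u) + 2)) (a, ?m2) = (a + 8 + u, m')" "m' 6 = ?m2 6"
        "\<forall>x\<ge>8. m' x = spread u 8 m0 tp x" by blast
    have "(step p ^^ ((8 + u) + ((i' - 8) * (8 + u) + 2))) (a, m) = (a + 8 + u, m')"
      by (rule funpow_trans[OF A m'(1)])
    moreover have "(8 + u) + ((i' - 8) * (8 + u) + 2) = (i - 8) * (8 + u) + 2"
    proof -
      have "i - 8 = Suc (i' - 8)" using i' by simp
      then show ?thesis by simp
    qed
    ultimately have "(step p ^^ ((i - 8) * (8 + u) + 2)) (a, m) = (a + 8 + u, m')" by (simp only:)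
    moreover have "m' 6 = m 6" using m'(2) i' gt unfolding m2 by simp
    ultimately show ?thesis
      using m'(3) by blast
  qed
qed

text \<open>The exit value \<open>v\<close> is for preludes that jump to the last instruction.\<close>

definition program :: "(nat \<Rightarrow> instr list) \<Rightarrow> nat \<Rightarrow> nat \<Rightarrow> nat \<Rightarrow> wcom \<Rightarrow> nat \<Rightarrow> instr list" where
  "program pre l u B c v =
    (let e = l + 8 + u + length (ccom u B c (l + 8 + u)) + 2
     in pre e @ reloc u l @ ccom u B c (l + 8 + u) @ [Const 8 0, Jzero 8 (Suc e)] @ [Const 0 v])"

text \<open>Addresses below 8 were registers of the prelude and hold leftovers, with one exception:
  register 6 tells where the prelude saved the lowest input cells.\<close>

definition loaded :: "memory \<Rightarrow> st \<Rightarrow> bool" where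
  "loaded m s \<longleftrightarrow> (\<forall>i\<ge>8. s 0 i = m i) \<and> s 6 0 = m 6 \<and> (\<forall>j\<ge>8. \<forall>i. s j i = 0)"

lemma program_correct:
  assumes p: "p = program pre l u B c v" and pre: "\<And>e. length (pre e) = l"
    and fits: "fits u B c" "4 \<le> u" "8 \<le> B" "B < 2 ^ u"
    and start: "(step p ^^ t0) (0, m0) = (l, m)"
    and m: "m 1 = tp" "8 \<le> tp" "m 2 = 1" "m 5 = 0" "m 7 = 8" "\<forall>x\<ge>tp. m x = 0"
    and run: "\<And>s. loaded m s \<Longrightarrow> run c s T (\<lambda>s'. s' 0 0 = y)"
  shows "\<exists>t m'. t \<le> t0 + (tp * (8 + u) + 2) + length (ccom u B c (l + 8 + u)) * T + 2 \<and>
    (step p ^^ t) (0, m0) = (length p, m') \<and> m' 0 = y"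
proof -
  let ?a = "l + 8 + u"
  let ?is = "ccom u B c ?a"
  let ?e = "?a + length ?is + 2"
  have p': "p = pre ?e @ reloc u l @ ?is @ [Const 8 0] @ [Jzero 8 (Suc ?e)] @ [Const 0 v]"
    unfolding p program_def by (simp add: Let_def)
  have ca: "code_at p 0 (pre ?e @ reloc u l @ ?is @ [Const 8 0] @ [Jzero 8 (Suc ?e)] @ [Const 0 v])"
    unfolding code_at_def by (intro exI[of _ "[]"]) (use p' in simp)
  have code: "code_at p l (reloc u l)" "code_at p ?a ?is" "code_at p (?a + length ?is) [Const 8 0]"
     "code_at p (Suc (?a + length ?is)) [Jzero 8 (Suc ?e)]"
    using ca unfolding code_at_append by (simp_all add: pre add.assoc)
  have len: "length p = Suc ?e" unfolding p' by (simp add: pre)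
  obtain m1 where m1: "(step p ^^ ((tp - 8) * (8 + u) + 2)) (l, m) = (?a, m1)" "m1 6 = m 6"
      "\<forall>x\<ge>8. m1 x = spread u 8 m tp x"
  proof -
    have "\<forall>x\<ge>8. m x = spread u tp m tp x" using m(6) by (auto simp: spread_def)
    then show ?thesis
      using reloc_correct[OF code(1) _ m(2) le_refl m(1,3-5)] fits that by fastforce
  qed
  define s where "s j i = (if j < B then m1 (2 ^ u * i + j) else 0)" for j i
  have rep: "rep u B s m1" by (simp add: rep_def s_def)
  have u16: "16 \<le> (2::nat) ^ u" using power_increasing[OF fits(2), of "2::nat"] by simp
  have ld: "loaded m s"
    unfolding loaded_def
  proof (intro conjI allI impI)
    fix i :: nat assume i: "8 \<le> i"
    then have "8 \<le> 2 ^ u * i" using u16 by (metis le_trans mult_le_mono1 mult_1 one_le_power one_le_numeral)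
    then have "s 0 i = spread u 8 m tp (2 ^ u * i)" using m1(3) fits by (simp add: s_def)
    also have "\<dots> = m i" using i m \<open>8 \<le> 2 ^ u * i\<close> by (auto simp: spread_def not_less)
    finally show "s 0 i = m i" .
  next
    show "s 6 0 = m 6" using m1 fits by (simp add: s_def)
  next
    fix j i :: nat assume j: "8 \<le> j"
    show "s j i = 0"
    proof (cases "j < B")
      case True
      have "\<nexists>y. 2 ^ u * i + j = 2 ^ u * y"
      proof
        assume "\<exists>y. 2 ^ u * i + j = 2 ^ u * y"
        then obtain y where "2 ^ u * i + j = 2 ^ u * y" by blast
        then have "(2 ^ u * i + j) mod 2 ^ u = 0" by simp
        then show False using True fits j by simp
      qed
      then show ?thesis using m1(3) j True by (auto simp: s_def spread_def)
    qed (simp add: s_def)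
  qed
  obtain t1 s' where w: "wexec c s t1 s'" "t1 \<le> T" "s' 0 0 = y"
    using run[OF ld] unfolding run_def by blast
  obtain t2 m2 where m2: "t2 \<le> length ?is * t1" "(step p ^^ t2) (?a, m1) = (?a + length ?is, m2)" "rep u B s' m2"
    using ccom_correct[OF w(1) fits(1) code(2) rep le_refl] by blast
  have y: "m2 0 = y" using m2(3) w(3) fits unfolding rep_def by (metis add.right_neutral le_zero_eq mult_0_right not_less numeral_le_iff zero_less_iff_neq_zero not_numeral_le_zero)
  have s3: "(step p ^^ 2) (?a + length ?is, m2) = (Suc ?e, m2(8 := 0))"
    using step_code[OF code(3)] step_code[OF code(4)] by (simp add: numeral_2_eq_2)
  have S: "(step p ^^ (t0 + ((tp - 8) * (8 + u) + 2) + t2 + 2)) (0, m0) = (Suc ?e, m2(8 := 0))"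
    by (rule funpow_trans[OF funpow_trans[OF funpow_trans[OF start m1(1)] m2(2)] s3])
  have B: "t0 + ((tp - 8) * (8 + u) + 2) + t2 + 2 \<le> t0 + (tp * (8 + u) + 2) + length ?is * T + 2"
  proof -
    have "(tp - 8) * (8 + u) \<le> tp * (8 + u)" by simp
    moreover have "t2 \<le> length ?is * T" using m2(1) w(2) by (meson le_trans mult_le_mono2)
    ultimately show ?thesis by linarith
  qed
  show ?thesis
    by (rule exI, rule exI[of _ "m2(8 := 0)"], intro conjI, rule B) (use S y len in simp_all)
qed

section \<open>Preludes for the two input formats\<close>

lemma outputs_withinI:
  assumes "(step p ^^ t) (0, \<lambda>a. if a < length xs then xs ! a else 0) = (pc, m)" "length p \<le> pc" "m 0 = y" "real t \<le> T"
  shows "outputs_within p xs y T"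
  unfolding outputs_within_def using assms by (intro exI[of _ t]) simp

definition nth0 :: "nat list \<Rightarrow> nat \<Rightarrow> nat" where
  "nth0 xs a = (if a < length xs then xs ! a else 0)"

text \<open>No cell is known to be free at the start. The only number that may be overwritten is the
  count \<open>L\<close> of clauses in cell 1, since it can be recovered later: three doublings turn
  it into the address \<open>8 * L\<close>, which lies behind the input of length
  \<open>2 + 3 * L\<close>. This needs \<open>L\<close> to be positive, so the empty formula is
  answered at once. Then cells 2, 0 and 3 to 7 are saved behind the input.\<close>

definition sat_pre :: "nat \<Rightarrow> instr list" where
  "sat_pre e = [Jzero 1 e, Add 1 1 1, Add 1 1 1, Add 1 1 1, Store 1 2, Const 2 1,
     Add 1 1 2, Store 1 0, Add 1 1 2, Store 1 3, Add 1 1 2, Store 1 4, Add 1 1 2, Store 1 5,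
     Add 1 1 2, Store 1 6, Add 1 1 2, Store 1 7, Add 1 1 2, Const 3 7, Sub 6 1 3, Const 7 8, Const 5 0]"

definition sat_loaded :: "nat \<Rightarrow> clause list \<Rightarrow> st \<Rightarrow> bool" where
  "sat_loaded n F s \<longleftrightarrow> (let xs = cnf_code n F; E = 8 * length F in
     s 6 0 = E \<and> (\<forall>i. 8 \<le> i \<and> i < length xs \<longrightarrow> s 0 i = xs ! i) \<and>
     s 0 E = nth0 xs 2 \<and> s 0 (E + 1) = n \<and> (\<forall>i<5. s 0 (E + 2 + i) = nth0 xs (3 + i)) \<and>
     (\<forall>j\<ge>8. \<forall>i. s j i = 0))"

lemma length_cnf_code: "length (cnf_code n F) = 2 + 3 * length F"
proof -
  have "length (clause_lits c) = 3" for c by (cases c) auto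
  then have "length (concat (map (\<lambda>c. map g (clause_lits c)) F)) = 3 * length F" for g :: "literal \<Rightarrow> nat"
    by (induction F) auto
  then show ?thesis by (simp add: cnf_code_def)
qed

lemma sat_program:
  "\<exists>p K. \<forall>n F y T. (F = [] \<longrightarrow> outputs_within p (cnf_code n F) 1 (real K)) \<and>
     (F \<noteq> [] \<longrightarrow> (\<forall>s. sat_loaded n F s \<longrightarrow> run c s T (\<lambda>s'. s' 0 0 = y)) \<longrightarrow>
        outputs_within p (cnf_code n F) y (real (K * (length F + T + 1))))"
proof -
  obtain u B where uB: "u \<ge> 4" "9 \<le> B" "B < 2 ^ u" "fits u B c"
    using fits_exists by blast
  let ?l = "23 :: nat"
  define p where "p = program sat_pre ?l u B c 1"
  let ?is = "ccom u B c (?l + 8 + u)"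
  let ?e = "?l + 8 + u + length ?is + 2"
  have len: "length (sat_pre e) = ?l" for e by (simp add: sat_pre_def)
  define K where "K = 22 + 15 * (8 + u) + length ?is + 10"
  have p': "p = sat_pre ?e @ reloc u ?l @ ?is @ [Const 8 0, Jzero 8 (Suc ?e)] @ [Const 0 1]"
    unfolding p_def program_def by (simp add: Let_def)
  have ca: "code_at p 0 (sat_pre ?e @ (reloc u ?l @ ?is @ [Const 8 0, Jzero 8 (Suc ?e)]) @ [Const 0 1])"
    unfolding code_at_def by (intro exI[of _ "[]"]) (use p' in simp)
  have code: "code_at p 0 (sat_pre ?e)" "code_at p ?e [Const 0 1]"
    using ca unfolding code_at_append[of _ _ "sat_pre ?e"] code_at_append[of _ _ "reloc u ?l @ ?is @ _"] by (simp_all add: len add.assoc)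
  have lenp: "length p = Suc ?e" unfolding p' by (simp add: len)
  define is' where "is' = tl (sat_pre ?e)"
  have sp: "sat_pre ?e = [Jzero 1 ?e] @ is'" by (simp add: sat_pre_def is'_def)
  have code1: "code_at p 0 [Jzero 1 ?e]" "code_at p 1 is'"
    using code(1) unfolding sp code_at_append by simp_all
  show ?thesis
  proof (intro exI allI conjI impI)
    fix n F y T
    let ?xs = "cnf_code n F"
    let ?m0 = "\<lambda>a. if a < length ?xs then ?xs ! a else 0"
    assume F: "F = []"
    have "(step p ^^ 2) (0, ?m0) = (length p, ?m0(0 := 1))"
      using step_code[OF code1(1)] step_code[OF code(2)] F
      by (simp add: numeral_2_eq_2 lenp cnf_code_def)
    then show "outputs_within p ?xs 1 (real K)"
      by (rule outputs_withinI) (auto simp: K_def)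
  next
    fix n F y T
    let ?xs = "cnf_code n F"
    let ?m0 = "\<lambda>a. if a < length ?xs then ?xs ! a else 0"
    assume F: "F \<noteq> []" and run: "\<forall>s. sat_loaded n F s \<longrightarrow> run c s T (\<lambda>s'. s' 0 0 = y)"
    define L where "L = length F"
    have L: "1 \<le> L" using F by (cases F) (auto simp: L_def)
    have m01: "?m0 1 = L" "?m0 0 = n" by (auto simp: cnf_code_def L_def)
    have m0big: "nth0 ?xs x = 0" if "8 * L \<le> x" for x using that L by (auto simp: nth0_def length_cnf_code L_def)
    have m0: "?m0 = nth0 ?xs" by (auto simp: nth0_def)
    have m01': "nth0 ?xs 1 = L" "nth0 ?xs 0 = n" by (auto simp: nth0_def cnf_code_def L_def)
    have s1: "(step p ^^ 1) (0, ?m0) = (1, ?m0)"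
      using step_code[OF code1(1), of "nth0 ?xs"] m01' L unfolding m0 by simp
    have st: "list_all straight is'" by (simp add: is'_def sat_pre_def)
    have len': "length is' = 22" by (simp add: is'_def sat_pre_def)
    let ?E = "8 * L"
    let ?m1 = "slrun is' ?m0"
    have s2: "(step p ^^ 22) (1, ?m0) = (?l, ?m1)"
      using step_straight[OF code1(2) st, of ?m0] len' by simp
    have start: "(step p ^^ (1 + 22)) (0, ?m0) = (?l, ?m1)"
      by (rule funpow_trans[OF s1 s2])
    have m1: "?m1 1 = ?E + 7" "?m1 2 = 1" "?m1 5 = 0" "?m1 6 = ?E" "?m1 7 = 8"
       "?m1 ?E = nth0 ?xs 2" "?m1 (?E + 1) = n" "?m1 (?E + 2) = nth0 ?xs 3" "?m1 (?E + 3) = nth0 ?xs 4"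
       "?m1 (?E + 4) = nth0 ?xs 5" "?m1 (?E + 5) = nth0 ?xs 6" "?m1 (?E + 6) = nth0 ?xs 7"
      unfolding m0 is'_def sat_pre_def using L m01' by simp_all
    have m1z: "?m1 x = nth0 ?xs x" if "8 \<le> x" "x < ?E \<or> ?E + 7 \<le> x" for x
      unfolding m0 is'_def sat_pre_def using L m01' that by (cases "x < 8 * L") simp_all
    have "\<exists>t m'. t \<le> (1 + 22) + ((?E + 7) * (8 + u) + 2) + length ?is * T + 2 \<and>
      (step p ^^ t) (0, ?m0) = (length p, m') \<and> m' 0 = y"
    proof (rule program_correct[OF p_def len uB(4,1) _ uB(3) start])
      show "\<forall>x\<ge>?E + 7. ?m1 x = 0"
        using m1z m0big L by simp
      fix s assume "loaded ?m1 s"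
      then have s': "s 6 0 = ?E" "\<forall>j\<ge>8. \<forall>i. s j i = 0" and s8: "\<forall>i\<ge>8. s 0 i = ?m1 i"
        using m1(4) unfolding loaded_def by auto
      have s: "s 0 i = ?m1 i" if "8 \<le> i" for i
        using s8 that by blast
      have five: "(\<forall>i<5. P i) \<longleftrightarrow> P 0 \<and> P 1 \<and> P 2 \<and> P 3 \<and> P 4" for P :: "nat \<Rightarrow> bool"
        by (auto simp: less_Suc_eq numeral_eq_Suc)
      have "s 0 i = ?xs ! i" if "8 \<le> i" "i < length ?xs" for i
      proof -
        have "i < ?E" using that L by (simp add: length_cnf_code L_def)
        then have "s 0 i = nth0 ?xs i" unfolding s[OF that(1)] by (intro m1z that) simp
        then show ?thesis using that by (simp add: nth0_def)
      qed
      moreover have "s 0 ?E = nth0 ?xs 2" "s 0 (?E + 1) = n"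
        using L s[of ?E] s[of "?E + 1"] m1 by simp_all
      moreover have "\<forall>i<5. s 0 (?E + 2 + i) = nth0 ?xs (3 + i)"
        unfolding five using L s[of "?E + 2"] s[of "?E + 3"] s[of "?E + 4"] s[of "?E + 5"] s[of "?E + 6"] m1 by (simp add: eval_nat_numeral)
      ultimately have "sat_loaded n F s"
        unfolding sat_loaded_def Let_def L_def[symmetric] using s' by blast
      then show "run c s T (\<lambda>s'. s' 0 0 = y)" using run by blast
    qed (use uB L m1 in auto)
    then obtain t m' where t: "t \<le> (1 + 22) + ((?E + 7) * (8 + u) + 2) + length ?is * T + 2"
      "(step p ^^ t) (0, ?m0) = (length p, m')" "m' 0 = y" by blast
    have "(?E + 7) * (8 + u) \<le> (15 * L) * (8 + u)" by (rule mult_le_mono1) (use L in simp)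
    then have "t \<le> 27 + 15 * (8 + u) * L + length ?is * T" using t(1) by (simp add: algebra_simps)
    also have "\<dots> \<le> K * (L + T + 1)"
    proof -
      have "K * (L + T + 1) = K * L + K * T + K" by (simp add: algebra_simps)
      moreover have "15 * (8 + u) * L \<le> K * L" "length ?is * T \<le> K * T" by (rule mult_le_mono1, simp add: K_def)+
      moreover have "27 \<le> K" by (simp add: K_def)
      ultimately show ?thesis by linarith
    qed
    finally have le: "t \<le> K * (length F + T + 1)" by (simp add: L_def)
    show "outputs_within p ?xs y (real (K * (length F + T + 1)))"
      by (rule outputs_withinI[OF t(2) le_refl t(3)]) (rule of_nat_mono[OF le])
  qed
qed

text \<open>From five vertices on, cells 3 to 7 belong to the first row of the adjacency matrix.
  They may be overwritten, as the matrix is symmetric with zero diagonal. Graphs with at most four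
  vertices contain no scorpion and get the answer 0. The address \<open>3 + n * n\<close> behind the
  input is computed by repeated addition, and only then are cells 0 to 2 saved there.\<close>

definition ind_pre :: "nat \<Rightarrow> instr list" where
  "ind_pre e = [Const 3 4, Sub 3 0 3, Jzero 3 e, Const 3 3, Const 5 1, Const 6 0, Add 4 0 6,
     Jzero 4 11, Add 3 3 0, Sub 4 4 5, Jzero 6 7,
     Add 6 3 6, Store 3 0, Add 3 3 5, Store 3 1, Add 3 3 5, Store 3 2, Add 3 3 5,
     Const 1 0, Add 1 3 1, Const 2 1, Const 5 0, Const 7 8]"

text \<open>Nothing is promised about row 0 of the matrix, part of which the prelude has
  destroyed.\<close>

definition ind_loaded :: "nat \<Rightarrow> nat \<Rightarrow> nat \<Rightarrow> nat graph \<Rightarrow> st \<Rightarrow> bool" where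
  "ind_loaded n k h G s \<longleftrightarrow> (let E = 3 + n * n in
     s 6 0 = E \<and> s 0 E = n \<and> s 0 (E + 1) = k \<and> s 0 (E + 2) = h \<and>
     (\<forall>a v. 1 \<le> a \<and> a < n \<and> v < n \<longrightarrow> s 0 (3 + n * a + v) = (if adj G a v then 1 else 0)) \<and>
     (\<forall>j\<ge>8. \<forall>i. s j i = 0))"

lemma length_concat_const: "(\<And>x. x \<in> set xs \<Longrightarrow> length (g x) = n) \<Longrightarrow> length (concat (map g xs)) = length xs * n"
  by (induction xs) auto

lemma nth_concat_const:
  "(\<And>x. x \<in> set xs \<Longrightarrow> length (g x) = n) \<Longrightarrow> a < length xs \<Longrightarrow> v < n \<Longrightarrow>
    concat (map g xs) ! (n * a + v) = g (xs ! a) ! v"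
proof (induction xs arbitrary: a)
  case (Cons x xs)
  show ?case
  proof (cases a)
    case (Suc a')
    have "concat (map g xs) ! (n * a' + v) = g (xs ! a') ! v"
      by (rule Cons.IH) (use Cons.prems Suc in auto)
    moreover have "n * a + v = length (g x) + (n * a' + v)" using Suc Cons.prems by simp
    ultimately show ?thesis using Suc by (simp only: nth_append_length_plus concat.simps list.map nth_Cons_Suc)
  qed (use Cons.prems in \<open>simp add: nth_append\<close>)
qed simp

lemma length_adj_matrix: "length (adj_matrix n G) = n * n"
  unfolding adj_matrix_def by (subst length_concat_const[where n = n]) auto

lemma nth_adj_matrix: "a < n \<Longrightarrow> v < n \<Longrightarrow> adj_matrix n G ! (n * a + v) = (if adj G a v then 1 else 0)"
  unfolding adj_matrix_def by (subst nth_concat_const) auto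

lemma ind_save:
  fixes z :: memory
  assumes "25 \<le> N"
  defines "m \<equiv> slrun [Add 6 3 6, Store 3 0, Add 3 3 5, Store 3 1, Add 3 3 5, Store 3 2, Add 3 3 5,
     Const 1 0, Add 1 3 1, Const 2 1, Const 5 0, Const 7 8] (z(3 := 3 + N, 5 := 1, 6 := 0, 4 := 0))"
  shows "m 1 = 3 + N + 3" "m 2 = 1" "m 5 = 0" "m 6 = 3 + N" "m 7 = 8" "m (3 + N) = z 0" "m (3 + N + 1) = z 1"
    "m (3 + N + 2) = z 2" "8 \<le> x \<Longrightarrow> x < 3 + N \<Longrightarrow> m x = z x" "8 \<le> x \<Longrightarrow> 3 + N + 3 \<le> x \<Longrightarrow> m x = z x"
  unfolding m_def using assms(1) by simp_all

lemma ind_program: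
  "\<exists>p K. \<forall>n k h G y T. 1 \<le> n \<longrightarrow> (n \<le> 4 \<longrightarrow> outputs_within p ([n, k, h] @ adj_matrix n G) 0 (real K)) \<and>
     (5 \<le> n \<longrightarrow> (\<forall>s. ind_loaded n k h G s \<longrightarrow> run c s T (\<lambda>s'. s' 0 0 = y)) \<longrightarrow>
        outputs_within p ([n, k, h] @ adj_matrix n G) y (real (K * (n * n + T + 1))))"
proof -
  obtain u B where uB: "u \<ge> 4" "9 \<le> B" "B < 2 ^ u" "fits u B c"
    using fits_exists by blast
  let ?l = "23 :: nat"
  define p where "p = program ind_pre ?l u B c 0"
  let ?is = "ccom u B c (?l + 8 + u)"
  let ?e = "?l + 8 + u + length ?is + 2"
  have len: "length (ind_pre e) = ?l" for e by (simp add: ind_pre_def)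
  define K where "K = 20 + 7 * (8 + u) + length ?is + 100"
  have p': "p = ind_pre ?e @ reloc u ?l @ ?is @ [Const 8 0, Jzero 8 (Suc ?e)] @ [Const 0 0]"
    unfolding p_def program_def by (simp add: Let_def)
  have ca: "code_at p 0 (ind_pre ?e @ (reloc u ?l @ ?is @ [Const 8 0, Jzero 8 (Suc ?e)]) @ [Const 0 0])"
    unfolding code_at_def by (intro exI[of _ "[]"]) (use p' in simp)
  have code: "code_at p 0 (ind_pre ?e)" "code_at p ?e [Const 0 0]"
    using ca unfolding code_at_append[of _ _ "ind_pre ?e"] code_at_append[of _ _ "reloc u ?l @ ?is @ _"] by (simp_all add: len add.assoc)
  have lenp: "length p = Suc ?e" unfolding p' by (simp add: len)
  define is1 where "is1 = [Const 3 3, Const 5 1, Const 6 0, Add 4 0 6]"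
  define is2 where "is2 = [Add 6 3 6, Store 3 0, Add 3 3 5, Store 3 1, Add 3 3 5, Store 3 2, Add 3 3 5,
     Const 1 0, Add 1 3 1, Const 2 1, Const 5 0, Const 7 8]"
  have sp: "ind_pre ?e = [Const 3 4, Sub 3 0 3] @ [Jzero 3 ?e] @ is1 @ [Jzero 4 11] @ [Add 3 3 0, Sub 4 4 5] @ [Jzero 6 7] @ is2"
    by (simp add: ind_pre_def is1_def is2_def)
  have cd: "code_at p 0 [Const 3 4, Sub 3 0 3]" "code_at p 2 [Jzero 3 ?e]" "code_at p 3 is1"
     "code_at p 7 [Jzero 4 11]" "code_at p 8 [Add 3 3 0, Sub 4 4 5]" "code_at p 10 [Jzero 6 7]" "code_at p 11 is2"
    using code(1) unfolding sp code_at_append by (simp_all add: is1_def eval_nat_numeral)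
  show ?thesis
  proof (intro exI allI conjI impI)
    fix n k h G y T
    let ?xs = "[n, k, h] @ adj_matrix n G"
    let ?m0 = "\<lambda>a. if a < length ?xs then ?xs ! a else 0"
    assume n: "1 \<le> n" "n \<le> 4"
    have h1: "(step p ^^ 2) (0, ?m0) = (2, ?m0(3 := 0))"
      using step_straight[OF cd(1), of ?m0] n by (simp add: eval_nat_numeral)
    have h2: "(step p ^^ 1) (2, ?m0(3 := 0)) = (?e, ?m0(3 := 0))"
      using step_code[OF cd(2)] by simp
    have h3: "(step p ^^ 1) (?e, ?m0(3 := 0)) = (Suc ?e, ?m0(3 := 0, 0 := 0))"
      using step_code[OF code(2)] by simp
    have "(step p ^^ (2 + 1 + 1)) (0, ?m0) = (Suc ?e, ?m0(3 := 0, 0 := 0))"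
      by (rule funpow_trans[OF funpow_trans[OF h1 h2] h3])
    then show "outputs_within p ?xs 0 (real K)"
      by (rule outputs_withinI) (auto simp: K_def lenp)
  next
    fix n k h G y T
    let ?xs = "[n, k, h] @ adj_matrix n G"
    let ?m0 = "\<lambda>a. if a < length ?xs then ?xs ! a else 0"
    assume n: "1 \<le> n" "5 \<le> n" and run: "\<forall>s. ind_loaded n k h G s \<longrightarrow> run c s T (\<lambda>s'. s' 0 0 = y)"
    have m0: "?m0 = nth0 ?xs" by (auto simp: nth0_def)
    have lenx: "length ?xs = 3 + n * n" by (simp add: length_adj_matrix)
    have m0v: "nth0 ?xs 0 = n" "nth0 ?xs 1 = k" "nth0 ?xs 2 = h" by (auto simp: nth0_def)
    have m0a: "nth0 ?xs (3 + n * a + v) = (if adj G a v then 1 else 0)" if "a < n" "v < n" for a v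
    proof -
      have "n * a + v < n * n"
        using that by (metis add_less_cancel_left less_le_trans mult_Suc_right add.commute mult_le_mono2 Suc_leI)
      then show ?thesis using nth_adj_matrix[OF that, of G] by (simp add: nth0_def length_adj_matrix)
    qed
    let ?E = "3 + n * n"
    have nn: "25 \<le> n * n" using mult_le_mono[OF n(2) n(2)] by simp
    let ?m1 = "(nth0 ?xs)(3 := n - 4)"
    have s1: "(step p ^^ 2) (0, nth0 ?xs) = (2, ?m1)"
      using step_straight[OF cd(1), of "nth0 ?xs"] m0v by (simp add: eval_nat_numeral)
    have s2: "(step p ^^ 1) (2, ?m1) = (3, ?m1)"
      using step_code[OF cd(2), of ?m1] n by simp
    \<comment> \<open>The state of the loop that forms \<open>n * n\<close>: register 4 counts the
      remaining additions, register 3 holds the sum so far, and register 6 is zero for the sake of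
      the jump back.\<close>
    let ?m2 = "\<lambda>i. (nth0 ?xs)(3 := 3 + n * (n - i), 5 := 1, 6 := 0, 4 := i)"
    have s3: "(step p ^^ 4) (3, ?m1) = (7, ?m2 n)"
    proof -
      have "slrun is1 ?m1 = ?m2 n" using m0v by (simp add: is1_def fun_eq_iff)
      moreover have "length is1 = 4" "list_all straight is1" by (simp_all add: is1_def)
      ultimately show ?thesis using step_straight[OF cd(3), of ?m1] by simp
    qed
    have lp: "(step p ^^ (4 * i + 1)) (7, ?m2 i) = (11, ?m2 0)" if "i \<le> n" for i
      using that
    proof (induction i)
      case 0
      then show ?case by (simp add: step_code[OF cd(4)])
    next
      case (Suc i)
      have h1: "(step p ^^ 1) (7, ?m2 (Suc i)) = (8, ?m2 (Suc i))"
        using step_code[OF cd(4), of "?m2 (Suc i)"] by simp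
      have h2: "(step p ^^ 2) (8, ?m2 (Suc i)) = (10, ?m2 i)"
      proof -
        have "n - i = Suc (n - Suc i)" using Suc.prems by simp
        then have "slrun [Add 3 3 0, Sub 4 4 5] (?m2 (Suc i)) = ?m2 i"
          using m0v by (simp add: fun_eq_iff)
        then show ?thesis using step_straight[OF cd(5), of "?m2 (Suc i)"] by (simp add: numeral_2_eq_2)
      qed
      have h3: "(step p ^^ 1) (10, ?m2 i) = (7, ?m2 i)"
        using step_code[OF cd(6), of "?m2 i"] by simp
      have h4: "(step p ^^ (4 * i + 1)) (7, ?m2 i) = (11, ?m2 0)"
        by (rule Suc.IH) (use Suc.prems in simp)
      have "(step p ^^ (1 + 2 + 1 + (4 * i + 1))) (7, ?m2 (Suc i)) = (11, ?m2 0)"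
        by (rule funpow_trans[OF funpow_trans[OF funpow_trans[OF h1 h2] h3] h4])
      moreover have "1 + 2 + 1 + (4 * i + 1) = 4 * Suc i + 1" by simp
      ultimately show ?case by (simp only:)
    qed
    define m3 where "m3 = slrun is2 (?m2 0)"
    have "length is2 = 12" "list_all straight is2" by (simp_all add: is2_def)
    then have s5: "(step p ^^ 12) (11, ?m2 0) = (?l, m3)"
      using step_straight[OF cd(7), of "?m2 0"] by (simp add: m3_def)
    have m3': "m3 = slrun is2 ((nth0 ?xs)(3 := 3 + n * n, 5 := 1, 6 := 0, 4 := 0))"
      unfolding m3_def by simp
    note m3 = ind_save[OF nn, where z = "nth0 ?xs", folded is2_def, folded m3', unfolded m0v]
    have m3z: "m3 x = nth0 ?xs x" if "8 \<le> x" "x < ?E \<or> ?E + 3 \<le> x" for x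
      using m3(9,10) that by blast
    have start: "(step p ^^ (2 + 1 + 4 + (4 * n + 1) + 12)) (0, ?m0) = (?l, m3)"
      unfolding m0 by (rule funpow_trans[OF funpow_trans[OF funpow_trans[OF funpow_trans[OF s1 s2] s3] lp[OF le_refl]] s5])
    have "\<exists>t m'. t \<le> (2 + 1 + 4 + (4 * n + 1) + 12) + ((?E + 3) * (8 + u) + 2) + length ?is * T + 2 \<and>
      (step p ^^ t) (0, ?m0) = (length p, m') \<and> m' 0 = y"
    proof (rule program_correct[OF p_def len uB(4,1) _ uB(3) start])
      show "\<forall>x\<ge>?E + 3. m3 x = 0"
      proof (intro allI impI)
        fix x assume "?E + 3 \<le> x"
        then show "m3 x = 0" using m3z[of x] nn lenx by (simp add: nth0_def)
      qed
      fix s assume s: "loaded m3 s"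
      have "ind_loaded n k h G s"
        unfolding ind_loaded_def Let_def
      proof (intro conjI allI impI)
        fix a v assume av: "1 \<le> a \<and> a < n \<and> v < n"
        then have 1: "n * 1 \<le> n * a" by (intro mult_le_mono2) simp
        have 2: "n * a + v < n * n"
          using av by (metis add_less_cancel_left less_le_trans mult_Suc_right add.commute mult_le_mono2 Suc_leI)
        have 8: "8 \<le> 3 + n * a + v" using 1 n by linarith
        then have "s 0 (3 + n * a + v) = m3 (3 + n * a + v)" using s unfolding loaded_def by blast
        also have "\<dots> = nth0 ?xs (3 + n * a + v)" by (rule m3z) (use 8 2 in auto)
        finally show "s 0 (3 + n * a + v) = (if adj G a v then 1 else 0)" using m0a av by simp
      qed (use s m3(1-8) nn in \<open>auto simp: loaded_def\<close>)
      then show "run c s T (\<lambda>s'. s' 0 0 = y)" using run by blast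
    qed (use uB m3(1-8) nn in auto)
    then obtain t m' where t: "t \<le> (2 + 1 + 4 + (4 * n + 1) + 12) + ((?E + 3) * (8 + u) + 2) + length ?is * T + 2"
      "(step p ^^ t) (0, ?m0) = (length p, m')" "m' 0 = y" by blast
    have "(?E + 3) * (8 + u) \<le> (7 * (n * n)) * (8 + u)" by (rule mult_le_mono1) (use nn n in simp)
    moreover have "4 * n \<le> 4 * (n * n)" using n by simp
    ultimately have "t \<le> 24 + 4 * (n * n) + (7 * (n * n)) * (8 + u) + length ?is * T" using t(1) by linarith
    also have "\<dots> = 24 + (4 + 7 * (8 + u)) * (n * n) + length ?is * T" by (simp add: algebra_simps)
    also have "\<dots> \<le> K * (n * n + T + 1)"
    proof -
      have "K * (n * n + T + 1) = K * (n * n) + K * T + K" by (simp add: algebra_simps)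
      moreover have "(4 + 7 * (8 + u)) * (n * n) \<le> K * (n * n)" "length ?is * T \<le> K * T" by (rule mult_le_mono1, simp add: K_def)+
      moreover have "24 \<le> K" by (simp add: K_def)
      ultimately show ?thesis by linarith
    qed
    finally have le: "t \<le> K * (n * n + T + 1)" .
    show "outputs_within p ?xs y (real (K * (n * n + T + 1)))"
      by (rule outputs_withinI[OF t(2) le_refl t(3)]) (rule of_nat_mono[OF le])
  qed
qed

subsection \<open>Interpreting random access machines\<close>

lemma run_WhileF: "wval e s = 0 \<Longrightarrow> Q s \<Longrightarrow> 1 \<le> T \<Longrightarrow> run (WhileC e c) s T Q"
  unfolding run_def using wWhileF by blast

lemma run_WhileT:
  assumes "wval e s \<noteq> 0" "run c s T1 (\<lambda>s'. run (WhileC e c) s' T2 Q)" "1 + T1 + T2 \<le> T"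
  shows "run (WhileC e c) s T Q"
proof -
  obtain t1 s1 t2 s2 where "wexec c s t1 s1" "t1 \<le> T1" "wexec (WhileC e c) s1 t2 s2" "t2 \<le> T2" "Q s2"
    using assms(2) unfolding run_def by blast
  then show ?thesis
    using wWhileT[OF assms(1), of c t1 s1 t2 s2] assms(3) unfolding run_def
    by (intro exI[of _ "Suc (t1 + t2)"] exI[of _ s2]) auto
qed

lemma run_IfC_Sq [simp]: "run (IfC e c1 c2 ;; c) s T Q \<longleftrightarrow>
    1 \<le> T \<and> (if wval e s \<noteq> 0 then run (c1 ;; c) s (T - 1) Q else run (c2 ;; c) s (T - 1) Q)"
proof -
  let ?c = "if wval e s \<noteq> 0 then c1 else c2"
  have "run (IfC e c1 c2 ;; c) s T Q \<longleftrightarrow> (\<exists>t s'. wexec (?c ;; c) s t s' \<and> Suc t \<le> T \<and> Q s')"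
    unfolding run_def wexec_IfC wexec_Sq by force
  also have "\<dots> \<longleftrightarrow> 1 \<le> T \<and> run (?c ;; c) s (T - 1) Q"
    unfolding run_def by (cases T) auto
  finally show ?thesis by simp
qed

text \<open>With truncated subtraction, both differences vanish exactly for equal numbers.\<close>

definition w_eq :: "wexp \<Rightarrow> wexp \<Rightarrow> wexp" where
  "w_eq a b = Mi (Cn 1) (Pl (Mi a b) (Mi b a))"

definition w_not :: "wexp \<Rightarrow> wexp" where
  "w_not a = Mi (Cn 1) a"

definition w_and :: "wexp \<Rightarrow> wexp \<Rightarrow> wexp" where
  "w_and a b = w_not (Pl (w_not a) (w_not b))"

lemma wval_eq [simp]: "wval (w_eq a b) s = (if wval a s = wval b s then 1 else 0)"
  by (auto simp: w_eq_def)

lemma wval_not [simp]: "wval (w_not a) s = (if wval a s = 0 then 1 else 0)"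
  by (auto simp: w_not_def)

lemma wval_and [simp]: "wval (w_and a b) s = (if wval a s \<noteq> 0 \<and> wval b s \<noteq> 0 then 1 else 0)"
  by (auto simp: w_and_def)

text \<open>The interpreted machine's memory cell \<open>a\<close> has the value \<open>10[a]\<close> if the stamp \<open>11[a]\<close> equals
  the current version \<open>12[0]\<close>, and is zero otherwise. So increasing the version clears the memory.
  The program counter is \<open>13[0]\<close>.\<close>

definition vmem :: "st \<Rightarrow> memory" where
  "vmem s a = (if s 11 a = s 12 0 then s 10 a else 0)"

definition vget :: "nat \<Rightarrow> wexp \<Rightarrow> wcom" where
  "vget d e = IfC (w_eq (Rd 11 e) (V 12)) (d ::= Rd 10 e) (d ::= Cn 0)"

definition vput :: "wexp \<Rightarrow> wexp \<Rightarrow> wcom" where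
  "vput e v = Wr 10 e v ;; Wr 11 e (V 12)"

primrec interp_instr :: "instr \<Rightarrow> wcom" where
  "interp_instr (Const i c) = vput (Cn i) (Cn c) ;; 13 ::= Pl (V 13) (Cn 1)"
| "interp_instr (Add i j k) = vget 14 (Cn j) ;; vget 15 (Cn k) ;; vput (Cn i) (Pl (V 14) (V 15)) ;; 13 ::= Pl (V 13) (Cn 1)"
| "interp_instr (Sub i j k) = vget 14 (Cn j) ;; vget 15 (Cn k) ;; vput (Cn i) (Mi (V 14) (V 15)) ;; 13 ::= Pl (V 13) (Cn 1)"
| "interp_instr (Half i j) = vget 14 (Cn j) ;; vput (Cn i) (Hf (V 14)) ;; 13 ::= Pl (V 13) (Cn 1)"
| "interp_instr (Load i j) = vget 14 (Cn j) ;; vget 15 (V 14) ;; vput (Cn i) (V 15) ;; 13 ::= Pl (V 13) (Cn 1)"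
| "interp_instr (Store i j) = vget 14 (Cn i) ;; vget 15 (Cn j) ;; vput (V 14) (V 15) ;; 13 ::= Pl (V 13) (Cn 1)"
| "interp_instr (Jzero i l) = vget 14 (Cn i) ;; IfC (V 14) (13 ::= Pl (V 13) (Cn 1)) (13 ::= Cn l)"

text \<open>The clause about array 11 keeps stamps from growing beyond the current version.
  Otherwise a later increase of the version could fail to clear the simulated memory.\<close>

definition only_interp :: "st \<Rightarrow> st \<Rightarrow> bool" where
  "only_interp s s' \<longleftrightarrow> (\<forall>j. j \<notin> {10, 11, 13, 14, 15} \<longrightarrow> s' j = s j) \<and>
     (\<forall>a. s' 11 a = s 11 a \<or> s' 11 a = s 12 0)"

lemma run_vget: "run (vget d e) s T Q \<longleftrightarrow> 2 \<le> T \<and> Q (put s d 0 (vmem s (wval e s)))"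
  by (auto simp: vget_def vmem_def)

lemma run_vget_Sq: "run (vget d e ;; c) s T Q \<longleftrightarrow> 2 \<le> T \<and> run c (put s d 0 (vmem s (wval e s))) (T - 2) Q"
proof -
  have *: "T - Suc (Suc 0) = T - 2" "Suc 0 \<le> T - Suc 0 \<longleftrightarrow> 2 \<le> T" by auto
  show ?thesis
    unfolding vget_def by (auto simp: vmem_def *)
qed

lemma run_interp_instr:
  "run (interp_instr i) s 8 (\<lambda>s'. (s' 13 0, vmem s') = exec i (s 13 0, vmem s) \<and> only_interp s s')"
  by (cases i) (auto simp: run_vget run_vget_Sq vput_def only_interp_def vmem_def fun_eq_iff)

text \<open>The dispatch compares the program counter with every instruction number; this costs a
  factor that depends only on the interpreted program.\<close>

primrec switch :: "instr list \<Rightarrow> nat \<Rightarrow> wcom" where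
  "switch [] n = Skp"
| "switch (i # is) n = IfC (w_eq (V 13) (Cn n)) (interp_instr i) (switch is (Suc n))"

lemma run_switch:
  "n \<le> s 13 0 \<Longrightarrow> s 13 0 < n + length p \<Longrightarrow>
   run (switch p n) s (length p + 8) (\<lambda>s'. (s' 13 0, vmem s') = exec (p ! (s 13 0 - n)) (s 13 0, vmem s) \<and> only_interp s s')"
proof (induction p arbitrary: n)
  case (Cons i p)
  show ?case
  proof (cases "s 13 0 = n")
    case True
    then show ?thesis using run_interp_instr[of i s] by (auto intro: run_mono)
  next
    case False
    have "run (switch p (Suc n)) s (length p + 8) (\<lambda>s'. (s' 13 0, vmem s') = exec (p ! (s 13 0 - Suc n)) (s 13 0, vmem s) \<and> only_interp s s')"
      by (rule Cons.IH) (use False Cons.prems in auto)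
    moreover have "p ! (s 13 0 - Suc n) = (i # p) ! (s 13 0 - n)"
      using False Cons.prems by (simp add: nth_Cons')
    ultimately show ?thesis using False by (simp add: add.commute)
  qed
qed simp

definition interp :: "instr list \<Rightarrow> wcom" where
  "interp p = WhileC (Mi (Cn (length p)) (V 13)) (switch p 0)"

lemma only_interp_trans: "only_interp s s' \<Longrightarrow> only_interp s' s'' \<Longrightarrow> only_interp s s''"
  unfolding only_interp_def by (auto; metis)

lemma run_interp:
  "(step p ^^ t) (s 13 0, vmem s) = (pc, m) \<Longrightarrow> length p \<le> pc \<Longrightarrow>
   run (interp p) s (t * (length p + 9) + 1) (\<lambda>s'. vmem s' = m \<and> only_interp s s')"
proof (induction t arbitrary: s)
  case 0
  then show ?case unfolding interp_def by (intro run_WhileF) (auto simp: only_interp_def)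
next
  case (Suc t)
  show ?case
  proof (cases "s 13 0 < length p")
    case False
    \<comment> \<open>The number \<open>t\<close> of steps may exceed the halting time; a halted
      machine idles.\<close>
    have stop: "(step p ^^ t) (s 13 0, vmem s) = (s 13 0, vmem s)" for t
      by (induction t) (use False in \<open>auto simp: step_def\<close>)
    show ?thesis using stop[of "Suc t"] Suc.prems False
      unfolding interp_def by (intro run_WhileF) (auto simp: only_interp_def)
  next
    case True
    have st: "step p (s 13 0, vmem s) = exec (p ! s 13 0) (s 13 0, vmem s)" using True by (simp add: step_def)
    have "run (switch p 0) s (length p + 8) (\<lambda>s'. (s' 13 0, vmem s') = exec (p ! s 13 0) (s 13 0, vmem s) \<and> only_interp s s')"
      using run_switch[of 0 s p] True by simp
    then have "run (switch p 0) s (length p + 8)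
        (\<lambda>s'. run (WhileC (Mi (Cn (length p)) (V 13)) (switch p 0)) s' (t * (length p + 9) + 1) (\<lambda>s'. vmem s' = m \<and> only_interp s s'))"
    proof (rule run_mono)
      fix s' assume s': "(s' 13 0, vmem s') = exec (p ! s 13 0) (s 13 0, vmem s) \<and> only_interp s s'"
      have "(step p ^^ t) (s' 13 0, vmem s') = (pc, m)"
        using Suc.prems(1) s' st by (simp add: funpow_swap1)
      from Suc.IH[OF this Suc.prems(2)]
      show "run (WhileC (Mi (Cn (length p)) (V 13)) (switch p 0)) s' (t * (length p + 9) + 1) (\<lambda>s'. vmem s' = m \<and> only_interp s s')"
        unfolding interp_def using s' only_interp_trans by (elim run_mono) auto
    qed simp
    from run_WhileT[OF _ this] show ?thesis
      unfolding interp_def using True by simp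
  qed
qed

section \<open>Counting scorpions by their paths\<close>

text \<open>All candidates for legs of the path. Edges among legs are unrestricted, so any subset of
  the right size completes the path to a scorpion.\<close>

definition legs_of :: "'a graph \<Rightarrow> 'a list \<Rightarrow> 'a set" where
  "legs_of G qs = {v \<in> verts G. adj G (hd qs) v \<and> (\<forall>q\<in>set (tl qs). \<not> adj G q v)}"

definition ipaths :: "'a graph \<Rightarrow> nat \<Rightarrow> 'a list set" where
  "ipaths G m = {qs. length qs = m \<and> induced_path G qs}"

lemma adj_commute: "adj G u v \<longleftrightarrow> adj G v u"
  unfolding adj_def by (simp add: insert_commute)

lemma adj_irrefl: "simple_graph G \<Longrightarrow> \<not> adj G v v"
  unfolding adj_def simple_graph_def by fastforce

lemma finite_ipaths: "simple_graph G \<Longrightarrow> finite (ipaths G m)"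
  by (rule finite_subset[OF _ finite_lists_length_eq[of "verts G" m]])
    (auto simp: ipaths_def induced_path_def simple_graph_def)

lemma ipath_adj:
  assumes "simple_graph G" "induced_path G qs" "i < length qs" "j < length qs"
  shows "adj G (qs ! i) (qs ! j) \<longleftrightarrow> j = Suc i \<or> i = Suc j"
proof (cases i j rule: linorder_cases)
  case less
  then show ?thesis using assms unfolding induced_path_def by auto
next
  case equal
  then show ?thesis using assms adj_irrefl by fastforce
next
  case greater
  then have "adj G (qs ! j) (qs ! i) \<longleftrightarrow> i = Suc j"
    using assms unfolding induced_path_def by auto
  then show ?thesis using greater by (auto simp: adj_commute)
qed

text \<open>On the path only the second vertex is adjacent to the first one, and it is no leg
  because it is also adjacent to the third. A third vertex exists as \<open>l\<close> is
  positive.\<close>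

lemma legs_disjoint:
  assumes "simple_graph G" "qs \<in> ipaths G (l + 2)" "1 \<le> l"
  shows "legs_of G qs \<inter> set qs = {}"
proof -
  have ip: "induced_path G qs" and len: "length qs = l + 2" using assms unfolding ipaths_def by auto
  have hd: "hd qs = qs ! 0" using len by (intro hd_conv_nth) auto
  have tl: "qs ! j \<in> set (tl qs)" if "1 \<le> j" "j < l + 2" for j
    using that len nth_mem[of "j - 1" "tl qs"] by (auto simp: nth_tl)
  have "qs ! i \<notin> legs_of G qs" if "i < l + 2" for i
  proof
    assume "qs ! i \<in> legs_of G qs"
    then have "adj G (qs ! 0) (qs ! i)" and *: "\<forall>q\<in>set (tl qs). \<not> adj G q (qs ! i)"
      unfolding legs_of_def using hd by auto
    then have "i = 1" using ipath_adj[OF assms(1) ip, of 0 i] that len by auto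
    moreover have "adj G (qs ! 2) (qs ! 1)"
      using ipath_adj[OF assms(1) ip, of 2 1] assms(3) len by auto
    ultimately show False using * tl[of 2] assms(3) by auto
  qed
  then show ?thesis using len by (auto simp: in_set_conv_nth)
qed

lemma adj_induced: "adj (induced G X) u v \<longleftrightarrow> adj G u v \<and> u \<in> X \<and> v \<in> X"
  unfolding adj_def induced_def by auto

text \<open>Enlarging the vertex set by \<open>X\<close> spares the assumption that \<open>X\<close>
  consists of vertices; for such \<open>X\<close> the graph on the right is \<open>G\<close>
  itself.\<close>

lemma induced_path_induced:
  "induced_path (induced G X) qs \<longleftrightarrow> set qs \<subseteq> X \<and> induced_path (X \<union> verts G, edges G) qs"
proof -
  have "adj (X \<union> verts G, edges G) u v = adj G u v" for u v by (simp add: adj_def)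
  then show ?thesis
    unfolding induced_path_def adj_induced by (auto simp: induced_def subset_iff)
qed

lemma scorpion_induced_iff:
  assumes G: "simple_graph G" and l: "1 \<le> l" and X: "X \<subseteq> verts G" "card X = k"
  shows "scorpion l (induced G X) \<longleftrightarrow>
    l + 4 \<le> k \<and> (\<exists>qs\<in>ipaths G (l + 2). \<exists>Y\<subseteq>legs_of G qs. card Y = k - l - 2 \<and> X = set qs \<union> Y)"
    (is "?L \<longleftrightarrow> ?R")
proof
  have fin: "finite X" using G X unfolding simple_graph_def by (meson finite_subset)
  have XV: "X \<union> verts G = verts G" using X by auto
  have vX: "verts (induced G X) = X" by (simp add: induced_def)
  assume ?L
  then obtain b ts s where 1: "length ts = l" "induced_path (induced G X) (b # ts @ [s])"
      "\<forall>v\<in>X - set (b # ts @ [s]). adj (induced G X) b v"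
      "\<forall>q\<in>set (b # ts @ [s]). \<forall>v\<in>X - set (b # ts @ [s]). adj (induced G X) q v \<longrightarrow> q = b"
      and k: "l + 4 \<le> k"
    unfolding scorpion_def Let_def vX X by auto
  let ?qs = "b # ts @ [s]"
  let ?Y = "X - set ?qs"
  have ip: "induced_path G ?qs" "set ?qs \<subseteq> X" using 1(2) unfolding induced_path_induced XV by auto
  have "?qs \<in> ipaths G (l + 2)" using ip 1(1) unfolding ipaths_def by simp
  moreover have "?Y \<subseteq> legs_of G ?qs"
  proof
    fix v assume v: "v \<in> ?Y"
    have "\<not> adj G q v" if "q \<in> set (ts @ [s])" for q
    proof
      assume "adj G q v"
      then have "adj (induced G X) q v" using v ip that unfolding adj_induced by auto
      then have "q = b" using 1(4) v that by auto
      then show False using ip(1) that unfolding induced_path_def by auto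
    qed
    then show "v \<in> legs_of G ?qs"
      using 1(3) v X unfolding legs_of_def adj_induced by auto
  qed
  moreover have "card ?Y = k - l - 2"
  proof -
    have "card (set ?qs) = l + 2" using ip(1) 1(1) distinct_card[of ?qs] unfolding induced_path_def by simp
    then show ?thesis using X(2) ip(2) fin by (subst card_Diff_subset) auto
  qed
  moreover have "X = set ?qs \<union> ?Y" using ip(2) by auto
  ultimately show ?R using k by blast
next
  have fin: "finite X" using G X unfolding simple_graph_def by (meson finite_subset)
  have XV: "X \<union> verts G = verts G" using X by auto
  have vX: "verts (induced G X) = X" by (simp add: induced_def)
  assume ?R
  then obtain qs Y where k: "l + 4 \<le> k" and qs: "qs \<in> ipaths G (l + 2)" and Y: "Y \<subseteq> legs_of G qs" "X = set qs \<union> Y"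
    by blast
  have ip: "induced_path G qs" and len: "length qs = l + 2" using qs unfolding ipaths_def by auto
  obtain b ts' where q1: "qs = b # ts'" using len by (cases qs) auto
  have "ts' \<noteq> []" using len q1 by auto
  then obtain ts s where q2: "ts' = ts @ [s]" by (metis append_butlast_last_id)
  have q: "qs = b # ts @ [s]" "length ts = l" using q1 q2 len by auto
  have sg: "simple_graph (induced G X)"
    using G fin unfolding simple_graph_def induced_def by auto
  have legs: "X - set qs \<subseteq> legs_of G qs" using Y by auto
  have "induced_path (induced G X) (b # ts @ [s])"
    unfolding induced_path_induced XV using ip Y(2) q by auto
  moreover have "\<forall>v\<in>X - set (b # ts @ [s]). adj (induced G X) b v"
    using legs Y(2) q unfolding adj_induced legs_of_def by auto
  moreover have "\<forall>q\<in>set (b # ts @ [s]). \<forall>v\<in>X - set (b # ts @ [s]). adj (induced G X) q v \<longrightarrow> q = b"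
    using legs q unfolding adj_induced legs_of_def by auto
  ultimately show ?L
    unfolding scorpion_def Let_def vX X using sg k q(2) by blast
qed

text \<open>The last vertex of the path has degree one and is attached to a vertex of degree two; this
  distinguishes it from the legs. The other vertices of the path follow one by one.\<close>

lemma scorpion_unique:
  assumes G: "simple_graph G" and l: "1 \<le> l"
    and qs: "qs \<in> ipaths G (l + 2)" "Y \<subseteq> legs_of G qs" "X = set qs \<union> Y" "2 \<le> card Y"
    and qs': "qs' \<in> ipaths G (l + 2)" "Y' \<subseteq> legs_of G qs'" "X = set qs' \<union> Y'" "2 \<le> card Y'"
  shows "qs = qs'"
proof -
  define nb where "nb v = {u \<in> X. adj G v u}" for v
  have nbs: "nb (ps ! (l + 1)) = {ps ! l} \<and> (\<forall>j. 1 \<le> j \<and> j \<le> l \<longrightarrow> nb (ps ! j) = {ps ! (j - 1), ps ! (j + 1)}) \<and>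
     nb (ps ! 0) = insert (ps ! 1) Z \<and> (\<forall>v\<in>Z. ps ! 0 \<in> nb v) \<and> ps ! 1 \<notin> Z \<and> distinct ps \<and> length ps = l + 2"
    if ps: "ps \<in> ipaths G (l + 2)" "Z \<subseteq> legs_of G ps" "X = set ps \<union> Z" for ps Z
  proof -
    have ip: "induced_path G ps" and len: "length ps = l + 2" using ps unfolding ipaths_def by auto
    note adj = ipath_adj[OF G ip, unfolded len]
    have hd: "hd ps = ps ! 0" using len by (intro hd_conv_nth) auto
    have tl: "ps ! j \<in> set (tl ps)" if "1 \<le> j" "j < l + 2" for j
      using that len nth_mem[of "j - 1" "tl ps"] by (auto simp: nth_tl)
    have Z: "adj G (ps ! 0) v" "1 \<le> j \<Longrightarrow> j < l + 2 \<Longrightarrow> \<not> adj G (ps ! j) v" if "v \<in> Z" for v j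
      using that ps(2) hd tl unfolding legs_of_def by auto
    have S: "set ps = (\<lambda>j. ps ! j) ` {..<l + 2}" using len by (auto simp: set_conv_nth)
    have nbS: "nb (ps ! i) = (\<lambda>j. ps ! j) ` {j. j < l + 2 \<and> (j = Suc i \<or> i = Suc j)} \<union> {v\<in>Z. adj G (ps ! i) v}" if "i < l + 2" for i
      unfolding nb_def ps(3) S using adj[OF that] by auto
    have disj: "Z \<inter> set ps = {}" using legs_disjoint[OF G ps(1) l] ps(2) by auto
    have e1: "{j. j < l + 2 \<and> (j = Suc (l + 1) \<or> l + 1 = Suc j)} = {l}" by auto
    have e2: "{j. j < l + 2 \<and> (j = Suc i \<or> i = Suc j)} = {i - 1, i + 1}" if "1 \<le> i" "i \<le> l" for i using that by auto
    have e3: "{j. j < l + 2 \<and> (j = Suc 0 \<or> 0 = Suc j)} = {1}" by auto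
    show ?thesis
    proof (intro conjI allI impI ballI)
      show "nb (ps ! (l + 1)) = {ps ! l}" using nbS[of "l + 1"] e1 Z by auto
      show "nb (ps ! j) = {ps ! (j - 1), ps ! (j + 1)}" if "1 \<le> j \<and> j \<le> l" for j
        using nbS[of j] e2[of j] Z(2)[of _ j] that by auto
      show "nb (ps ! 0) = insert (ps ! 1) Z" using nbS[of 0] e3 Z(1) by auto
      show "ps ! 0 \<in> nb v" if "v \<in> Z" for v
        using Z(1)[OF that] nth_mem[of 0 ps] len unfolding nb_def ps(3) by (auto simp: adj_commute)
      show "ps ! 1 \<notin> Z" using disj len nth_mem[of 1 ps] by auto
      show "distinct ps" using ip unfolding induced_path_def by auto
    qed (rule len)
  qed
  note A = nbs[OF qs(1-3)] and A' = nbs[OF qs'(1-3)]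
  have finY: "finite Y" using qs(4) by (intro card_ge_0_finite) simp
  have three: "card (nb (qs ! 0)) \<ge> 3" using A qs(4) finY by simp
  have s': "qs' ! (l + 1) = qs ! (l + 1)"
  proof -
    let ?s = "qs' ! (l + 1)"
    have one: "nb ?s = {qs' ! l}" using A' by simp
    have two: "card (nb (qs' ! l)) \<le> 2" using A' l by (simp add: card_insert_le_m1)
    have "?s \<in> X" using A' qs'(3) by (metis Un_iff add_less_cancel_left lessI nth_mem one_add_one plus_1_eq_Suc)
    then consider i where "i < l + 2" "?s = qs ! i" | "?s \<in> Y"
      unfolding qs(3) using A by (auto simp: in_set_conv_nth)
    then show ?thesis
    proof cases
      case 1
      then consider "i = 0" | "1 \<le> i" "i \<le> l" | "i = l + 1" by linarith
      then show ?thesis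
      proof cases
        case 1
        then show ?thesis using three one \<open>?s = qs ! i\<close> by simp
      next
        case 2
        then have "qs ! (i - 1) = qs ! (i + 1)" using A one \<open>?s = qs ! i\<close> by auto
        then show ?thesis using A 2 by (simp add: nth_eq_iff_index_eq)
      qed (use 1 in simp)
    next
      case 2
      then have "qs ! 0 = qs' ! l" using A one by auto
      then show ?thesis using three two by simp
    qed
  qed
  \<comment> \<open>Walking back from the common last vertex, an inner vertex has exactly two
    neighbours, so it and its successor determine its predecessor. The induction therefore carries
    two consecutive vertices.\<close>
  have "qs' ! (l + 1 - i) = qs ! (l + 1 - i) \<and> (1 \<le> i \<longrightarrow> qs' ! (l + 1 - i + 1) = qs ! (l + 1 - i + 1))" if "i \<le> l + 1" for i
    using that
  proof (induction i)
    case 0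
    then show ?case using s' by simp
  next
    case (Suc i)
    define j where "j = l + 1 - i"
    have j: "1 \<le> j" "j \<le> l + 1" "l + 1 - Suc i = j - 1" using Suc.prems by (auto simp: j_def)
    have e: "qs' ! j = qs ! j" using Suc j_def by simp
    have "qs' ! (j - 1) = qs ! (j - 1)"
    proof (cases "j = l + 1")
      case True
      then have "{qs' ! l} = {qs ! l}" using A A' e by metis
      then show ?thesis using True by simp
    next
      case False
      then have "1 \<le> i" using j_def j by auto
      then have e1: "qs' ! (j + 1) = qs ! (j + 1)" using Suc j_def by simp
      have "nb (qs' ! j) = {qs' ! (j - 1), qs' ! (j + 1)}" "nb (qs ! j) = {qs ! (j - 1), qs ! (j + 1)}"
        using A A' False j by auto
      then have "{qs' ! (j - 1), qs ! (j + 1)} = {qs ! (j - 1), qs ! (j + 1)}" using e e1 by simp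
      then show ?thesis by (metis doubleton_eq_iff)
    qed
    then show ?case using j e by simp
  qed
  then have "qs ! j = qs' ! j" if "j < l + 2" for j
    using that spec[of "\<lambda>i. i \<le> l + 1 \<longrightarrow> qs' ! (l + 1 - i) = qs ! (l + 1 - i)" "l + 1 - j"] by simp
  then show ?thesis using A A' by (intro nth_equalityI) auto
qed

theorem num_IndSub_Psi:
  assumes G: "simple_graph G" and l: "f k = l" "1 \<le> l"
  shows "num_IndSub (Psi f) G k =
    (if k < l + 4 then 0 else \<Sum>qs\<in>ipaths G (l + 2). card (legs_of G qs) choose (k - l - 2))"
proof -
  let ?r = "k - l - 2"
  define F where "F qs = (\<lambda>Y. set qs \<union> Y) ` {Y. Y \<subseteq> legs_of G qs \<and> card Y = ?r}" for qs
  have fin: "finite (legs_of G qs)" for qs using G unfolding legs_of_def simple_graph_def by auto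
  have vX: "verts (induced G X) = X" for X by (simp add: induced_def)
  have "{X. X \<subseteq> verts G \<and> card X = k \<and> Psi f (induced G X)} =
      {X. X \<subseteq> verts G \<and> card X = k \<and> l + 4 \<le> k \<and> (\<exists>qs\<in>ipaths G (l + 2). \<exists>Y\<subseteq>legs_of G qs. card Y = ?r \<and> X = set qs \<union> Y)}"
    using scorpion_induced_iff[OF G l(2)] l(1) unfolding Psi_def vX by blast
  also have "\<dots> = (if k < l + 4 then {} else \<Union>(F ` ipaths G (l + 2)))"
  proof (cases "k < l + 4")
    case False
    have *: "X \<subseteq> verts G \<and> card X = k" if "qs \<in> ipaths G (l + 2)" "Y \<subseteq> legs_of G qs" "card Y = ?r" "X = set qs \<union> Y" for X qs Y
    proof
      show "X \<subseteq> verts G" using that unfolding ipaths_def induced_path_def legs_of_def by auto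
      have "card (set qs) = l + 2" using that(1) distinct_card[of qs] unfolding ipaths_def induced_path_def by simp
      moreover have "set qs \<inter> Y = {}" using legs_disjoint[OF G that(1) l(2)] that(2) by auto
      ultimately show "card X = k"
        unfolding that(4) using that(2,3) fin False by (subst card_Un_disjoint) (auto intro: finite_subset)
    qed
    have "X \<in> \<Union>(F ` ipaths G (l + 2)) \<longleftrightarrow> (\<exists>qs\<in>ipaths G (l + 2). \<exists>Y\<subseteq>legs_of G qs. card Y = ?r \<and> X = set qs \<union> Y)" for X
      unfolding F_def by blast
    then show ?thesis using False * by (simp add: set_eq_iff) meson
  qed auto
  finally have E: "num_IndSub (Psi f) G k = card (if k < l + 4 then {} else \<Union>(F ` ipaths G (l + 2)))"
    unfolding num_IndSub_def by simp
  show ?thesis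
  proof (cases "k < l + 4")
    case False
    have "card (\<Union>(F ` ipaths G (l + 2))) = (\<Sum>qs\<in>ipaths G (l + 2). card (F qs))"
    proof (rule card_UN_disjoint[OF finite_ipaths[OF G]])
      show "\<forall>qs\<in>ipaths G (l + 2). finite (F qs)" unfolding F_def using fin by auto
      show "\<forall>qs\<in>ipaths G (l + 2). \<forall>qs'\<in>ipaths G (l + 2). qs \<noteq> qs' \<longrightarrow> F qs \<inter> F qs' = {}"
      proof (intro ballI impI, rule ccontr)
        fix qs qs' assume *: "qs \<in> ipaths G (l + 2)" "qs' \<in> ipaths G (l + 2)" "qs \<noteq> qs'" "F qs \<inter> F qs' \<noteq> {}"
        then obtain X Y Y' where **: "Y \<subseteq> legs_of G qs" "card Y = ?r" "X = set qs \<union> Y"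
            "Y' \<subseteq> legs_of G qs'" "card Y' = ?r" "X = set qs' \<union> Y'" unfolding F_def by blast
        \<comment> \<open>Here \<open>l + 4 \<le> k\<close> is essential: with a single leg the
          scorpion would be a path and could be read from both ends.\<close>
        have "2 \<le> card Y" "2 \<le> card Y'" using ** False by auto
        then show False using scorpion_unique[OF G l(2) *(1) **(1,3) _ *(2) **(4,6)] *(3) by blast
      qed
    qed
    also have "\<dots> = (\<Sum>qs\<in>ipaths G (l + 2). card (legs_of G qs) choose ?r)"
    proof (rule sum.cong[OF refl])
      fix qs assume qs: "qs \<in> ipaths G (l + 2)"
      have "inj_on (\<lambda>Y. set qs \<union> Y) {Y. Y \<subseteq> legs_of G qs \<and> card Y = ?r}"
        using legs_disjoint[OF G qs l(2)] by (intro inj_onI) blast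
      then show "card (F qs) = card (legs_of G qs) choose ?r"
        unfolding F_def by (simp add: card_image n_subsets[OF fin])
    qed
    finally show ?thesis using E False by simp
  qed (use E in simp)
qed

lemma num_IndSub_Psi_pos:
  assumes "simple_graph G" "f k = l" "1 \<le> l" "l + 4 \<le> k"
  shows "num_IndSub (Psi f) G k > 0 \<longleftrightarrow> (\<exists>qs\<in>ipaths G (l + 2). k - l - 2 \<le> card (legs_of G qs))"
  using num_IndSub_Psi[of G f k l] assms finite_ipaths[of G "l + 2"]
  by (auto simp: sum_eq_0_iff neq0_conv[symmetric] binomial_eq_0_iff not_less simp del: neq0_conv)

section \<open>No algorithm is sublinear\<close>

fun touch :: "instr \<Rightarrow> memory \<Rightarrow> nat list" where
  "touch (Const i c) m = [i]"
| "touch (Add i j k) m = [i, j, k]"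
| "touch (Sub i j k) m = [i, j, k]"
| "touch (Half i j) m = [i, j]"
| "touch (Load i j) m = [i, j, m j]"
| "touch (Store i j) m = [i, j, m i]"
| "touch (Jzero i l) m = [i]"

definition touched :: "instr list \<Rightarrow> memory \<Rightarrow> nat \<Rightarrow> nat set" where
  "touched p m t = (\<Union>n<t. let c = (step p ^^ n) (0, m) in
     if fst c < length p then set (touch (p ! fst c) (snd c)) else {})"

lemma card_touched: "finite (touched p m t) \<and> card (touched p m t) \<le> 3 * t"
proof (induction t)
  case (Suc t)
  let ?c = "(step p ^^ t) (0, m)"
  let ?A = "if fst ?c < length p then set (touch (p ! fst ?c) (snd ?c)) else {}"
  have "length (touch i m) \<le> 3" for i m by (cases i) auto
  then have "card ?A \<le> 3" using card_length le_trans by fastforce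
  moreover have "touched p m (Suc t) = touched p m t \<union> ?A"
    by (auto simp: touched_def lessThan_Suc Let_def)
  ultimately show ?case using Suc card_Un_le[of "touched p m t" ?A] by auto
qed (simp add: touched_def)

lemma exec_agree:
  assumes "\<forall>a. a \<notin> S \<longrightarrow> m a = m' a" "set (touch i m) \<inter> S = {}"
  shows "fst (exec i (pc, m)) = fst (exec i (pc, m')) \<and>
    (\<forall>a. a \<notin> S \<longrightarrow> snd (exec i (pc, m)) a = snd (exec i (pc, m')) a)"
  using assms by (cases i) auto

text \<open>Cells that are written count as touched as well, so \<open>S\<close> is left alone by
  the first run; nothing in \<open>S\<close> ever influences control flow or addresses, and the
  second run follows the first.\<close>

lemma steps_agree:
  assumes "\<forall>a. a \<notin> S \<longrightarrow> m a = m' a" "touched p m t \<inter> S = {}"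
  shows "fst ((step p ^^ t) (0, m)) = fst ((step p ^^ t) (0, m')) \<and>
    (\<forall>a. a \<notin> S \<longrightarrow> snd ((step p ^^ t) (0, m)) a = snd ((step p ^^ t) (0, m')) a)"
  using assms(2)
proof (induction t)
  case (Suc t)
  obtain pc n where 1: "(step p ^^ t) (0, m) = (pc, n)" by fastforce
  obtain pc' n' where 2: "(step p ^^ t) (0, m') = (pc', n')" by fastforce
  have "touched p m t \<subseteq> touched p m (Suc t)" unfolding touched_def by (rule UN_mono) auto
  then have "touched p m t \<inter> S = {}" using Suc.prems by blast
  then have *: "pc' = pc" "\<forall>a. a \<notin> S \<longrightarrow> n a = n' a" using Suc.IH 1 2 by auto
  have st: "step p (pc, x) = (if pc < length p then exec (p ! pc) (pc, x) else (pc, x))" for x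
    by (simp add: step_def)
  show ?case
  proof (cases "pc < length p")
    case True
    have "set (touch (p ! pc) n) \<inter> S = {}"
      using Suc.prems 1 True by (fastforce simp: touched_def lessThan_Suc)
    then show ?thesis using exec_agree[OF *(2), of "p ! pc" pc] 1 2 * True by (simp add: st)
  qed (use 1 2 * in \<open>simp add: st\<close>)
qed (use assms in simp)

lemma halted: "length p \<le> pc \<Longrightarrow> (step p ^^ t) (pc, m) = (pc, m)"
  by (induction t) (auto simp: step_def)

text \<open>Since halted machines idle, both runs can be extended to the common time
  \<open>t + t'\<close>.\<close>

lemma halted_unique:
  assumes "(step p ^^ t) c = (pc, m)" "length p \<le> pc" "(step p ^^ t') c = (pc', m')" "length p \<le> pc'"
  shows "m = m'"
proof -
  have "(step p ^^ (t + t')) c = (pc, m)" using assms(1,2) by (simp add: funpow_add_app halted)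
  moreover have "(step p ^^ (t' + t)) c = (pc', m')" using assms(3,4) by (simp add: funpow_add_app halted)
  ultimately show ?thesis by (simp add: add.commute)
qed

lemma planted_scorpion:
  assumes "finite U" "W \<subseteq> U" "card W = k" "l + 4 \<le> k" "1 \<le> l"
  obtains G where "simple_graph G" "verts G = U" "\<And>u v. adj G u v \<Longrightarrow> u \<in> W \<and> v \<in> W"
    "\<exists>qs\<in>ipaths G (l + 2). k - l - 2 \<le> card (legs_of G qs)"
proof -
  have "finite W" using assms finite_subset by auto
  then obtain ws where ws: "set ws = W" "distinct ws" using finite_distinct_list by blast
  have len: "length ws = k" using distinct_card[OF ws(2)] ws assms by simp
  \<comment> \<open>The first \<open>l + 2\<close> entries of \<open>ws\<close> form the path and
    the remaining ones are legs attached to entry 0; \<open>P\<close> lists each edge with its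
    smaller index first.\<close>
  define P where "P i j \<longleftrightarrow> i < j \<and> j < k \<and> (j = Suc i \<and> i < l + 1 \<or> i = 0 \<and> l + 2 \<le> j)" for i j
  define E where "E = {{ws ! i, ws ! j} | i j. P i j}"
  let ?G = "(U, E)"
  have nth: "ws ! i = ws ! j \<longleftrightarrow> i = j" if "i < k" "j < k" for i j
    using ws(2) len that by (simp add: nth_eq_iff_index_eq)
  have inW: "ws ! i \<in> W" if "i < k" for i using that len ws(1) nth_mem by blast
  have PE: "i < k \<and> j < k \<and> i \<noteq> j" if "P i j" for i j using that unfolding P_def by auto
  have adj: "adj ?G (ws ! i) (ws ! j) \<longleftrightarrow> P i j \<or> P j i" if "i < k" "j < k" for i j
  proof
    assume "adj ?G (ws ! i) (ws ! j)"
    then obtain i' j' where "P i' j'" "{ws ! i, ws ! j} = {ws ! i', ws ! j'}" unfolding adj_def E_def by auto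
    then show "P i j \<or> P j i" using PE[of i' j'] nth that by (auto simp: doubleton_eq_iff)
  next
    assume "P i j \<or> P j i"
    then show "adj ?G (ws ! i) (ws ! j)" unfolding adj_def E_def by (auto simp: insert_commute)
  qed
  show ?thesis
  proof
    show "simple_graph ?G"
      unfolding simple_graph_def
    proof (intro conjI ballI)
      fix e assume "e \<in> edges ?G"
      then obtain i j where "e = {ws ! i, ws ! j}" "P i j" unfolding E_def by auto
      then show "e \<subseteq> verts ?G" "card e = 2" using PE[of i j] inW assms(2) nth[of i j] by auto
    qed (use assms in simp)
    show "u \<in> W \<and> v \<in> W" if "adj ?G u v" for u v
      using that PE inW unfolding adj_def E_def by (fastforce simp: doubleton_eq_iff)
    let ?qs = "take (l + 2) ws"
    have "?qs \<in> ipaths ?G (l + 2)"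
      unfolding ipaths_def induced_path_def
      using len assms ws adj by (auto simp: P_def set_take_subset[THEN subsetD] dest: set_take_subset[THEN subsetD])
    moreover have "k - l - 2 \<le> card (legs_of ?G ?qs)"
    proof -
      have "set (drop (l + 2) ws) \<subseteq> legs_of ?G ?qs"
      proof
        fix v assume "v \<in> set (drop (l + 2) ws)"
        then obtain j where "j < length ws - (l + 2)" "v = drop (l + 2) ws ! j"
          by (auto simp: in_set_conv_nth)
        then have j: "v = ws ! (l + 2 + j)" "l + 2 + j < k" using len by auto
        have "ws \<noteq> []" using len assms by auto
        then have hd: "hd ?qs = ws ! 0" by (simp add: hd_conv_nth)
        have "\<not> adj ?G q v" if q: "q \<in> set (tl ?qs)" for q
        proof -
          have "\<exists>i<length (tl ?qs). q = tl ?qs ! i" using q by (metis in_set_conv_nth)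
          then obtain i where "i < l + 1" "q = ws ! Suc i"
            using len assms by (auto simp: nth_tl)
          then show ?thesis using adj[of "Suc i" "l + 2 + j"] j unfolding P_def by auto
        qed
        moreover have "v \<in> U" using j inW assms(2) by auto
        moreover have "adj ?G (ws ! 0) v" using adj[of 0 "l + 2 + j"] j unfolding P_def by auto
        ultimately show "v \<in> legs_of ?G ?qs" unfolding legs_of_def hd by auto
      qed
      moreover have "card (set (drop (l + 2) ws)) = k - l - 2" using ws(2) len by (simp add: distinct_card)
      moreover have "finite (legs_of ?G ?qs)" using assms(1) unfolding legs_of_def by simp
      ultimately show ?thesis by (metis card_mono)
    qed
    ultimately show "\<exists>qs\<in>ipaths ?G (l + 2). k - l - 2 \<le> card (legs_of ?G qs)" by blast
  qed simp
qed

lemma nth0_input: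
  assumes "1 \<le> n"
  shows "nth0 ([n, k, h] @ adj_matrix n G) x = (if x < 3 then [n, k, h] ! x
    else if x < 3 + n * n \<and> adj G ((x - 3) div n) ((x - 3) mod n) then 1 else 0)"
proof (cases "3 \<le> x \<and> x < 3 + n * n")
  case True
  let ?a = "(x - 3) div n" and ?v = "(x - 3) mod n"
  have "?a < n" "?v < n" using True assms by (auto simp: less_mult_imp_div_less)
  then have "adj_matrix n G ! (n * ?a + ?v) = (if adj G ?a ?v then 1 else 0)" by (rule nth_adj_matrix)
  moreover have "n * ?a + ?v = x - 3" by simp
  ultimately have "adj_matrix n G ! (x - 3) = (if adj G ?a ?v then 1 else 0)" by simp
  moreover have "([n, k, h] @ adj_matrix n G) ! x = adj_matrix n G ! (x - 3)" using True by (subst nth_append) (auto simp: numeral_3_eq_3)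
  ultimately show ?thesis using True by (simp add: nth0_def length_adj_matrix)
next
  case False
  then show ?thesis by (auto simp: nth0_def length_adj_matrix nth_append nth_Cons split: nat.split)
qed

lemma outputs_withinE:
  assumes "outputs_within p xs y T"
  obtains t pc m where "real t \<le> T" "(step p ^^ t) (0, nth0 xs) = (pc, m)" "length p \<le> pc" "m 0 = y"
proof -
  have m: "(\<lambda>a. if a < length xs then xs ! a else 0) = nth0 xs" by (auto simp: nth0_def)
  obtain t where t: "real t \<le> T" "let (pc, m) = (step p ^^ t) (0, nth0 xs) in length p \<le> pc \<and> m 0 = y"
    using assms unfolding outputs_within_def m by blast
  obtain pc m where "(step p ^^ t) (0, nth0 xs) = (pc, m)" by fastforce
  then show ?thesis using t that by auto
qed

text \<open>On the edgeless graph a sublinear program misses all pairs of some \<open>k\<close> vertices, so it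
  cannot notice a scorpion planted there.\<close>
lemma no_sublinear:
  assumes l: "f k = l" "1 \<le> l" "l + 4 \<le> k" and a: "\<alpha> * real l < 1"
  shows "\<not> IndSub_solvable h (Psi f) {k} (\<lambda>n k. real n powr (\<alpha> * real (f k)))"
proof
  assume "IndSub_solvable h (Psi f) {k} (\<lambda>n k. real n powr (\<alpha> * real (f k)))"
  then obtain p C where pC: "\<And>n G. n \<ge> 1 \<Longrightarrow> simple_graph G \<Longrightarrow> verts G = {..<n} \<Longrightarrow>
      outputs_within p ([n, k, h k] @ adj_matrix n G) (num_IndSub (Psi f) G k) (C * real n powr (\<alpha> * real l))"
    unfolding IndSub_solvable_def l(1)[symmetric] by blast
  define a where "a = \<alpha> * real l"
  define D where "D = max C 1"
  have a1: "a < 1" using assms unfolding a_def by simp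
  \<comment> \<open>The machine touches at most \<open>3 * t\<close> addresses, which mention at
    most \<open>6 * t\<close> vertices. The choice of \<open>n\<close> ensures
    \<open>12 * t \<le> n\<close> and \<open>2 * k \<le> n\<close>, so at least \<open>k\<close>
    vertices are never mentioned. The exponent \<open>1 / (1 - a)\<close> solves the first condition
    for \<open>n\<close>.\<close>
  define n where "n = nat \<lceil>max ((12 * D) powr (1 / (1 - a))) (2 * real k)\<rceil> + 1"
  have n1: "1 \<le> n" by (simp add: n_def)
  have nb: "(12 * D) powr (1 / (1 - a)) \<le> real n" "2 * real k \<le> real n" unfolding n_def by linarith+
  have "12 * D = ((12 * D) powr (1 / (1 - a))) powr (1 - a)"
    using a1 by (simp add: powr_powr D_def)
  also have "\<dots> \<le> real n powr (1 - a)" using nb(1) a1 by (intro powr_mono2) auto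
  finally have "12 * D * real n powr a \<le> real n powr (1 - a) * real n powr a" by (intro mult_right_mono) auto
  also have "\<dots> = real n" using n1 by (simp add: powr_add[symmetric])
  finally have main: "12 * D * real n powr a \<le> real n" .
  let ?G0 = "({..<n}, {}) :: nat graph"
  let ?x0 = "[n, k, h k] @ adj_matrix n ?G0"
  let ?m0 = "nth0 ?x0"
  have sg0: "simple_graph ?G0" unfolding simple_graph_def by simp
  have "num_IndSub (Psi f) ?G0 k = 0"
  proof -
    have "ipaths ?G0 (l + 2) = {}"
    proof -
      have "\<not> induced_path ?G0 qs" if "length qs = l + 2" for qs
        using that l(2) unfolding induced_path_def adj_def by (auto intro!: exI[of _ 0] exI[of _ 1])
      then show ?thesis unfolding ipaths_def by auto
    qed
    then show ?thesis using num_IndSub_Psi[of ?G0 f k l, OF sg0 l(1,2)] by simp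
  qed
  then have "outputs_within p ?x0 0 (C * real n powr a)"
    using pC[OF n1 sg0] unfolding a_def by simp
  then obtain t pc m1 where t: "real t \<le> C * real n powr a" "(step p ^^ t) (0, ?m0) = (pc, m1)" "length p \<le> pc" "m1 0 = 0"
    by (rule outputs_withinE)
  have "12 * (C * real n powr a) \<le> 12 * (D * real n powr a)" by (intro mult_left_mono mult_right_mono) (auto simp: D_def)
  then have "12 * real t \<le> real n" using t(1) main by linarith
  then have t12: "12 * t \<le> n" by linarith
  let ?T = "touched p ?m0 t"
  \<comment> \<open>The row and column indices of all touched matrix entries. Truncated subtraction
    adds vertex 0 for the addresses below 3, which only shrinks the reservoir of untouched
    vertices.\<close>
  let ?D = "(\<lambda>x. (x - 3) div n) ` ?T \<union> (\<lambda>x. (x - 3) mod n) ` ?T"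
  have "card ?D \<le> 6 * t"
  proof -
    have "card ((\<lambda>x. (x - 3) div n) ` ?T) \<le> 3 * t" "card ((\<lambda>x. (x - 3) mod n) ` ?T) \<le> 3 * t"
      by (rule le_trans[OF card_image_le]; use card_touched[of p ?m0 t] in blast)+
    then show ?thesis using card_Un_le[of "(\<lambda>x. (x - 3) div n) ` ?T" "(\<lambda>x. (x - 3) mod n) ` ?T"] by linarith
  qed
  moreover have "finite ?D" using card_touched by blast
  ultimately have "k \<le> card ({..<n} - ?D)"
  proof -
    assume D: "card ?D \<le> 6 * t" "finite ?D"
    have "n - card ?D \<le> card ({..<n} - ?D)" using diff_card_le_card_Diff[OF D(2), of "{..<n}"] by (simp only: card_lessThan)
    then show ?thesis using D(1) t12 nb(2) by linarith
  qed
  then obtain W where W: "W \<subseteq> {..<n} - ?D" "card W = k" by (meson obtain_subset_with_card_n)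
  obtain G where G: "simple_graph G" "verts G = {..<n}" "\<And>u v. adj G u v \<Longrightarrow> u \<in> W \<and> v \<in> W"
     "\<exists>qs\<in>ipaths G (l + 2). k - l - 2 \<le> card (legs_of G qs)"
  proof -
    have "W \<subseteq> {..<n}" using W(1) by blast
    from planted_scorpion[OF finite_lessThan this W(2) l(3,2)] that show ?thesis by blast
  qed
  let ?x1 = "[n, k, h k] @ adj_matrix n G"
  have pos: "num_IndSub (Psi f) G k > 0" using num_IndSub_Psi_pos[of G f k l, OF G(1) l] G(4) by simp
  define S where "S = {x. 3 \<le> x \<and> (x - 3) div n \<in> W \<and> (x - 3) mod n \<in> W}"
  have "\<forall>x. x \<notin> S \<longrightarrow> ?m0 x = nth0 ?x1 x"
    unfolding nth0_input[OF n1] S_def using G(3) by (auto simp: adj_def)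
  moreover have "?T \<inter> S = {}" unfolding S_def using W by auto
  ultimately have ag: "fst ((step p ^^ t) (0, ?m0)) = fst ((step p ^^ t) (0, nth0 ?x1))"
     "\<forall>x. x \<notin> S \<longrightarrow> snd ((step p ^^ t) (0, ?m0)) x = snd ((step p ^^ t) (0, nth0 ?x1)) x"
    using steps_agree by blast+
  \<comment> \<open>Both runs agree outside the planted entries, in particular in the output
    cell.\<close>
  have "0 \<notin> S" unfolding S_def by simp
  then obtain m2 where m2: "(step p ^^ t) (0, nth0 ?x1) = (pc, m2)" "m2 0 = 0"
    using ag t by (metis eq_snd_iff fst_conv)
  have "outputs_within p ?x1 (num_IndSub (Psi f) G k) (C * real n powr a)"
    using pC[OF n1 G(1,2)] unfolding a_def .
  then obtain t' pc' m3 where "(step p ^^ t') (0, nth0 ?x1) = (pc', m3)" "length p \<le> pc'" "m3 0 = num_IndSub (Psi f) G k"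
    by (rule outputs_withinE)
  then show False using halted_unique[OF m2(1) t(3)] m2(2) pos by fastforce
qed

section \<open>An algorithm for counting scorpions\<close>

abbreviation (input) "vN \<equiv> 20 :: nat"
abbreviation (input) "vK \<equiv> 21 :: nat"
abbreviation (input) "vL \<equiv> 22 :: nat"
abbreviation (input) "aRow \<equiv> 23 :: nat"
abbreviation (input) "aAdj \<equiv> 24 :: nat"
abbreviation (input) "aCh \<equiv> 25 :: nat"
abbreviation (input) "vM \<equiv> 26 :: nat"
abbreviation (input) "vR \<equiv> 27 :: nat"
abbreviation (input) "aQ \<equiv> 28 :: nat"
abbreviation (input) "vOk \<equiv> 29 :: nat"
abbreviation (input) "vCnt \<equiv> 30 :: nat"
abbreviation (input) "vRes \<equiv> 31 :: nat"
abbreviation (input) "vCont \<equiv> 32 :: nat"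
abbreviation (input) "vI \<equiv> 33 :: nat"
abbreviation (input) "vJ \<equiv> 34 :: nat"
abbreviation (input) "vU \<equiv> 35 :: nat"
abbreviation (input) "vAcc \<equiv> 36 :: nat"
abbreviation (input) "vTmp \<equiv> 37 :: nat"
abbreviation (input) "vGood \<equiv> 38 :: nat"

definition incr :: "nat \<Rightarrow> wcom" where
  "incr x = (x ::= Pl (V x) (Cn 1))"

lemma run_incr [simp]: "run (incr x) s T Q \<longleftrightarrow> 1 \<le> T \<and> Q (put s x 0 (Suc (s x 0)))"
  "run (incr x ;; c) s T Q \<longleftrightarrow> 1 \<le> T \<and> run c (put s x 0 (Suc (s x 0))) (T - 1) Q"
  by (simp_all add: incr_def)

lemma mods_incr [simp]: "mods (incr x) = {x}"
  by (simp add: incr_def)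

section \<open>Tables of multiples, adjacencies and binomial coefficients\<close>

definition has_rows :: "nat \<Rightarrow> st \<Rightarrow> bool" where
  "has_rows n s \<longleftrightarrow> (\<forall>a<n. s aRow a = n * a)"

definition has_adj :: "nat \<Rightarrow> nat graph \<Rightarrow> st \<Rightarrow> bool" where
  "has_adj n G s \<longleftrightarrow> (\<forall>a<n. \<forall>v<n. s aAdj (n * a + v) = (if adj G a v then 1 else 0))"

definition adjE :: "wexp \<Rightarrow> wexp \<Rightarrow> wexp" where
  "adjE a b = Rd aAdj (Pl (Rd aRow a) b)"

lemma wval_adjE: "has_rows n s \<Longrightarrow> has_adj n G s \<Longrightarrow> wval a s < n \<Longrightarrow> wval b s < n \<Longrightarrow>
   wval (adjE a b) s = (if adj G (wval a s) (wval b s) then 1 else 0)"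
  by (simp add: adjE_def has_rows_def has_adj_def)

text \<open>Multiples of \<open>n\<close> are tabulated by repeated addition, so that matrix entries
  can be addressed without multiplication.\<close>

definition rows_com :: wcom where
  "rows_com = For vI (V vN) (Wr aRow (Pl (V vI) (Cn 1)) (Pl (Rd aRow (V vI)) (V vN)))"

lemma run_rows_com:
  assumes "s0 vN 0 = n" "s0 aRow 0 = 0"
  shows "run rows_com s0 (n * 3 + 2) (has_rows n)"
  unfolding rows_com_def
proof (rule run_For[where n = n and T = 1 and I = "\<lambda>i s. s vN 0 = n \<and> (\<forall>a\<le>i. s aRow a = n * a)"])
  fix i s
  assume "i < n" "s vN 0 = n \<and> (\<forall>a\<le>i. s aRow a = n * a)" "s vI 0 = i"
  then show "run (Wr aRow (Pl (V vI) (Cn 1)) (Pl (Rd aRow (V vI)) (V vN))) s 1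
    (\<lambda>s'. s' vI 0 = i \<and> wval (V vN) (put s' vI 0 (Suc i)) = n \<and>
      put s' vI 0 (Suc i) vN 0 = n \<and> (\<forall>a\<le>Suc i. put s' vI 0 (Suc i) aRow a = n * a))"
    by (auto simp: le_Suc_eq)
qed (use assms in \<open>auto simp: has_rows_def\<close>)

text \<open>Only entries below the diagonal are read. Their row index is at least 1, so they
  survived the prelude, and symmetry supplies the rest.\<close>

definition adj_com :: wcom where
  "adj_com = For vI (V vN) (For vJ (V vN)
     (Wr aAdj (Pl (Rd aRow (V vI)) (V vJ)) (Cn 0) ;;
      IfC (Mi (V vI) (V vJ)) (Wr aAdj (Pl (Rd aRow (V vI)) (V vJ)) (Rd 0 (Pl (Pl (Cn 3) (Rd aRow (V vI))) (V vJ))))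
       (IfC (Mi (V vJ) (V vI)) (Wr aAdj (Pl (Rd aRow (V vI)) (V vJ)) (Rd 0 (Pl (Pl (Cn 3) (Rd aRow (V vJ))) (V vI)))) Skp)))"

lemma cell_inj:
  fixes n :: nat
  assumes "v < n" "v' < n"
  shows "n * a + v = n * a' + v' \<longleftrightarrow> a = a' \<and> v = v'"
proof
  assume h: "n * a + v = n * a' + v'"
  have "(n * a + v) div n = a" "(n * a' + v') div n = a'" "(n * a + v) mod n = v" "(n * a' + v') mod n = v'"
    using assms by auto
  then show "a = a' \<and> v = v'" using h by metis
qed simp

lemma run_adj_com:
  assumes "s0 vN 0 = n" "has_rows n s0" "simple_graph G"
    and lower: "\<And>a v. 1 \<le> a \<Longrightarrow> a < n \<Longrightarrow> v < n \<Longrightarrow> s0 0 (3 + n * a + v) = (if adj G a v then 1 else 0)"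
  shows "run adj_com s0 (n * (n * 6 + 4) + 2) (has_adj n G)"
  unfolding adj_com_def
proof (rule run_For[where n = n and T = "n * 6 + 2" and I = "\<lambda>i s. s vN = s0 vN \<and> s aRow = s0 aRow \<and> s 0 = s0 0 \<and>
    (\<forall>a<i. \<forall>v<n. s aAdj (n * a + v) = (if adj G a v then 1 else 0))"])
  fix i s
  assume i: "i < n" "s vN = s0 vN \<and> s aRow = s0 aRow \<and> s 0 = s0 0 \<and>
    (\<forall>a<i. \<forall>v<n. s aAdj (n * a + v) = (if adj G a v then 1 else 0))" "s vI 0 = i"
  show "run (For vJ (V vN)
     (Wr aAdj (Pl (Rd aRow (V vI)) (V vJ)) (Cn 0) ;;
      IfC (Mi (V vI) (V vJ)) (Wr aAdj (Pl (Rd aRow (V vI)) (V vJ)) (Rd 0 (Pl (Pl (Cn 3) (Rd aRow (V vI))) (V vJ))))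
       (IfC (Mi (V vJ) (V vI)) (Wr aAdj (Pl (Rd aRow (V vI)) (V vJ)) (Rd 0 (Pl (Pl (Cn 3) (Rd aRow (V vJ))) (V vI)))) Skp))) s (n * 6 + 2)
    (\<lambda>s'. s' vI 0 = i \<and> wval (V vN) (put s' vI 0 (Suc i)) = n \<and>
        (put s' vI 0 (Suc i)) vN = s0 vN \<and> (put s' vI 0 (Suc i)) aRow = s0 aRow \<and> (put s' vI 0 (Suc i)) 0 = s0 0 \<and>
        (\<forall>a<Suc i. \<forall>v<n. (put s' vI 0 (Suc i)) aAdj (n * a + v) = (if adj G a v then 1 else 0)))"
  proof (rule run_For[where n = n and T = 4 and I = "\<lambda>j s. s vN = s0 vN \<and> s aRow = s0 aRow \<and> s 0 = s0 0 \<and> s vI 0 = i \<and>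
    (\<forall>a<i. \<forall>v<n. s aAdj (n * a + v) = (if adj G a v then 1 else 0)) \<and>
    (\<forall>v<j. s aAdj (n * i + v) = (if adj G i v then 1 else 0))"])
    fix j s
    assume j: "j < n" "s vN = s0 vN \<and> s aRow = s0 aRow \<and> s 0 = s0 0 \<and> s vI 0 = i \<and>
      (\<forall>a<i. \<forall>v<n. s aAdj (n * a + v) = (if adj G a v then 1 else 0)) \<and>
      (\<forall>v<j. s aAdj (n * i + v) = (if adj G i v then 1 else 0))" "s vJ 0 = j"
    have r: "s0 aRow i = n * i" "s0 aRow j = n * j" using assms(2) i(1) j(1) by (auto simp: has_rows_def)
    have ne: "n * a + v \<noteq> n * i + j" if "a < i" "v < n" for a v using cell_inj[of v n j a i] that j(1) by auto
    have lo: "s0 0 (3 + n * i + j) = (if adj G i j then 1 else 0)" if "j < i" using lower[of i j] that i(1) j(1) by auto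
    have up: "s0 0 (3 + n * j + i) = (if adj G i j then 1 else 0)" if "i < j" using lower[of j i] that i(1) j(1) by (auto simp: adj_commute)
    have di: "\<not> adj G i j" if "i = j" using that adj_irrefl[OF assms(3)] by simp
    show "run (Wr aAdj (Pl (Rd aRow (V vI)) (V vJ)) (Cn 0) ;;
      IfC (Mi (V vI) (V vJ)) (Wr aAdj (Pl (Rd aRow (V vI)) (V vJ)) (Rd 0 (Pl (Pl (Cn 3) (Rd aRow (V vI))) (V vJ))))
       (IfC (Mi (V vJ) (V vI)) (Wr aAdj (Pl (Rd aRow (V vI)) (V vJ)) (Rd 0 (Pl (Pl (Cn 3) (Rd aRow (V vJ))) (V vI)))) Skp)) s 4
      (\<lambda>s'. s' vJ 0 = j \<and> wval (V vN) (put s' vJ 0 (Suc j)) = n \<and>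
        (put s' vJ 0 (Suc j)) vN = s0 vN \<and> (put s' vJ 0 (Suc j)) aRow = s0 aRow \<and> (put s' vJ 0 (Suc j)) 0 = s0 0 \<and> (put s' vJ 0 (Suc j)) vI 0 = i \<and>
        (\<forall>a<i. \<forall>v<n. (put s' vJ 0 (Suc j)) aAdj (n * a + v) = (if adj G a v then 1 else 0)) \<and>
        (\<forall>v<Suc j. (put s' vJ 0 (Suc j)) aAdj (n * i + v) = (if adj G i v then 1 else 0)))"
      using j r ne lo up di assms(1) by (cases i j rule: linorder_cases) (simp_all add: less_Suc_eq)
  qed (use i assms in \<open>auto simp: less_Suc_eq\<close>)
qed (use assms in \<open>auto simp: has_adj_def algebra_simps\<close>)

text \<open>The column \<open>r\<close> of Pascal's triangle, by summing up the previous column in place.\<close>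

definition choose_com :: wcom where
  "choose_com = For vI (Pl (V vN) (Cn 1)) (Wr aCh (V vI) (Cn 1)) ;;
     For vJ (V vR) (vAcc ::= Cn 0 ;;
       For vI (Pl (V vN) (Cn 1)) (vTmp ::= Rd aCh (V vI) ;; Wr aCh (V vI) (V vAcc) ;; vAcc ::= Pl (V vAcc) (V vTmp)))"

lemma run_choose_com:
  assumes "s0 vN 0 = n" "s0 vR 0 = r"
  shows "run choose_com s0 (((n + 1) * 3 + 2) + (r * ((n + 1) * 5 + 5) + 2)) (\<lambda>s. \<forall>a\<le>n. s aCh a = a choose r)"
  unfolding choose_com_def
proof (rule run_Sq)
  show "run (For vI (Pl (V vN) (Cn 1)) (Wr aCh (V vI) (Cn 1))) s0 ((n + 1) * 3 + 2)
    (\<lambda>s1. run (For vJ (V vR) (vAcc ::= Cn 0 ;;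
       For vI (Pl (V vN) (Cn 1)) (vTmp ::= Rd aCh (V vI) ;; Wr aCh (V vI) (V vAcc) ;; vAcc ::= Pl (V vAcc) (V vTmp)))) s1
     (r * ((n + 1) * 5 + 5) + 2) (\<lambda>s. \<forall>a\<le>n. s aCh a = a choose r))"
  proof (rule run_For[where n = "n + 1" and T = 1 and I = "\<lambda>i s. s vN 0 = n \<and> s vR 0 = r \<and> (\<forall>a<i. s aCh a = 1)"])
    fix s1 :: st
    assume s1: "s1 vN 0 = n \<and> s1 vR 0 = r \<and> (\<forall>a<n + 1. s1 aCh a = 1)"
    show "run (For vJ (V vR) (vAcc ::= Cn 0 ;;
       For vI (Pl (V vN) (Cn 1)) (vTmp ::= Rd aCh (V vI) ;; Wr aCh (V vI) (V vAcc) ;; vAcc ::= Pl (V vAcc) (V vTmp)))) s1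
     (r * ((n + 1) * 5 + 5) + 2) (\<lambda>s. \<forall>a\<le>n. s aCh a = a choose r)"
    proof (rule run_For[where n = r and T = "1 + ((n + 1) * 5 + 2)" and I = "\<lambda>j s. s vN 0 = n \<and> s vR 0 = r \<and> (\<forall>a\<le>n. s aCh a = a choose j)"])
      fix j s
      assume j: "j < r" "s vN 0 = n \<and> s vR 0 = r \<and> (\<forall>a\<le>n. s aCh a = a choose j)" "s vJ 0 = j"
      let ?s = "put s vAcc 0 0"
      have "run (For vI (Pl (V vN) (Cn 1)) (vTmp ::= Rd aCh (V vI) ;; Wr aCh (V vI) (V vAcc) ;; vAcc ::= Pl (V vAcc) (V vTmp))) ?s ((n + 1) * 5 + 2)
        (\<lambda>s. s vN 0 = n \<and> s vR 0 = r \<and> s vJ 0 = j \<and> (\<forall>a\<le>n. s aCh a = a choose Suc j))"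
      \<comment> \<open>The accumulator is the sum of the old entries below \<open>i\<close>, which
        is \<open>i choose Suc j\<close> by the hockey-stick identity.\<close>
      proof (rule run_For[where n = "n + 1" and T = 3 and I = "\<lambda>i s. s vN 0 = n \<and> s vR 0 = r \<and> s vJ 0 = j \<and> s vAcc 0 = i choose Suc j \<and>
          (\<forall>a<i. s aCh a = a choose Suc j) \<and> (\<forall>a. i \<le> a \<and> a \<le> n \<longrightarrow> s aCh a = a choose j)"])
        fix s :: st
        assume "s vN 0 = n \<and> s vR 0 = r \<and> s vJ 0 = j \<and> s vAcc 0 = (n + 1) choose Suc j \<and>
          (\<forall>a<n + 1. s aCh a = a choose Suc j) \<and> (\<forall>a. n + 1 \<le> a \<and> a \<le> n \<longrightarrow> s aCh a = a choose j)"
        then show "s vN 0 = n \<and> s vR 0 = r \<and> s vJ 0 = j \<and> (\<forall>a\<le>n. s aCh a = a choose Suc j)"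
          by simp
      qed (use j in \<open>auto simp: less_Suc_eq\<close>)
      then show "run (vAcc ::= Cn 0 ;; For vI (Pl (V vN) (Cn 1)) (vTmp ::= Rd aCh (V vI) ;; Wr aCh (V vI) (V vAcc) ;; vAcc ::= Pl (V vAcc) (V vTmp))) s
        (1 + ((n + 1) * 5 + 2)) (\<lambda>s'. s' vJ 0 = j \<and> wval (V vR) (put s' vJ 0 (Suc j)) = r \<and>
          (put s' vJ 0 (Suc j)) vN 0 = n \<and> (put s' vJ 0 (Suc j)) vR 0 = r \<and> (\<forall>a\<le>n. (put s' vJ 0 (Suc j)) aCh a = a choose Suc j))"
        by (auto elim: run_mono)
    qed (use s1 in auto)
  qed (use assms in \<open>auto simp: less_Suc_eq\<close>)
qed

section \<open>Testing one tuple and counting its legs\<close>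

definition check_com :: wcom where
  "check_com = vOk ::= Cn 1 ;; For vI (V vM) (For vJ (V vI)
     (IfC (adjE (Rd aQ (V vJ)) (Rd aQ (V vI)))
        (IfC (w_eq (V vI) (Pl (V vJ) (Cn 1))) Skp (vOk ::= Cn 0))
        (IfC (Pl (w_eq (V vI) (Pl (V vJ) (Cn 1))) (w_eq (Rd aQ (V vI)) (Rd aQ (V vJ)))) (vOk ::= Cn 0) Skp)))"

definition good_pair :: "nat graph \<Rightarrow> (nat \<Rightarrow> nat) \<Rightarrow> nat \<Rightarrow> nat \<Rightarrow> bool" where
  "good_pair G q j i \<longleftrightarrow> (adj G (q j) (q i) \<longleftrightarrow> i = Suc j) \<and> q j \<noteq> q i"

definition good_tuple :: "nat graph \<Rightarrow> nat \<Rightarrow> (nat \<Rightarrow> nat) \<Rightarrow> bool" where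
  "good_tuple G m q \<longleftrightarrow> (\<forall>i<m. \<forall>j<i. good_pair G q j i)"

lemma run_check_com:
  assumes "s0 vM 0 = m" "has_rows n s0" "has_adj n G s0" "simple_graph G" "\<And>i. i < m \<Longrightarrow> s0 aQ i < n"
  shows "run check_com s0 (m * (m * 5 + 4) + 3) (\<lambda>s. s vOk 0 = (if good_tuple G m (s0 aQ) then 1 else 0))"
proof -
  let ?body = "IfC (adjE (Rd aQ (V vJ)) (Rd aQ (V vI)))
        (IfC (w_eq (V vI) (Pl (V vJ) (Cn 1))) Skp (vOk ::= Cn 0))
        (IfC (Pl (w_eq (V vI) (Pl (V vJ) (Cn 1))) (w_eq (Rd aQ (V vI)) (Rd aQ (V vJ)))) (vOk ::= Cn 0) Skp)"
  let ?q = "s0 aQ"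
  have "run (For vI (V vM) (For vJ (V vI) ?body)) (put s0 vOk 0 1) (m * (m * 5 + 4) + 2)
    (\<lambda>s. s vOk 0 = (if good_tuple G m (s0 aQ) then 1 else 0))"
  proof (rule run_For[where n = m and T = "m * 5 + 2" and I = "\<lambda>i s. s vM = s0 vM \<and> s aRow = s0 aRow \<and> s aAdj = s0 aAdj \<and> s aQ = s0 aQ \<and>
      s vOk 0 = (if \<forall>i'<i. \<forall>j<i'. good_pair G ?q j i' then 1 else 0)"])
    fix i s
    assume i: "i < m" "s vM = s0 vM \<and> s aRow = s0 aRow \<and> s aAdj = s0 aAdj \<and> s aQ = s0 aQ \<and>
      s vOk 0 = (if \<forall>i'<i. \<forall>j<i'. good_pair G ?q j i' then 1 else 0)" "s vI 0 = i"
    let ?b = "\<forall>i'<i. \<forall>j<i'. good_pair G ?q j i'"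
    have "run (For vJ (V vI) ?body) s (i * 5 + 2) (\<lambda>s'. s' vM = s0 vM \<and> s' aRow = s0 aRow \<and> s' aAdj = s0 aAdj \<and> s' aQ = s0 aQ \<and>
      s' vI 0 = i \<and> s' vOk 0 = (if ?b \<and> (\<forall>j'<i. good_pair G ?q j' i) then 1 else 0))"
    proof (rule run_For[where n = i and T = 3 and I = "\<lambda>j s'. s' vM = s0 vM \<and> s' aRow = s0 aRow \<and> s' aAdj = s0 aAdj \<and> s' aQ = s0 aQ \<and>
      s' vI 0 = i \<and> s' vOk 0 = (if ?b \<and> (\<forall>j'<j. good_pair G ?q j' i) then 1 else 0)"])
      fix j s'
      assume j: "j < i" "s' vM = s0 vM \<and> s' aRow = s0 aRow \<and> s' aAdj = s0 aAdj \<and> s' aQ = s0 aQ \<and>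
        s' vI 0 = i \<and> s' vOk 0 = (if ?b \<and> (\<forall>j'<j. good_pair G ?q j' i) then 1 else 0)" "s' vJ 0 = j"
      have "has_rows n s'" "has_adj n G s'" using j assms(2,3) by (auto simp: has_rows_def has_adj_def)
      then have a: "wval (adjE (Rd aQ (V vJ)) (Rd aQ (V vI))) s' = (if adj G (?q j) (?q i) then 1 else 0)"
        using j i assms(5) by (subst wval_adjE) auto
      have irr: "adj G (?q j) (?q i) \<Longrightarrow> ?q j \<noteq> ?q i" using adj_irrefl[OF assms(4)] by metis
      show "run ?body s' 3 (\<lambda>s''. s'' vJ 0 = j \<and> wval (V vI) (put s'' vJ 0 (Suc j)) = i \<and> (put s'' vJ 0 (Suc j)) vM = s0 vM \<and>
         (put s'' vJ 0 (Suc j)) aRow = s0 aRow \<and> (put s'' vJ 0 (Suc j)) aAdj = s0 aAdj \<and> (put s'' vJ 0 (Suc j)) aQ = s0 aQ \<and>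
         (put s'' vJ 0 (Suc j)) vI 0 = i \<and> (put s'' vJ 0 (Suc j)) vOk 0 = (if ?b \<and> (\<forall>j'<Suc j. good_pair G ?q j' i) then 1 else 0))"
      proof -
        obtain c where c: "?b \<and> (\<forall>j'<j. good_pair G ?q j' i) \<longleftrightarrow> c" by blast
        have c': "?b \<and> (\<forall>j'<Suc j. good_pair G ?q j' i) \<longleftrightarrow> c \<and> good_pair G ?q j i"
          using c by (auto simp: less_Suc_eq)
        note j' = j[unfolded c]
        show ?thesis
          unfolding c' unfolding run_IfC[of "adjE _ _"] a good_pair_def
          using j' irr by (cases "adj G (?q j) (?q i)"; cases "i = Suc j"; cases "?q j = ?q i") simp_all
      qed
    qed (use i in auto)
    then show "run (For vJ (V vI) ?body) s (m * 5 + 2) (\<lambda>s'. s' vI 0 = i \<and> wval (V vM) (put s' vI 0 (Suc i)) = m \<and>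
      (put s' vI 0 (Suc i)) vM = s0 vM \<and> (put s' vI 0 (Suc i)) aRow = s0 aRow \<and> (put s' vI 0 (Suc i)) aAdj = s0 aAdj \<and>
      (put s' vI 0 (Suc i)) aQ = s0 aQ \<and>
      (put s' vI 0 (Suc i)) vOk 0 = (if \<forall>i'<Suc i. \<forall>j<i'. good_pair G ?q j i' then 1 else 0))"
      by (rule run_mono) (use i assms(1) in \<open>auto simp: less_Suc_eq\<close>)
  qed (use assms in \<open>auto simp: good_tuple_def algebra_simps\<close>)
  then show ?thesis unfolding check_com_def by simp
qed

definition legs_com :: wcom where
  "legs_com = vCnt ::= Cn 0 ;; For vU (V vN)
     (vGood ::= adjE (Rd aQ (Cn 0)) (V vU) ;;
      For vI (V vM) (IfC (w_and (V vI) (adjE (Rd aQ (V vI)) (V vU))) (vGood ::= Cn 0) Skp) ;;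
      IfC (V vGood) (incr vCnt) Skp)"

definition is_leg :: "nat graph \<Rightarrow> nat \<Rightarrow> (nat \<Rightarrow> nat) \<Rightarrow> nat \<Rightarrow> bool" where
  "is_leg G m q v \<longleftrightarrow> adj G (q 0) v \<and> (\<forall>i<m. 0 < i \<longrightarrow> \<not> adj G (q i) v)"

lemma card_less_Suc_if: "card {v. v < Suc n \<and> P v} = card {v. v < n \<and> P v} + (if P n then 1 else 0)"
proof -
  have "{v. v < Suc n \<and> P v} = {v. v < n \<and> P v} \<union> (if P n then {n} else {})" by (auto simp: less_Suc_eq)
  then show ?thesis by (auto simp: card_insert_if)
qed

lemma run_legs_com:
  assumes "s0 vM 0 = m" "1 \<le> m" "s0 vN 0 = n" "has_rows n s0" "has_adj n G s0" "\<And>i. i < m \<Longrightarrow> s0 aQ i < n"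
  shows "run legs_com s0 (n * (m * 4 + 7) + 3) (\<lambda>s. s vCnt 0 = card {v. v < n \<and> is_leg G m (s0 aQ) v})"
proof -
  let ?q = "s0 aQ"
  let ?in = "IfC (w_and (V vI) (adjE (Rd aQ (V vI)) (V vU))) (vGood ::= Cn 0) Skp"
  let ?body = "vGood ::= adjE (Rd aQ (Cn 0)) (V vU) ;; For vI (V vM) ?in ;; IfC (V vGood) (incr vCnt) Skp"
  have "run (For vU (V vN) ?body) (put s0 vCnt 0 0) (n * (m * 4 + 7) + 2)
    (\<lambda>s. s vCnt 0 = card {v. v < n \<and> is_leg G m (s0 aQ) v})"
  proof (rule run_For[where n = n and T = "1 + ((m * 4 + 2) + 2)" and I = "\<lambda>u s. s vN = s0 vN \<and> s vM = s0 vM \<and> s aRow = s0 aRow \<and> s aAdj = s0 aAdj \<and> s aQ = s0 aQ \<and>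
      s vCnt 0 = card {v. v < u \<and> is_leg G m ?q v}"])
    fix u s
    assume u: "u < n" "s vN = s0 vN \<and> s vM = s0 vM \<and> s aRow = s0 aRow \<and> s aAdj = s0 aAdj \<and> s aQ = s0 aQ \<and>
      s vCnt 0 = card {v. v < u \<and> is_leg G m ?q v}" "s vU 0 = u"
    have "has_rows n s" "has_adj n G s" using u assms(4,5) by (auto simp: has_rows_def has_adj_def)
    then have a0: "wval (adjE (Rd aQ (Cn 0)) (V vU)) s = (if adj G (?q 0) u then 1 else 0)"
      using u assms by (subst wval_adjE) auto
    let ?s = "put s vGood 0 (if adj G (?q 0) u then 1 else 0)"
    have "run (For vI (V vM) ?in) ?s (m * 4 + 2) (\<lambda>s. s vN = s0 vN \<and> s vM = s0 vM \<and> s aRow = s0 aRow \<and> s aAdj = s0 aAdj \<and> s aQ = s0 aQ \<and>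
      s vCnt 0 = card {v. v < u \<and> is_leg G m ?q v} \<and> s vU 0 = u \<and> s vGood 0 = (if is_leg G m ?q u then 1 else 0))"
    proof (rule run_For[where n = m and T = 2 and I = "\<lambda>i s. s vN = s0 vN \<and> s vM = s0 vM \<and> s aRow = s0 aRow \<and> s aAdj = s0 aAdj \<and> s aQ = s0 aQ \<and>
      s vCnt 0 = card {v. v < u \<and> is_leg G m ?q v} \<and> s vU 0 = u \<and> s vGood 0 = (if is_leg G i ?q u then 1 else 0)"])
      fix i s'
      assume i: "i < m" "s' vN = s0 vN \<and> s' vM = s0 vM \<and> s' aRow = s0 aRow \<and> s' aAdj = s0 aAdj \<and> s' aQ = s0 aQ \<and>
      s' vCnt 0 = card {v. v < u \<and> is_leg G m ?q v} \<and> s' vU 0 = u \<and> s' vGood 0 = (if is_leg G i ?q u then 1 else 0)" "s' vI 0 = i"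
      have "has_rows n s'" "has_adj n G s'" using i assms(4,5) by (auto simp: has_rows_def has_adj_def)
      then have a: "wval (adjE (Rd aQ (V vI)) (V vU)) s' = (if adj G (?q i) u then 1 else 0)"
        using i u assms by (subst wval_adjE) auto
      have l: "is_leg G (Suc i) ?q u \<longleftrightarrow> is_leg G i ?q u \<and> (0 < i \<longrightarrow> \<not> adj G (?q i) u)"
        unfolding is_leg_def by (auto simp: less_Suc_eq)
      show "run ?in s' 2 (\<lambda>s''. s'' vI 0 = i \<and> wval (V vM) (put s'' vI 0 (Suc i)) = m \<and> (put s'' vI 0 (Suc i)) vN = s0 vN \<and> (put s'' vI 0 (Suc i)) vM = s0 vM \<and>
        (put s'' vI 0 (Suc i)) aRow = s0 aRow \<and> (put s'' vI 0 (Suc i)) aAdj = s0 aAdj \<and> (put s'' vI 0 (Suc i)) aQ = s0 aQ \<and>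
        (put s'' vI 0 (Suc i)) vCnt 0 = card {v. v < u \<and> is_leg G m ?q v} \<and> (put s'' vI 0 (Suc i)) vU 0 = u \<and>
        (put s'' vI 0 (Suc i)) vGood 0 = (if is_leg G (Suc i) ?q u then 1 else 0))"
        unfolding l run_IfC wval_and a using i assms(1) by simp
    qed (use u assms in \<open>auto simp: is_leg_def\<close>)
    then have "run (For vI (V vM) ?in ;; IfC (V vGood) (incr vCnt) Skp) ?s ((m * 4 + 2) + 2) (\<lambda>s. s vN = s0 vN \<and> s vM = s0 vM \<and> s aRow = s0 aRow \<and> s aAdj = s0 aAdj \<and> s aQ = s0 aQ \<and>
      s vCnt 0 = card {v. v < Suc u \<and> is_leg G m ?q v} \<and> s vU 0 = u)"
      by (intro run_Sq) (rule run_mono, assumption, auto simp: card_less_Suc_if)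
    then have "run ?body s (1 + ((m * 4 + 2) + 2)) (\<lambda>s. s vN = s0 vN \<and> s vM = s0 vM \<and> s aRow = s0 aRow \<and> s aAdj = s0 aAdj \<and> s aQ = s0 aQ \<and>
      s vCnt 0 = card {v. v < Suc u \<and> is_leg G m ?q v} \<and> s vU 0 = u)"
      unfolding run_Wr_Sq a0 by simp
    then show "run ?body s (1 + ((m * 4 + 2) + 2)) (\<lambda>s'. s' vU 0 = u \<and> wval (V vN) (put s' vU 0 (Suc u)) = n \<and> (put s' vU 0 (Suc u)) vN = s0 vN \<and>
       (put s' vU 0 (Suc u)) vM = s0 vM \<and> (put s' vU 0 (Suc u)) aRow = s0 aRow \<and> (put s' vU 0 (Suc u)) aAdj = s0 aAdj \<and> (put s' vU 0 (Suc u)) aQ = s0 aQ \<and>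
      (put s' vU 0 (Suc u)) vCnt 0 = card {v. v < Suc u \<and> is_leg G m ?q v})"
      by (rule run_mono) (use assms(3) in auto)
  qed (use assms in \<open>auto simp: algebra_simps\<close>)
  then show ?thesis unfolding legs_com_def by simp
qed

subsection \<open>Enumerating tuples\<close>

text \<open>Digit \<open>i\<close> of \<open>x\<close> in base \<open>n\<close>, the least
  significant digit having index 0. Tuples of vertices are enumerated by counting from 0 to
  \<open>n ^ m - 1\<close>.\<close>

definition dig :: "nat \<Rightarrow> nat \<Rightarrow> nat \<Rightarrow> nat" where
  "dig n x i = x div n ^ i mod n"

lemma dig_less: "1 \<le> n \<Longrightarrow> dig n x i < n"
  by (simp add: dig_def)

text \<open>If all digits below \<open>i\<close> are maximal, adding one carries through to position
  \<open>i\<close>.\<close>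

lemma dig_carry:
  assumes "1 \<le> n" "\<And>j. j < i \<Longrightarrow> Suc (dig n x j) = n"
  shows "n ^ i dvd Suc x \<and> Suc x div n ^ i = Suc (x div n ^ i)"
  using assms(2)
proof (induction i)
  case (Suc i)
  then have IH: "n ^ i dvd Suc x" "Suc x div n ^ i = Suc (x div n ^ i)" by auto
  let ?y = "x div n ^ i"
  have "Suc (?y mod n) = n" using Suc.prems[of i] by (simp add: dig_def)
  then have "Suc ?y mod n = 0" by (simp add: mod_Suc)
  then have d: "n dvd Suc ?y" by (simp add: mod_eq_0_iff_dvd)
  have "Suc x = n ^ i * Suc ?y" using IH by (metis dvd_mult_div_cancel)
  moreover obtain z where "Suc ?y = n * z" using d by (rule dvdE)
  ultimately have "Suc x = n ^ Suc i * z" by simp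
  then have "n ^ Suc i dvd Suc x" by (rule dvdI)
  moreover have "Suc x div n ^ Suc i = Suc ?y div n"
    using IH(2) by (simp only: power_Suc2 div_mult2_eq)
  moreover have "Suc ?y div n = Suc (?y div n)" using d by (simp add: div_Suc dvd_eq_mod_eq_0)
  ultimately show ?case by (simp only: power_Suc2 div_mult2_eq)
qed simp

lemma dig_Suc:
  assumes n: "1 \<le> n" and c: "\<And>j. j < i \<Longrightarrow> Suc (dig n x j) = n" and ne: "Suc (dig n x i) \<noteq> n"
  shows "dig n (Suc x) j = (if j < i then 0 else if j = i then Suc (dig n x i) else dig n x j)"
proof -
  have D: "n ^ i dvd Suc x" "Suc x div n ^ i = Suc (x div n ^ i)" using dig_carry[OF n c] by auto
  let ?y = "x div n ^ i"
  have ne': "Suc (?y mod n) \<noteq> n" using ne by (simp add: dig_def)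
  have lt: "?y mod n < n" using n by simp
  consider "j < i" | "j = i" | "i < j" by linarith
  then show ?thesis
  proof cases
    case 1
    then have "n ^ Suc j dvd n ^ i" by (intro le_imp_power_dvd) simp
    then obtain z where z: "Suc x = n ^ Suc j * z" using D(1) by (meson dvdE dvd_trans)
    have "Suc x div n ^ j = n * z" using n unfolding z by simp
    then show ?thesis using 1 by (simp add: dig_def)
  next
    case 2
    then show ?thesis using D(2) ne' lt by (simp add: dig_def mod_Suc)
  next
    case 3
    then obtain d where d: "j = Suc i + d" by (metis less_iff_Suc_add add_Suc)
    have "n ^ j = n ^ i * n * n ^ d" by (simp add: d power_add mult.commute mult.left_commute)
    then have e: "x div n ^ j = x div n ^ i div n div n ^ d" for x :: nat
      by (simp only: div_mult2_eq)
    have "Suc ?y div n = ?y div n" using ne' by (simp add: div_Suc mod_Suc)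
    then have "Suc x div n ^ j = x div n ^ j" unfolding e D(2) by simp
    then show ?thesis using 3 by (simp add: dig_def)
  qed
qed

lemma dig_last:
  assumes n: "1 \<le> n" and x: "x < n ^ m"
  shows "(\<forall>j<m. Suc (dig n x j) = n) \<longleftrightarrow> Suc x = n ^ m"
proof
  assume "\<forall>j<m. Suc (dig n x j) = n"
  then have "n ^ m dvd Suc x" using dig_carry[OF n, of m x] by auto
  then show "Suc x = n ^ m" using x by (auto dest: dvd_imp_le)
next
  assume e: "Suc x = n ^ m"
  show "\<forall>j<m. Suc (dig n x j) = n"
  proof (intro allI impI)
    fix j assume "j < m"
    then show "Suc (dig n x j) = n"
    proof (induction j rule: less_induct)
      case (less j)
      then have D: "Suc x div n ^ j = Suc (x div n ^ j)" using dig_carry[OF n, of j x] by auto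
      have "n ^ m = n ^ j * (n * n ^ (m - Suc j))"
        using less.prems by (metis add.commute add_Suc_right less_imp_Suc_add power_Suc power_add diff_add_inverse)
      then have "Suc (x div n ^ j) = n * n ^ (m - Suc j)" using D e n by simp
      then have "Suc (x div n ^ j) mod n = 0" by simp
      then show ?case by (auto simp: dig_def mod_Suc split: if_splits)
    qed
  qed
qed

text \<open>Digits determine the number by repeated division with remainder; surjectivity follows
  since both sides have \<open>n ^ m\<close> elements.\<close>

lemma bij_betw_dig:
  assumes "1 \<le> n"
  shows "bij_betw (\<lambda>x. map (dig n x) [0..<m]) {..<n ^ m} {qs. set qs \<subseteq> {..<n} \<and> length qs = m}"
proof -
  have inj: "x = y" if "x < n ^ m" "y < n ^ m" "\<forall>i<m. dig n x i = dig n y i" for x y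
    using that
  proof (induction m arbitrary: x y)
    case (Suc m)
    have d: "dig n x (Suc i) = dig n (x div n) i" for x i by (simp add: dig_def div_mult2_eq)
    have "x div n = y div n"
    proof (rule Suc.IH)
      show "x div n < n ^ m" "y div n < n ^ m" using Suc.prems assms by (auto simp: less_mult_imp_div_less mult.commute)
      show "\<forall>i<m. dig n (x div n) i = dig n (y div n) i" using Suc.prems(3) d by auto
    qed
    moreover have "x mod n = y mod n" using Suc.prems(3) by (auto simp: dig_def)
    ultimately show ?case by (metis div_mult_mod_eq)
  qed simp
  have i: "inj_on (\<lambda>x. map (dig n x) [0..<m]) {..<n ^ m}"
    by (intro inj_onI inj) (auto simp: map_eq_conv)
  have s: "(\<lambda>x. map (dig n x) [0..<m]) ` {..<n ^ m} \<subseteq> {qs. set qs \<subseteq> {..<n} \<and> length qs = m}"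
    using dig_less[OF assms] by auto
  have "card ((\<lambda>x. map (dig n x) [0..<m]) ` {..<n ^ m}) = card {qs. set qs \<subseteq> {..<n} \<and> length qs = m}"
    using card_lists_length_eq[of "{..<n}" m] by (simp add: card_image[OF i])
  then have "(\<lambda>x. map (dig n x) [0..<m]) ` {..<n ^ m} = {qs. set qs \<subseteq> {..<n} \<and> length qs = m}"
    by (intro card_subset_eq s finite_lists_length_eq) auto
  then show ?thesis using i by (simp add: bij_betw_def)
qed

definition next_com :: wcom where
  "next_com = vI ::= Cn 0 ;;
     WhileC (w_and (Mi (V vM) (V vI)) (w_eq (Pl (Rd aQ (V vI)) (Cn 1)) (V vN))) (Wr aQ (V vI) (Cn 0) ;; incr vI) ;;
     IfC (Mi (V vM) (V vI)) (Wr aQ (V vI) (Pl (Rd aQ (V vI)) (Cn 1))) (vCont ::= Cn 0)"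

lemma run_next_com:
  assumes "s0 vM 0 = m" "s0 vN 0 = n" "1 \<le> n" "x < n ^ m" "\<forall>i<m. s0 aQ i = dig n x i"
  shows "run next_com s0 (m * 3 + 4) (\<lambda>s. if Suc x < n ^ m then s vCont 0 = s0 vCont 0 \<and> (\<forall>i<m. s aQ i = dig n (Suc x) i) else s vCont 0 = 0)"
proof -
  let ?e = "w_and (Mi (V vM) (V vI)) (w_eq (Pl (Rd aQ (V vI)) (Cn 1)) (V vN))"
  define I where "I s \<longleftrightarrow> (\<exists>i\<le>m. s vI 0 = i \<and> s vM 0 = m \<and> s vN 0 = n \<and> s vCont 0 = s0 vCont 0 \<and> (\<forall>j<i. Suc (dig n x j) = n \<and> s aQ j = 0) \<and>
    (\<forall>j. i \<le> j \<and> j < m \<longrightarrow> s aQ j = dig n x j))" for s :: st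
  have "run (WhileC ?e (Wr aQ (V vI) (Cn 0) ;; incr vI)) (put s0 vI 0 0) (m * 3 + 1) (\<lambda>s. I s \<and> wval ?e s = 0)"
  proof (rule run_While[where I = I and B = "\<lambda>s. (m - s vI 0) * 3 + 1"])
    fix s assume s: "I s" "wval ?e s \<noteq> 0"
    then obtain i where i: "i < m" "s vI 0 = i" "s vM 0 = m" "s vN 0 = n" "s vCont 0 = s0 vCont 0" "\<forall>j<i. Suc (dig n x j) = n \<and> s aQ j = 0"
      "\<forall>j. i \<le> j \<and> j < m \<longrightarrow> s aQ j = dig n x j" "Suc (s aQ i) = n"
      unfolding I_def by (auto split: if_splits)
    have "Suc (dig n x i) = n" using i by auto
    then have "I (put (put s aQ i 0) vI 0 (Suc i))" unfolding I_def using i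
      by (intro exI[of _ "Suc i"]) (auto simp: less_Suc_eq)
    then show "\<exists>T. run (Wr aQ (V vI) (Cn 0) ;; incr vI) s T (\<lambda>s'. I s' \<and> (m - s' vI 0) * 3 + 1 + T + 1 \<le> (m - s vI 0) * 3 + 1)"
      using i by (intro exI[of _ 2]) (auto simp: Suc_diff_Suc[symmetric])
  qed (use assms in \<open>auto simp: I_def\<close>)
  then have "run (WhileC ?e (Wr aQ (V vI) (Cn 0) ;; incr vI) ;;
     IfC (Mi (V vM) (V vI)) (Wr aQ (V vI) (Pl (Rd aQ (V vI)) (Cn 1))) (vCont ::= Cn 0)) (put s0 vI 0 0) ((m * 3 + 1) + 2)
     (\<lambda>s. if Suc x < n ^ m then s vCont 0 = s0 vCont 0 \<and> (\<forall>i<m. s aQ i = dig n (Suc x) i) else s vCont 0 = 0)"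
  proof (intro run_Sq, elim run_mono)
    fix s assume s: "I s \<and> wval ?e s = 0"
    then obtain i where i: "i \<le> m" "s vI 0 = i" "s vM 0 = m" "s vN 0 = n" "s vCont 0 = s0 vCont 0" "\<forall>j<i. Suc (dig n x j) = n \<and> s aQ j = 0"
      "\<forall>j. i \<le> j \<and> j < m \<longrightarrow> s aQ j = dig n x j" unfolding I_def by blast
    show "run (IfC (Mi (V vM) (V vI)) (Wr aQ (V vI) (Pl (Rd aQ (V vI)) (Cn 1))) (vCont ::= Cn 0)) s 2
      (\<lambda>s. if Suc x < n ^ m then s vCont 0 = s0 vCont 0 \<and> (\<forall>i<m. s aQ i = dig n (Suc x) i) else s vCont 0 = 0)"
    proof (cases "i = m")
      case True
      then have "Suc x = n ^ m" using dig_last[OF assms(3,4)] i(6) by auto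
      then show ?thesis using True i by simp
    next
      case False
      then have im: "i < m" using i by simp
      then have ne: "Suc (dig n x i) \<noteq> n" using s i by (auto split: if_splits)
      then have "Suc x \<noteq> n ^ m" using dig_last[OF assms(3,4)] im by auto
      then have "Suc x < n ^ m" using assms(4) by simp
      moreover have "\<forall>j<m. (put s aQ i (Suc (dig n x i))) aQ j = dig n (Suc x) j"
        using dig_Suc[OF assms(3) _ ne] i by auto
      ultimately show ?thesis using im i by simp
    qed
  qed simp
  then show ?thesis
    unfolding next_com_def run_Wr_Sq wval.simps by (intro conjI) (simp, erule run_mono, auto)
qed

subsection \<open>The main loop\<close>

definition count_body :: wcom where
  "count_body = check_com ;; IfC (V vOk) (legs_com ;; vRes ::= Pl (V vRes) (Rd aCh (V vCnt))) Skp ;; next_com"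

definition count_com :: wcom where
  "count_com = vM ::= Pl (V vL) (Cn 2) ;; vR ::= Mi (V vK) (V vM) ;; rows_com ;; adj_com ;; choose_com ;;
     vCont ::= Cn 1 ;; WhileC (V vCont) count_body"

definition tuple_val :: "nat graph \<Rightarrow> nat \<Rightarrow> nat \<Rightarrow> nat \<Rightarrow> (nat \<Rightarrow> nat) \<Rightarrow> nat" where
  "tuple_val G n m r q = (if good_tuple G m q then card {v. v < n \<and> is_leg G m q v} choose r else 0)"

definition count_inv :: "nat graph \<Rightarrow> nat \<Rightarrow> nat \<Rightarrow> nat \<Rightarrow> st \<Rightarrow> bool" where
  "count_inv G n m r s \<longleftrightarrow> s vN 0 = n \<and> s vM 0 = m \<and> has_rows n s \<and> has_adj n G s \<and> (\<forall>a\<le>n. s aCh a = a choose r)"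

lemma count_inv_cong:
  "count_inv G n m r s \<Longrightarrow> (\<forall>j\<in>{vN, vM, aRow, aAdj, aCh}. s' j = s j) \<Longrightarrow> count_inv G n m r s'"
  by (auto simp: count_inv_def has_rows_def has_adj_def)

lemma mods_check [simp]: "mods check_com = {vOk, vI, vJ}"
  by (auto simp: check_com_def)

lemma mods_legs [simp]: "mods legs_com = {vCnt, vU, vGood, vI}"
  by (auto simp: legs_com_def)

lemma mods_next [simp]: "mods next_com = {vI, aQ, vCont}"
  by (auto simp: next_com_def)

text \<open>Quadratic in \<open>m\<close> for the path test and of order \<open>n * m\<close> for
  the legs, hence of order \<open>k * n\<close> when \<open>m \<le> k \<le> n\<close>. Times the
  \<open>n ^ (l + 2)\<close> tuples this is the source of the bound
  \<open>k * n ^ (l + 3)\<close>.\<close>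

definition body_time :: "nat \<Rightarrow> nat \<Rightarrow> nat" where
  "body_time n m = (m * (m * 5 + 4) + 3) + (1 + ((n * (m * 4 + 7) + 3) + 1) + (m * 3 + 4))"

lemma tuple_cong:
  assumes "\<And>i. i < m \<Longrightarrow> q i = q' i" "1 \<le> m"
  shows "tuple_val G n m r q = tuple_val G n m r q'"
proof -
  have "good_tuple G m q = good_tuple G m q'"
    unfolding good_tuple_def good_pair_def using assms by (metis less_trans)
  moreover have "is_leg G m q v = is_leg G m q' v" for v
    unfolding is_leg_def using assms by auto
  ultimately show ?thesis by (simp add: tuple_val_def)
qed

lemma run_count_body:
  assumes inv: "count_inv G n m r s0" and G: "simple_graph G" and nm: "1 \<le> n" "1 \<le> m"
    and x: "x < n ^ m" "\<forall>i<m. s0 aQ i = dig n x i" "s0 vCont 0 = 1"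
  shows "run count_body s0 (body_time n m) (\<lambda>s. count_inv G n m r s \<and> s vRes 0 = s0 vRes 0 + tuple_val G n m r (dig n x) \<and>
     (if Suc x < n ^ m then s vCont 0 = 1 \<and> (\<forall>i<m. s aQ i = dig n (Suc x) i) else s vCont 0 = 0))"
proof -
  have q: "i < m \<Longrightarrow> s0 aQ i < n" for i using x dig_less[OF nm(1)] by auto
  have val: "tuple_val G n m r (s0 aQ) = tuple_val G n m r (dig n x)"
    by (rule tuple_cong) (use x nm in auto)
  let ?Q = "\<lambda>s. count_inv G n m r s \<and> s vRes 0 = s0 vRes 0 + tuple_val G n m r (dig n x) \<and>
     (if Suc x < n ^ m then s vCont 0 = 1 \<and> (\<forall>i<m. s aQ i = dig n (Suc x) i) else s vCont 0 = 0)"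
  have nxt: "run next_com s (m * 3 + 4) ?Q" if s: "count_inv G n m r s" "s vRes 0 = s0 vRes 0 + tuple_val G n m r (dig n x)" "s aQ = s0 aQ" "s vCont = s0 vCont" for s
  proof -
    have "run next_com s (m * 3 + 4) (\<lambda>s'. if Suc x < n ^ m then s' vCont 0 = s vCont 0 \<and> (\<forall>i<m. s' aQ i = dig n (Suc x) i) else s' vCont 0 = 0)"
      by (rule run_next_com) (use s x nm in \<open>auto simp: count_inv_def\<close>)
    from run_frame[OF this] show ?thesis
    proof (rule run_mono)
      fix s' assume s': "(if Suc x < n ^ m then s' vCont 0 = s vCont 0 \<and> (\<forall>i<m. s' aQ i = dig n (Suc x) i) else s' vCont 0 = 0) \<and>
        (\<forall>j. j \<notin> mods next_com \<longrightarrow> s' j = s j)"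
      then have "count_inv G n m r s'" by (intro count_inv_cong[OF s(1)]) auto
      then show "?Q s'" using s' s x(3) by auto
    qed simp
  qed
  have "run check_com s0 (m * (m * 5 + 4) + 3) (\<lambda>s. s vOk 0 = (if good_tuple G m (s0 aQ) then 1 else 0))"
    by (rule run_check_com) (use inv G q in \<open>auto simp: count_inv_def\<close>)
  from run_frame[OF this] show ?thesis
    unfolding count_body_def body_time_def
  proof (intro run_Sq, elim run_mono)
    fix s assume s: "s vOk 0 = (if good_tuple G m (s0 aQ) then 1 else 0) \<and> (\<forall>j. j \<notin> mods check_com \<longrightarrow> s j = s0 j)"
    then have ci: "count_inv G n m r s" by (intro count_inv_cong[OF inv]) auto
    have eq: "s aQ = s0 aQ" "s vCont = s0 vCont" "s vRes = s0 vRes" using s by auto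
    show "run (IfC (V vOk) (legs_com ;; vRes ::= Pl (V vRes) (Rd aCh (V vCnt))) Skp ;; next_com) s
       (1 + ((n * (m * 4 + 7) + 3) + 1) + (m * 3 + 4)) ?Q"
    proof (cases "good_tuple G m (s0 aQ)")
      case False
      have "run next_com s (m * 3 + 4) ?Q"
        by (rule nxt) (use ci eq False val in \<open>auto simp: tuple_val_def\<close>)
      then show ?thesis using False s by (auto elim: run_mono)
    next
      case True
      have "run legs_com s (n * (m * 4 + 7) + 3) (\<lambda>s'. s' vCnt 0 = card {v. v < n \<and> is_leg G m (s aQ) v})"
        by (rule run_legs_com) (use ci q eq nm in \<open>auto simp: count_inv_def\<close>)
      from run_frame[OF this]
      have "run (legs_com ;; vRes ::= Pl (V vRes) (Rd aCh (V vCnt)) ;; next_com) s ((n * (m * 4 + 7) + 3) + (1 + (m * 3 + 4))) ?Q"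
      proof (intro run_Sq[of legs_com], elim run_mono)
        fix s' assume s': "s' vCnt 0 = card {v. v < n \<and> is_leg G m (s aQ) v} \<and> (\<forall>j. j \<notin> mods legs_com \<longrightarrow> s' j = s j)"
        then have ci': "count_inv G n m r s'" by (intro count_inv_cong[OF ci]) auto
        have "card {v. v < n \<and> is_leg G m (s aQ) v} \<le> card {..<n}" by (rule card_mono) auto
        then have "s' aCh (s' vCnt 0) = s' vCnt 0 choose r" using s' ci' by (auto simp: count_inv_def)
        then have v: "s' aCh (s' vCnt 0) = tuple_val G n m r (dig n x)"
          using s' eq True val by (simp add: tuple_val_def)
        have "run next_com (put s' vRes 0 (s' vRes 0 + s' aCh (s' vCnt 0))) (m * 3 + 4) ?Q"
          by (rule nxt) (use s' eq v in \<open>auto intro: count_inv_cong[OF ci']\<close>)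
        then show "run (vRes ::= Pl (V vRes) (Rd aCh (V vCnt)) ;; next_com) s' (1 + (m * 3 + 4)) ?Q"
          unfolding run_Wr_Sq wval.simps by (intro conjI) (simp, erule run_mono, simp_all)
      qed simp
      then show ?thesis using True s by (simp add: run_Sq_assoc)
    qed
  qed simp
qed

lemma run_count_loop:
  assumes G: "simple_graph G" and nm: "1 \<le> n" "1 \<le> m"
  shows "count_inv G n m r s \<Longrightarrow> x < n ^ m \<Longrightarrow> \<forall>i<m. s aQ i = dig n x i \<Longrightarrow> s vCont 0 = 1 \<Longrightarrow>
    s vRes 0 = (\<Sum>y<x. tuple_val G n m r (dig n y)) \<Longrightarrow>
    run (WhileC (V vCont) count_body) s ((n ^ m - x) * (body_time n m + 1) + 1)
      (\<lambda>s. s vRes 0 = (\<Sum>y<n ^ m. tuple_val G n m r (dig n y)))"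
proof (induction "n ^ m - x" arbitrary: x s)
  case (Suc d)
  have "run count_body s (body_time n m) (\<lambda>s'. count_inv G n m r s' \<and> s' vRes 0 = s vRes 0 + tuple_val G n m r (dig n x) \<and>
     (if Suc x < n ^ m then s' vCont 0 = 1 \<and> (\<forall>i<m. s' aQ i = dig n (Suc x) i) else s' vCont 0 = 0))"
    by (rule run_count_body) (use Suc.prems G nm in auto)
  then have "run count_body s (body_time n m) (\<lambda>s'. run (WhileC (V vCont) count_body) s' (d * (body_time n m + 1) + 1)
      (\<lambda>s. s vRes 0 = (\<Sum>y<n ^ m. tuple_val G n m r (dig n y))))"
  proof (rule run_mono)
    fix s' assume s': "count_inv G n m r s' \<and> s' vRes 0 = s vRes 0 + tuple_val G n m r (dig n x) \<and>
     (if Suc x < n ^ m then s' vCont 0 = 1 \<and> (\<forall>i<m. s' aQ i = dig n (Suc x) i) else s' vCont 0 = 0)"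
    then have res: "s' vRes 0 = (\<Sum>y<Suc x. tuple_val G n m r (dig n y))" using Suc.prems by simp
    show "run (WhileC (V vCont) count_body) s' (d * (body_time n m + 1) + 1) (\<lambda>s. s vRes 0 = (\<Sum>y<n ^ m. tuple_val G n m r (dig n y)))"
    proof (cases "Suc x < n ^ m")
      case True
      have d: "d = n ^ m - Suc x" using Suc.hyps(2) by simp
      show ?thesis unfolding d by (rule Suc.hyps(1)) (use d s' True res in auto)
    next
      case False
      then have "Suc x = n ^ m" using Suc.prems by simp
      then show ?thesis using False s' res by (intro run_WhileF) auto
    qed
  qed simp
  then show ?case
    by (rule run_WhileT[rotated]) (use Suc.prems Suc.hyps(2)[symmetric] in auto)
qed simp

lemma sum_tuples:
  assumes G: "simple_graph G" "verts G = {..<n}" and n: "1 \<le> n" and m: "3 \<le> m"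
  shows "(\<Sum>y<n ^ m. tuple_val G n m r (dig n y)) = (\<Sum>qs\<in>ipaths G m. card (legs_of G qs) choose r)"
proof -
  let ?L = "{qs. set qs \<subseteq> {..<n} \<and> length qs = m}"
  have "tuple_val G n m r (dig n y) = tuple_val G n m r ((!) (map (dig n y) [0..<m]))" for y
    by (rule tuple_cong) (use m in auto)
  then have "(\<Sum>y<n ^ m. tuple_val G n m r (dig n y)) = (\<Sum>qs\<in>?L. tuple_val G n m r ((!) qs))"
    using sum.reindex_bij_betw[OF bij_betw_dig[OF n, of m], of "\<lambda>qs. tuple_val G n m r ((!) qs)"] by simp
  also have "\<dots> = (\<Sum>qs\<in>ipaths G m. card (legs_of G qs) choose r)"
  proof (rule sum.mono_neutral_cong_right)
    show "finite ?L" by (intro finite_lists_length_eq) auto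
    show "ipaths G m \<subseteq> ?L" using G(2) by (auto simp: ipaths_def induced_path_def)
    have good: "good_tuple G m ((!) qs) \<longleftrightarrow> qs \<in> ipaths G m" if "qs \<in> ?L" for qs
    proof
      assume g: "good_tuple G m ((!) qs)"
      have "distinct qs" unfolding distinct_conv_nth
      proof (intro allI impI)
        fix i j assume "i < length qs" "j < length qs" "i \<noteq> j"
        then show "qs ! i \<noteq> qs ! j" using g that unfolding good_tuple_def good_pair_def
          by (cases i j rule: linorder_cases) (auto, metis)
      qed
      then show "qs \<in> ipaths G m"
        using g that G(2) unfolding good_tuple_def good_pair_def ipaths_def induced_path_def by auto
    next
      assume "qs \<in> ipaths G m"
      then show "good_tuple G m ((!) qs)"
        unfolding good_tuple_def good_pair_def ipaths_def induced_path_def by (auto simp: nth_eq_iff_index_eq)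
    qed
    then show "\<forall>qs\<in>?L - ipaths G m. tuple_val G n m r ((!) qs) = 0" by (auto simp: tuple_val_def)
    fix qs assume qs: "qs \<in> ipaths G m"
    then have L: "qs \<in> ?L" "length qs = m" using \<open>ipaths G m \<subseteq> ?L\<close> by auto
    have hd: "hd qs = qs ! 0" using L m by (intro hd_conv_nth) auto
    have tl: "set (tl qs) = {qs ! i | i. i < m \<and> 0 < i}"
    proof -
      have "set (tl qs) = (\<lambda>i. tl qs ! i) ` {..<m - 1}"
        using L(2) by (auto simp: set_conv_nth)
      also have "\<dots> = (\<lambda>i. qs ! Suc i) ` {..<m - 1}"
        by (rule image_cong) (use L(2) in \<open>auto simp: nth_tl\<close>)
      also have "\<dots> = (!) qs ` (Suc ` {..<m - 1})" by (simp add: image_image)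
      also have "Suc ` {..<m - 1} = {i. i < m \<and> 0 < i}"
        unfolding image_Suc_lessThan using m by auto
      finally show ?thesis by auto
    qed
    have "{v. v < n \<and> is_leg G m ((!) qs) v} = legs_of G qs"
      unfolding legs_of_def is_leg_def hd tl using G(2) by auto
    then show "tuple_val G n m r ((!) qs) = card (legs_of G qs) choose r"
      using good[OF L(1)] qs by (simp add: tuple_val_def)
  qed
  finally show ?thesis .
qed

section \<open>Assembling the counting program and bounding its time\<close>

definition count_time :: "nat \<Rightarrow> nat \<Rightarrow> nat \<Rightarrow> nat" where
  "count_time n m r = (n * 3 + 2) + ((n * (n * 6 + 4) + 2) + ((((n + 1) * 3 + 2) + (r * ((n + 1) * 5 + 5) + 2)) +
     (1 + (n ^ m * (body_time n m + 1) + 1))))"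

lemma run_count_com:
  assumes s: "s vN 0 = n" "s vK 0 = k" "s vL 0 = l" "s aRow 0 = 0" "\<forall>i. s aQ i = 0" "s vRes 0 = 0"
    and G: "simple_graph G" "verts G = {..<n}" and n: "1 \<le> n" "1 \<le> l" "l + 4 \<le> k"
    and lower: "\<And>a v. 1 \<le> a \<Longrightarrow> a < n \<Longrightarrow> v < n \<Longrightarrow> s 0 (3 + n * a + v) = (if adj G a v then 1 else 0)"
  shows "run count_com s (2 + count_time n (l + 2) (k - l - 2))
    (\<lambda>s. s vRes 0 = (\<Sum>qs\<in>ipaths G (l + 2). card (legs_of G qs) choose (k - l - 2)))"
proof -
  let ?m = "l + 2" and ?r = "k - l - 2"
  define P where "P s' \<longleftrightarrow> s' vN 0 = n \<and> s' vM 0 = ?m \<and> s' vR 0 = ?r \<and> s' 0 = s 0 \<and> (\<forall>i. s' aQ i = 0) \<and> s' vRes 0 = 0" for s' :: st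
  let ?s = "put (put s vM 0 ?m) vR 0 ?r"
  have P0: "P ?s" using s by (auto simp: P_def)
  let ?Q = "\<lambda>s. s vRes 0 = (\<Sum>qs\<in>ipaths G (l + 2). card (legs_of G qs) choose (k - l - 2))"
  have A: "run (vCont ::= Cn 1 ;; WhileC (V vCont) count_body) s' (1 + (n ^ ?m * (body_time n ?m + 1) + 1)) ?Q"
    if "P s'" "count_inv G n ?m ?r s'" for s'
  proof -
    have "run (WhileC (V vCont) count_body) (put s' vCont 0 1) ((n ^ ?m - 0) * (body_time n ?m + 1) + 1) (\<lambda>s. s vRes 0 = (\<Sum>y<n ^ ?m. tuple_val G n ?m ?r (dig n y)))"
    proof (rule run_count_loop)
      show "count_inv G n ?m ?r (put s' vCont 0 1)" by (rule count_inv_cong[OF that(2)]) auto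
    qed (use that G n in \<open>auto simp: P_def dig_def\<close>)
    then show ?thesis using sum_tuples[OF G n(1), of ?m ?r] n by simp
  qed
  have B: "run (choose_com ;; vCont ::= Cn 1 ;; WhileC (V vCont) count_body) s'
     ((((n + 1) * 3 + 2) + (?r * ((n + 1) * 5 + 5) + 2)) + (1 + (n ^ ?m * (body_time n ?m + 1) + 1))) ?Q"
    if "P s'" "has_rows n s'" "has_adj n G s'" for s'
  proof (rule run_Sq)
    have "run choose_com s' (((n + 1) * 3 + 2) + (?r * ((n + 1) * 5 + 5) + 2)) (\<lambda>s. \<forall>a\<le>n. s aCh a = a choose ?r)"
      by (rule run_choose_com) (use that in \<open>auto simp: P_def\<close>)
    from run_frame[OF this]
    show "run choose_com s' (((n + 1) * 3 + 2) + (?r * ((n + 1) * 5 + 5) + 2)) (\<lambda>s1. run (vCont ::= Cn 1 ;; WhileC (V vCont) count_body) s1 (1 + (n ^ ?m * (body_time n ?m + 1) + 1)) ?Q)"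
    proof (rule run_mono)
      fix s1 assume s1: "(\<forall>a\<le>n. s1 aCh a = a choose ?r) \<and> (\<forall>j. j \<notin> mods choose_com \<longrightarrow> s1 j = s' j)"
      then have e: "\<forall>j\<in>{0, vN, vM, vR, aQ, vRes, aRow, aAdj}. s1 j = s' j" by (auto simp: choose_com_def)
      show "run (vCont ::= Cn 1 ;; WhileC (V vCont) count_body) s1 (1 + (n ^ ?m * (body_time n ?m + 1) + 1)) ?Q"
        by (rule A) (use that e s1 in \<open>auto simp: P_def count_inv_def has_rows_def has_adj_def\<close>)
    qed simp
  qed
  have C: "run (adj_com ;; choose_com ;; vCont ::= Cn 1 ;; WhileC (V vCont) count_body) s'
     ((n * (n * 6 + 4) + 2) + ((((n + 1) * 3 + 2) + (?r * ((n + 1) * 5 + 5) + 2)) + (1 + (n ^ ?m * (body_time n ?m + 1) + 1)))) ?Q"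
    if "P s'" "has_rows n s'" for s'
  proof (rule run_Sq)
    have "run adj_com s' (n * (n * 6 + 4) + 2) (has_adj n G)"
      by (rule run_adj_com) (use that G lower in \<open>auto simp: P_def\<close>)
    from run_frame[OF this]
    show "run adj_com s' (n * (n * 6 + 4) + 2) (\<lambda>s1. run (choose_com ;; vCont ::= Cn 1 ;; WhileC (V vCont) count_body) s1
     ((((n + 1) * 3 + 2) + (?r * ((n + 1) * 5 + 5) + 2)) + (1 + (n ^ ?m * (body_time n ?m + 1) + 1))) ?Q)"
    proof (rule run_mono)
      fix s1 assume s1: "has_adj n G s1 \<and> (\<forall>j. j \<notin> mods adj_com \<longrightarrow> s1 j = s' j)"
      then have e: "\<forall>j\<in>{0, vN, vM, vR, aQ, vRes, aRow}. s1 j = s' j" by (auto simp: adj_com_def)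
      show "run (choose_com ;; vCont ::= Cn 1 ;; WhileC (V vCont) count_body) s1
     ((((n + 1) * 3 + 2) + (?r * ((n + 1) * 5 + 5) + 2)) + (1 + (n ^ ?m * (body_time n ?m + 1) + 1))) ?Q"
        by (rule B) (use that e s1 in \<open>auto simp: P_def has_rows_def\<close>)
    qed simp
  qed
  have "run rows_com ?s (n * 3 + 2) (has_rows n)"
    by (rule run_rows_com) (use s in auto)
  from run_frame[OF this]
  have "run (rows_com ;; adj_com ;; choose_com ;; vCont ::= Cn 1 ;; WhileC (V vCont) count_body) ?s (count_time n ?m ?r) ?Q"
    unfolding count_time_def
  proof (intro run_Sq[of rows_com], elim run_mono)
    fix s1 assume s1: "has_rows n s1 \<and> (\<forall>j. j \<notin> mods rows_com \<longrightarrow> s1 j = ?s j)"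
    then have e: "\<forall>j\<in>{0, vN, vM, vR, aQ, vRes}. s1 j = ?s j" by (auto simp: rows_com_def)
    show "run (adj_com ;; choose_com ;; vCont ::= Cn 1 ;; WhileC (V vCont) count_body) s1
     ((n * (n * 6 + 4) + 2) + ((((n + 1) * 3 + 2) + (?r * ((n + 1) * 5 + 5) + 2)) + (1 + (n ^ ?m * (body_time n ?m + 1) + 1)))) ?Q"
      by (rule C) (use e s1 P0 in \<open>auto simp: P_def\<close>)
  qed simp
  then show ?thesis
    unfolding count_com_def run_Wr_Sq using s by simp
qed

text \<open>The command \<open>gl\<close> provides \<open>f k\<close>. It is run only if
  \<open>k\<close> is at most \<open>n\<close>: its time is bounded in terms of \<open>k\<close>
  alone, and for larger \<open>k\<close> the answer is 0 anyway.\<close>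

definition ind_com :: "wcom \<Rightarrow> wcom" where
  "ind_com gl = vN ::= Rd 0 (V 6) ;; vK ::= Rd 0 (Pl (V 6) (Cn 1)) ;;
     IfC (Mi (V vK) (V vN)) (0 ::= Cn 0)
       (gl ;; IfC (Mi (Pl (V vL) (Cn 4)) (V vK)) (0 ::= Cn 0) (count_com ;; 0 ::= V vRes))"

lemma count_time_bound:
  assumes "l + 2 \<le> k" "k \<le> n" "1 \<le> k"
  shows "count_time n (l + 2) (k - l - 2) \<le> 80 * (k * n ^ (l + 3))"
proof -
  define m where "m = l + 2"
  let ?m = m and ?P = "k * n" and ?Z = "k * n ^ (l + 3)"
  have mk: "m \<le> k" using assms(1) by (simp add: m_def)
  have n1: "1 \<le> n" using assms by simp
  \<comment> \<open>This is where \<open>k \<le> n\<close> is used: the quadratic path test is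
    dominated by \<open>k * n\<close>.\<close>
  have "?m * ?m \<le> ?P" by (rule mult_le_mono) (use assms mk in auto)
  moreover have "?m \<le> ?P" using mult_le_mono[OF mk n1] by simp
  moreover have "n * ?m \<le> ?P" using mult_le_mono[OF mk le_refl, of n] by (simp add: mult.commute)
  moreover have "n \<le> ?P" using mult_le_mono[OF assms(3) le_refl, of n] by simp
  moreover have "1 \<le> ?P" using mult_le_mono[OF assms(3) n1] by simp
  moreover have "body_time n ?m = 5 * (?m * ?m) + 4 * ?m + 3 + (1 + (4 * (n * ?m) + 7 * n + 3 + 1 + (3 * ?m + 4)))"
    unfolding body_time_def by (simp add: algebra_simps)
  ultimately have "body_time n ?m + 1 \<le> 36 * ?P" by linarith
  then have "n ^ ?m * (body_time n ?m + 1) \<le> n ^ ?m * (36 * ?P)" by (rule mult_le_mono2)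
  also have "\<dots> = 36 * ?Z" by (simp add: m_def power_add algebra_simps eval_nat_numeral)
  finally have main: "n ^ ?m * (body_time n ?m + 1) \<le> 36 * ?Z" .
  have pw: "n ^ 1 \<le> n ^ (l + 3)" "n ^ 2 \<le> n ^ (l + 3)" by (rule power_increasing; use n1 in simp)+
  have nn: "n * n \<le> ?Z" using mult_le_mono[OF assms(3) pw(2)] by (simp add: power2_eq_square)
  have kn: "?P \<le> ?Z" using mult_le_mono[OF le_refl pw(1), of k] by simp
  have n': "n \<le> ?Z" using mult_le_mono[OF assms(3) pw(1)] by simp
  have "(k - l - 2) * ((n + 1) * 5 + 5) \<le> k * (15 * n)"
    by (rule mult_le_mono) (use n1 in auto)
  then have ch: "(k - l - 2) * ((n + 1) * 5 + 5) \<le> 15 * ?Z" using kn by linarith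
  have "count_time n ?m (k - l - 2) = 3 * n + 2 + (6 * (n * n) + 4 * n + 2 + (3 * n + 3 + 2 + ((k - l - 2) * ((n + 1) * 5 + 5) + 2) +
     (1 + (n ^ ?m * (body_time n ?m + 1) + 1))))"
    unfolding count_time_def by (simp add: algebra_simps)
  then show ?thesis using main nn n' ch n1 unfolding m_def[symmetric] by linarith
qed

lemma num_IndSub_large: "finite (verts G) \<Longrightarrow> card (verts G) < k \<Longrightarrow> num_IndSub P G k = 0"
proof -
  assume G: "finite (verts G)" "card (verts G) < k"
  have "{X. X \<subseteq> verts G \<and> card X = k \<and> P (induced G X)} = {}"
    using card_mono[OF G(1)] G(2) by (auto simp: not_less[symmetric])
  then show ?thesis unfolding num_IndSub_def by (simp only: card.empty)
qed

lemma run_ind_com: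
  assumes gl: "\<And>s. s 6 0 = 3 + n * n \<Longrightarrow> s 0 (3 + n * n + 2) = h \<Longrightarrow> s vK 0 = k \<Longrightarrow> (\<forall>j\<in>{10, 11}. \<forall>i. s j i = 0) \<Longrightarrow>
      run gl s Tg (\<lambda>s. s vL 0 = l)"
    and mods: "mods gl \<subseteq> {10, 11, 12, 13, 14, 15, vL}"
    and l: "f k = l" "1 \<le> l" and G: "simple_graph G" "verts G = {..<n}" and n: "1 \<le> n" "1 \<le> k"
    and s: "ind_loaded n k h G s"
  shows "run (ind_com gl) s (if k \<le> n then 10 + Tg + 80 * (k * n ^ (l + 3)) else 4) (\<lambda>s. s 0 0 = num_IndSub (Psi f) G k)"
proof -
  let ?E = "3 + n * n"
  have L: "s 6 0 = ?E" "s 0 ?E = n" "s 0 (?E + 1) = k" "s 0 (?E + 2) = h" "\<And>j i. 8 \<le> j \<Longrightarrow> s j i = 0"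
    and lower: "\<And>a v. 1 \<le> a \<Longrightarrow> a < n \<Longrightarrow> v < n \<Longrightarrow> s 0 (3 + n * a + v) = (if adj G a v then 1 else 0)"
    using s unfolding ind_loaded_def Let_def by auto
  let ?s = "put (put s vN 0 n) vK 0 k"
  let ?Q = "\<lambda>s. s 0 0 = num_IndSub (Psi f) G k"
  show ?thesis
  proof (cases "k \<le> n")
    case False
    then have "num_IndSub (Psi f) G k = 0" using G by (intro num_IndSub_large) auto
    then show ?thesis using False L unfolding ind_com_def by simp
  next
    case True
    let ?T = "80 * (k * n ^ (l + 3))"
    have "run gl ?s Tg (\<lambda>s. s vL 0 = l)"
      by (rule gl) (use L in auto)
    from run_frame[OF this]
    have "run (gl ;; IfC (Mi (Pl (V vL) (Cn 4)) (V vK)) (0 ::= Cn 0) (count_com ;; 0 ::= V vRes)) ?s (Tg + (4 + ?T)) ?Q"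
    proof (intro run_Sq, elim run_mono)
      fix s1 assume s1: "s1 vL 0 = l \<and> (\<forall>j. j \<notin> mods gl \<longrightarrow> s1 j = ?s j)"
      then have e: "\<forall>j. j \<notin> {10, 11, 12, 13, 14, 15, vL} \<longrightarrow> s1 j = ?s j" using mods by blast
      show "run (IfC (Mi (Pl (V vL) (Cn 4)) (V vK)) (0 ::= Cn 0) (count_com ;; 0 ::= V vRes)) s1 (4 + ?T) ?Q"
      proof (cases "k < l + 4")
        case True
        then have "num_IndSub (Psi f) G k = 0" using num_IndSub_Psi[of G f k l, OF G(1) l] by simp
        then show ?thesis using True s1 e by simp
      next
        case False
        have "run count_com s1 (2 + count_time n (l + 2) (k - l - 2)) (\<lambda>s. s vRes 0 = (\<Sum>qs\<in>ipaths G (l + 2). card (legs_of G qs) choose (k - l - 2)))"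
          by (rule run_count_com) (use e s1 G n l False L lower in auto)
        then have "run (count_com ;; 0 ::= V vRes) s1 ((2 + ?T) + 1) ?Q"
          using num_IndSub_Psi[of G f k l, OF G(1) l] False count_time_bound[of l k n] True n
          by (intro run_Sq) (auto elim!: run_mono)
        then show ?thesis using False s1 e by (auto elim!: run_mono)
      qed
    qed simp
    then show ?thesis using True L unfolding ind_com_def by (auto elim!: run_mono)
  qed
qed

lemma outputs_within_mono: "outputs_within p xs y T \<Longrightarrow> T \<le> T' \<Longrightarrow> outputs_within p xs y T'"
  unfolding outputs_within_def by (meson order_trans)

text \<open>The two versions of the problem differ only in \<open>gl\<close>, which reads
  \<open>f k\<close> from the input or computes it. Its allowance in terms of \<open>k\<close>
  becomes one in terms of \<open>n\<close> since it is run only for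
  \<open>k \<le> n\<close>.\<close>

lemma upper_bound:
  fixes f h :: "nat \<Rightarrow> nat"
  assumes f: "\<And>k. 1 \<le> k \<Longrightarrow> 1 \<le> f k" and c0: "0 \<le> c"
    and gl: "\<And>k. 1 \<le> k \<Longrightarrow> \<exists>Tg. real Tg \<le> c * (real k * real k ^ (f k + 3)) \<and>
      (\<forall>n s. s 6 0 = 3 + n * n \<longrightarrow> s 0 (3 + n * n + 2) = h k \<longrightarrow> s vK 0 = k \<longrightarrow> (\<forall>j\<in>{10, 11}. \<forall>i. s j i = 0) \<longrightarrow>
        run gl s Tg (\<lambda>s. s vL 0 = f k))"
    and mods: "mods gl \<subseteq> {10, 11, 12, 13, 14, 15, vL}"
  shows "IndSub_solvable h (Psi f) {1..} (\<lambda>n k. real k * real n ^ (f k + 3))"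
proof -
  obtain p K where pK: "\<And>n k h G y T. 1 \<le> n \<Longrightarrow> (n \<le> 4 \<longrightarrow> outputs_within p ([n, k, h] @ adj_matrix n G) 0 (real K)) \<and>
     (5 \<le> n \<longrightarrow> (\<forall>s. ind_loaded n k h G s \<longrightarrow> run (ind_com gl) s T (\<lambda>s'. s' 0 0 = y)) \<longrightarrow>
        outputs_within p ([n, k, h] @ adj_matrix n G) y (real (K * (n * n + T + 1))))"
    using ind_program[of "ind_com gl"] by blast
  define C where "C = real K * (100 + c)"
  show ?thesis
    unfolding IndSub_solvable_def
  proof (intro exI[of _ p] exI[of _ C] ballI allI impI)
    fix k n :: nat and G :: "nat graph"
    assume k: "k \<in> {1..}" and n: "1 \<le> n" and G: "simple_graph G \<and> verts G = {..<n}"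
    define l where "l = f k"
    have l: "f k = l" "1 \<le> l" using f k by (auto simp: l_def)
    let ?Z = "real k * real n ^ (f k + 3)"
    have Z1: "1 \<le> ?Z"
    proof -
      have "1 * 1 \<le> ?Z" by (rule mult_mono) (use k n in auto)
      then show ?thesis by simp
    qed
    show "outputs_within p ([n, k, h k] @ adj_matrix n G) (num_IndSub (Psi f) G k) (C * ?Z)"
    proof (cases "n \<le> 4")
      case True
      \<comment> \<open>A scorpion has at least \<open>l + 4\<close> vertices, hence five, so the
        early exit of the prelude is correct.\<close>
      have "num_IndSub (Psi f) G k = 0"
      proof (cases "k < l + 4")
        case True
        then show ?thesis using num_IndSub_Psi[of G f k l, OF _ l] G by simp
      next
        case False
        then have "n < k" using True l by simp
        then show ?thesis using G by (intro num_IndSub_large) auto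
      qed
      moreover have KC: "real K \<le> C * ?Z"
      proof -
        have "real K * 1 \<le> C * ?Z"
        proof (rule mult_mono)
          have "real K * 1 \<le> C" unfolding C_def by (rule mult_left_mono) (use c0 in auto)
          then show "real K \<le> C" by simp
        qed (use Z1 c0 in \<open>auto simp: C_def\<close>)
        then show ?thesis by simp
      qed
      moreover have "outputs_within p ([n, k, h k] @ adj_matrix n G) 0 (C * ?Z)"
        by (rule outputs_within_mono[OF _ KC]) (use pK[OF n] True in blast)
      ultimately show ?thesis by simp
    next
      case False
      obtain Tg where Tg: "real Tg \<le> c * (real k * real k ^ (f k + 3))"
        "\<And>s. s 6 0 = 3 + n * n \<Longrightarrow> s 0 (3 + n * n + 2) = h k \<Longrightarrow> s vK 0 = k \<Longrightarrow> (\<forall>j\<in>{10, 11}. \<forall>i. s j i = 0) \<Longrightarrow>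
        run gl s Tg (\<lambda>s. s vL 0 = l)"
        using gl[of k] k l by auto
      define T where "T = (if k \<le> n then 10 + Tg + 80 * (k * n ^ (l + 3)) else 4)"
      have "\<forall>s. ind_loaded n k (h k) G s \<longrightarrow> run (ind_com gl) s T (\<lambda>s'. s' 0 0 = num_IndSub (Psi f) G k)"
        unfolding T_def by (intro allI impI run_ind_com[where h = "h k"] Tg(2) mods l) (use G n k in auto)
      then have O: "outputs_within p ([n, k, h k] @ adj_matrix n G) (num_IndSub (Psi f) G k) (real (K * (n * n + T + 1)))"
        using pK[OF n, THEN conjunct2, rule_format] False by simp
      have "real T \<le> 14 + 80 * ?Z + c * ?Z"
      proof (cases "k \<le> n")
        case True
        have "real Tg \<le> c * (real k * real n ^ (f k + 3))"
          using Tg(1) True c0 by (elim order_trans) (intro mult_left_mono power_mono, auto)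
        then show ?thesis using True by (simp add: T_def l)
      next
        case False
        have "0 \<le> c * ?Z" using c0 by simp
        then show ?thesis using False Z1 by (simp add: T_def)
      qed
      moreover have "real n * real n \<le> ?Z"
      proof -
        have "real n ^ 2 \<le> real n ^ (f k + 3)" by (rule power_increasing) (use n in auto)
        then have "1 * real n ^ 2 \<le> ?Z" by (intro mult_mono) (use k in auto)
        then show ?thesis by (simp add: power2_eq_square)
      qed
      ultimately have "real (n * n + T + 1) \<le> (100 + c) * ?Z" using Z1 by (simp add: algebra_simps)
      then have "real K * real (n * n + T + 1) \<le> real K * ((100 + c) * ?Z)" by (intro mult_left_mono) auto
      then have "real (K * (n * n + T + 1)) \<le> C * ?Z" unfolding C_def by (simp only: of_nat_mult mult.assoc)
      then show ?thesis using outputs_within_mono[OF O] by simp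
    qed
  qed
qed

lemma mods_interp: "mods (interp p) \<subseteq> {10, 11, 13, 14, 15}"
proof -
  have i: "mods (interp_instr i) \<subseteq> {10, 11, 13, 14, 15}" for i
    by (cases i) (auto simp: vget_def vput_def)
  have "mods (switch q n) \<subseteq> {10, 11, 13, 14, 15}" for q n
  proof (induction q arbitrary: n)
    case (Cons a q)
    then show ?case using i[of a] by simp
  qed simp
  then show ?thesis by (simp add: interp_def)
qed

lemma upper_bound_given:
  assumes "\<And>k. 1 \<le> k \<Longrightarrow> 1 \<le> f k"
  shows "IndSub_solvable f (Psi f) {1..} (\<lambda>n k. real k * real n ^ (f k + 3))"
proof (rule upper_bound[where c = 1 and gl = "vL ::= Rd 0 (Pl (V 6) (Cn 2))"])
  fix k :: nat assume k: "1 \<le> k"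
  have "1 * 1 \<le> real k * real k ^ (f k + 3)" by (rule mult_mono) (use k in auto)
  then show "\<exists>Tg. real Tg \<le> 1 * (real k * real k ^ (f k + 3)) \<and>
      (\<forall>n s. s 6 0 = 3 + n * n \<longrightarrow> s 0 (3 + n * n + 2) = f k \<longrightarrow> s vK 0 = k \<longrightarrow> (\<forall>j\<in>{10, 11}. \<forall>i. s j i = 0) \<longrightarrow>
        run (vL ::= Rd 0 (Pl (V 6) (Cn 2))) s Tg (\<lambda>s. s vL 0 = f k))"
    by (intro exI[of _ 1]) auto
qed (use assms in auto)

lemma upper_bound_computable:
  assumes f: "\<And>k. 1 \<le> k \<Longrightarrow> 1 \<le> f k" and comp: "computable_in_time f (\<lambda>k. real k * real k ^ (f k + 3))"
  shows "IndSub_solvable (\<lambda>_. 0) (Psi f) {1..} (\<lambda>n k. real k * real n ^ (f k + 3))"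
proof -
  obtain p C where p: "\<And>k. 1 \<le> k \<Longrightarrow> outputs_within p [k] (f k) (C * (real k * real k ^ (f k + 3)))"
    using comp unfolding computable_in_time_def by auto
  \<comment> \<open>All stamps are still 0, so version 1 starts from an empty simulated memory, and
    only its cell 0 has to be filled, with \<open>k\<close>.\<close>
  let ?gl = "12 ::= Cn 1 ;; vput (Cn 0) (V vK) ;; 13 ::= Cn 0 ;; interp p ;; vget vL (Cn 0)"
  define c where "c = 10 + max C 0 * (real (length p) + 9)"
  show ?thesis
  proof (rule upper_bound[where c = c and gl = ?gl])
    show "0 \<le> c" by (simp add: c_def)
    show "mods ?gl \<subseteq> {10, 11, 12, 13, 14, 15, vL}"
      using mods_interp[of p] by (auto simp: vget_def vput_def)
    fix k :: nat assume k: "1 \<le> k"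
    let ?Z = "real k * real k ^ (f k + 3)"
    have Z: "1 \<le> ?Z"
    proof -
      have "1 * 1 \<le> ?Z" by (rule mult_mono) (use k in auto)
      then show ?thesis by simp
    qed
    obtain t pc m where t: "real t \<le> C * ?Z" "(step p ^^ t) (0, nth0 [k]) = (pc, m)" "length p \<le> pc" "m 0 = f k"
      by (rule outputs_withinE[OF p[OF k]])
    let ?Tg = "4 + ((t * (length p + 9) + 1) + 2)"
    have "real t * (real (length p) + 9) \<le> max C 0 * ?Z * (real (length p) + 9)"
      using t(1) Z by (intro mult_right_mono) (auto elim!: order_trans intro!: mult_right_mono)
    then have "real ?Tg \<le> c * ?Z" using Z by (simp add: c_def algebra_simps)
    moreover have "run ?gl s ?Tg (\<lambda>s. s vL 0 = f k)" if s: "s vK 0 = k" "\<forall>j\<in>{10, 11}. \<forall>i. s j i = 0" for s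
    proof -
      let ?s = "put (put (put (put s 12 0 1) 10 0 k) 11 0 1) 13 0 0"
      have "vmem ?s = nth0 [k]" using s by (auto simp: vmem_def nth0_def)
      then have "run (interp p) ?s (t * (length p + 9) + 1) (\<lambda>s'. vmem s' = m \<and> only_interp ?s s')"
        using run_interp[where p = p and t = t and s = ?s and pc = pc and m = m] t by simp
      then have "run (interp p ;; vget vL (Cn 0)) ?s ((t * (length p + 9) + 1) + 2) (\<lambda>s. s vL 0 = f k)"
        by (intro run_Sq) (elim run_mono, auto simp: run_vget t)
      then show ?thesis using s by (auto simp: vput_def elim!: run_mono)
    qed
    ultimately show "\<exists>Tg. real Tg \<le> c * ?Z \<and>
      (\<forall>n s. s 6 0 = 3 + n * n \<longrightarrow> s 0 (3 + n * n + 2) = 0 \<longrightarrow> s vK 0 = k \<longrightarrow> (\<forall>j\<in>{10, 11}. \<forall>i. s j i = 0) \<longrightarrow>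
        run ?gl s Tg (\<lambda>s. s vL 0 = f k))"
      by (intro exI[of _ ?Tg]) blast
  qed (use f in auto)
qed

section \<open>Sparsification\<close>

text \<open>This is the sparsification lemma of Impagliazzo, Paturi and Zane for clauses with three
  literals. The clauses are given by a symmetric relation \<open>E\<close> on the literals below \<open>A\<close>; the branching
  process adds unit clauses \<open>U\<close> and clauses \<open>P\<close> with two literals. Clauses that contain a smaller
  clause are inactive.\<close>

definition pact :: "(nat \<Rightarrow> bool) \<Rightarrow> (nat \<Rightarrow> nat \<Rightarrow> bool) \<Rightarrow> nat \<Rightarrow> nat \<Rightarrow> bool" where
  "pact U P a b \<longleftrightarrow> P a b \<and> \<not> U a \<and> \<not> U b"

definition eact :: "(nat \<Rightarrow> nat \<Rightarrow> nat \<Rightarrow> bool) \<Rightarrow> (nat \<Rightarrow> bool) \<Rightarrow> (nat \<Rightarrow> nat \<Rightarrow> bool) \<Rightarrow> nat \<Rightarrow> nat \<Rightarrow> nat \<Rightarrow> bool" where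
  "eact E U P a b c \<longleftrightarrow> E a b c \<and> \<not> U a \<and> \<not> U b \<and> \<not> U c \<and> \<not> P a b \<and> \<not> P b c \<and> \<not> P a c"

text \<open>In the application \<open>L\<close> consists of the assignments that give complementary
  literals opposite values; the branching argument works for any set.\<close>

definition sat_state :: "(nat \<Rightarrow> bool) set \<Rightarrow> (nat \<Rightarrow> nat \<Rightarrow> nat \<Rightarrow> bool) \<Rightarrow> (nat \<Rightarrow> bool) \<Rightarrow> (nat \<Rightarrow> nat \<Rightarrow> bool) \<Rightarrow> bool" where
  "sat_state L E U P \<longleftrightarrow> (\<exists>\<beta>\<in>L. (\<forall>a. U a \<longrightarrow> \<beta> a) \<and> (\<forall>a b. P a b \<longrightarrow> \<beta> a \<or> \<beta> b) \<and>
     (\<forall>a b c. E a b c \<longrightarrow> \<beta> a \<or> \<beta> b \<or> \<beta> c))"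

text \<open>The sunflowers of the sparsification lemma: many pairs around a literal, many triples
  around a pair, many triples around a literal. A type is used only if the previous ones are
  impossible; this is what keeps the number of pairs at each literal below \<open>2 * th\<close>,
  also after new pairs are added.\<close>

definition branch :: "nat \<Rightarrow> nat \<Rightarrow> (nat \<Rightarrow> nat \<Rightarrow> nat \<Rightarrow> bool) \<Rightarrow> (nat \<Rightarrow> bool) \<Rightarrow> (nat \<Rightarrow> nat \<Rightarrow> bool) \<Rightarrow> nat \<Rightarrow> nat \<Rightarrow> nat \<Rightarrow> bool" where
  "branch A th E U P typ ha hb \<longleftrightarrow>
     (typ = 1 \<and> ha < A \<and> th \<le> card {b. b < A \<and> pact U P ha b}) \<or>
     (typ = 2 \<and> ha < A \<and> hb < A \<and> (\<forall>a<A. card {b. b < A \<and> pact U P a b} < th) \<and>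
        th \<le> card {c. c < A \<and> eact E U P ha hb c}) \<or>
     (typ = 3 \<and> ha < A \<and> (\<forall>a<A. card {b. b < A \<and> pact U P a b} < th) \<and>
        (\<forall>a<A. \<forall>b<A. card {c. c < A \<and> eact E U P a b c} < th) \<and>
        4 * th * th \<le> card {(b, c). b < A \<and> c < A \<and> eact E U P ha b c})"

definition leaf :: "nat \<Rightarrow> nat \<Rightarrow> (nat \<Rightarrow> nat \<Rightarrow> nat \<Rightarrow> bool) \<Rightarrow> (nat \<Rightarrow> bool) \<Rightarrow> (nat \<Rightarrow> nat \<Rightarrow> bool) \<Rightarrow> bool" where
  "leaf A th E U P \<longleftrightarrow> (\<forall>a<A. card {b. b < A \<and> pact U P a b} < th) \<and>
     (\<forall>a<A. card {(b, c). b < A \<and> c < A \<and> eact E U P a b c} < 4 * th * th)"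

text \<open>The first child (\<open>U0\<close>, \<open>P0\<close>) assumes that the heart of the
  sunflower holds, the second one (\<open>U1\<close>, \<open>P1\<close>) that all petals
  hold.\<close>

definition U0 :: "nat \<Rightarrow> nat \<Rightarrow> (nat \<Rightarrow> bool) \<Rightarrow> nat \<Rightarrow> bool" where
  "U0 typ ha U a \<longleftrightarrow> U a \<or> (typ \<noteq> 2 \<and> a = ha)"

definition P0 :: "nat \<Rightarrow> nat \<Rightarrow> nat \<Rightarrow> (nat \<Rightarrow> nat \<Rightarrow> bool) \<Rightarrow> nat \<Rightarrow> nat \<Rightarrow> bool" where
  "P0 typ ha hb P a b \<longleftrightarrow> P a b \<or> (typ = 2 \<and> (a = ha \<and> b = hb \<or> a = hb \<and> b = ha))"

definition U1 :: "nat \<Rightarrow> nat \<Rightarrow> nat \<Rightarrow> (nat \<Rightarrow> nat \<Rightarrow> nat \<Rightarrow> bool) \<Rightarrow> (nat \<Rightarrow> bool) \<Rightarrow> (nat \<Rightarrow> nat \<Rightarrow> bool) \<Rightarrow> nat \<Rightarrow> bool" where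
  "U1 typ ha hb E U P b \<longleftrightarrow> U b \<or> (typ = 1 \<and> pact U P ha b) \<or> (typ = 2 \<and> eact E U P ha hb b)"

definition P1 :: "nat \<Rightarrow> nat \<Rightarrow> (nat \<Rightarrow> nat \<Rightarrow> nat \<Rightarrow> bool) \<Rightarrow> (nat \<Rightarrow> bool) \<Rightarrow> (nat \<Rightarrow> nat \<Rightarrow> bool) \<Rightarrow> nat \<Rightarrow> nat \<Rightarrow> bool" where
  "P1 typ ha E U P b c \<longleftrightarrow> P b c \<or> (typ = 3 \<and> eact E U P ha b c)"

definition wf_state :: "nat \<Rightarrow> nat \<Rightarrow> (nat \<Rightarrow> bool) \<Rightarrow> (nat \<Rightarrow> nat \<Rightarrow> bool) \<Rightarrow> bool" where
  "wf_state A th U P \<longleftrightarrow> (\<forall>a. U a \<longrightarrow> a < A) \<and> (\<forall>a b. P a b \<longrightarrow> a < A \<and> b < A \<and> P b a) \<and>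
     (\<forall>a<A. card {b. b < A \<and> pact U P a b} \<le> 2 * th)"

definition sym3 :: "nat \<Rightarrow> (nat \<Rightarrow> nat \<Rightarrow> nat \<Rightarrow> bool) \<Rightarrow> bool" where
  "sym3 A E \<longleftrightarrow> (\<forall>a b c. E a b c \<longrightarrow> a < A \<and> b < A \<and> c < A \<and> E b a c \<and> E a c b)"

text \<open>The progress measure. It never exceeds \<open>10 * th * A\<close>, and a branching
  raises it a little in the first child but very much in the second; this asymmetry keeps the
  branching tree small.\<close>

definition used :: "nat \<Rightarrow> nat \<Rightarrow> (nat \<Rightarrow> bool) \<Rightarrow> (nat \<Rightarrow> nat \<Rightarrow> bool) \<Rightarrow> nat" where
  "used A th U P = 8 * th * card {a. a < A \<and> U a} + card {(a, b). a < A \<and> b < A \<and> pact U P a b}"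

text \<open>An assignment that falsifies the heart must satisfy every petal of the
  sunflower.\<close>

lemma sat_branch:
  assumes "branch A th E U P typ ha hb" "sym3 A E"
  shows "sat_state L E U P \<longleftrightarrow>
    sat_state L E (U0 typ ha U) (P0 typ ha hb P) \<or> sat_state L E (U1 typ ha hb E U P) (P1 typ ha E U P)"
proof
  assume "sat_state L E U P"
  then obtain \<beta> where b: "\<beta> \<in> L" "\<And>a. U a \<Longrightarrow> \<beta> a" "\<And>a b. P a b \<Longrightarrow> \<beta> a \<or> \<beta> b" "\<And>a b c. E a b c \<Longrightarrow> \<beta> a \<or> \<beta> b \<or> \<beta> c"
    unfolding sat_state_def by blast
  show "sat_state L E (U0 typ ha U) (P0 typ ha hb P) \<or> sat_state L E (U1 typ ha hb E U P) (P1 typ ha E U P)"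
  proof (cases "typ \<noteq> 2 \<and> \<beta> ha \<or> typ = 2 \<and> (\<beta> ha \<or> \<beta> hb)")
    case True
    have "(\<forall>a. U0 typ ha U a \<longrightarrow> \<beta> a) \<and> (\<forall>a c. P0 typ ha hb P a c \<longrightarrow> \<beta> a \<or> \<beta> c)"
      unfolding U0_def P0_def using b(2,3) True by auto
    then have "sat_state L E (U0 typ ha U) (P0 typ ha hb P)"
      unfolding sat_state_def using b(1,4) by auto
    then show ?thesis ..
  next
    case False
    have "typ = 1 \<or> typ = 2 \<or> typ = 3" using assms(1) by (auto simp: branch_def)
    with False have "\<And>a. U1 typ ha hb E U P a \<Longrightarrow> \<beta> a" "\<And>a c. P1 typ ha E U P a c \<Longrightarrow> \<beta> a \<or> \<beta> c"
      unfolding U1_def P1_def pact_def eact_def using b(2,3) by (auto dest: b(3,4))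
    then have "sat_state L E (U1 typ ha hb E U P) (P1 typ ha E U P)"
      unfolding sat_state_def using b(1,4) by auto
    then show ?thesis ..
  qed
qed (auto simp: sat_state_def U0_def P0_def U1_def P1_def)

text \<open>An inactive clause contains a smaller clause and is implied by it.\<close>

lemma sat_active: "sat_state L E U P \<longleftrightarrow> (\<exists>\<beta>\<in>L. (\<forall>a. U a \<longrightarrow> \<beta> a) \<and> (\<forall>a b. pact U P a b \<longrightarrow> \<beta> a \<or> \<beta> b) \<and>
     (\<forall>a b c. eact E U P a b c \<longrightarrow> \<beta> a \<or> \<beta> b \<or> \<beta> c))"
  unfolding sat_state_def pact_def eact_def by (rule bex_cong[OF refl]) blast

lemma card_pairs: "card {(a, b). a < A \<and> b < (A::nat) \<and> R a b} = (\<Sum>a<A. card {b. b < A \<and> R a b})"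
proof -
  have "{(a, b). a < A \<and> b < A \<and> R a b} = Sigma {..<A} (\<lambda>a. {b. b < A \<and> R a b})" by auto
  then show ?thesis by (simp add: card_SigmaI)
qed

lemma finite_pairs: "finite {(a, b). a < A \<and> b < (A::nat) \<and> R a b}"
  by (rule finite_subset[of _ "{..<A} \<times> {..<A}"]) auto

lemma used_le:
  assumes "wf_state A th U P"
  shows "used A th U P \<le> 10 * th * A"
proof -
  have "card {a. a < A \<and> U a} \<le> card {..<A}" by (rule card_mono) auto
  then have "8 * th * card {a. a < A \<and> U a} \<le> 8 * th * A" by (intro mult_le_mono2) simp
  moreover have "card {(a, b). a < A \<and> b < A \<and> pact U P a b} \<le> (\<Sum>a<A. 2 * th)"
    unfolding card_pairs by (rule sum_mono) (use assms in \<open>auto simp: wf_state_def\<close>)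
  then have "card {(a, b). a < A \<and> b < A \<and> pact U P a b} \<le> 2 * th * A" by (simp add: mult.commute)
  moreover have "10 * th * A = 8 * th * A + 2 * th * A" by (simp add: algebra_simps)
  ultimately show ?thesis unfolding used_def by linarith
qed

text \<open>A new unit clause deactivates at most \<open>4 * th\<close> ordered pairs, half of its weight.\<close>
lemma used_grows:
  assumes wf: "wf_state A th U P" and sub: "\<And>a. U a \<Longrightarrow> U' a" "\<And>a b. P a b \<Longrightarrow> P' a b"
    and new: "N \<subseteq> {(a, b). a < A \<and> b < A \<and> pact U' P' a b \<and> \<not> P a b}"
    and d: "d = card {a. a < A \<and> U' a \<and> \<not> U a}"
  shows "used A th U P + 4 * th * d + card N \<le> used A th U' P'"
proof -
  let ?D = "{a. a < A \<and> U' a \<and> \<not> U a}"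
  let ?S = "{(a, b). a < A \<and> b < A \<and> pact U P a b}" and ?S' = "{(a, b). a < A \<and> b < A \<and> pact U' P' a b}"
  let ?K = "Sigma ?D (\<lambda>a. {b. b < A \<and> pact U P a b})"
  have deg: "card {b. b < A \<and> pact U P a b} \<le> 2 * th" if "a < A" for a using wf that by (auto simp: wf_state_def)
  have "card ?K = (\<Sum>a\<in>?D. card {b. b < A \<and> pact U P a b})" by (rule card_SigmaI) auto
  also have "\<dots> \<le> (\<Sum>a\<in>?D. 2 * th)" by (rule sum_mono) (use deg in auto)
  finally have "card ?K \<le> (\<Sum>a\<in>?D. 2 * th)" .
  then have K: "card ?K \<le> d * (2 * th)" using d by simp
  have finK: "finite ?K" by auto
  have sym: "pact U P a b \<Longrightarrow> pact U P b a" for a b using wf by (auto simp: wf_state_def pact_def)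
  \<comment> \<open>A pair is deactivated only if one of its literals becomes a unit:
    \<open>?K\<close> has the pairs where it is the first literal, the swapped copy those where it
    is the second.\<close>
  have "?S \<subseteq> (?S' - N) \<union> ?K \<union> prod.swap ` ?K"
  proof (rule subsetI)
    fix x assume "x \<in> ?S"
    then obtain a b where x: "x = (a, b)" "a < A" "b < A" "pact U P a b" by auto
    show "x \<in> (?S' - N) \<union> ?K \<union> prod.swap ` ?K"
    proof (cases "U' a \<or> U' b")
      case True
      then have "(a, b) \<in> ?K \<or> (b, a) \<in> ?K" using x sym by (auto simp: pact_def)
      then show ?thesis unfolding x(1) by (metis (no_types, lifting) UnCI image_eqI swap_simp)
    next
      case False
      then show ?thesis using x sub new by (auto simp: pact_def)
    qed
  qed
  then have "card ?S \<le> card ((?S' - N) \<union> ?K \<union> prod.swap ` ?K)"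
    by (intro card_mono) (use finK finite_pairs in auto)
  also have "\<dots> \<le> card (?S' - N) + card ?K + card (prod.swap ` ?K)"
    by (meson add_le_mono1 card_Un_le le_trans)
  also have "\<dots> \<le> card (?S' - N) + d * (2 * th) + d * (2 * th)"
    using K card_image_le[OF finK, of prod.swap] by linarith
  finally have "card ?S \<le> card (?S' - N) + 4 * th * d" by (simp add: algebra_simps)
  moreover have "N \<subseteq> ?S'" using new by auto
  then have "card (?S' - N) + card N = card ?S'"
  proof -
    assume N: "N \<subseteq> ?S'"
    have f: "finite ?S'" by (rule finite_pairs)
    have "card (?S' - N) = card ?S' - card N" by (rule card_Diff_subset[OF finite_subset[OF N f] N])
    then show ?thesis using card_mono[OF f N] by linarith
  qed
  ultimately have S: "card ?S + card N \<le> card ?S' + 4 * th * d" by linarith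
  have "{a. a < A \<and> U' a} = {a. a < A \<and> U a} \<union> ?D" using sub by auto
  then have "card {a. a < A \<and> U' a} = card {a. a < A \<and> U a} + d"
    unfolding d by (simp only:) (rule card_Un_disjoint, auto)
  then have "used A th U' P' = 8 * th * card {a. a < A \<and> U a} + 8 * th * d + card ?S'"
    unfolding used_def by (simp add: algebra_simps)
  moreover have "8 * th * d = 4 * th * d + 4 * th * d" by simp
  ultimately show ?thesis using S unfolding used_def[of A th U P] by linarith
qed

lemma card_posD: "1 \<le> card {x. R x} \<Longrightarrow> \<exists>x. R x"
  by (metis card.empty empty_Collect_eq not_one_le_zero)

text \<open>The heart is always new: an active sunflower around it shows that it is not yet among
  the clauses. For the petals, either \<open>th\<close> new units gain a net \<open>4 * th\<close>
  each, or \<open>4 * th * th\<close> ordered pairs appear. The latter explains the threshold for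
  triples around a literal.\<close>

lemma branch_grows:
  assumes br: "branch A th E U P typ ha hb" and wf: "wf_state A th U P" and th: "1 \<le> th"
  shows "used A th U P + 1 \<le> used A th (U0 typ ha U) (P0 typ ha hb P)"
    "used A th U P + 4 * th * th \<le> used A th (U1 typ ha hb E U P) (P1 typ ha E U P)"
proof -
  have sub: "U a \<Longrightarrow> U0 typ ha U a" "P a b \<Longrightarrow> P0 typ ha hb P a b" "U a \<Longrightarrow> U1 typ ha hb E U P a" "P a b \<Longrightarrow> P1 typ ha E U P a b" for a b
    by (auto simp: U0_def P0_def U1_def P1_def)
  show "used A th U P + 1 \<le> used A th (U0 typ ha U) (P0 typ ha hb P)"
  proof (cases "typ = 2")
    case True
    then have "1 \<le> card {c. c < A \<and> eact E U P ha hb c}" "ha < A" "hb < A" using br th by (auto simp: branch_def)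
    then obtain c where "eact E U P ha hb c" using card_posD by blast
    then have "{(ha, hb)} \<subseteq> {(a, b). a < A \<and> b < A \<and> pact (U0 typ ha U) (P0 typ ha hb P) a b \<and> \<not> P a b}"
      using True \<open>ha < A\<close> \<open>hb < A\<close> by (auto simp: pact_def U0_def P0_def eact_def)
    from used_grows[OF wf sub(1,2) this refl] show ?thesis by simp
  next
    case False
    have "\<not> U ha" "ha < A"
    proof -
      have "4 * th * th \<ge> 1" using th by (metis One_nat_def Suc_leI mult_is_0 not_gr_zero not_one_le_zero zero_neq_numeral)
      moreover have "th \<le> card {b. b < A \<and> pact U P ha b} \<or> 4 * th * th \<le> card {x. case x of (b, c) \<Rightarrow> b < A \<and> c < A \<and> eact E U P ha b c}"
        using br False by (auto simp: branch_def)
      ultimately have "1 \<le> card {b. b < A \<and> pact U P ha b} \<or> 1 \<le> card {x. case x of (b, c) \<Rightarrow> b < A \<and> c < A \<and> eact E U P ha b c}"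
        using th le_trans by blast
      then show "\<not> U ha" using card_posD by (fastforce simp: pact_def eact_def)
      show "ha < A" using br by (auto simp: branch_def)
    qed
    then have "{a. a < A \<and> U0 typ ha U a \<and> \<not> U a} = {ha}" using False by (auto simp: U0_def)
    then have "card {a. a < A \<and> U0 typ ha U a \<and> \<not> U a} = 1" by simp
    then show ?thesis using used_grows[OF wf, of "U0 typ ha U" "P0 typ ha hb P" "{}" 1] sub(1,2) th by simp
  qed
  show "used A th U P + 4 * th * th \<le> used A th (U1 typ ha hb E U P) (P1 typ ha E U P)"
  proof (cases "typ = 3")
    case False
    have "th \<le> card {a. a < A \<and> U1 typ ha hb E U P a \<and> \<not> U a}"
    proof -
      have "typ = 1 \<and> th \<le> card {b. b < A \<and> pact U P ha b} \<or> typ = 2 \<and> th \<le> card {c. c < A \<and> eact E U P ha hb c}"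
        using br False by (auto simp: branch_def)
      moreover have "card {b. b < A \<and> pact U P ha b} \<le> card {a. a < A \<and> U1 typ ha hb E U P a \<and> \<not> U a}" if "typ = 1"
        by (rule card_mono) (use that in \<open>auto simp: U1_def pact_def\<close>)
      moreover have "card {b. b < A \<and> eact E U P ha hb b} \<le> card {a. a < A \<and> U1 typ ha hb E U P a \<and> \<not> U a}" if "typ = 2"
        by (rule card_mono) (use that in \<open>auto simp: U1_def eact_def\<close>)
      ultimately show ?thesis by linarith
    qed
    then have "4 * th * th \<le> 4 * th * card {a. a < A \<and> U1 typ ha hb E U P a \<and> \<not> U a}" by (rule mult_le_mono2)
    moreover have "used A th U P + 4 * th * card {a. a < A \<and> U1 typ ha hb E U P a \<and> \<not> U a} + card ({} :: (nat \<times> nat) set)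
      \<le> used A th (U1 typ ha hb E U P) (P1 typ ha E U P)"
      by (rule used_grows[OF wf]) (use sub in auto)
    ultimately show ?thesis by linarith
  next
    case True
    let ?N = "{(b, c). b < A \<and> c < A \<and> eact E U P ha b c}"
    have "?N \<subseteq> {(a, b). a < A \<and> b < A \<and> pact (U1 typ ha hb E U P) (P1 typ ha E U P) a b \<and> \<not> P a b}"
      using True by (auto simp: pact_def U1_def P1_def eact_def)
    from used_grows[OF wf sub(3,4) this refl] have "used A th U P + card ?N \<le> used A th (U1 typ ha hb E U P) (P1 typ ha E U P)"
      by linarith
    moreover have "4 * th * th \<le> card ?N" using br True by (auto simp: branch_def)
    ultimately show ?thesis by linarith
  qed
qed

text \<open>New units only deactivate pairs. A heart of two literals raises a degree below
  \<open>th\<close> by at most one. Petals of two literals add fewer than \<open>th\<close> pairs at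
  each literal, because no pair is the heart of a large sunflower at that stage.\<close>

lemma branch_wf:
  assumes br: "branch A th E U P typ ha hb" and wf: "wf_state A th U P" and th: "1 \<le> th" and E: "sym3 A E"
  shows "wf_state A th (U0 typ ha U) (P0 typ ha hb P)" "wf_state A th (U1 typ ha hb E U P) (P1 typ ha E U P)"
proof -
  have deg: "card {b. b < A \<and> pact U P a b} \<le> 2 * th" if "a < A" for a using wf that by (auto simp: wf_state_def)
  have le: "card {b. b < A \<and> R b} \<le> card {b. b < A \<and> R' b}" if "\<And>b. R b \<Longrightarrow> R' b" for R R' :: "nat \<Rightarrow> bool"
    by (rule card_mono) (use that in auto)
  have d0: "card {b. b < A \<and> pact (U0 typ ha U) (P0 typ ha hb P) a b} \<le> 2 * th" if a: "a < A" for a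
  proof (cases "typ = 2")
    case False
    have "card {b. b < A \<and> pact (U0 typ ha U) (P0 typ ha hb P) a b} \<le> card {b. b < A \<and> pact U P a b}"
      by (rule le) (use False in \<open>auto simp: pact_def U0_def P0_def\<close>)
    then show ?thesis using deg[OF a] by linarith
  next
    case True
    have "{b. b < A \<and> pact (U0 typ ha U) (P0 typ ha hb P) a b} \<subseteq> insert (if a = ha then hb else ha) {b. b < A \<and> pact U P a b}"
      using True by (auto simp: pact_def U0_def P0_def)
    then have "card {b. b < A \<and> pact (U0 typ ha U) (P0 typ ha hb P) a b} \<le> card (insert (if a = ha then hb else ha) {b. b < A \<and> pact U P a b})"
      by (intro card_mono) auto
    also have "\<dots> \<le> Suc (card {b. b < A \<and> pact U P a b})" by (simp add: card_insert_if)
    also have "\<dots> \<le> 2 * th" using br True a th by (auto simp: branch_def Suc_le_eq intro: less_le_trans)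
    finally show ?thesis .
  qed
  have d1: "card {b. b < A \<and> pact (U1 typ ha hb E U P) (P1 typ ha E U P) a b} \<le> 2 * th" if a: "a < A" for a
  proof (cases "typ = 3")
    case False
    have "card {b. b < A \<and> pact (U1 typ ha hb E U P) (P1 typ ha E U P) a b} \<le> card {b. b < A \<and> pact U P a b}"
      by (rule le) (use False in \<open>auto simp: pact_def U1_def P1_def\<close>)
    then show ?thesis using deg[OF a] by linarith
  next
    case True
    have "{b. b < A \<and> pact (U1 typ ha hb E U P) (P1 typ ha E U P) a b} \<subseteq> {b. b < A \<and> pact U P a b} \<union> {c. c < A \<and> eact E U P ha a c}"
      using True by (auto simp: pact_def U1_def P1_def)
    then have "card {b. b < A \<and> pact (U1 typ ha hb E U P) (P1 typ ha E U P) a b} \<le> card ({b. b < A \<and> pact U P a b} \<union> {c. c < A \<and> eact E U P ha a c})"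
      by (intro card_mono) auto
    also have "\<dots> \<le> card {b. b < A \<and> pact U P a b} + card {c. c < A \<and> eact E U P ha a c}" by (rule card_Un_le)
    also have "\<dots> \<le> th + th"
      by (rule add_mono) (use br True a in \<open>auto simp: branch_def intro: less_imp_le\<close>)
    finally show ?thesis by simp
  qed
  have lt: "ha < A" "typ = 2 \<Longrightarrow> hb < A" using br by (auto simp: branch_def)
  show "wf_state A th (U0 typ ha U) (P0 typ ha hb P)"
    unfolding wf_state_def using d0 wf lt by (auto simp: wf_state_def U0_def P0_def)
  have "eact E U P ha b c \<Longrightarrow> b < A \<and> c < A \<and> eact E U P ha c b" for b c
    using E wf unfolding eact_def sym3_def wf_state_def by blast
  moreover have "eact E U P ha hb b \<Longrightarrow> b < A" for b using E unfolding eact_def sym3_def by blast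
  ultimately show "wf_state A th (U1 typ ha hb E U P) (P1 typ ha E U P)"
    unfolding wf_state_def using d1 wf unfolding wf_state_def U1_def P1_def pact_def[of U P] by blast
qed

lemma leaf_sparse:
  assumes "leaf A th E U P"
  shows "card {a. a < A \<and> U a} + card {(a, b). a < A \<and> b < A \<and> pact U P a b} +
    (\<Sum>a<A. card {(b, c). b < A \<and> c < A \<and> eact E U P a b c}) \<le> A * (1 + th + 4 * th * th)"
proof -
  have "card {a. a < A \<and> U a} \<le> card {..<A}" by (rule card_mono) auto
  moreover have "card {(a, b). a < A \<and> b < A \<and> pact U P a b} \<le> (\<Sum>a<A. th)"
    unfolding card_pairs by (rule sum_mono) (use assms in \<open>auto simp: leaf_def intro: less_imp_le\<close>)
  moreover have "(\<Sum>a<A. card {(b, c). b < A \<and> c < A \<and> eact E U P a b c}) \<le> (\<Sum>a<A. 4 * th * th)"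
    by (rule sum_mono) (use assms in \<open>auto simp: leaf_def intro: less_imp_le\<close>)
  ultimately show ?thesis by (simp add: algebra_simps)
qed

text \<open>\<open>weight\<close> bounds the number of nodes of the branching tree below a state.\<close>

definition weight :: "nat \<Rightarrow> nat \<Rightarrow> real \<Rightarrow> (nat \<Rightarrow> bool) \<Rightarrow> (nat \<Rightarrow> nat \<Rightarrow> bool) \<Rightarrow> real" where
  "weight A th x U P = 2 * x ^ (10 * th * A - used A th U P) - 1"

lemma weight_ge: "1 \<le> x \<Longrightarrow> 1 \<le> weight A th x U P"
  unfolding weight_def using one_le_power[of x] by (smt (verit))

text \<open>With \<open>r\<close> units of the measure left, tree sizes obey T(r) \<le> 1 + T(r - 1)
  + T(r - N) for \<open>N = 4 * th * th\<close>. The assumption on \<open>x\<close> is the matching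
  inequality for powers, and the summand -1 in the weight pays for the node itself.\<close>

lemma weight_branch:
  assumes br: "branch A th E U P typ ha hb" and wf: "wf_state A th U P" and th: "1 \<le> th" and E: "sym3 A E"
    and x: "1 \<le> x" "x ^ (4 * th * th - 1) + 1 \<le> x ^ (4 * th * th)"
  shows "1 + weight A th x (U0 typ ha U) (P0 typ ha hb P) + weight A th x (U1 typ ha hb E U P) (P1 typ ha E U P) \<le> weight A th x U P"
proof -
  let ?R = "10 * th * A" and ?N = "4 * th * th"
  let ?u = "used A th U P" and ?ua = "used A th (U0 typ ha U) (P0 typ ha hb P)" and ?ub = "used A th (U1 typ ha hb E U P) (P1 typ ha E U P)"
  have g: "?u + 1 \<le> ?ua" "?u + ?N \<le> ?ub" using branch_grows[OF br wf th] .
  have l: "?ua \<le> ?R" "?ub \<le> ?R" using used_le branch_wf[OF br wf th E] by blast+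
  define e where "e = ?R - ?u - ?N"
  have N1: "1 \<le> ?N" using th by (metis One_nat_def Suc_leI mult_is_0 not_gr_zero not_one_le_zero zero_neq_numeral)
  have eu: "?R - ?u = e + ?N" using g l unfolding e_def by linarith
  have "x ^ (?R - ?ua) \<le> x ^ (e + (?N - 1))" by (rule power_increasing) (use g l eu N1 x in linarith)+
  moreover have "x ^ (?R - ?ub) \<le> x ^ e" by (rule power_increasing) (use g l eu x in linarith)+
  moreover have "x ^ (e + (?N - 1)) + x ^ e = x ^ e * (x ^ (?N - 1) + 1)" by (simp add: power_add algebra_simps)
  moreover have "x ^ e * (x ^ (?N - 1) + 1) \<le> x ^ e * x ^ ?N" by (rule mult_left_mono) (use x in auto)
  moreover have "x ^ e * x ^ ?N = x ^ (?R - ?u)" unfolding eu by (simp add: power_add)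
  ultimately show ?thesis unfolding weight_def by linarith
qed

lemma sparsification_parameters:
  assumes "(0::real) < \<epsilon>"
  obtains th :: nat and x :: real where "1 \<le> th" "1 \<le> x" "x ^ (4 * th * th - 1) + 1 \<le> x ^ (4 * th * th)"
    "\<And>A. x ^ (10 * th * A) \<le> 2 powr (\<epsilon> * real A)"
proof -
  \<comment> \<open>The number 32768 is the cube of the 32 in the definition of \<open>y\<close>.
    With \<open>y\<close> of order \<epsilon> / \<open>th\<close>, the power
    \<open>(1 + y) ^ (10 * th * A)\<close> is at most the exponential of
    \<open>10 / 32 * \<epsilon> * A\<close>, and \<open>10 / 32\<close> is below
    \<open>ln 2\<close>.\<close>
  define th where "th = nat \<lceil>32768 / \<epsilon> ^ 3\<rceil> + 1"
  define y where "y = \<epsilon> / (32 * real th)"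
  have th: "1 \<le> th" "32768 / \<epsilon> ^ 3 \<le> real th" unfolding th_def by linarith+
  have y: "0 < y" using assms th(1) by (simp add: y_def)
  show ?thesis
  proof
    show "1 \<le> th" by (rule th(1))
    show "1 \<le> 1 + y" using y by simp
    let ?j = "th * th"
    have jy: "(real ?j * y) ^ 2 * y = real th * \<epsilon> ^ 3 / 32768"
      using th(1) by (simp add: y_def field_simps power2_eq_square power3_eq_cube)
    have "32768 \<le> real th * \<epsilon> ^ 3" using th(2) assms by (simp add: field_simps)
    then have big: "1 \<le> (real ?j * y) ^ 2 * y" unfolding jy by simp
    \<comment> \<open>Bernoulli alone bounds \<open>y * (1 + y) ^ (th * th)\<close> below by a
      multiple of the square of \<epsilon>, independently of \<open>th\<close>. Squaring the power
      gains the missing factor \<open>th\<close>, and the exponent \<open>2 * th * th\<close> is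
      still available.\<close>
    have "real ?j * y \<le> (1 + y) ^ ?j" using Bernoulli_inequality[of y ?j] y by simp
    then have "(real ?j * y) ^ 2 \<le> ((1 + y) ^ ?j) ^ 2" using y by (intro power_mono) auto
    also have "\<dots> = (1 + y) ^ (2 * ?j)" by (simp add: power_mult[symmetric] mult.commute)
    also have "\<dots> \<le> (1 + y) ^ (4 * th * th - 1)"
    proof (rule power_increasing)
      have "1 \<le> th * th" using th(1) by (metis mult_le_mono nat_mult_1)
      then show "2 * ?j \<le> 4 * th * th - 1" by simp
    qed (use y in simp)
    finally have "(real ?j * y) ^ 2 * y \<le> (1 + y) ^ (4 * th * th - 1) * y" using y by (intro mult_right_mono) auto
    then have main: "1 \<le> (1 + y) ^ (4 * th * th - 1) * y" using big by linarith
    have "4 * th * th = Suc (4 * th * th - 1)" using th(1) by (cases th) auto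
    then have "(1 + y) ^ (4 * th * th) = (1 + y) ^ (4 * th * th - 1) * (1 + y)" by (metis power_Suc2)
    then show "(1 + y) ^ (4 * th * th - 1) + 1 \<le> (1 + y) ^ (4 * th * th)" using main by (simp add: distrib_left)
    fix A :: nat
    have "(1 + y) ^ (10 * th * A) \<le> exp y ^ (10 * th * A)" by (intro power_mono exp_ge_add_one_self) (use y in auto)
    also have "\<dots> = exp (real (10 * th * A) * y)" by (rule exp_of_nat_mult[symmetric])
    also have "real (10 * th * A) * y = \<epsilon> * real A * (10 / 32)" using th(1) by (simp add: y_def field_simps)
    also have "exp (\<epsilon> * real A * (10 / 32)) \<le> exp (\<epsilon> * real A * ln 2)"
    proof -
      have "(1 / 2 :: real) \<le> ln 2"
      proof -
        have "1 - 1 / 2 \<le> ln (2::real)" using ln_ge_iff[of 2 "1/2"] ln_add_one_self_le_self2 ln_le_minus_one[of "1/2 :: real"] by (simp add: ln_div)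
        then show ?thesis by simp
      qed
      then show ?thesis using assms by (auto intro!: mult_left_mono)
    qed
    also have "\<dots> = 2 powr (\<epsilon> * real A)" by (simp add: powr_def)
    finally show "(1 + y) ^ (10 * th * A) \<le> 2 powr (\<epsilon> * real A)" .
  qed
qed

section \<open>From sparse formulas to scorpions\<close>

text \<open>Every vertex has a position between \<open>0\<close> and \<open>l + 2\<close>. The path of the intended scorpions runs
  through the positions \<open>1, \<dots>, l + 2\<close> and their legs are the vertices with position \<open>0\<close>. The positions
  \<open>3 * i + 2\<close> are occupied by cliques, from which the path selects one vertex each.\<close>

definition isT :: "nat \<Rightarrow> nat \<Rightarrow> bool" where
  "isT g p \<longleftrightarrow> p mod 3 = 2 \<and> p div 3 < g"

definition sz :: "nat \<Rightarrow> nat \<Rightarrow> nat \<Rightarrow> nat \<Rightarrow> nat" where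
  "sz g r w p = (if p = 0 then r else if isT g p then w else 1)"

definition adjp :: "nat \<Rightarrow> (nat \<Rightarrow> nat \<Rightarrow> nat \<Rightarrow> nat \<Rightarrow> bool) \<Rightarrow> nat \<Rightarrow> nat \<Rightarrow> nat \<Rightarrow> nat \<Rightarrow> bool" where
  "adjp g conf p x q y \<longleftrightarrow> p = Suc q \<or> q = Suc p \<or>
     isT g p \<and> isT g q \<and> (if p = q then x \<noteq> y else conf (p div 3) x (q div 3) y)"

definition red_graph :: "nat \<Rightarrow> (nat \<Rightarrow> nat \<Rightarrow> nat \<Rightarrow> nat \<Rightarrow> bool) \<Rightarrow> nat \<Rightarrow> (nat \<Rightarrow> nat) \<Rightarrow> (nat \<Rightarrow> nat) \<Rightarrow> nat graph" where
  "red_graph g conf N pos idx =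
    ({..<N}, {{u, v} | u v. u < N \<and> v < N \<and> adjp g conf (pos u) (idx u) (pos v) (idx v)})"

text \<open>The numbering of the vertices is left open: the reduction is proved for every numbering,
  in particular for the one in which the program happens to create them.\<close>

definition layout :: "nat \<Rightarrow> nat \<Rightarrow> nat \<Rightarrow> nat \<Rightarrow> nat \<Rightarrow> (nat \<Rightarrow> nat) \<Rightarrow> (nat \<Rightarrow> nat) \<Rightarrow> bool" where
  "layout l g r w N pos idx \<longleftrightarrow>
     bij_betw (\<lambda>v. (pos v, idx v)) {..<N} {(p, x). p \<le> l + 2 \<and> x < sz g r w p}"

lemma adjp_irrefl: "\<not> adjp g conf p x p x"
  by (simp add: adjp_def)

text \<open>A walk with unit steps that never revisits a point cannot turn around.\<close>

lemma unit_steps: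
  fixes f :: "nat \<Rightarrow> int"
  assumes "\<And>p. p < n \<Longrightarrow> \<bar>f (Suc p) - f p\<bar> = 1" "inj_on f {..n}" "p \<le> n"
  shows "f p = f 0 + int p * (f 1 - f 0)"
  using assms(3)
proof (induction p rule: less_induct)
  case (less p)
  consider "p = 0" | "p = 1" | p' where "p = Suc (Suc p')" by (metis One_nat_def not0_implies_Suc)
  then show ?case
  proof cases
    case 3
    have IH: "f p' = f 0 + int p' * (f 1 - f 0)" "f (Suc p') = f 0 + int (Suc p') * (f 1 - f 0)"
      by (rule less.IH; use 3 less.prems in simp)+
    have "f p \<noteq> f p'" using assms(2) less.prems 3 by (auto dest: inj_onD)
    moreover have "\<bar>f p - f (Suc p')\<bar> = 1" using assms(1)[of "Suc p'"] less.prems 3 by simp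
    moreover have "\<bar>f (Suc p') - f p'\<bar> = 1" using assms(1)[of p'] less.prems 3 by simp
    moreover have "f (Suc p') - f p' = f 1 - f 0" using IH by (simp add: algebra_simps)
    ultimately have "f p = f (Suc p') + (f 1 - f 0)" by linarith
    then show ?thesis using IH(2) 3 by (simp add: algebra_simps)
  qed auto
qed

locale reduction =
  fixes l g r w N :: nat and conf :: "nat \<Rightarrow> nat \<Rightarrow> nat \<Rightarrow> nat \<Rightarrow> bool" and pos idx :: "nat \<Rightarrow> nat"
  assumes g: "3 * g \<le> l + 1" and r: "2 \<le> r" and l: "1 \<le> l"
    and conf_sym: "\<And>i x j y. conf i x j y \<Longrightarrow> conf j y i x"
    and layout: "layout l g r w N pos idx"
begin

abbreviation "G \<equiv> red_graph g conf N pos idx"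

text \<open>Positions 1 and \<open>l + 1\<close> are therefore occupied by single vertices, which
  shields the legs and the end position from the cliques.\<close>

lemma isT_bounds: "isT g p \<Longrightarrow> 2 \<le> p \<and> p \<le> l"
proof -
  assume "isT g p"
  then have "p mod 3 = 2" "p div 3 < g" unfolding isT_def by auto
  moreover have "p = 3 * (p div 3) + p mod 3" by simp
  ultimately show ?thesis using g by linarith
qed

text \<open>The purpose of the spacing by three: the position after one clique is never the position
  before another.\<close>

lemma isT_apart: "isT g p \<Longrightarrow> \<not> isT g (p + 1) \<and> \<not> isT g (p + 2) \<and> \<not> isT g (p - 1)"
proof -
  assume T: "isT g p"
  then obtain p' where p': "p = Suc p'" using isT_bounds[OF T] by (cases p) auto
  have "p mod 3 = 2" using T by (simp add: isT_def)
  then have "Suc p mod 3 = 0" "Suc (Suc p) mod 3 = 1" "p' mod 3 = 1"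
    unfolding p' by (auto simp: mod_Suc split: if_splits)
  then show ?thesis by (auto simp: isT_def p')
qed

lemma simple_G: "simple_graph G"
  unfolding simple_graph_def
proof (intro conjI ballI)
  fix e assume "e \<in> edges G"
  then obtain u v where "e = {u, v}" "u < N" "v < N" "adjp g conf (pos u) (idx u) (pos v) (idx v)"
    unfolding red_graph_def by auto
  moreover then have "u \<noteq> v" using adjp_irrefl by metis
  ultimately show "e \<subseteq> verts G" "card e = 2" by (auto simp: red_graph_def)
qed (simp add: red_graph_def)

lemma verts_G: "verts G = {..<N}"
  by (simp add: red_graph_def)

lemma adjp_commute: "adjp g conf p x q y \<Longrightarrow> adjp g conf q y p x"
  unfolding adjp_def using conf_sym by (auto split: if_splits)

lemma adj_G: "adj G u v \<longleftrightarrow> u < N \<and> v < N \<and> adjp g conf (pos u) (idx u) (pos v) (idx v)"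
  unfolding adj_def red_graph_def using adjp_commute by (auto simp: doubleton_eq_iff)

lemma pos_idx: "u < N \<Longrightarrow> pos u \<le> l + 2 \<and> idx u < sz g r w (pos u)"
  using layout unfolding layout_def bij_betw_def by auto

lemma vertex_eq: "u < N \<Longrightarrow> v < N \<Longrightarrow> pos u = pos v \<Longrightarrow> idx u = idx v \<Longrightarrow> u = v"
  using layout unfolding layout_def bij_betw_def inj_on_def by auto

lemma vertex_ex: "p \<le> l + 2 \<Longrightarrow> x < sz g r w p \<Longrightarrow> \<exists>v<N. pos v = p \<and> idx v = x"
proof -
  assume "p \<le> l + 2" "x < sz g r w p"
  then have "(p, x) \<in> (\<lambda>v. (pos v, idx v)) ` {..<N}" using layout unfolding layout_def bij_betw_def by auto
  then show ?thesis by auto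
qed

lemma single: "u < N \<Longrightarrow> v < N \<Longrightarrow> pos u = pos v \<Longrightarrow> pos u \<noteq> 0 \<Longrightarrow> \<not> isT g (pos u) \<Longrightarrow> u = v"
  using pos_idx[of u] pos_idx[of v] vertex_eq[of u v] by (auto simp: sz_def)

lemma same_T: "u < N \<Longrightarrow> v < N \<Longrightarrow> pos u = pos v \<Longrightarrow> isT g (pos u) \<Longrightarrow> u \<noteq> v \<Longrightarrow> adj G u v"
  using vertex_eq[of u v] by (auto simp: adj_G adjp_def)

lemma consecutive: "u < N \<Longrightarrow> v < N \<Longrightarrow> pos v = Suc (pos u) \<Longrightarrow> adj G u v"
  by (simp add: adj_G adjp_def)

lemma scorpion_if:
  assumes x: "\<And>i. i < g \<Longrightarrow> x i < w" "\<And>i j. i < g \<Longrightarrow> j < g \<Longrightarrow> i \<noteq> j \<Longrightarrow> \<not> conf i (x i) j (x j)"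
  shows "\<exists>qs\<in>ipaths G (l + 2). r \<le> card (legs_of G qs)"
proof -
  have "\<exists>v. \<forall>p. 1 \<le> p \<and> p \<le> l + 2 \<longrightarrow> v p < N \<and> pos (v p) = p \<and> idx (v p) = (if isT g p then x (p div 3) else 0)"
  proof (rule choice, rule allI)
    fix p
    have "(if isT g p then x (p div 3) else 0) < sz g r w p" if "1 \<le> p"
      using x(1) that by (auto simp: sz_def isT_def)
    then show "\<exists>v. 1 \<le> p \<and> p \<le> l + 2 \<longrightarrow> v < N \<and> pos v = p \<and> idx v = (if isT g p then x (p div 3) else 0)"
      using vertex_ex by blast
  qed
  then obtain v where v: "\<And>p. 1 \<le> p \<Longrightarrow> p \<le> l + 2 \<Longrightarrow> v p < N \<and> pos (v p) = p \<and> idx (v p) = (if isT g p then x (p div 3) else 0)" by blast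
  define qs where "qs = map (\<lambda>t. v (Suc t)) [0..<l + 2]"
  have len: "length qs = l + 2" by (simp add: qs_def)
  have nth: "qs ! t = v (Suc t)" if "t < l + 2" for t using that by (simp add: qs_def del: upt_Suc)
  have "induced_path G qs"
    unfolding induced_path_def len
  proof (intro conjI allI impI)
    show "distinct qs" unfolding distinct_conv_nth len
    proof (intro allI impI)
      fix i j assume "i < l + 2" "j < l + 2" "i \<noteq> j"
      then show "qs ! i \<noteq> qs ! j" using v[of "Suc i"] v[of "Suc j"] nth by (metis Suc_inject Suc_le_eq le_add1 plus_1_eq_Suc)
    qed
    show "set qs \<subseteq> verts G" using v by (auto simp: qs_def verts_G)
    fix i j assume ij: "i < j \<and> j < l + 2"
    \<comment> \<open>Clique positions agree modulo 3, so different ones have different quotients,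
      and the hypothesis on conflicts excludes chords.\<close>
    have d: "isT g (Suc i) \<and> isT g (Suc j) \<Longrightarrow> Suc i div 3 \<noteq> Suc j div 3" using ij unfolding isT_def by (metis Suc_inject div_mult_mod_eq less_irrefl)
    show "adj G (qs ! i) (qs ! j) \<longleftrightarrow> j = Suc i"
      using ij d v[of "Suc i"] v[of "Suc j"] x(2)[of "Suc i div 3" "Suc j div 3"] by (auto simp: nth adj_G adjp_def isT_def)
  qed
  then have "qs \<in> ipaths G (l + 2)" using len by (simp add: ipaths_def)
  moreover have "r \<le> card (legs_of G qs)"
  proof -
    have sub: "{u. u < N \<and> pos u = 0} \<subseteq> legs_of G qs"
    proof
      fix u assume u: "u \<in> {u. u < N \<and> pos u = 0}"
      have hd: "hd qs = v 1" using len nth[of 0] by (metis One_nat_def add_gr_0 hd_conv_nth length_greater_0_conv zero_less_numeral)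
      have "\<not> adj G q u" if q: "q \<in> set (tl qs)" for q
      proof -
        obtain t where "t < length (tl qs)" "q = tl qs ! t" using q by (auto simp: in_set_conv_nth)
        then have "q = v (Suc (Suc t))" "t < l + 1" using len nth by (auto simp: nth_tl)
        then show ?thesis using v[of "Suc (Suc t)"] u by (auto simp: adj_G adjp_def isT_def)
      qed
      then show "u \<in> legs_of G qs" unfolding legs_of_def hd using u v[of 1] by (auto simp: verts_G adj_G adjp_def)
    qed
    have "{..<r} \<subseteq> idx ` {u. u < N \<and> pos u = 0}"
    proof
      fix x assume "x \<in> {..<r}"
      then show "x \<in> idx ` {u. u < N \<and> pos u = 0}" using vertex_ex[of 0 x] by (auto simp: sz_def)
    qed
    then have "r \<le> card (idx ` {u. u < N \<and> pos u = 0})" using card_mono[of "idx ` {u. u < N \<and> pos u = 0}" "{..<r}"] by auto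
    also have "\<dots> \<le> card {u. u < N \<and> pos u = 0}" by (rule card_image_le) auto
    also have "\<dots> \<le> card (legs_of G qs)" by (rule card_mono[OF _ sub]) (simp add: legs_of_def verts_G)
    finally show ?thesis .
  qed
  ultimately show ?thesis by blast
qed

text \<open>The body of a scorpion has degree at least three, so it has neither position \<open>0\<close> nor \<open>l + 2\<close>, and
  only the other end of the path can have such a position. Since induced paths contain no triangles, a
  second vertex from a clique costs two neighbouring positions; hence the path meets every position from
  \<open>1\<close> to \<open>l + 1\<close> once, and it can only pass them in order.\<close>

lemma scorpion_only_if:
  assumes qs: "qs \<in> ipaths G (l + 2)" "r \<le> card (legs_of G qs)"
  shows "\<exists>x. (\<forall>i<g. x i < w) \<and> (\<forall>i<g. \<forall>j<g. i \<noteq> j \<longrightarrow> \<not> conf i (x i) j (x j))"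
proof -
  have ip: "induced_path G qs" and len: "length qs = l + 2" using qs unfolding ipaths_def by auto
  note adjq = ipath_adj[OF simple_G ip, unfolded len]
  have dist: "distinct qs" using ip by (simp add: induced_path_def)
  have qN: "qs ! i < N" if "i < l + 2" for i
  proof -
    have "qs ! i \<in> set qs" using that len by simp
    then show ?thesis using ip unfolding induced_path_def verts_G by auto
  qed
  have inj: "qs ! i = qs ! j \<longleftrightarrow> i = j" if "i < l + 2" "j < l + 2" for i j
    using dist that len by (simp add: nth_eq_iff_index_eq)
  have hd: "hd qs = qs ! 0" using len by (intro hd_conv_nth) auto
  have finL: "finite (legs_of G qs)" unfolding legs_of_def verts_G by simp
  have deg: "3 \<le> card {u. adj G (qs ! 0) u}"
  proof -
    have "qs ! 1 \<notin> legs_of G qs" using legs_disjoint[OF simple_G qs(1) l] len by auto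
    moreover have "insert (qs ! 1) (legs_of G qs) \<subseteq> {u. adj G (qs ! 0) u}"
      using adjq[of 0 1] by (auto simp: legs_of_def hd)
    moreover have "finite {u. adj G (qs ! 0) u}" by (rule finite_subset[of _ "{..<N}"]) (auto simp: adj_G)
    ultimately show ?thesis using card_mono[of "{u. adj G (qs ! 0) u}" "insert (qs ! 1) (legs_of G qs)"] qs(2) r finL by simp
  qed
  \<comment> \<open>A vertex at an extreme position sees only the adjacent position, which holds a
    single vertex.\<close>
  have ends: "\<exists>z. \<forall>v. adj G u v \<longrightarrow> v = z" if u: "u < N" "pos u = 0 \<or> pos u = l + 2" for u
  proof -
    define p where "p = (if pos u = 0 then 1 else l + 1)"
    have p: "p \<noteq> 0" "\<not> isT g p" "p \<le> l + 2" using isT_bounds[of p] by (auto simp: p_def)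
    have "\<not> isT g (pos u)" using u isT_bounds[of "pos u"] by auto
    then have n: "pos v = p" if "adj G u v" for v
      using that u pos_idx[of v] by (auto simp: adj_G adjp_def p_def split: if_splits)
    show ?thesis
    proof (cases "\<exists>z. adj G u z")
      case True
      then obtain z where z: "adj G u z" by blast
      have "v = z" if "adj G u v" for v
        by (rule single) (use n[OF that] n[OF z] that z p in \<open>auto simp: adj_G\<close>)
      then show ?thesis by blast
    qed blast
  qed
  \<comment> \<open>Nothing is claimed about the last vertex \<open>qs ! (l + 1)\<close>, which may
    lie anywhere; the first \<open>l + 1\<close> vertices suffice for the rest.\<close>
  have inner: "1 \<le> pos (qs ! i) \<and> pos (qs ! i) \<le> l + 1" if i: "i \<le> l" for i
  proof (rule ccontr)
    assume "\<not> ?thesis"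
    then have "pos (qs ! i) = 0 \<or> pos (qs ! i) = l + 2" using pos_idx[OF qN, of i] i by auto
    then obtain z where z: "\<And>v. adj G (qs ! i) v \<Longrightarrow> v = z" using ends[of "qs ! i"] qN[of i] i by auto
    show False
    proof (cases "i = 0")
      case True
      then have "{u. adj G (qs ! 0) u} \<subseteq> {z}" using z by auto
      then have "card {u. adj G (qs ! 0) u} \<le> card {z}" by (intro card_mono) auto
      then show False using deg by simp
    next
      case False
      have "qs ! (i - 1) = z" by (rule z) (use adjq[of i "i - 1"] False i in auto)
      moreover have "qs ! (i + 1) = z" by (rule z) (use adjq[of i "i + 1"] i in auto)
      ultimately have "qs ! (i - 1) = qs ! (i + 1)" by simp
      moreover have "i - 1 < l + 2" "i + 1 < l + 2" using i by linarith+
      ultimately have "i - 1 = i + 1" using inj by blast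
      then show False by simp
    qed
  qed
  have tri: "\<not> (adj G (qs ! a) (qs ! b) \<and> adj G (qs ! b) (qs ! c) \<and> adj G (qs ! a) (qs ! c))"
    if "a \<le> l" "b \<le> l" "c \<le> l" for a b c
    using adjq[of a b] adjq[of b c] adjq[of a c] that by auto
  define ps where "ps a = pos (qs ! a)" for a
  have psT: "isT g (ps a) \<Longrightarrow> ps a = ps b \<Longrightarrow> a \<noteq> b \<Longrightarrow> a \<le> l \<Longrightarrow> b \<le> l \<Longrightarrow> adj G (qs ! a) (qs ! b)" for a b
    unfolding ps_def by (rule same_T) (use qN inj in auto)
  have psS: "ps b = Suc (ps a) \<Longrightarrow> a \<le> l \<Longrightarrow> b \<le> l \<Longrightarrow> adj G (qs ! a) (qs ! b)" for a b
    unfolding ps_def by (rule consecutive) (use qN in auto)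
  have ps1: "\<not> isT g (ps a) \<Longrightarrow> ps a = ps b \<Longrightarrow> a \<le> l \<Longrightarrow> b \<le> l \<Longrightarrow> a = b" for a b
    using single[of "qs ! a" "qs ! b"] qN inner[of a] inj[of a b] unfolding ps_def by auto
  have nodouble: "ps a \<noteq> ps b" if ab: "a < b" "b \<le> l" for a b
  proof
    assume e: "ps a = ps b"
    then have T: "isT g (ps a)" using ps1[of a b] ab by auto
    have adjab: "adj G (qs ! a) (qs ! b)" using psT[OF T e] ab by auto
    \<comment> \<open>A vertex beside a clique visited twice would form a triangle with the two
      visitors.\<close>
    have no: "ps c \<noteq> ps d + 1 \<and> ps c \<noteq> ps d - 1" if "isT g (ps d)" "ps d = ps e" "d \<noteq> e" "c \<le> l" "d \<le> l" "e \<le> l" for c d e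
    proof -
      have A: "adj G (qs ! d) (qs ! e)" using psT that by auto
      have "1 \<le> ps d" using isT_bounds[OF that(1)] by auto
      then show ?thesis using psS[of c d] psS[of c e] psS[of d c] psS[of e c] tri[of d e c] tri[of c d e] that A by (auto simp: adj_commute)
    qed
    define \<phi> where "\<phi> c = (if \<exists>d<c. ps d = ps c then ps c - 1 else ps c)" for c
    have second: "isT g (ps c)" if "d < c" "ps d = ps c" "c \<le> l" for c d using ps1[of d c] that by auto
    have "inj_on \<phi> {..l}"
    proof (rule inj_onI)
      fix c c' assume c: "c \<in> {..l}" "c' \<in> {..l}" "\<phi> c = \<phi> c'"
      have same: False if "d < c" "ps d = ps c" "\<phi> c' = ps c'" "c \<le> l" "c' \<le> l" "\<phi> c = \<phi> c'" for c c' d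
      proof -
        have "\<phi> c = ps c - 1" unfolding \<phi>_def using that(1,2) by auto
        then have "ps c' = ps c - 1" using that by simp
        then have c'c: "ps c' = ps c - 1" .
        have Tc: "isT g (ps c)" using second that(1,2,4) .
        have "c \<noteq> d" "d \<le> l" using that(1,4) by auto
        then have "ps c' \<noteq> ps c - 1"
          using no[OF Tc that(2)[symmetric] _ that(5,4)] by blast
        then show False using c'c by simp
      qed
      have triple: "x = y" if "isT g (ps x)" "ps x = ps y" "x \<le> l" "y \<le> l" "d < x" "ps d = ps x" "d' < y" "ps d' = ps y" for x y d d'
      proof (rule ccontr)
        assume "x \<noteq> y"
        define d0 where "d0 = min d d'"
        have d0: "d0 < x" "d0 < y" "d0 \<le> l" "ps d0 = ps x" using that by (auto simp: d0_def min_def)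
        show False using tri[of d0 x y] psT[of d0 x] psT[of x y] psT[of d0 y] d0 that \<open>x \<noteq> y\<close> by auto
      qed
      show "c = c'"
      proof (cases "\<exists>d<c. ps d = ps c"; cases "\<exists>d<c'. ps d = ps c'")
        assume 1: "\<exists>d<c. ps d = ps c" "\<exists>d<c'. ps d = ps c'"
        then obtain d d' where d: "d < c" "ps d = ps c" "d' < c'" "ps d' = ps c'" by blast
        have T: "isT g (ps c)" "isT g (ps c')" using second d c by auto
        have "ps c - 1 = ps c' - 1" using c 1 by (simp add: \<phi>_def)
        then have "ps c = ps c'" using isT_bounds[OF T(1)] isT_bounds[OF T(2)] by auto
        then show ?thesis using triple[of c c' d d'] T d c by auto
      next
        assume 1: "\<exists>d<c. ps d = ps c" "\<not> (\<exists>d<c'. ps d = ps c')"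
        then obtain d where d: "d < c" "ps d = ps c" by blast
        have "\<phi> c' = ps c'" unfolding \<phi>_def using 1(2) by (rule if_not_P)
        then show ?thesis using same[OF d] c by blast
      next
        assume 1: "\<not> (\<exists>d<c. ps d = ps c)" "\<exists>d<c'. ps d = ps c'"
        then obtain d where d: "d < c'" "ps d = ps c'" by blast
        have "\<phi> c = ps c" unfolding \<phi>_def using 1(1) by (rule if_not_P)
        then show ?thesis using same[OF d] c(1,2) c(3)[symmetric] by blast
      next
        assume 1: "\<not> (\<exists>d<c. ps d = ps c)" "\<not> (\<exists>d<c'. ps d = ps c')"
        have "\<phi> c = ps c" unfolding \<phi>_def using 1(1) by (rule if_not_P)
        moreover have "\<phi> c' = ps c'" unfolding \<phi>_def using 1(2) by (rule if_not_P)
        ultimately have "ps c = ps c'" using c(3) by simp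
        then show ?thesis using 1 by (metis linorder_neqE_nat)
      qed
    qed
    moreover have "\<phi> ` {..l} \<subseteq> {1..l + 1} - {ps a + 1}"
    proof (rule image_subsetI)
      fix c assume c: "c \<in> {..l}"
      have P: "1 \<le> ps c" "ps c \<le> l + 1" using inner[of c] c unfolding ps_def by auto
      have n: "ps c \<noteq> ps a + 1" using no[of a b c] T e ab c by auto
      show "\<phi> c \<in> {1..l + 1} - {ps a + 1}"
      proof (cases "\<exists>d<c. ps d = ps c")
        case True
        then have "isT g (ps c)" using second c by auto
        then have "2 \<le> ps c" "ps c \<noteq> ps a + 2" using isT_bounds isT_apart[OF T] by auto
        then show ?thesis using True P by (auto simp: \<phi>_def)
      qed (use P n in \<open>auto simp: \<phi>_def\<close>)
    qed
    ultimately have "card {..l} \<le> card ({1..l + 1} - {ps a + 1})" by (metis card_inj_on_le finite_Diff finite_atLeastAtMost)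
    moreover have "card ({1..l + 1} - {ps a + 1}) = l" using isT_bounds[OF T] by (simp add: card_Diff_singleton)
    ultimately show False by simp
  qed
  have "inj_on ps {..l}" by (rule inj_onI) (metis atMost_iff linorder_neqE_nat nodouble)
  moreover have "ps ` {..l} \<subseteq> {1..l + 1}" using inner unfolding ps_def by auto
  ultimately have bij: "ps ` {..l} = {1..l + 1}" by (intro card_subset_eq) (auto simp: card_image)
  have "\<exists>\<tau>. \<forall>p. p \<le> l \<longrightarrow> \<tau> p \<le> l \<and> ps (\<tau> p) = Suc p"
  proof (rule choice, rule allI)
    fix p
    have "p \<le> l \<Longrightarrow> Suc p \<in> ps ` {..l}" unfolding bij by auto
    then show "\<exists>a. p \<le> l \<longrightarrow> a \<le> l \<and> ps a = Suc p" by fastforce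
  qed
  then obtain \<tau> where \<tau>: "\<And>p. p \<le> l \<Longrightarrow> \<tau> p \<le> l \<and> ps (\<tau> p) = Suc p" by blast
  \<comment> \<open>\<open>\<tau> p\<close> is the index on the path of the vertex at position
    \<open>p + 1\<close>. Vertices at consecutive positions are adjacent, so on an induced path
    their indices differ by one.\<close>
  have stepT: "\<bar>int (\<tau> (Suc p)) - int (\<tau> p)\<bar> = 1" if "p < l" for p
    using psS[of "\<tau> (Suc p)" "\<tau> p"] \<tau>[of p] \<tau>[of "Suc p"] that adjq[of "\<tau> p" "\<tau> (Suc p)"] by auto
  have injT: "inj_on (\<lambda>p. int (\<tau> p)) {..l}"
  proof (rule inj_onI)
    fix p p' assume p: "p \<in> {..l}" "p' \<in> {..l}" "int (\<tau> p) = int (\<tau> p')"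
    have "ps (\<tau> p) = Suc p" by (rule \<tau>[THEN conjunct2]) (use p in simp)
    moreover have "ps (\<tau> p') = Suc p'" by (rule \<tau>[THEN conjunct2]) (use p in simp)
    moreover have "\<tau> p = \<tau> p'" using p(3) by (simp only: of_nat_eq_iff)
    ultimately show "p = p'" by (metis Suc_inject)
  qed
  have lin: "int (\<tau> p) = int (\<tau> 0) + int p * (int (\<tau> 1) - int (\<tau> 0))" if "p \<le> l" for p
    by (rule unit_steps[OF stepT injT that])
  have d1: "\<bar>int (\<tau> 1) - int (\<tau> 0)\<bar> = 1" using stepT[of 0] l by simp
  define x where "x i = idx (qs ! \<tau> (3 * i + 1))" for i
  have iT: "3 * i + 1 \<le> l \<and> isT g (Suc (3 * i + 1)) \<and> Suc (3 * i + 1) div 3 = i" if "i < g" for i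
  proof -
    have "Suc (3 * i + 1) mod 3 = 2" "Suc (3 * i + 1) div 3 = i" by presburger+
    then show ?thesis using that g by (auto simp: isT_def)
  qed
  have xw: "x i < w" if "i < g" for i
  proof -
    have "pos (qs ! \<tau> (3 * i + 1)) = Suc (3 * i + 1)" "\<tau> (3 * i + 1) \<le> l" using \<tau>[of "3 * i + 1"] iT[OF that] unfolding ps_def by auto
    then show ?thesis using pos_idx[OF qN, of "\<tau> (3 * i + 1)"] iT[OF that] unfolding x_def by (simp add: sz_def)
  qed
  have xc: "\<not> conf i (x i) j (x j)" if ij: "i < g" "j < g" "i \<noteq> j" for i j
  proof
    assume c: "conf i (x i) j (x j)"
    let ?a = "\<tau> (3 * i + 1)" and ?b = "\<tau> (3 * j + 1)"
    have ab: "?a \<le> l" "?b \<le> l" "pos (qs ! ?a) = Suc (3 * i + 1)" "pos (qs ! ?b) = Suc (3 * j + 1)"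
      using \<tau> iT[OF ij(1)] iT[OF ij(2)] unfolding ps_def by auto
    have "adj G (qs ! ?a) (qs ! ?b)"
      using c ij iT[OF ij(1)] iT[OF ij(2)] ab qN unfolding x_def adj_G adjp_def by auto
    then have "\<bar>int ?a - int ?b\<bar> = 1" using adjq[of ?a ?b] ab by auto
    \<comment> \<open>The path runs linearly through the positions, so indices of clique vertices
      differ by multiples of 3 and a conflict edge would be a chord.\<close>
    moreover have "int ?a - int ?b = 3 * (int i - int j) * (int (\<tau> 1) - int (\<tau> 0))"
      using lin[of "3 * i + 1"] lin[of "3 * j + 1"] iT[OF ij(1)] iT[OF ij(2)] by (simp add: algebra_simps)
    ultimately have "3 * \<bar>int i - int j\<bar> * \<bar>int (\<tau> 1) - int (\<tau> 0)\<bar> = 1" by (simp only: abs_mult abs_numeral)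
    then have "3 * \<bar>int i - int j\<bar> = 1" unfolding d1 by simp
    then have "(3 :: int) dvd 1" by (metis dvd_triv_left)
    then show False by simp
  qed
  show ?thesis using xw xc by blast
qed

lemma scorpion_iff: "(\<exists>qs\<in>ipaths G (l + 2). r \<le> card (legs_of G qs)) \<longleftrightarrow>
    (\<exists>x. (\<forall>i<g. x i < w) \<and> (\<forall>i<g. \<forall>j<g. i \<noteq> j \<longrightarrow> \<not> conf i (x i) j (x j)))"
proof
  assume "\<exists>qs\<in>ipaths G (l + 2). r \<le> card (legs_of G qs)"
  then show "\<exists>x. (\<forall>i<g. x i < w) \<and> (\<forall>i<g. \<forall>j<g. i \<noteq> j \<longrightarrow> \<not> conf i (x i) j (x j))"
    using scorpion_only_if by blast
next
  assume "\<exists>x. (\<forall>i<g. x i < w) \<and> (\<forall>i<g. \<forall>j<g. i \<noteq> j \<longrightarrow> \<not> conf i (x i) j (x j))"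
  then obtain x where "\<And>i. i < g \<Longrightarrow> x i < w" "\<And>i j. i < g \<Longrightarrow> j < g \<Longrightarrow> i \<noteq> j \<Longrightarrow> \<not> conf i (x i) j (x j)" by blast
  then show "\<exists>qs\<in>ipaths G (l + 2). r \<le> card (legs_of G qs)" by (rule scorpion_if)
qed

end

text \<open>A vertex of clique \<open>i\<close> has an index below \<open>4 ^ q\<close>. Its \<open>q\<close> digits in base 4 choose a literal from each of
  the clauses \<open>i * q, \<dots>, i * q + q - 1\<close>.\<close>

definition lit_of :: "(nat \<Rightarrow> nat) \<Rightarrow> (nat \<Rightarrow> nat) \<Rightarrow> (nat \<Rightarrow> nat) \<Rightarrow> nat \<Rightarrow> nat \<Rightarrow> nat" where
  "lit_of L0 L1 L2 c d = (if d = 0 then L0 c else if d = 1 then L1 c else L2 c)"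

text \<open>Base 4 instead of 3, because the machine extracts digits by halving; digits 2 and 3 both
  stand for the third literal. The last groups may run out of clauses, hence the test against
  \<open>M\<close>.\<close>

definition chosen :: "nat \<Rightarrow> nat \<Rightarrow> (nat \<Rightarrow> nat) \<Rightarrow> (nat \<Rightarrow> nat) \<Rightarrow> (nat \<Rightarrow> nat) \<Rightarrow> nat \<Rightarrow> nat \<Rightarrow> nat \<Rightarrow> bool" where
  "chosen q M L0 L1 L2 i x a \<longleftrightarrow> (\<exists>j<q. i * q + j < M \<and> a = lit_of L0 L1 L2 (i * q + j) (dig 4 x j))"

text \<open>The union of both choices is inspected. So a vertex whose own choices contradict each
  other clashes with every vertex of the other cliques and cannot be selected.\<close>

definition clash :: "nat \<Rightarrow> (nat \<Rightarrow> bool) \<Rightarrow> (nat \<Rightarrow> bool) \<Rightarrow> bool" where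
  "clash n S S' \<longleftrightarrow> (\<exists>v<n. (S (2 * v) \<or> S' (2 * v)) \<and> (S (2 * v + 1) \<or> S' (2 * v + 1)))"

text \<open>Literal \<open>2 * v + 1\<close> is the variable \<open>v\<close> and
  \<open>2 * v\<close> its negation.\<close>

definition litass :: "nat \<Rightarrow> (nat \<Rightarrow> bool) set" where
  "litass n = {\<beta>. \<forall>v<n. \<beta> (2 * v) \<noteq> \<beta> (2 * v + 1)}"

lemma dig_exists: "1 \<le> b \<Longrightarrow> (\<And>j. j < q \<Longrightarrow> d j < b) \<Longrightarrow> \<exists>x<b ^ q. \<forall>j<q. dig b x j = d j"
proof -
  assume b: "1 \<le> b" "\<And>j. j < q \<Longrightarrow> d j < b"
  have "map d [0..<q] \<in> {qs. set qs \<subseteq> {..<b} \<and> length qs = q}" using b by auto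
  then have "map d [0..<q] \<in> (\<lambda>x. map (dig b x) [0..<q]) ` {..<b ^ q}"
    using bij_betw_dig[OF b(1), of q] unfolding bij_betw_def by simp
  then obtain x where "x < b ^ q" "map d [0..<q] = map (dig b x) [0..<q]" by auto
  then show ?thesis by (intro exI[of _ x]) (auto simp: map_eq_conv)
qed

lemma choices_iff:
  assumes g: "2 \<le> g" and M: "M \<le> g * q" and lits: "\<And>c. c < M \<Longrightarrow> L0 c < 2 * n \<and> L1 c < 2 * n \<and> L2 c < 2 * n"
  defines "S \<equiv> chosen q M L0 L1 L2"
  shows "(\<exists>x. (\<forall>i<g. x i < 4 ^ q) \<and> (\<forall>i<g. \<forall>j<g. i \<noteq> j \<longrightarrow> \<not> clash n (S i (x i)) (S j (x j)))) \<longleftrightarrow>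
    (\<exists>\<beta>\<in>litass n. \<forall>c<M. \<beta> (L0 c) \<or> \<beta> (L1 c) \<or> \<beta> (L2 c))"
proof
  assume "\<exists>x. (\<forall>i<g. x i < 4 ^ q) \<and> (\<forall>i<g. \<forall>j<g. i \<noteq> j \<longrightarrow> \<not> clash n (S i (x i)) (S j (x j)))"
  then obtain x where x: "\<And>i j. i < g \<Longrightarrow> j < g \<Longrightarrow> i \<noteq> j \<Longrightarrow> \<not> clash n (S i (x i)) (S j (x j))" by blast
  define C where "C a \<longleftrightarrow> (\<exists>i<g. S i (x i) a)" for a
  have cons: "\<not> (C (2 * v) \<and> C (2 * v + 1))" if v: "v < n" for v
  proof
    assume "C (2 * v) \<and> C (2 * v + 1)"
    then obtain i j where ij: "i < g" "j < g" "S i (x i) (2 * v)" "S j (x j) (2 * v + 1)" unfolding C_def by blast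
    show False
    proof (cases "i = j")
      case False
      then show False using x[of i j] ij v unfolding clash_def by blast
    next
      case True
      \<comment> \<open>A contradiction inside one group is only detected by comparison with another
        group, so there must be two of them.\<close>
      obtain j' where "j' < g" "j' \<noteq> i" using g by (metis One_nat_def Suc_1 Suc_le_eq less_le_trans zero_less_one zero_neq_one zero_less_Suc)
      then show False using x[of i j'] ij True v unfolding clash_def by blast
    qed
  qed
  \<comment> \<open>A variable none of whose literals is chosen becomes true.\<close>
  define \<beta> where "\<beta> a \<longleftrightarrow> (if even a then C a else \<not> C (a - 1))" for a
  have "\<beta> \<in> litass n" unfolding litass_def \<beta>_def by auto
  moreover have C\<beta>: "\<beta> a" if "C a" "a < 2 * n" for a
  proof (cases "even a")
    case False
    then obtain v where "a = 2 * v + 1" using oddE by blast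
    then show ?thesis using cons[of v] that by (auto simp: \<beta>_def)
  qed (use that in \<open>simp add: \<beta>_def\<close>)
  have "\<beta> (L0 c) \<or> \<beta> (L1 c) \<or> \<beta> (L2 c)" if c: "c < M" for c
  proof -
    have q0: "0 < q" using M c by (cases q) auto
    have "c div q < g" using M c q0 by (simp add: less_mult_imp_div_less)
    moreover have "c div q * q + c mod q = c" by simp
    ultimately have "C (lit_of L0 L1 L2 c (dig 4 (x (c div q)) (c mod q)))"
      unfolding C_def S_def chosen_def using c q0 by (metis mod_less_divisor)
    moreover have "lit_of L0 L1 L2 c d < 2 * n" for d using lits[OF c] by (simp add: lit_of_def)
    ultimately have "\<beta> (lit_of L0 L1 L2 c (dig 4 (x (c div q)) (c mod q)))" using C\<beta> by blast
    then show ?thesis by (auto simp: lit_of_def split: if_splits)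
  qed
  ultimately show "\<exists>\<beta>\<in>litass n. \<forall>c<M. \<beta> (L0 c) \<or> \<beta> (L1 c) \<or> \<beta> (L2 c)" by blast
next
  assume "\<exists>\<beta>\<in>litass n. \<forall>c<M. \<beta> (L0 c) \<or> \<beta> (L1 c) \<or> \<beta> (L2 c)"
  then obtain \<beta> where \<beta>: "\<beta> \<in> litass n" "\<And>c. c < M \<Longrightarrow> \<beta> (L0 c) \<or> \<beta> (L1 c) \<or> \<beta> (L2 c)" by blast
  \<comment> \<open>The digit of the first satisfied literal of the clause.\<close>
  define d where "d c = (if \<beta> (L0 c) then 0 else if \<beta> (L1 c) then 1 else (2 :: nat))" for c
  have "\<exists>x. \<forall>i. x i < 4 ^ q \<and> (\<forall>j<q. dig 4 (x i) j = d (i * q + j))"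
    by (rule choice, rule allI, rule dig_exists) (auto simp: d_def)
  then obtain x where x: "\<And>i. x i < 4 ^ q" "\<And>i j. j < q \<Longrightarrow> dig 4 (x i) j = d (i * q + j)" by blast
  have true: "\<beta> a" if S: "S i (x i) a" for i a
  proof -
    obtain j where j: "j < q" "i * q + j < M" "a = lit_of L0 L1 L2 (i * q + j) (dig 4 (x i) j)"
      using S unfolding S_def chosen_def by blast
    then show ?thesis using \<beta>(2)[OF j(2)] by (auto simp: lit_of_def x(2) d_def split: if_splits)
  qed
  have "\<not> clash n (S i (x i)) (S j (x j))" for i j
  proof
    assume "clash n (S i (x i)) (S j (x j))"
    then obtain v where "v < n" "\<beta> (2 * v)" "\<beta> (2 * v + 1)" unfolding clash_def using true by blast
    then show False using \<beta>(1) unfolding litass_def by blast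
  qed
  then show "\<exists>x. (\<forall>i<g. x i < 4 ^ q) \<and> (\<forall>i<g. \<forall>j<g. i \<noteq> j \<longrightarrow> \<not> clash n (S i (x i)) (S j (x j)))"
    using x(1) by blast
qed

definition formula_graph :: "nat \<Rightarrow> nat \<Rightarrow> nat \<Rightarrow> nat \<Rightarrow> (nat \<Rightarrow> nat) \<Rightarrow> (nat \<Rightarrow> nat) \<Rightarrow> (nat \<Rightarrow> nat) \<Rightarrow> nat \<Rightarrow> (nat \<Rightarrow> nat) \<Rightarrow> (nat \<Rightarrow> nat) \<Rightarrow> nat graph" where
  "formula_graph n g q M L0 L1 L2 N pos idx =
    red_graph g (\<lambda>i x j y. clash n (chosen q M L0 L1 L2 i x) (chosen q M L0 L1 L2 j y)) N pos idx"

theorem formula_graph_correct: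
  assumes lk: "1 \<le> l" "l + 4 \<le> k" "f k = l" and gl: "3 * g \<le> l + 1" "2 \<le> g" and M: "M \<le> g * q"
    and lits: "\<And>c. c < M \<Longrightarrow> L0 c < 2 * n \<and> L1 c < 2 * n \<and> L2 c < 2 * n"
    and lay: "layout l g (k - l - 2) (4 ^ q) N pos idx"
  defines "G \<equiv> formula_graph n g q M L0 L1 L2 N pos idx"
  shows "simple_graph G" "verts G = {..<N}"
    "num_IndSub (Psi f) G k > 0 \<longleftrightarrow> (\<exists>\<beta>\<in>litass n. \<forall>c<M. \<beta> (L0 c) \<or> \<beta> (L1 c) \<or> \<beta> (L2 c))"
proof -
  let ?conf = "\<lambda>i x j y. clash n (chosen q M L0 L1 L2 i x) (chosen q M L0 L1 L2 j y)"
  interpret reduction l g "k - l - 2" "4 ^ q" N ?conf pos idx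
    by unfold_locales (use lk gl lay in \<open>auto simp: clash_def\<close>)
  show 1: "simple_graph G" "verts G = {..<N}" unfolding G_def formula_graph_def by (rule simple_G, rule verts_G)
  have "num_IndSub (Psi f) G k > 0 \<longleftrightarrow> (\<exists>qs\<in>ipaths G (l + 2). k - l - 2 \<le> card (legs_of G qs))"
    by (rule num_IndSub_Psi_pos[of G f k l, OF 1(1) lk(3,1,2)])
  also have "\<dots> \<longleftrightarrow> (\<exists>x. (\<forall>i<g. x i < 4 ^ q) \<and> (\<forall>i<g. \<forall>j<g. i \<noteq> j \<longrightarrow> \<not> ?conf i (x i) j (x j)))"
    unfolding G_def formula_graph_def by (rule scorpion_iff)
  also have "\<dots> \<longleftrightarrow> (\<exists>\<beta>\<in>litass n. \<forall>c<M. \<beta> (L0 c) \<or> \<beta> (L1 c) \<or> \<beta> (L2 c))"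
    by (rule choices_iff[OF gl(2) M lits])
  finally show "num_IndSub (Psi f) G k > 0 \<longleftrightarrow> (\<exists>\<beta>\<in>litass n. \<forall>c<M. \<beta> (L0 c) \<or> \<beta> (L1 c) \<or> \<beta> (L2 c))" .
qed

section \<open>Deciding satisfiability with an algorithm for scorpions\<close>

definition agr :: "nat set \<Rightarrow> st \<Rightarrow> st \<Rightarrow> bool" where
  "agr M s s' \<longleftrightarrow> (\<forall>j. j \<notin> M \<longrightarrow> s' j = s j)"

lemma agr_refl [simp]: "agr M s s"
  by (simp add: agr_def)

lemma agr_trans: "agr M s s' \<Longrightarrow> agr M s' s'' \<Longrightarrow> agr M s s''"
  by (simp add: agr_def)

lemma agr_mono: "agr M s s' \<Longrightarrow> M \<subseteq> M' \<Longrightarrow> agr M' s s'"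
  by (auto simp: agr_def)

lemma agr_upd [simp]: "x \<in> M \<Longrightarrow> agr M s (s'(x := a)) \<longleftrightarrow> agr M s s'"
  by (auto simp: agr_def)

lemma agrD: "agr M s s' \<Longrightarrow> j \<notin> M \<Longrightarrow> s' j = s j"
  by (simp add: agr_def)

lemma run_agr: "run c s T Q \<Longrightarrow> mods c \<subseteq> M \<Longrightarrow> run c s T (\<lambda>s'. Q s' \<and> agr M s s')"
  by (drule run_frame) (auto simp: agr_def elim!: run_mono)

text \<open>The frame condition relative to the start takes over all bookkeeping of unchanged
  arrays, so an invariant only describes what the loop produces. It must not depend on the counter
  cell itself, which \<open>stable\<close> expresses.\<close>

lemma run_for:
  assumes M: "x \<in> M" "mods c \<subseteq> M" and e: "\<And>s. agr M s0 s \<Longrightarrow> wval e s = n"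
    and I0: "I 0 (put s0 x 0 0)"
    and step: "\<And>i s. i < n \<Longrightarrow> agr M s0 s \<Longrightarrow> s x 0 = i \<Longrightarrow> I i s \<Longrightarrow> run c s T (\<lambda>s'. s' x 0 = i \<and> I (Suc i) s')"
    and stable: "\<And>i s v. I i s \<Longrightarrow> I i (put s x 0 v)"
  shows "run (For x e c) s0 (n * (T + 2) + 2) (\<lambda>s. agr M s0 s \<and> I n s)"
proof (rule run_For[where n = n and T = T and I = "\<lambda>i s. agr M s0 s \<and> I i s"])
  fix i s assume i: "i < n" "agr M s0 s \<and> I i s" "s x 0 = i"
  have "run c s T (\<lambda>s'. (s' x 0 = i \<and> I (Suc i) s') \<and> agr M s s')"
    by (rule run_agr[OF step]) (use i M in auto)
  then show "run c s T (\<lambda>s'. s' x 0 = i \<and> wval e (put s' x 0 (Suc i)) = n \<and>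
      agr M s0 (put s' x 0 (Suc i)) \<and> I (Suc i) (put s' x 0 (Suc i)))"
  proof (rule run_mono)
    fix s' assume s': "(s' x 0 = i \<and> I (Suc i) s') \<and> agr M s s'"
    then have "agr M s0 (put s' x 0 (Suc i))" using i M agr_trans[of M s0 s s'] by simp
    then show "s' x 0 = i \<and> wval e (put s' x 0 (Suc i)) = n \<and> agr M s0 (put s' x 0 (Suc i)) \<and> I (Suc i) (put s' x 0 (Suc i))"
      using s' e stable by blast
  qed simp
qed (use M e I0 in auto)

text \<open>The pending states of the branching process form a queue with the indices from \<open>xHead\<close> to
  \<open>xTail - 1\<close>. Item \<open>j\<close> has its units \<open>U a\<close> in \<open>yU\<close> at \<open>j * A + a\<close> and its pairs \<open>P a b\<close> in \<open>yP\<close> at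
  \<open>j * A * A + a * A + b\<close>. As the machine cannot multiply, the registers \<open>xHU\<close>, \<open>xHP\<close>, \<open>xTU\<close>, \<open>xTP\<close>
  and the tables \<open>yR\<close>, \<open>yRR\<close> provide the products.\<close>

abbreviation (input) "xN \<equiv> 40 :: nat"
abbreviation (input) "xA \<equiv> 41 :: nat"
abbreviation (input) "xCl \<equiv> 42 :: nat"
abbreviation (input) "yR \<equiv> 43 :: nat"
abbreviation (input) "yRR \<equiv> 44 :: nat"
abbreviation (input) "yE \<equiv> 45 :: nat"
abbreviation (input) "yL \<equiv> 46 :: nat"
abbreviation (input) "yU \<equiv> 47 :: nat"
abbreviation (input) "yP \<equiv> 48 :: nat"
abbreviation (input) "xHU \<equiv> 49 :: nat"
abbreviation (input) "xHP \<equiv> 50 :: nat"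
abbreviation (input) "xTU \<equiv> 51 :: nat"
abbreviation (input) "xTP \<equiv> 52 :: nat"
abbreviation (input) "xHead \<equiv> 53 :: nat"
abbreviation (input) "xTail \<equiv> 54 :: nat"
abbreviation (input) "xFound \<equiv> 55 :: nat"
abbreviation (input) "xTyp \<equiv> 56 :: nat"
abbreviation (input) "xHa \<equiv> 57 :: nat"
abbreviation (input) "xHb \<equiv> 58 :: nat"
abbreviation (input) "xCnt \<equiv> 59 :: nat"
abbreviation (input) "xI \<equiv> 60 :: nat"
abbreviation (input) "xJ \<equiv> 61 :: nat"
abbreviation (input) "xC \<equiv> 62 :: nat"
abbreviation (input) "xAA \<equiv> 63 :: nat"

definition uE :: "wexp \<Rightarrow> wexp" where
  "uE a = Rd yU (Pl (V xHU) a)"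

definition pE :: "wexp \<Rightarrow> wexp \<Rightarrow> wexp" where
  "pE a b = Rd yP (Pl (V xHP) (Pl (Rd yR a) b))"

definition pactE :: "wexp \<Rightarrow> wexp \<Rightarrow> wexp" where
  "pactE a b = w_and (pE a b) (w_not (Pl (uE a) (uE b)))"

definition eactE :: "wexp \<Rightarrow> wexp \<Rightarrow> wexp \<Rightarrow> wexp" where
  "eactE a b c = w_and (Rd yE (Pl (Rd yRR a) (Pl (Rd yR b) c)))
     (w_not (Pl (Pl (uE a) (Pl (uE b) (uE c))) (Pl (pE a b) (Pl (pE b c) (pE a c)))))"

definition tables :: "nat \<Rightarrow> (nat \<Rightarrow> nat \<Rightarrow> nat \<Rightarrow> bool) \<Rightarrow> st \<Rightarrow> bool" where
  "tables A E s \<longleftrightarrow> s xA 0 = A \<and> s xAA 0 = A * A \<and> (\<forall>a<A. s yR a = a * A) \<and> (\<forall>a<A. s yRR a = a * A * A) \<and>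
     (\<forall>a<A. \<forall>b<A. \<forall>c<A. s yE (a * A * A + (b * A + c)) \<noteq> 0 \<longleftrightarrow> E a b c)"

text \<open>Truth is coded by any nonzero value, since new items store sums of flags.\<close>

definition item :: "nat \<Rightarrow> st \<Rightarrow> nat \<Rightarrow> (nat \<Rightarrow> bool) \<Rightarrow> (nat \<Rightarrow> nat \<Rightarrow> bool) \<Rightarrow> bool" where
  "item A s j U P \<longleftrightarrow> (\<forall>a<A. s yU (j * A + a) \<noteq> 0 \<longleftrightarrow> U a) \<and>
     (\<forall>a<A. \<forall>b<A. s yP (j * (A * A) + (a * A + b)) \<noteq> 0 \<longleftrightarrow> P a b)"

definition view :: "nat \<Rightarrow> (nat \<Rightarrow> nat \<Rightarrow> nat \<Rightarrow> bool) \<Rightarrow> (nat \<Rightarrow> bool) \<Rightarrow> (nat \<Rightarrow> nat \<Rightarrow> bool) \<Rightarrow> nat \<Rightarrow> st \<Rightarrow> bool" where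
  "view A E U P h s \<longleftrightarrow> tables A E s \<and> s xHU 0 = h * A \<and> s xHP 0 = h * (A * A) \<and> item A s h U P"

lemma view_agr: "view A E U P h s \<Longrightarrow> agr M s s' \<Longrightarrow> M \<inter> {xA, xAA, yR, yRR, yE, yU, yP, xHU, xHP} = {} \<Longrightarrow> view A E U P h s'"
  unfolding view_def tables_def item_def agr_def by auto

lemma view_uE: "view A E U P h s \<Longrightarrow> wval a s < A \<Longrightarrow> wval (uE a) s \<noteq> 0 \<longleftrightarrow> U (wval a s)"
  by (simp add: view_def item_def uE_def)

lemma view_pE: "view A E U P h s \<Longrightarrow> wval a s < A \<Longrightarrow> wval b s < A \<Longrightarrow> wval (pE a b) s \<noteq> 0 \<longleftrightarrow> P (wval a s) (wval b s)"
  by (simp add: view_def item_def pE_def tables_def)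

lemma view_pactE: "view A E U P h s \<Longrightarrow> wval a s < A \<Longrightarrow> wval b s < A \<Longrightarrow>
    wval (pactE a b) s \<noteq> 0 \<longleftrightarrow> pact U P (wval a s) (wval b s)"
  using view_uE[of A E U P h s a] view_uE[of A E U P h s b] view_pE[of A E U P h s a b]
  by (auto simp: pactE_def pact_def)

lemma view_eactE: "view A E U P h s \<Longrightarrow> wval a s < A \<Longrightarrow> wval b s < A \<Longrightarrow> wval c s < A \<Longrightarrow>
    wval (eactE a b c) s \<noteq> 0 \<longleftrightarrow> eact E U P (wval a s) (wval b s) (wval c s)"
proof -
  assume v: "view A E U P h s" and lt: "wval a s < A" "wval b s < A" "wval c s < A"
  have "wval (Rd yE (Pl (Rd yRR a) (Pl (Rd yR b) c))) s \<noteq> 0 \<longleftrightarrow> E (wval a s) (wval b s) (wval c s)"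
    using v lt by (simp add: view_def tables_def)
  then show ?thesis
    unfolding eactE_def eact_def wval_and wval_not wval.simps(3) add_is_0
    using view_uE[OF v lt(1)] view_uE[OF v lt(2)] view_uE[OF v lt(3)] view_pE[OF v lt(1,2)] view_pE[OF v lt(2,3)] view_pE[OF v lt(1,3)]
    by (simp only: one_neq_zero if_False if_True simp_thms split: if_split) argo
qed

lemma run_for_sum:
  assumes M: "x \<in> M" "mods c \<subseteq> M" "x \<noteq> y" and e: "\<And>s. agr M s0 s \<Longrightarrow> wval e s = n"
    and step: "\<And>i s. i < n \<Longrightarrow> agr M s0 s \<Longrightarrow> s x 0 = i \<Longrightarrow> run c s T (\<lambda>s'. s' x 0 = i \<and> s' y 0 = s y 0 + f i)"
  shows "run (For x e c) s0 (n * (T + 2) + 2) (\<lambda>s. agr M s0 s \<and> s y 0 = s0 y 0 + (\<Sum>i<n. f i))"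
proof (rule run_for[OF M(1,2) e])
  fix i s assume "i < n" "agr M s0 s" "s x 0 = i" "s y 0 = s0 y 0 + (\<Sum>i<i. f i)"
  then show "run c s T (\<lambda>s'. s' x 0 = i \<and> s' y 0 = s0 y 0 + (\<Sum>i<Suc i. f i))"
    by (intro run_mono[OF step]) auto
qed (use M in auto)

lemma run_for_count:
  assumes M: "x \<in> M" "y \<in> M" "x \<noteq> y" and e: "\<And>s. agr M s0 s \<Longrightarrow> wval e s = n"
    and step: "\<And>i s. i < n \<Longrightarrow> agr M s0 s \<Longrightarrow> s x 0 = i \<Longrightarrow> wval b s \<noteq> 0 \<longleftrightarrow> R i"
  shows "run (For x e (IfC b (incr y) Skp)) s0 (n * 4 + 2) (\<lambda>s. agr M s0 s \<and> s y 0 = s0 y 0 + card {i. i < n \<and> R i})"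
proof -
  have "run (For x e (IfC b (incr y) Skp)) s0 (n * (2 + 2) + 2) (\<lambda>s. agr M s0 s \<and> s y 0 = s0 y 0 + (\<Sum>i<n. if R i then 1 else 0))"
  proof (rule run_for_sum[OF M(1) _ M(3) e])
    fix i s assume "i < n" "agr M s0 s" "s x 0 = i"
    then show "run (IfC b (incr y) Skp) s 2 (\<lambda>s'. s' x 0 = i \<and> s' y 0 = s y 0 + (if R i then 1 else 0))"
      using step[of i s] M(3) by auto
  qed (use M in auto)
  moreover have "(\<Sum>i<n. if R i then 1 else 0) = card {i. i < n \<and> R i}"
    by (simp add: sum.If_cases Int_def)
  ultimately show ?thesis by simp
qed

subsection \<open>Choosing a branch\<close>

text \<open>The searches do not stop at a hit but keep the last one; polynomial factors do not
  matter beside the exponential number of states.\<close>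

definition find1 :: "nat \<Rightarrow> wcom" where
  "find1 th = For xI (V xA) (xCnt ::= Cn 0 ;; For xJ (V xA) (IfC (pactE (V xI) (V xJ)) (incr xCnt) Skp) ;;
     IfC (w_not (Mi (Cn th) (V xCnt))) (xTyp ::= Cn 1 ;; xHa ::= V xI) Skp)"

definition find2 :: "nat \<Rightarrow> wcom" where
  "find2 th = For xI (V xA) (For xJ (V xA) (xCnt ::= Cn 0 ;; For xC (V xA) (IfC (eactE (V xI) (V xJ) (V xC)) (incr xCnt) Skp) ;;
     IfC (w_not (Mi (Cn th) (V xCnt))) (xTyp ::= Cn 2 ;; xHa ::= V xI ;; xHb ::= V xJ) Skp))"

definition find3 :: "nat \<Rightarrow> wcom" where
  "find3 d = For xI (V xA) (xCnt ::= Cn 0 ;; For xJ (V xA) (For xC (V xA) (IfC (eactE (V xI) (V xJ) (V xC)) (incr xCnt) Skp)) ;;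
     IfC (w_not (Mi (Cn d) (V xCnt))) (xTyp ::= Cn 3 ;; xHa ::= V xI) Skp)"

text \<open>Each search is run only after the previous ones failed, which yields the side conditions
  in \<open>branch\<close>; failure of all three gives a leaf.\<close>

definition find_com :: "nat \<Rightarrow> wcom" where
  "find_com th = xTyp ::= Cn 0 ;; xHa ::= Cn 0 ;; xHb ::= Cn 0 ;; find1 th ;;
     IfC (V xTyp) Skp (find2 th ;; IfC (V xTyp) Skp (find3 (4 * th * th)))"

abbreviation (input) "findM \<equiv> {xTyp, xHa, xHb, xCnt, xI, xJ, xC}"

lemma mods_find1 [simp]: "mods (find1 th) = {xI, xCnt, xJ, xTyp, xHa}" by (auto simp: find1_def)
lemma mods_find2 [simp]: "mods (find2 th) = {xI, xCnt, xJ, xC, xTyp, xHa, xHb}" by (auto simp: find2_def)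
lemma mods_find3 [simp]: "mods (find3 th) = {xI, xCnt, xJ, xC, xTyp, xHa}" by (auto simp: find3_def)

lemma mods_find_com [simp]: "mods (find_com th) = findM" by (auto simp: find_com_def)

lemma run_find1:
  assumes v: "view A E U P h s0" and t: "s0 xTyp 0 = 0" and A: "s0 xHa 0 < A"
  shows "run (find1 th) s0 (A * (A * 4 + 8) + 2) (\<lambda>s. s xHa 0 < A \<and>
    (s xTyp 0 = 0 \<and> (\<forall>a<A. card {b. b < A \<and> pact U P a b} < th) \<or>
     s xTyp 0 = 1 \<and> th \<le> card {b. b < A \<and> pact U P (s xHa 0) b}))"
proof -
  define I where "I i s \<longleftrightarrow> s xHa 0 < A \<and> (s xTyp 0 = 0 \<and> (\<forall>a<i. card {b. b < A \<and> pact U P a b} < th) \<or>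
     s xTyp 0 = 1 \<and> th \<le> card {b. b < A \<and> pact U P (s xHa 0) b})" for i and s :: st
  let ?M = "{xI, xCnt, xJ, xTyp, xHa}"
  have xA: "s xA 0 = A" if "agr ?M s0 s" for s
    using v that unfolding view_def tables_def agr_def by auto
  have "run (find1 th) s0 (A * ((1 + ((A * 4 + 2) + 3)) + 2) + 2) (\<lambda>s. agr ?M s0 s \<and> I A s)"
    unfolding find1_def
  proof (rule run_for)
    fix i s assume i: "i < A" "agr ?M s0 s" "s xI 0 = i" "I i s"
    let ?s = "put s xCnt 0 0"
    have vs: "view A E U P h ?s" by (rule view_agr[OF v, of ?M]) (use i in auto)
    have "run (For xJ (V xA) (IfC (pactE (V xI) (V xJ)) (incr xCnt) Skp)) ?s (A * 4 + 2)
       (\<lambda>s'. agr {xJ, xCnt} ?s s' \<and> s' xCnt 0 = ?s xCnt 0 + card {b. b < A \<and> pact U P i b})"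
    proof (rule run_for_count)
      fix j s' assume j: "j < A" "agr {xJ, xCnt} ?s s'" "s' xJ 0 = j"
      have "view A E U P h s'" by (rule view_agr[OF vs j(2)]) auto
      moreover have "s' xI 0 = i" using agrD[OF j(2), of xI] i by simp
      ultimately show "wval (pactE (V xI) (V xJ)) s' \<noteq> 0 \<longleftrightarrow> pact U P i j"
        using view_pactE[of A E U P h s' "V xI" "V xJ"] i j by simp
    next
      fix s' assume "agr {xJ, xCnt} ?s s'"
      from agrD[OF this, of xA] show "wval (V xA) s' = A" using xA[OF i(2)] by simp
    qed auto
    then have "run (For xJ (V xA) (IfC (pactE (V xI) (V xJ)) (incr xCnt) Skp) ;;
        IfC (w_not (Mi (Cn th) (V xCnt))) (xTyp ::= Cn 1 ;; xHa ::= V xI) Skp) ?s ((A * 4 + 2) + 3)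
        (\<lambda>s'. s' xI 0 = i \<and> I (Suc i) s')"
    proof (intro run_Sq, elim run_mono)
      fix s' assume s': "agr {xJ, xCnt} ?s s' \<and> s' xCnt 0 = ?s xCnt 0 + card {b. b < A \<and> pact U P i b}"
      then have e: "s' xI 0 = i" "s' xHa 0 = s xHa 0" "s' xTyp 0 = s xTyp 0" "s' xCnt 0 = card {b. b < A \<and> pact U P i b}"
        using i by (auto simp: agr_def)
      show "run (IfC (w_not (Mi (Cn th) (V xCnt))) (xTyp ::= Cn 1 ;; xHa ::= V xI) Skp) s' 3 (\<lambda>s'. s' xI 0 = i \<and> I (Suc i) s')"
        using i(1,4) e unfolding I_def by (auto simp: less_Suc_eq not_less)
    qed simp
    then show "run (xCnt ::= Cn 0 ;; For xJ (V xA) (IfC (pactE (V xI) (V xJ)) (incr xCnt) Skp) ;;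
        IfC (w_not (Mi (Cn th) (V xCnt))) (xTyp ::= Cn 1 ;; xHa ::= V xI) Skp) s (1 + ((A * 4 + 2) + 3))
        (\<lambda>s'. s' xI 0 = i \<and> I (Suc i) s')" by simp
  qed (use xA t A in \<open>auto simp: I_def\<close>)
  then show ?thesis by (rule run_mono) (auto simp: I_def)
qed

lemma run_find2:
  assumes v: "view A E U P h s0" and t: "s0 xTyp 0 = 0" and A: "s0 xHa 0 < A" "s0 xHb 0 < A"
  shows "run (find2 th) s0 (A * ((A * (A * 4 + 9) + 2) + 2) + 2) (\<lambda>s. s xHa 0 < A \<and> s xHb 0 < A \<and>
    (s xTyp 0 = 0 \<and> (\<forall>a<A. \<forall>b<A. card {c. c < A \<and> eact E U P a b c} < th) \<or>
     s xTyp 0 = 2 \<and> th \<le> card {c. c < A \<and> eact E U P (s xHa 0) (s xHb 0) c}))"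
proof -
  let ?hit = "\<lambda>s. s xTyp 0 = 2 \<and> th \<le> card {c. c < A \<and> eact E U P (s xHa 0) (s xHb 0) c}"
  define J where "J i j s \<longleftrightarrow> s xHa 0 < A \<and> s xHb 0 < A \<and> (s xTyp 0 = 0 \<and> (\<forall>a<i. \<forall>b<A. card {c. c < A \<and> eact E U P a b c} < th) \<and>
     (\<forall>b<j. card {c. c < A \<and> eact E U P i b c} < th) \<or> ?hit s)" for i j and s :: st
  define I where "I i s \<longleftrightarrow> s xHa 0 < A \<and> s xHb 0 < A \<and> (s xTyp 0 = 0 \<and> (\<forall>a<i. \<forall>b<A. card {c. c < A \<and> eact E U P a b c} < th) \<or> ?hit s)" for i and s :: st
  let ?M = "{xI, xCnt, xJ, xC, xTyp, xHa, xHb}"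
  let ?M' = "{xCnt, xJ, xC, xTyp, xHa, xHb}"
  have xA: "s xA 0 = A" if "agr ?M s0 s" for s
    using v that unfolding view_def tables_def agr_def by auto
  let ?b3 = "IfC (w_not (Mi (Cn th) (V xCnt))) (xTyp ::= Cn 2 ;; xHa ::= V xI ;; xHb ::= V xJ) Skp"
  let ?b2 = "For xC (V xA) (IfC (eactE (V xI) (V xJ) (V xC)) (incr xCnt) Skp)"
  have "run (find2 th) s0 (A * ((A * ((1 + ((A * 4 + 2) + 4)) + 2) + 2) + 2) + 2) (\<lambda>s. agr ?M s0 s \<and> I A s)"
    unfolding find2_def
  proof (rule run_for)
    fix i s assume i: "i < A" "agr ?M s0 s" "s xI 0 = i" "I i s"
    have "run (For xJ (V xA) (xCnt ::= Cn 0 ;; ?b2 ;; ?b3)) s (A * ((1 + ((A * 4 + 2) + 4)) + 2) + 2) (\<lambda>s'. agr ?M' s s' \<and> J i A s')"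
    proof (rule run_for)
      fix j s1 assume j: "j < A" "agr ?M' s s1" "s1 xJ 0 = j" "J i j s1"
      have a1: "agr ?M s0 s1" by (rule agr_trans[OF i(2) agr_mono[OF j(2)]]) auto
      have i1: "s1 xI 0 = i" using agrD[OF j(2), of xI] i by simp
      let ?s = "put s1 xCnt 0 0"
      have vs: "view A E U P h ?s" by (rule view_agr[OF v, of ?M]) (use a1 in auto)
      have "run ?b2 ?s (A * 4 + 2) (\<lambda>s'. agr {xC, xCnt} ?s s' \<and> s' xCnt 0 = ?s xCnt 0 + card {c. c < A \<and> eact E U P i j c})"
      proof (rule run_for_count)
        fix c s' assume c: "c < A" "agr {xC, xCnt} ?s s'" "s' xC 0 = c"
        have "view A E U P h s'" by (rule view_agr[OF vs c(2)]) auto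
        moreover have "s' xI 0 = i" "s' xJ 0 = j" using agrD[OF c(2), of xI] agrD[OF c(2), of xJ] i1 j by auto
        ultimately show "wval (eactE (V xI) (V xJ) (V xC)) s' \<noteq> 0 \<longleftrightarrow> eact E U P i j c"
          using view_eactE[of A E U P h s' "V xI" "V xJ" "V xC"] i j c by simp
      next
        fix s' assume "agr {xC, xCnt} ?s s'"
        from agrD[OF this, of xA] show "wval (V xA) s' = A" using xA[OF a1] by simp
      qed auto
      then have "run (?b2 ;; ?b3) ?s ((A * 4 + 2) + 4) (\<lambda>s'. s' xJ 0 = j \<and> J i (Suc j) s')"
      proof (intro run_Sq, elim run_mono)
        fix s' assume s': "agr {xC, xCnt} ?s s' \<and> s' xCnt 0 = ?s xCnt 0 + card {c. c < A \<and> eact E U P i j c}"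
        then have e: "s' xI 0 = i" "s' xJ 0 = j" "s' xHa 0 = s1 xHa 0" "s' xHb 0 = s1 xHb 0" "s' xTyp 0 = s1 xTyp 0"
            "s' xCnt 0 = card {c. c < A \<and> eact E U P i j c}"
          using i1 j by (auto simp: agr_def)
        show "run ?b3 s' 4 (\<lambda>s'. s' xJ 0 = j \<and> J i (Suc j) s')"
          using i(1) j(1,4) e unfolding J_def by (auto simp: less_Suc_eq not_less)
      qed simp
      then show "run (xCnt ::= Cn 0 ;; ?b2 ;; ?b3) s1 (1 + ((A * 4 + 2) + 4)) (\<lambda>s'. s' xJ 0 = j \<and> J i (Suc j) s')" by simp
    next
      fix s' assume "agr ?M' s s'"
      from agrD[OF this, of xA] show "wval (V xA) s' = A" using xA[OF i(2)] by simp
    qed (use i in \<open>auto simp: J_def I_def\<close>)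
    then show "run (For xJ (V xA) (xCnt ::= Cn 0 ;; ?b2 ;; ?b3)) s (A * ((1 + ((A * 4 + 2) + 4)) + 2) + 2) (\<lambda>s'. s' xI 0 = i \<and> I (Suc i) s')"
      by (rule run_mono) (use i in \<open>auto simp: J_def I_def less_Suc_eq agr_def\<close>)
  qed (use xA t A in \<open>auto simp: I_def\<close>)
  then show ?thesis by (rule run_mono) (auto simp: I_def)
qed

lemma run_find3:
  assumes v: "view A E U P h s0" and t: "s0 xTyp 0 = 0" and A: "s0 xHa 0 < A"
  shows "run (find3 d) s0 (A * ((A * (A * 4 + 4) + 2) + 6) + 2) (\<lambda>s. s xHa 0 < A \<and>
    (s xTyp 0 = 0 \<and> (\<forall>a<A. card {(b, c). b < A \<and> c < A \<and> eact E U P a b c} < d) \<or>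
     s xTyp 0 = 3 \<and> d \<le> card {(b, c). b < A \<and> c < A \<and> eact E U P (s xHa 0) b c}))"
proof -
  define I where "I i s \<longleftrightarrow> s xHa 0 < A \<and> (s xTyp 0 = 0 \<and> (\<forall>a<i. card {(b, c). b < A \<and> c < A \<and> eact E U P a b c} < d) \<or>
     s xTyp 0 = 3 \<and> d \<le> card {(b, c). b < A \<and> c < A \<and> eact E U P (s xHa 0) b c})" for i and s :: st
  let ?M = "{xI, xCnt, xJ, xC, xTyp, xHa}"
  have xA: "s xA 0 = A" if "agr ?M s0 s" for s
    using v that unfolding view_def tables_def agr_def by auto
  let ?b3 = "IfC (w_not (Mi (Cn d) (V xCnt))) (xTyp ::= Cn 3 ;; xHa ::= V xI) Skp"
  let ?b2 = "For xC (V xA) (IfC (eactE (V xI) (V xJ) (V xC)) (incr xCnt) Skp)"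
  have "run (find3 d) s0 (A * ((1 + ((A * ((A * 4 + 2) + 2) + 2) + 3)) + 2) + 2) (\<lambda>s. agr ?M s0 s \<and> I A s)"
    unfolding find3_def
  proof (rule run_for)
    fix i s assume i: "i < A" "agr ?M s0 s" "s xI 0 = i" "I i s"
    let ?s = "put s xCnt 0 0"
    have vs: "view A E U P h ?s" by (rule view_agr[OF v, of ?M]) (use i in auto)
    have "run (For xJ (V xA) ?b2) ?s (A * ((A * 4 + 2) + 2) + 2)
       (\<lambda>s'. agr {xJ, xC, xCnt} ?s s' \<and> s' xCnt 0 = ?s xCnt 0 + (\<Sum>j<A. card {c. c < A \<and> eact E U P i j c}))"
    proof (rule run_for_sum)
      fix j s1 assume j: "j < A" "agr {xJ, xC, xCnt} ?s s1" "s1 xJ 0 = j"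
      have v1: "view A E U P h s1" by (rule view_agr[OF vs j(2)]) auto
      have i1: "s1 xI 0 = i" using agrD[OF j(2), of xI] i by simp
      have "run ?b2 s1 (A * 4 + 2) (\<lambda>s'. agr {xC, xCnt} s1 s' \<and> s' xCnt 0 = s1 xCnt 0 + card {c. c < A \<and> eact E U P i j c})"
      proof (rule run_for_count)
        fix c s' assume c: "c < A" "agr {xC, xCnt} s1 s'" "s' xC 0 = c"
        have "view A E U P h s'" by (rule view_agr[OF v1 c(2)]) auto
        moreover have "s' xI 0 = i" "s' xJ 0 = j" using agrD[OF c(2), of xI] agrD[OF c(2), of xJ] i1 j by auto
        ultimately show "wval (eactE (V xI) (V xJ) (V xC)) s' \<noteq> 0 \<longleftrightarrow> eact E U P i j c"
          using view_eactE[of A E U P h s' "V xI" "V xJ" "V xC"] i j c by simp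
      next
        fix s' assume "agr {xC, xCnt} s1 s'"
        from agrD[OF this, of xA] show "wval (V xA) s' = A" using v1 by (simp add: view_def tables_def)
      qed auto
      then show "run ?b2 s1 (A * 4 + 2) (\<lambda>s'. s' xJ 0 = j \<and> s' xCnt 0 = s1 xCnt 0 + card {c. c < A \<and> eact E U P i j c})"
        by (rule run_mono) (use j in \<open>auto simp: agr_def\<close>)
    next
      fix s' assume "agr {xJ, xC, xCnt} ?s s'"
      from agrD[OF this, of xA] show "wval (V xA) s' = A" using xA[OF i(2)] by simp
    qed auto
    then have "run (For xJ (V xA) ?b2 ;; ?b3) ?s ((A * ((A * 4 + 2) + 2) + 2) + 3)
        (\<lambda>s'. s' xI 0 = i \<and> I (Suc i) s')"
    proof (intro run_Sq, elim run_mono)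
      fix s' assume s': "agr {xJ, xC, xCnt} ?s s' \<and> s' xCnt 0 = ?s xCnt 0 + (\<Sum>j<A. card {c. c < A \<and> eact E U P i j c})"
      then have e: "s' xI 0 = i" "s' xHa 0 = s xHa 0" "s' xTyp 0 = s xTyp 0" "s' xCnt 0 = card {(b, c). b < A \<and> c < A \<and> eact E U P i b c}"
        using i by (auto simp: agr_def card_pairs)
      show "run ?b3 s' 3 (\<lambda>s'. s' xI 0 = i \<and> I (Suc i) s')"
        using i(1,4) e unfolding I_def by (auto simp: less_Suc_eq not_less)
    qed simp
    then show "run (xCnt ::= Cn 0 ;; For xJ (V xA) ?b2 ;; ?b3) s (1 + ((A * ((A * 4 + 2) + 2) + 2) + 3))
        (\<lambda>s'. s' xI 0 = i \<and> I (Suc i) s')" by simp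
  qed (use xA t A in \<open>auto simp: I_def\<close>)
  then show ?thesis by (rule run_mono) (auto simp: I_def algebra_simps)
qed

lemma run_find_com:
  assumes v: "view A E U P h s0" and A: "1 \<le> A" and th: "1 \<le> th"
  shows "run (find_com th) s0 (60 * (A * A * A)) (\<lambda>s. agr findM s0 s \<and> s xHa 0 < A \<and> s xHb 0 < A \<and>
    (s xTyp 0 = 0 \<and> leaf A th E U P \<or> s xTyp 0 \<noteq> 0 \<and> branch A th E U P (s xTyp 0) (s xHa 0) (s xHb 0)))"
proof -
  let ?Q = "\<lambda>s. s xHa 0 < A \<and> s xHb 0 < A \<and>
    (s xTyp 0 = 0 \<and> leaf A th E U P \<or> s xTyp 0 \<noteq> 0 \<and> branch A th E U P (s xTyp 0) (s xHa 0) (s xHb 0))"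
  let ?T1 = "A * (A * 4 + 8) + 2" and ?T2 = "A * ((A * (A * 4 + 9) + 2) + 2) + 2" and ?T3 = "A * ((A * (A * 4 + 4) + 2) + 6) + 2"
  let ?c3 = "IfC (V xTyp) Skp (find3 (4 * th * th))"
  let ?c2 = "IfC (V xTyp) Skp (find2 th ;; ?c3)"
  let ?s = "put (put (put s0 xTyp 0 0) xHa 0 0) xHb 0 0"
  have vs: "view A E U P h ?s" by (rule view_agr[OF v, of findM]) auto
  have "run (find1 th) ?s ?T1 (\<lambda>s. s xHa 0 < A \<and>
    (s xTyp 0 = 0 \<and> (\<forall>a<A. card {b. b < A \<and> pact U P a b} < th) \<or>
     s xTyp 0 = 1 \<and> th \<le> card {b. b < A \<and> pact U P (s xHa 0) b}))"
    by (rule run_find1[OF vs]) (use A in auto)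
  from run_agr[OF this order_refl, unfolded mods_find1]
  have "run (find1 th ;; ?c2) ?s (?T1 + (1 + (?T2 + (1 + ?T3)))) ?Q"
  proof (intro run_Sq, elim run_mono)
    fix s1 assume s1: "(s1 xHa 0 < A \<and>
      (s1 xTyp 0 = 0 \<and> (\<forall>a<A. card {b. b < A \<and> pact U P a b} < th) \<or>
       s1 xTyp 0 = 1 \<and> th \<le> card {b. b < A \<and> pact U P (s1 xHa 0) b})) \<and> agr {xI, xCnt, xJ, xTyp, xHa} ?s s1"
    then have hb: "s1 xHb 0 = 0" by (auto simp: agr_def)
    show "run ?c2 s1 (1 + (?T2 + (1 + ?T3))) ?Q"
    proof (cases "s1 xTyp 0 = 0")
      case False
      then show ?thesis using s1 hb A by (auto simp: branch_def)
    next
      case True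
      then have P: "\<forall>a<A. card {b. b < A \<and> pact U P a b} < th" using s1 by auto
      have v1: "view A E U P h s1" by (rule view_agr[OF vs, of "{xI, xCnt, xJ, xTyp, xHa}"]) (use s1 in auto)
      have "run (find2 th) s1 ?T2 (\<lambda>s. s xHa 0 < A \<and> s xHb 0 < A \<and>
        (s xTyp 0 = 0 \<and> (\<forall>a<A. \<forall>b<A. card {c. c < A \<and> eact E U P a b c} < th) \<or>
         s xTyp 0 = 2 \<and> th \<le> card {c. c < A \<and> eact E U P (s xHa 0) (s xHb 0) c}))"
        by (rule run_find2[OF v1]) (use True s1 hb A in auto)
      from run_agr[OF this order_refl, unfolded mods_find2]
      have "run (find2 th ;; ?c3) s1 (?T2 + (1 + ?T3)) ?Q"
      proof (intro run_Sq, elim run_mono)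
        fix s2 assume s2: "(s2 xHa 0 < A \<and> s2 xHb 0 < A \<and>
          (s2 xTyp 0 = 0 \<and> (\<forall>a<A. \<forall>b<A. card {c. c < A \<and> eact E U P a b c} < th) \<or>
           s2 xTyp 0 = 2 \<and> th \<le> card {c. c < A \<and> eact E U P (s2 xHa 0) (s2 xHb 0) c})) \<and> agr {xI, xCnt, xJ, xC, xTyp, xHa, xHb} s1 s2"
        show "run ?c3 s2 (1 + ?T3) ?Q"
        proof (cases "s2 xTyp 0 = 0")
          case False
          then show ?thesis using s2 P by (auto simp: branch_def)
        next
          case t2: True
          then have EE: "\<forall>a<A. \<forall>b<A. card {c. c < A \<and> eact E U P a b c} < th" using s2 by auto
          have v2: "view A E U P h s2" by (rule view_agr[OF v1, of "{xI, xCnt, xJ, xC, xTyp, xHa, xHb}"]) (use s2 in auto)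
          have "run (find3 (4 * th * th)) s2 ?T3 (\<lambda>s. s xHa 0 < A \<and>
            (s xTyp 0 = 0 \<and> (\<forall>a<A. card {(b, c). b < A \<and> c < A \<and> eact E U P a b c} < 4 * th * th) \<or>
             s xTyp 0 = 3 \<and> 4 * th * th \<le> card {(b, c). b < A \<and> c < A \<and> eact E U P (s xHa 0) b c}))"
            by (rule run_find3[OF v2]) (use t2 s2 in auto)
          from run_agr[OF this order_refl, unfolded mods_find3]
          have "run (find3 (4 * th * th)) s2 ?T3 ?Q"
            by (rule run_mono) (use P EE s2 in \<open>auto simp: branch_def leaf_def agr_def\<close>)
          then show ?thesis using t2 by simp
        qed
      qed auto
      then show ?thesis using True by simp
    qed
  qed auto
  then have "run (find_com th) s0 (3 + (?T1 + (1 + (?T2 + (1 + ?T3))))) ?Q"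
    unfolding find_com_def by (auto elim!: run_mono)
  moreover have "3 + (?T1 + (1 + (?T2 + (1 + ?T3)))) \<le> 30 * (A * A * A) + 30 * (A * A * A)"
  proof -
    have "A \<le> A * A" "A * A \<le> A * A * A" "1 \<le> A * A * A" using A by auto
    moreover have "3 + (?T1 + (1 + (?T2 + (1 + ?T3)))) = 8 * (A * A * A) + 17 * (A * A) + 20 * A + 11"
      by (simp add: algebra_simps)
    ultimately show ?thesis by linarith
  qed
  ultimately have "run (find_com th) s0 (60 * (A * A * A)) ?Q" by (elim run_mono) auto
  from run_agr[OF this order_refl, unfolded mods_find_com] show ?thesis
    by (rule run_mono) auto
qed

subsection \<open>Creating the two children of a state\<close>

definition child_com :: "wexp \<Rightarrow> wexp \<Rightarrow> wcom" where
  "child_com uv pv = For xI (V xA) (Wr yU (Pl (V xTU) (V xI)) uv) ;;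
     For xI (V xA) (For xJ (V xA) (Wr yP (Pl (V xTP) (Pl (Rd yR (V xI)) (V xJ))) pv)) ;;
     xTU ::= Pl (V xTU) (V xA) ;; xTP ::= Pl (V xTP) (V xAA) ;; incr xTail"

definition same_old :: "nat \<Rightarrow> nat \<Rightarrow> st \<Rightarrow> st \<Rightarrow> bool" where
  "same_old A t s0 s \<longleftrightarrow> (\<forall>i<t * A. s yU i = s0 yU i) \<and> (\<forall>i<t * (A * A). s yP i = s0 yP i)"

abbreviation (input) "childM \<equiv> {yU, yP, xI, xJ, xTU, xTP, xTail}"

lemma pair_index: "a < (A::nat) \<Longrightarrow> b < A \<Longrightarrow> a * A + b < A * A"
  by (metis add_less_cancel_left less_le_trans mult_Suc Suc_leI mult_le_mono1 add.commute)

lemma cell_inj': "b < (A::nat) \<Longrightarrow> b' < A \<Longrightarrow> a * A + b = a' * A + b' \<longleftrightarrow> a = a' \<and> b = b'"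
  using cell_inj[of b A b' a a'] by (simp add: mult.commute)

lemma old_index: "h < t \<Longrightarrow> a < (A::nat) \<Longrightarrow> h * A + a < t * A"
  by (metis add_less_cancel_left less_le_trans mult_Suc Suc_leI mult_le_mono1 add.commute)

lemma item_old: "item A s0 h U P \<Longrightarrow> same_old A t s0 s \<Longrightarrow> h < t \<Longrightarrow> item A s h U P"
  unfolding item_def same_old_def using old_index[of h t _ A] old_index[of h t _ "A * A"] pair_index by simp

lemma same_old_trans: "same_old A t s0 s1 \<Longrightarrow> same_old A t' s1 s2 \<Longrightarrow> t \<le> t' \<Longrightarrow> same_old A t s0 s2"
proof -
  assume a: "same_old A t s0 s1" "same_old A t' s1 s2" "t \<le> t'"
  have "t * A \<le> t' * A" "t * (A * A) \<le> t' * (A * A)" using a(3) by (rule mult_le_mono1)+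
  then have "i < t' * A" if "i < t * A" for i using that by linarith
  moreover have "i < t' * (A * A)" if "i < t * (A * A)" for i using that \<open>t * (A * A) \<le> _\<close> by linarith
  ultimately show ?thesis using a(1,2) unfolding same_old_def by simp
qed

text \<open>The flags are evaluated while the new item is already being written. Their meaning may
  therefore rely only on items before \<open>t\<close>, which \<open>same_old\<close> guarantees to
  be intact.\<close>

lemma run_child_com:
  assumes tab: "tables A E s0" and t: "s0 xTU 0 = t * A" "s0 xTP 0 = t * (A * A)" "s0 xTail 0 = t"
    and uv: "\<And>s a. a < A \<Longrightarrow> agr childM s0 s \<Longrightarrow> same_old A t s0 s \<Longrightarrow> s xI 0 = a \<Longrightarrow> wval uv s \<noteq> 0 \<longleftrightarrow> U' a"
    and pv: "\<And>s a b. a < A \<Longrightarrow> b < A \<Longrightarrow> agr childM s0 s \<Longrightarrow> same_old A t s0 s \<Longrightarrow> s xI 0 = a \<Longrightarrow> s xJ 0 = b \<Longrightarrow>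
      wval pv s \<noteq> 0 \<longleftrightarrow> P' a b"
  shows "run (child_com uv pv) s0 (3 * (A * A) + 7 * A + 7) (\<lambda>s. agr childM s0 s \<and> same_old A t s0 s \<and> item A s t U' P' \<and>
    s xTU 0 = Suc t * A \<and> s xTP 0 = Suc t * (A * A) \<and> s xTail 0 = Suc t)"
proof -
  have A: "s0 xA 0 = A" "s0 xAA 0 = A * A" "\<And>a. a < A \<Longrightarrow> s0 yR a = a * A" using tab by (auto simp: tables_def)
  let ?c2 = "For xI (V xA) (For xJ (V xA) (Wr yP (Pl (V xTP) (Pl (Rd yR (V xI)) (V xJ))) pv))"
  let ?c3 = "xTU ::= Pl (V xTU) (V xA) ;; xTP ::= Pl (V xTP) (V xAA) ;; incr xTail"
  let ?Q = "\<lambda>s. agr childM s0 s \<and> same_old A t s0 s \<and> item A s t U' P' \<and>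
    s xTU 0 = Suc t * A \<and> s xTP 0 = Suc t * (A * A) \<and> s xTail 0 = Suc t"
  define I where "I i s \<longleftrightarrow> same_old A t s0 s \<and> (\<forall>a<i. s yU (t * A + a) \<noteq> 0 \<longleftrightarrow> U' a)" for i and s :: st
  have 1: "run (For xI (V xA) (Wr yU (Pl (V xTU) (V xI)) uv)) s0 (A * (1 + 2) + 2) (\<lambda>s. agr {xI, yU} s0 s \<and> I A s)"
  proof (rule run_for)
    fix i s assume i: "i < A" "agr {xI, yU} s0 s" "s xI 0 = i" "I i s"
    have "agr childM s0 s" by (rule agr_mono[OF i(2)]) auto
    then have u: "wval uv s \<noteq> 0 \<longleftrightarrow> U' i" using uv[of i s] i by (auto simp: I_def)
    have "s xTU 0 = t * A" using agrD[OF i(2), of xTU] t by simp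
    then show "run (Wr yU (Pl (V xTU) (V xI)) uv) s 1 (\<lambda>s'. s' xI 0 = i \<and> I (Suc i) s')"
      using i u by (auto simp: I_def same_old_def less_Suc_eq)
  qed (use A in \<open>auto simp: I_def same_old_def agr_def\<close>)
  have 2: "run ?c2 s1 (A * ((A * (1 + 2) + 2) + 2) + 2) (\<lambda>s. agr {xI, xJ, yP} s1 s \<and> same_old A t s0 s \<and>
      (\<forall>a<A. \<forall>b<A. s yP (t * (A * A) + (a * A + b)) \<noteq> 0 \<longleftrightarrow> P' a b))"
    if s1: "agr {xI, yU} s0 s1" "I A s1" for s1
  proof -
    define J where "J i s \<longleftrightarrow> same_old A t s0 s \<and> (\<forall>a<i. \<forall>b<A. s yP (t * (A * A) + (a * A + b)) \<noteq> 0 \<longleftrightarrow> P' a b)" for i and s :: st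
    have "run ?c2 s1 (A * ((A * (1 + 2) + 2) + 2) + 2) (\<lambda>s. agr {xI, xJ, yP} s1 s \<and> J A s)"
    proof (rule run_for)
      fix i s assume i: "i < A" "agr {xI, xJ, yP} s1 s" "s xI 0 = i" "J i s"
      have "run (For xJ (V xA) (Wr yP (Pl (V xTP) (Pl (Rd yR (V xI)) (V xJ))) pv)) s (A * (1 + 2) + 2)
         (\<lambda>s'. agr {xJ, yP} s s' \<and> (J i s' \<and> (\<forall>b<A. s' yP (t * (A * A) + (i * A + b)) \<noteq> 0 \<longleftrightarrow> P' i b)))"
      proof (rule run_for[where I = "\<lambda>j s'. J i s' \<and> (\<forall>b<j. s' yP (t * (A * A) + (i * A + b)) \<noteq> 0 \<longleftrightarrow> P' i b)"])
        fix j s' assume j: "j < A" "agr {xJ, yP} s s'" "s' xJ 0 = j"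
           "J i s' \<and> (\<forall>b<j. s' yP (t * (A * A) + (i * A + b)) \<noteq> 0 \<longleftrightarrow> P' i b)"
        have ag: "agr childM s0 s'"
          by (rule agr_trans[OF agr_mono[OF s1(1)] agr_trans[OF agr_mono[OF i(2)] agr_mono[OF j(2)]]]) auto
        have xi: "s' xI 0 = i" using agrD[OF j(2), of xI] i by simp
        have e: "s' xTP 0 = t * (A * A)" "s' yR i = i * A"
          using agrD[OF j(2), of xTP] agrD[OF i(2), of xTP] agrD[OF s1(1), of xTP] agrD[OF j(2), of yR] agrD[OF i(2), of yR] agrD[OF s1(1), of yR] t A(3)[OF i(1)] by auto
        have p: "wval pv s' \<noteq> 0 \<longleftrightarrow> P' i j" using pv[of i j s'] i j ag xi by (auto simp: J_def)
        have ne: "a * A + b \<noteq> i * A + j" if "a < i" "b < A" for a b using that j cell_inj'[of b A j a i] by auto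
        show "run (Wr yP (Pl (V xTP) (Pl (Rd yR (V xI)) (V xJ))) pv) s' 1 (\<lambda>s'. s' xJ 0 = j \<and>
           (J i s' \<and> (\<forall>b<Suc j. s' yP (t * (A * A) + (i * A + b)) \<noteq> 0 \<longleftrightarrow> P' i b)))"
          using j xi e p ne by (auto simp: J_def same_old_def less_Suc_eq)
      next
        fix s' assume "agr {xJ, yP} s s'"
        then show "wval (V xA) s' = A" using agrD[OF i(2), of xA] agrD[OF s1(1), of xA] A by (auto simp: agr_def)
      qed (use i in \<open>auto simp: J_def same_old_def\<close>)
      then show "run (For xJ (V xA) (Wr yP (Pl (V xTP) (Pl (Rd yR (V xI)) (V xJ))) pv)) s (A * (1 + 2) + 2) (\<lambda>s'. s' xI 0 = i \<and> J (Suc i) s')"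
        by (rule run_mono) (use i in \<open>auto simp: J_def less_Suc_eq agr_def\<close>)
    next
      fix s' assume "agr {xI, xJ, yP} s1 s'"
      then show "wval (V xA) s' = A" using agrD[OF s1(1), of xA] A by (auto simp: agr_def)
    qed (use s1 in \<open>auto simp: J_def I_def same_old_def\<close>)
    then show ?thesis by (rule run_mono) (auto simp: J_def)
  qed
  have "run (child_com uv pv) s0 ((A * (1 + 2) + 2) + ((A * ((A * (1 + 2) + 2) + 2) + 2) + 3)) ?Q"
    unfolding child_com_def
  proof (rule run_Sq, rule run_mono[OF 1 le_refl])
    fix s1 assume s1: "agr {xI, yU} s0 s1 \<and> I A s1"
    show "run (?c2 ;; ?c3) s1 ((A * ((A * (1 + 2) + 2) + 2) + 2) + 3) ?Q"
    proof (rule run_Sq, rule run_mono[OF 2 le_refl])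
      fix s assume s: "agr {xI, xJ, yP} s1 s \<and> same_old A t s0 s \<and> (\<forall>a<A. \<forall>b<A. s yP (t * (A * A) + (a * A + b)) \<noteq> 0 \<longleftrightarrow> P' a b)"
      have ag: "agr {yU, yP, xI, xJ} s0 s"
        by (rule agr_trans[OF agr_mono agr_mono]) (use s1 s in auto)
      have "s yU = s1 yU" using s by (auto simp: agr_def)
      then have it: "item A s t U' P'" using s s1 by (auto simp: item_def I_def)
      have e: "s xA = s0 xA" "s xAA = s0 xAA" "s xTU = s0 xTU" "s xTP = s0 xTP" "s xTail = s0 xTail"
        using ag by (auto simp: agr_def)
      have ag': "agr childM s0 s" by (rule agr_mono[OF ag]) auto
      show "run ?c3 s 3 ?Q" using ag' it e s A t by (simp add: same_old_def item_def)
    qed (use s1 in auto)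
  qed
  then show ?thesis by (rule run_mono) (auto simp: algebra_simps)
qed

definition branch_com :: wcom where
  "branch_com =
     child_com (Pl (uE (V xI)) (w_and (w_not (w_eq (V xTyp) (Cn 2))) (w_eq (V xI) (V xHa))))
       (Pl (pE (V xI) (V xJ)) (w_and (w_eq (V xTyp) (Cn 2))
          (Pl (w_and (w_eq (V xI) (V xHa)) (w_eq (V xJ) (V xHb))) (w_and (w_eq (V xI) (V xHb)) (w_eq (V xJ) (V xHa)))))) ;;
     child_com (Pl (uE (V xI)) (Pl (w_and (w_eq (V xTyp) (Cn 1)) (pactE (V xHa) (V xI)))
          (w_and (w_eq (V xTyp) (Cn 2)) (eactE (V xHa) (V xHb) (V xI)))))
       (Pl (pE (V xI) (V xJ)) (w_and (w_eq (V xTyp) (Cn 3)) (eactE (V xHa) (V xI) (V xJ))))"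

lemma view_child:
  assumes "view A E U P h s0" "h < t" "agr childM s0 s" "same_old A t s0 s"
  shows "view A E U P h s"
proof -
  have "tables A E s" using assms(1,3) unfolding view_def tables_def agr_def by auto
  moreover have "s xHU = s0 xHU" "s xHP = s0 xHP" using assms(3) by (auto simp: agr_def)
  ultimately show ?thesis using item_old[OF _ assms(4,2)] assms(1) by (simp add: view_def)
qed

lemma run_branch_com:
  assumes v: "view A E U P h s0" and h: "h < t" and t: "s0 xTU 0 = t * A" "s0 xTP 0 = t * (A * A)" "s0 xTail 0 = t"
    and b: "s0 xHa 0 = ha" "s0 xHb 0 = hb" "s0 xTyp 0 = typ" "ha < A" "hb < A"
  shows "run branch_com s0 (6 * (A * A) + 14 * A + 14) (\<lambda>s. agr childM s0 s \<and> same_old A t s0 s \<and>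
    item A s t (U0 typ ha U) (P0 typ ha hb P) \<and> item A s (Suc t) (U1 typ ha hb E U P) (P1 typ ha E U P) \<and>
    s xTU 0 = (t + 2) * A \<and> s xTP 0 = (t + 2) * (A * A) \<and> s xTail 0 = t + 2)"
proof -
  have bs: "s xHa 0 = ha \<and> s xHb 0 = hb \<and> s xTyp 0 = typ" if "agr childM s0 s" for s
    using b that by (auto simp: agr_def)
  let ?c1 = "child_com (Pl (uE (V xI)) (w_and (w_not (w_eq (V xTyp) (Cn 2))) (w_eq (V xI) (V xHa))))
       (Pl (pE (V xI) (V xJ)) (w_and (w_eq (V xTyp) (Cn 2))
          (Pl (w_and (w_eq (V xI) (V xHa)) (w_eq (V xJ) (V xHb))) (w_and (w_eq (V xI) (V xHb)) (w_eq (V xJ) (V xHa))))))"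
  let ?c2 = "child_com (Pl (uE (V xI)) (Pl (w_and (w_eq (V xTyp) (Cn 1)) (pactE (V xHa) (V xI)))
          (w_and (w_eq (V xTyp) (Cn 2)) (eactE (V xHa) (V xHb) (V xI)))))
       (Pl (pE (V xI) (V xJ)) (w_and (w_eq (V xTyp) (Cn 3)) (eactE (V xHa) (V xI) (V xJ))))"
  have 1: "run ?c1 s0 (3 * (A * A) + 7 * A + 7) (\<lambda>s. agr childM s0 s \<and> same_old A t s0 s \<and> item A s t (U0 typ ha U) (P0 typ ha hb P) \<and>
    s xTU 0 = Suc t * A \<and> s xTP 0 = Suc t * (A * A) \<and> s xTail 0 = Suc t)"
  proof (rule run_child_com)
    show "tables A E s0" using v by (simp add: view_def)
    show "s0 xTU 0 = t * A" "s0 xTP 0 = t * (A * A)" "s0 xTail 0 = t" by (fact t)+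
    fix s a assume s: "a < A" "agr childM s0 s" "same_old A t s0 s" "s xI 0 = a"
    have "view A E U P h s" by (rule view_child[OF v h s(2,3)])
    from view_uE[OF this, of "V xI"]
    show "wval (Pl (uE (V xI)) (w_and (w_not (w_eq (V xTyp) (Cn 2))) (w_eq (V xI) (V xHa)))) s \<noteq> 0 \<longleftrightarrow> U0 typ ha U a"
      using s bs[OF s(2)] by (auto simp: U0_def)
  next
    fix s a b assume s: "a < A" "b < A" "agr childM s0 s" "same_old A t s0 s" "s xI 0 = a" "s xJ 0 = b"
    have "view A E U P h s" by (rule view_child[OF v h s(3,4)])
    from view_pE[OF this, of "V xI" "V xJ"]
    show "wval (Pl (pE (V xI) (V xJ)) (w_and (w_eq (V xTyp) (Cn 2))
          (Pl (w_and (w_eq (V xI) (V xHa)) (w_eq (V xJ) (V xHb))) (w_and (w_eq (V xI) (V xHb)) (w_eq (V xJ) (V xHa)))))) s \<noteq> 0 \<longleftrightarrow> P0 typ ha hb P a b"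
      using s bs[OF s(3)] by (auto simp: P0_def)
  qed
  have "run branch_com s0 ((3 * (A * A) + 7 * A + 7) + (3 * (A * A) + 7 * A + 7)) (\<lambda>s. agr childM s0 s \<and> same_old A t s0 s \<and>
    item A s t (U0 typ ha U) (P0 typ ha hb P) \<and> item A s (Suc t) (U1 typ ha hb E U P) (P1 typ ha E U P) \<and>
    s xTU 0 = (t + 2) * A \<and> s xTP 0 = (t + 2) * (A * A) \<and> s xTail 0 = t + 2)"
    unfolding branch_com_def
  proof (rule run_Sq, rule run_mono[OF 1 le_refl])
    fix s1 assume s1: "agr childM s0 s1 \<and> same_old A t s0 s1 \<and> item A s1 t (U0 typ ha U) (P0 typ ha hb P) \<and>
      s1 xTU 0 = Suc t * A \<and> s1 xTP 0 = Suc t * (A * A) \<and> s1 xTail 0 = Suc t"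
    have v1: "view A E U P h s1" using view_child[OF v h] s1 by blast
    have h1: "h < Suc t" using h by simp
    have "run ?c2 s1 (3 * (A * A) + 7 * A + 7) (\<lambda>s. agr childM s1 s \<and> same_old A (Suc t) s1 s \<and> item A s (Suc t) (U1 typ ha hb E U P) (P1 typ ha E U P) \<and>
       s xTU 0 = Suc (Suc t) * A \<and> s xTP 0 = Suc (Suc t) * (A * A) \<and> s xTail 0 = Suc (Suc t))"
    proof (rule run_child_com)
      show "tables A E s1" using v1 by (simp add: view_def)
      show "s1 xTU 0 = Suc t * A" "s1 xTP 0 = Suc t * (A * A)" "s1 xTail 0 = Suc t" using s1 by auto
      fix s a assume s: "a < A" "agr childM s1 s" "same_old A (Suc t) s1 s" "s xI 0 = a"
      have vs: "view A E U P h s" by (rule view_child[OF v1 h1 s(2,3)])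
      have "agr childM s0 s" using s1 s agr_trans by blast
      note bb = bs[OF this]
      show "wval (Pl (uE (V xI)) (Pl (w_and (w_eq (V xTyp) (Cn 1)) (pactE (V xHa) (V xI)))
          (w_and (w_eq (V xTyp) (Cn 2)) (eactE (V xHa) (V xHb) (V xI))))) s \<noteq> 0 \<longleftrightarrow> U1 typ ha hb E U P a"
        using view_uE[OF vs, of "V xI"] view_pactE[OF vs, of "V xHa" "V xI"] view_eactE[OF vs, of "V xHa" "V xHb" "V xI"] s bb b(4,5)
        by (auto simp: U1_def)
    next
      fix s a b' assume s: "a < A" "b' < A" "agr childM s1 s" "same_old A (Suc t) s1 s" "s xI 0 = a" "s xJ 0 = b'"
      have vs: "view A E U P h s" by (rule view_child[OF v1 h1 s(3,4)])
      have "agr childM s0 s" using s1 s agr_trans by blast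
      note bb = bs[OF this]
      show "wval (Pl (pE (V xI) (V xJ)) (w_and (w_eq (V xTyp) (Cn 3)) (eactE (V xHa) (V xI) (V xJ)))) s \<noteq> 0 \<longleftrightarrow> P1 typ ha E U P a b'"
        using view_pE[OF vs, of "V xI" "V xJ"] view_eactE[OF vs, of "V xHa" "V xI" "V xJ"] s bb b(4,5)
        by (auto simp: P1_def)
    qed
    then show "run ?c2 s1 (3 * (A * A) + 7 * A + 7) (\<lambda>s. agr childM s0 s \<and> same_old A t s0 s \<and>
      item A s t (U0 typ ha U) (P0 typ ha hb P) \<and> item A s (Suc t) (U1 typ ha hb E U P) (P1 typ ha E U P) \<and>
      s xTU 0 = (t + 2) * A \<and> s xTP 0 = (t + 2) * (A * A) \<and> s xTail 0 = t + 2)"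
    proof (rule run_mono[OF _ le_refl])
      fix s assume s: "agr childM s1 s \<and> same_old A (Suc t) s1 s \<and> item A s (Suc t) (U1 typ ha hb E U P) (P1 typ ha E U P) \<and>
       s xTU 0 = Suc (Suc t) * A \<and> s xTP 0 = Suc (Suc t) * (A * A) \<and> s xTail 0 = Suc (Suc t)"
      have "agr childM s0 s" using s s1 agr_trans by blast
      moreover have "same_old A t s0 s" by (rule same_old_trans[of A t s0 s1 "Suc t"]) (use s s1 in auto)
      moreover have "item A s t (U0 typ ha U) (P0 typ ha hb P)" by (rule item_old[of A s1 t _ _ "Suc t"]) (use s s1 in auto)
      ultimately show "agr childM s0 s \<and> same_old A t s0 s \<and>
        item A s t (U0 typ ha U) (P0 typ ha hb P) \<and> item A s (Suc t) (U1 typ ha hb E U P) (P1 typ ha E U P) \<and>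
        s xTU 0 = (t + 2) * A \<and> s xTP 0 = (t + 2) * (A * A) \<and> s xTail 0 = t + 2"
        using s by simp
    qed
  qed
  then show ?thesis by (rule run_mono) auto
qed

subsection \<open>Listing the active clauses of a leaf\<close>

abbreviation (input) "zM \<equiv> 64 :: nat"
abbreviation (input) "zL0 \<equiv> 65 :: nat"
abbreviation (input) "zL1 \<equiv> 66 :: nat"
abbreviation (input) "zL2 \<equiv> 67 :: nat"

definition push :: "wexp \<Rightarrow> wexp \<Rightarrow> wexp \<Rightarrow> wcom" where
  "push a b c = Wr zL0 (V zM) a ;; Wr zL1 (V zM) b ;; Wr zL2 (V zM) c ;; incr zM"

text \<open>Satisfiability depends only on this set, so order and repetitions of the listed clauses
  are forgotten; the length of the list is tracked separately.\<close>

definition trips :: "st \<Rightarrow> (nat \<times> nat \<times> nat) set" where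
  "trips s = {(s zL0 c, s zL1 c, s zL2 c) | c. c < s zM 0}"

lemma run_push:
  assumes "x < zM" "y < zM" "z < zM"
  shows "run (push (V x) (V y) (V z)) s 4 (\<lambda>s'. trips s' = insert (s x 0, s y 0, s z 0) (trips s) \<and> s' zM 0 = Suc (s zM 0) \<and> agr {zM, zL0, zL1, zL2} s s')"
proof -
  have "{(f c, g c, h c) |c. c < Suc n} = insert (f n, g n, h n) {(f c, g c, h c) |c. c < n}" for f g h :: "nat \<Rightarrow> nat" and n
    by (auto simp: less_Suc_eq)
  moreover have "{((f(n := a)) c, (g(n := b)) c, (h(n := d)) c) |c. c < n} = {(f c, g c, h c) |c. c < n}" for f g h :: "nat \<Rightarrow> nat" and n a b d
    by (auto; metis less_irrefl)
  ultimately show ?thesis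
    using assms by (simp add: push_def trips_def)
qed

lemma trips_if [simp]: "x < zM \<Longrightarrow> trips (\<lambda>a. if a = x then g else s a) = trips s"
  by (simp add: trips_def)

lemma run_for_trips:
  assumes M: "x \<in> M" "mods c \<subseteq> M" "x < zM" and e: "\<And>s. agr M s0 s \<Longrightarrow> wval e s = n"
    and step: "\<And>i s. i < n \<Longrightarrow> agr M s0 s \<Longrightarrow> s x 0 = i \<Longrightarrow>
      run c s T (\<lambda>s'. s' x 0 = i \<and> trips s' = trips s \<union> F i \<and> s' zM 0 = s zM 0 + f i)"
  shows "run (For x e c) s0 (n * (T + 2) + 2) (\<lambda>s. agr M s0 s \<and> trips s = trips s0 \<union> (\<Union>i<n. F i) \<and> s zM 0 = s0 zM 0 + (\<Sum>i<n. f i))"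
proof (rule run_for[OF M(1,2) e])
  fix i s assume "i < n" "agr M s0 s" "s x 0 = i" "trips s = trips s0 \<union> (\<Union>i<i. F i) \<and> s zM 0 = s0 zM 0 + (\<Sum>i<i. f i)"
  then show "run c s T (\<lambda>s'. s' x 0 = i \<and> trips s' = trips s0 \<union> (\<Union>i<Suc i. F i) \<and> s' zM 0 = s0 zM 0 + (\<Sum>i<Suc i. f i))"
    by (intro run_mono[OF step]) (auto simp: lessThan_Suc)
qed (use M in simp_all)

text \<open>Units and pairs become triples with repeated literals, so that the graph construction
  meets only one kind of clause. Symmetric copies are listed too, which costs a constant
  factor.\<close>

definition list_com :: wcom where
  "list_com = zM ::= Cn 0 ;; For xI (V xA) (IfC (uE (V xI)) (push (V xI) (V xI) (V xI)) Skp) ;;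
     For xI (V xA) (For xJ (V xA) (IfC (pactE (V xI) (V xJ)) (push (V xI) (V xJ) (V xJ)) Skp)) ;;
     For xI (V xA) (For xJ (V xA) (For xC (V xA) (IfC (eactE (V xI) (V xJ) (V xC)) (push (V xI) (V xJ) (V xC)) Skp)))"

abbreviation (input) "listM \<equiv> {zM, zL0, zL1, zL2, xI, xJ, xC}"

definition state_trips :: "nat \<Rightarrow> (nat \<Rightarrow> nat \<Rightarrow> nat \<Rightarrow> bool) \<Rightarrow> (nat \<Rightarrow> bool) \<Rightarrow> (nat \<Rightarrow> nat \<Rightarrow> bool) \<Rightarrow> (nat \<times> nat \<times> nat) set" where
  "state_trips A E U P = (\<Union>a<A. if U a then {(a, a, a)} else {}) \<union>
     (\<Union>a<A. \<Union>b<A. if pact U P a b then {(a, b, b)} else {}) \<union>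
     (\<Union>a<A. \<Union>b<A. \<Union>c<A. if eact E U P a b c then {(a, b, c)} else {})"

lemma card_as_sum: "(\<Sum>b<A. if R b then 1 else 0) = card {b. b < A \<and> R (b::nat)}"
  by (simp add: sum.If_cases Int_def)

lemma run_list_com:
  assumes v: "view A E U P h s0"
  shows "run list_com s0 (7 * (A * A * A) + 11 * (A * A) + 15 * A + 7) (\<lambda>s. agr listM s0 s \<and> trips s = state_trips A E U P \<and>
    s zM 0 = card {a. a < A \<and> U a} + card {(a, b). a < A \<and> b < A \<and> pact U P a b} +
      (\<Sum>a<A. card {(b, c). b < A \<and> c < A \<and> eact E U P a b c}))"
proof -
  let ?p1 = "IfC (uE (V xI)) (push (V xI) (V xI) (V xI)) Skp"
  let ?p2 = "IfC (pactE (V xI) (V xJ)) (push (V xI) (V xJ) (V xJ)) Skp"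
  let ?p3 = "IfC (eactE (V xI) (V xJ) (V xC)) (push (V xI) (V xJ) (V xC)) Skp"
  have cond_push: "run (IfC e (push (V x) (V y) (V z)) Skp) s 5 (\<lambda>s'. trips s' = trips s \<union> (if b then {(s x 0, s y 0, s z 0)} else {}) \<and>
      s' zM 0 = s zM 0 + (if b then 1 else 0) \<and> agr {zM, zL0, zL1, zL2} s s')"
    if "x < zM" "y < zM" "z < zM" "wval e s \<noteq> 0 \<longleftrightarrow> b" for e x y z s b
    using run_push[OF that(1-3), of s] that(4) by (auto elim!: run_mono)
  have mp: "mods (push (V x) (V y) (V z)) = {zM, zL0, zL1, zL2}" for x y z by (auto simp: push_def)
  have xA: "wval (V xA) s = A" if "agr listM s0 s" for s
    using v that by (auto simp: view_def tables_def agr_def)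
  have vw: "view A E U P h s" if "agr listM s0 s" for s by (rule view_agr[OF v that]) auto
  let ?F1 = "\<lambda>a. if U a then {(a, a, a)} else {}" and ?F2 = "\<lambda>a. \<Union>b<A. if pact U P a b then {(a, b, b)} else {}"
    and ?F3 = "\<lambda>a. \<Union>b<A. \<Union>c<A. if eact E U P a b c then {(a, b, c)} else {}"
  have L1: "run (For xI (V xA) ?p1) s1 (A * (5 + 2) + 2)
     (\<lambda>s. agr listM s1 s \<and> trips s = trips s1 \<union> (\<Union>i<A. ?F1 i) \<and> s zM 0 = s1 zM 0 + (\<Sum>i<A. if U i then 1 else 0))"
    if s1: "agr listM s0 s1" for s1
  proof (rule run_for_trips)
    fix i s assume i: "i < A" "agr listM s1 s" "s xI 0 = i"
    have "view A E U P h s" by (rule vw[OF agr_trans[OF s1 i(2)]])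
    then have "wval (uE (V xI)) s \<noteq> 0 \<longleftrightarrow> U i" using view_uE[of A E U P h s "V xI"] i by simp
    note pu = cond_push[OF _ _ _ this, of xI xI xI]
    show "run ?p1 s 5 (\<lambda>s'. s' xI 0 = i \<and> trips s' = trips s \<union> ?F1 i \<and> s' zM 0 = s zM 0 + (if U i then 1 else 0))"
      by (rule run_mono[OF pu]) (use i(3) in \<open>simp_all add: agr_def\<close>)
  qed (use xA agr_trans[OF s1] in \<open>auto simp: mp\<close>)
  have L2: "run (For xI (V xA) (For xJ (V xA) ?p2)) s1 (A * ((A * (5 + 2) + 2) + 2) + 2)
     (\<lambda>s. agr listM s1 s \<and> trips s = trips s1 \<union> (\<Union>i<A. ?F2 i) \<and> s zM 0 = s1 zM 0 + (\<Sum>i<A. \<Sum>j<A. if pact U P i j then 1 else 0))"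
    if s1: "agr listM s0 s1" for s1
  proof (rule run_for_trips)
    fix i s assume i: "i < A" "agr listM s1 s" "s xI 0 = i"
    let ?M = "{zM, zL0, zL1, zL2, xJ}"
    have sub: "agr listM s0 s'" if "agr ?M s s'" for s' by (rule agr_trans[OF agr_trans[OF s1 i(2)] agr_mono[OF that]]) auto
    have "run (For xJ (V xA) ?p2) s (A * (5 + 2) + 2) (\<lambda>s'. agr ?M s s' \<and> trips s' = trips s \<union> (\<Union>j<A. if pact U P i j then {(i, j, j)} else {}) \<and>
       s' zM 0 = s zM 0 + (\<Sum>j<A. if pact U P i j then 1 else 0))"
    proof (rule run_for_trips)
      fix j s' assume j: "j < A" "agr ?M s s'" "s' xJ 0 = j"
      have xi: "s' xI 0 = i" using agrD[OF j(2), of xI] i by simp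
      have "view A E U P h s'" by (rule vw[OF sub[OF j(2)]])
      then have "wval (pactE (V xI) (V xJ)) s' \<noteq> 0 \<longleftrightarrow> pact U P i j" using view_pactE[of A E U P h s' "V xI" "V xJ"] i j xi by simp
      note pu = cond_push[OF _ _ _ this, of xI xJ xJ]
      show "run ?p2 s' 5 (\<lambda>s''. s'' xJ 0 = j \<and> trips s'' = trips s' \<union> (if pact U P i j then {(i, j, j)} else {}) \<and>
          s'' zM 0 = s' zM 0 + (if pact U P i j then 1 else 0))"
        by (rule run_mono[OF pu]) (use j(3) xi in \<open>simp_all add: agr_def\<close>)
    qed (use xA sub in \<open>auto simp: mp\<close>)
    then show "run (For xJ (V xA) ?p2) s (A * (5 + 2) + 2) (\<lambda>s'. s' xI 0 = i \<and> trips s' = trips s \<union> ?F2 i \<and>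
       s' zM 0 = s zM 0 + (\<Sum>j<A. if pact U P i j then 1 else 0))"
      by (rule run_mono) (use i(3) in \<open>auto simp: agr_def\<close>)
  qed (use xA agr_trans[OF s1] in \<open>auto simp: mp\<close>)
  have L3: "run (For xI (V xA) (For xJ (V xA) (For xC (V xA) ?p3))) s1 (A * ((A * ((A * (5 + 2) + 2) + 2) + 2) + 2) + 2)
     (\<lambda>s. agr listM s1 s \<and> trips s = trips s1 \<union> (\<Union>i<A. ?F3 i) \<and> s zM 0 = s1 zM 0 + (\<Sum>i<A. \<Sum>j<A. \<Sum>c<A. if eact E U P i j c then 1 else 0))"
    if s1: "agr listM s0 s1" for s1
  proof (rule run_for_trips)
    fix i s assume i: "i < A" "agr listM s1 s" "s xI 0 = i"
    let ?M = "{zM, zL0, zL1, zL2, xJ, xC}"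
    have sub: "agr listM s0 s'" if "agr ?M s s'" for s' by (rule agr_trans[OF agr_trans[OF s1 i(2)] agr_mono[OF that]]) auto
    have "run (For xJ (V xA) (For xC (V xA) ?p3)) s (A * ((A * (5 + 2) + 2) + 2) + 2) (\<lambda>s'. agr ?M s s' \<and>
       trips s' = trips s \<union> (\<Union>j<A. \<Union>c<A. if eact E U P i j c then {(i, j, c)} else {}) \<and>
       s' zM 0 = s zM 0 + (\<Sum>j<A. \<Sum>c<A. if eact E U P i j c then 1 else 0))"
    proof (rule run_for_trips)
      fix j s2 assume j: "j < A" "agr ?M s s2" "s2 xJ 0 = j"
      let ?M2 = "{zM, zL0, zL1, zL2, xC}"
      have sub2: "agr listM s0 s'" if "agr ?M2 s2 s'" for s' by (rule agr_trans[OF sub[OF j(2)] agr_mono[OF that]]) auto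
      have "run (For xC (V xA) ?p3) s2 (A * (5 + 2) + 2) (\<lambda>s'. agr ?M2 s2 s' \<and>
         trips s' = trips s2 \<union> (\<Union>c<A. if eact E U P i j c then {(i, j, c)} else {}) \<and>
         s' zM 0 = s2 zM 0 + (\<Sum>c<A. if eact E U P i j c then 1 else 0))"
      proof (rule run_for_trips)
        fix c s' assume c: "c < A" "agr ?M2 s2 s'" "s' xC 0 = c"
        have xi: "s' xI 0 = i" "s' xJ 0 = j" using agrD[OF c(2), of xI] agrD[OF c(2), of xJ] agrD[OF j(2), of xI] i j by auto
        have "view A E U P h s'" by (rule vw[OF sub2[OF c(2)]])
        then have "wval (eactE (V xI) (V xJ) (V xC)) s' \<noteq> 0 \<longleftrightarrow> eact E U P i j c"
          using view_eactE[of A E U P h s' "V xI" "V xJ" "V xC"] i j c xi by simp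
        note pu = cond_push[OF _ _ _ this, of xI xJ xC]
        show "run ?p3 s' 5 (\<lambda>s''. s'' xC 0 = c \<and> trips s'' = trips s' \<union> (if eact E U P i j c then {(i, j, c)} else {}) \<and>
            s'' zM 0 = s' zM 0 + (if eact E U P i j c then 1 else 0))"
          by (rule run_mono[OF pu]) (use c(3) xi in \<open>simp_all add: agr_def\<close>)
      qed (use xA sub2 in \<open>auto simp: mp\<close>)
      then show "run (For xC (V xA) ?p3) s2 (A * (5 + 2) + 2) (\<lambda>s'. s' xJ 0 = j \<and> trips s' = trips s2 \<union> (\<Union>c<A. if eact E U P i j c then {(i, j, c)} else {}) \<and>
         s' zM 0 = s2 zM 0 + (\<Sum>c<A. if eact E U P i j c then 1 else 0))"
        by (rule run_mono) (use j(3) in \<open>auto simp: agr_def\<close>)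
    qed (use xA sub in \<open>auto simp: mp\<close>)
    then show "run (For xJ (V xA) (For xC (V xA) ?p3)) s (A * ((A * (5 + 2) + 2) + 2) + 2) (\<lambda>s'. s' xI 0 = i \<and> trips s' = trips s \<union> ?F3 i \<and>
       s' zM 0 = s zM 0 + (\<Sum>j<A. \<Sum>c<A. if eact E U P i j c then 1 else 0))"
      by (rule run_mono) (use i(3) in \<open>auto simp: agr_def\<close>)
  qed (use xA agr_trans[OF s1] in \<open>auto simp: mp\<close>)
  let ?T1 = "A * (5 + 2) + 2" and ?T2 = "A * ((A * (5 + 2) + 2) + 2) + 2" and ?T3 = "A * ((A * ((A * (5 + 2) + 2) + 2) + 2) + 2) + 2"
  let ?Q = "\<lambda>s. agr listM s0 s \<and> trips s = state_trips A E U P \<and>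
    s zM 0 = card {a. a < A \<and> U a} + card {(a, b). a < A \<and> b < A \<and> pact U P a b} +
      (\<Sum>a<A. card {(b, c). b < A \<and> c < A \<and> eact E U P a b c})"
  let ?s = "put s0 zM 0 0"
  have a0: "agr listM s0 ?s" by simp
  have "run (For xI (V xA) ?p1 ;; For xI (V xA) (For xJ (V xA) ?p2) ;; For xI (V xA) (For xJ (V xA) (For xC (V xA) ?p3))) ?s (?T1 + (?T2 + ?T3)) ?Q"
  proof (rule run_Sq, rule run_mono[OF L1[OF a0] le_refl])
    fix s1 assume s1: "agr listM ?s s1 \<and> trips s1 = trips ?s \<union> (\<Union>i<A. ?F1 i) \<and> s1 zM 0 = ?s zM 0 + (\<Sum>i<A. if U i then 1 else 0)"
    then have a1: "agr listM s0 s1" using agr_trans[OF a0] by blast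
    show "run (For xI (V xA) (For xJ (V xA) ?p2) ;; For xI (V xA) (For xJ (V xA) (For xC (V xA) ?p3))) s1 (?T2 + ?T3) ?Q"
    proof (rule run_Sq, rule run_mono[OF L2[OF a1] le_refl])
      fix s2 assume s2: "agr listM s1 s2 \<and> trips s2 = trips s1 \<union> (\<Union>i<A. ?F2 i) \<and> s2 zM 0 = s1 zM 0 + (\<Sum>i<A. \<Sum>j<A. if pact U P i j then 1 else 0)"
      then have a2: "agr listM s0 s2" using agr_trans[OF a1] by blast
      show "run (For xI (V xA) (For xJ (V xA) (For xC (V xA) ?p3))) s2 ?T3 ?Q"
      proof (rule run_mono[OF L3[OF a2] le_refl])
        fix s3 assume s3: "agr listM s2 s3 \<and> trips s3 = trips s2 \<union> (\<Union>i<A. ?F3 i) \<and> s3 zM 0 = s2 zM 0 + (\<Sum>i<A. \<Sum>j<A. \<Sum>c<A. if eact E U P i j c then 1 else 0)"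
        have "trips ?s = {}" by (simp add: trips_def)
        then have "trips s3 = state_trips A E U P" using s1 s2 s3 unfolding state_trips_def by simp
        moreover have "s3 zM 0 = (\<Sum>i<A. if U i then 1 else 0) + (\<Sum>i<A. \<Sum>j<A. if pact U P i j then 1 else 0) + (\<Sum>i<A. \<Sum>j<A. \<Sum>c<A. if eact E U P i j c then 1 else 0)"
          using s1 s2 s3 by simp
        moreover have "agr listM s0 s3" using agr_trans[OF a2] s3 by blast
        ultimately show "?Q s3" by (simp only: card_as_sum card_pairs)
      qed
    qed
  qed
  then have "run list_com s0 (1 + (?T1 + (?T2 + ?T3))) ?Q" unfolding list_com_def by (auto elim!: run_mono)
  then show ?thesis by (rule run_mono) (simp_all add: algebra_simps)
qed

lemma mem_state_trips: "(x, y, z) \<in> state_trips A E U P \<longleftrightarrow> x < A \<and> U x \<and> y = x \<and> z = x \<or>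
    x < A \<and> y < A \<and> pact U P x y \<and> z = y \<or> x < A \<and> y < A \<and> z < A \<and> eact E U P x y z"
  unfolding state_trips_def by (auto split: if_splits)

lemma trips_sat:
  assumes "trips s = state_trips A E U P" "wf_state A th U P" "sym3 A E"
  shows "sat_state L E U P \<longleftrightarrow> (\<exists>\<beta>\<in>L. \<forall>c<s zM 0. \<beta> (s zL0 c) \<or> \<beta> (s zL1 c) \<or> \<beta> (s zL2 c))"
proof -
  have 1: "(\<forall>c<s zM 0. \<beta> (s zL0 c) \<or> \<beta> (s zL1 c) \<or> \<beta> (s zL2 c)) \<longleftrightarrow> (\<forall>x y z. (x, y, z) \<in> state_trips A E U P \<longrightarrow> \<beta> x \<or> \<beta> y \<or> \<beta> z)" for \<beta>
    unfolding assms(1)[symmetric] trips_def by blast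
  have lt: "\<And>a. U a \<Longrightarrow> a < A" "\<And>a b. pact U P a b \<Longrightarrow> a < A \<and> b < A" "\<And>a b c. eact E U P a b c \<Longrightarrow> a < A \<and> b < A \<and> c < A"
    using assms(2,3) unfolding wf_state_def sym3_def pact_def eact_def by blast+
  have 2: "(\<forall>x y z. (x, y, z) \<in> state_trips A E U P \<longrightarrow> \<beta> x \<or> \<beta> y \<or> \<beta> z) \<longleftrightarrow>
      (\<forall>a. U a \<longrightarrow> \<beta> a) \<and> (\<forall>a b. pact U P a b \<longrightarrow> \<beta> a \<or> \<beta> b) \<and> (\<forall>a b c. eact E U P a b c \<longrightarrow> \<beta> a \<or> \<beta> b \<or> \<beta> c)" for \<beta>
    unfolding mem_state_trips by (intro iffI conjI allI impI) (use lt in \<open>metis+\<close>)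
  show ?thesis unfolding 1 2 sat_active by blast
qed

lemma trips_lits: "trips s = state_trips A E U P \<Longrightarrow> c < s zM 0 \<Longrightarrow> s zL0 c < A \<and> s zL1 c < A \<and> s zL2 c < A"
proof -
  assume "trips s = state_trips A E U P" "c < s zM 0"
  then have "(s zL0 c, s zL1 c, s zL2 c) \<in> state_trips A E U P" unfolding trips_def by auto
  then show ?thesis unfolding mem_state_trips by auto
qed

subsection \<open>Solving a leaf with the algorithm for scorpions\<close>

text \<open>Vertex \<open>v\<close> has the position \<open>zPos[v]\<close> and the index \<open>zIdx[v]\<close>. If it belongs to a clique, then the
  literals that it chooses are marked in \<open>zLit\<close> at \<open>zVB[v] + a\<close>, and the clauses from which it chooses
  start with the clause \<open>zBase[v]\<close>.\<close>

abbreviation (input) "zQ \<equiv> 68 :: nat"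
abbreviation (input) "zW \<equiv> 69 :: nat"
abbreviation (input) "zS \<equiv> 70 :: nat"
abbreviation (input) "zN \<equiv> 71 :: nat"
abbreviation (input) "zPos \<equiv> 72 :: nat"
abbreviation (input) "zIdx \<equiv> 73 :: nat"
abbreviation (input) "zT \<equiv> 74 :: nat"
abbreviation (input) "zBase \<equiv> 75 :: nat"
abbreviation (input) "zVB \<equiv> 76 :: nat"
abbreviation (input) "zOff \<equiv> 77 :: nat"
abbreviation (input) "zX \<equiv> 78 :: nat"
abbreviation (input) "zLit \<equiv> 79 :: nat"
abbreviation (input) "zV \<equiv> 80 :: nat"
abbreviation (input) "zY \<equiv> 81 :: nat"
abbreviation (input) "zH \<equiv> 82 :: nat"
abbreviation (input) "zK \<equiv> 83 :: nat"
abbreviation (input) "zU \<equiv> 84 :: nat"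
abbreviation (input) "zCl \<equiv> 85 :: nat"
abbreviation (input) "zRes \<equiv> 86 :: nat"

text \<open>Repeated subtraction of \<open>g\<close> computes the quotient \<open>q\<close> of the
  number of clauses by \<open>g\<close>, rounded up, and two doublings per round yield
  \<open>4 ^ q\<close>.\<close>

definition power_com :: "nat \<Rightarrow> wcom" where
  "power_com g = zS ::= V zM ;; zQ ::= Cn 0 ;; zW ::= Cn 1 ;;
     WhileC (V zS) (zS ::= Mi (V zS) (Cn g) ;; incr zQ ;; zW ::= Pl (V zW) (V zW) ;; zW ::= Pl (V zW) (V zW))"

lemma mods_power_com [simp]: "mods (power_com g) = {zS, zQ, zW}"
  by (auto simp: power_com_def)

lemma run_power_com:
  assumes g: "1 \<le> g"
  shows "run (power_com g) s0 (5 * s0 zM 0 + 4) (\<lambda>s. agr {zS, zQ, zW} s0 s \<and> s zW 0 = 4 ^ s zQ 0 \<and>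
    s0 zM 0 \<le> g * s zQ 0 \<and> g * s zQ 0 < s0 zM 0 + g)"
proof -
  let ?M = "s0 zM 0"
  define I where "I s \<longleftrightarrow> s zW 0 = 4 ^ s zQ 0 \<and> (if s zS 0 = 0 then ?M \<le> g * s zQ 0 \<and> g * s zQ 0 < ?M + g else ?M = s zS 0 + g * s zQ 0)" for s :: st
  have "run (power_com g) s0 (3 + (5 * ?M + 1)) (\<lambda>s. I s \<and> s zS 0 = 0)"
    unfolding power_com_def
  proof (simp, rule run_While[where I = I and B = "\<lambda>s. 5 * s zS 0 + 1"])
    fix s assume s: "I s" "wval (V zS) s \<noteq> 0"
    then have e: "?M = s zS 0 + g * s zQ 0" "s zS 0 \<noteq> 0" "s zW 0 = 4 ^ s zQ 0" by (auto simp: I_def)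
    show "\<exists>T. run (zS ::= Mi (V zS) (Cn g) ;; incr zQ ;; zW ::= Pl (V zW) (V zW) ;; zW ::= Pl (V zW) (V zW)) s T
        (\<lambda>s'. I s' \<and> 5 * s' zS 0 + 1 + T + 1 \<le> 5 * s zS 0 + 1)"
      by (rule exI[of _ 4]) (use e g in \<open>auto simp: I_def\<close>)
  qed (use g in \<open>auto simp: I_def\<close>)
  from run_agr[OF this order_refl, unfolded mods_power_com] show ?thesis
    by (rule run_mono) (auto simp: I_def)
qed

primrec mulE :: "nat \<Rightarrow> wexp \<Rightarrow> wexp" where
  "mulE 0 e = Cn 0"
| "mulE (Suc n) e = Pl e (mulE n e)"

lemma wval_mulE [simp]: "wval (mulE n e) s = n * wval e s"
  by (induction n) auto

definition size_exp :: "nat \<Rightarrow> nat \<Rightarrow> nat \<Rightarrow> wexp" where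
  "size_exp g r p = (if p = 0 then Cn r else if isT g p then V zW else Cn 1)"

definition vert_com :: "nat \<Rightarrow> nat \<Rightarrow> nat \<Rightarrow> wcom" where
  "vert_com g r p = For zX (size_exp g r p) (Wr zPos (V zN) (Cn p) ;; Wr zIdx (V zN) (V zX) ;;
     Wr zT (V zN) (Cn (if isT g p then 1 else 0)) ;; Wr zBase (V zN) (mulE (p div 3) (V zQ)) ;;
     Wr zVB (V zN) (V zOff) ;; zOff ::= Pl (V zOff) (V xA) ;; incr zN)"

text \<open>The positions depend only on the fixed \<open>k\<close>, so the loop over them is
  unrolled into the program text; thereby \<open>p div 3\<close> and the test for cliques are
  constants of the program.\<close>

primrec verts_com :: "nat \<Rightarrow> nat \<Rightarrow> nat \<Rightarrow> wcom" where
  "verts_com g r 0 = (zN ::= Cn 0 ;; zOff ::= Cn 0)"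
| "verts_com g r (Suc p) = verts_com g r p ;; vert_com g r p"

abbreviation (input) "vertM \<equiv> {zX, zPos, zIdx, zT, zBase, zVB, zOff, zN}"

lemma mods_vert_com [simp]: "mods (vert_com g r p) = vertM"
  by (auto simp: vert_com_def)

lemma mods_verts_com: "mods (verts_com g r p) \<subseteq> vertM"
  by (induction p) auto

text \<open>The stage of the construction at which all positions below \<open>p\<close> and the
  first \<open>x\<close> vertices of position \<open>p\<close> exist.\<close>

definition placed :: "nat \<Rightarrow> nat \<Rightarrow> nat \<Rightarrow> nat \<Rightarrow> nat \<Rightarrow> st \<Rightarrow> nat \<Rightarrow> nat \<Rightarrow> bool" where
  "placed g r w q A s p x \<longleftrightarrow>
     bij_betw (\<lambda>v. (s zPos v, s zIdx v)) {..<s zN 0} {(p', x'). p' < p \<and> x' < sz g r w p' \<or> p' = p \<and> x' < x} \<and>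
     (\<forall>v<s zN 0. (s zT v \<noteq> 0 \<longleftrightarrow> isT g (s zPos v)) \<and> s zBase v = s zPos v div 3 * q \<and> s zVB v = v * A) \<and>
     s zOff 0 = s zN 0 * A"

lemma bij_betw_extend:
  assumes "bij_betw f {..<n} S" "y \<notin> S" "\<And>v. v < n \<Longrightarrow> f' v = f v" "f' n = y"
  shows "bij_betw f' {..<Suc n} (insert y S)"
proof -
  have "bij_betw f' {..<n} S" using assms(1,3) by (subst bij_betw_cong[where g = f]) auto
  then have "bij_betw f' (insert n {..<n}) (insert y S)"
    using assms(2,4) notIn_Un_bij_betw[of n "{..<n}" f' S] by simp
  then show ?thesis by (simp add: lessThan_Suc)
qed

lemma run_vert_com:
  assumes p: "placed g r w q A s0 p 0" and c: "s0 xA 0 = A" "s0 zW 0 = w" "s0 zQ 0 = q"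
  shows "run (vert_com g r p) s0 (sz g r w p * (7 + 2) + 2) (\<lambda>s. agr vertM s0 s \<and> placed g r w q A s (Suc p) 0)"
proof -
  have "run (vert_com g r p) s0 (sz g r w p * (7 + 2) + 2) (\<lambda>s. agr vertM s0 s \<and> placed g r w q A s p (sz g r w p))"
    unfolding vert_com_def
  proof (rule run_for)
    fix i s assume i: "i < sz g r w p" "agr vertM s0 s" "s zX 0 = i" "placed g r w q A s p i"
    have e: "s xA 0 = A" "s zQ 0 = q" using i(2) c by (auto simp: agr_def)
    have S: "{(p', x'). p' < p \<and> x' < sz g r w p' \<or> p' = p \<and> x' < Suc i} =
        insert (p, i) {(p', x'). p' < p \<and> x' < sz g r w p' \<or> p' = p \<and> x' < i}"
      by (auto simp: less_Suc_eq)
    show "run (Wr zPos (V zN) (Cn p) ;; Wr zIdx (V zN) (V zX) ;;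
       Wr zT (V zN) (Cn (if isT g p then 1 else 0)) ;; Wr zBase (V zN) (mulE (p div 3) (V zQ)) ;;
       Wr zVB (V zN) (V zOff) ;; zOff ::= Pl (V zOff) (V xA) ;; incr zN) s 7 (\<lambda>s'. s' zX 0 = i \<and> placed g r w q A s' p (Suc i))"
      using i(3,4) e unfolding placed_def S
      by (auto simp: less_Suc_eq intro!: bij_betw_extend)
  next
    fix s assume "agr vertM s0 s"
    then show "wval (size_exp g r p) s = sz g r w p" using c by (auto simp: size_exp_def sz_def agr_def)
  qed (use p in \<open>auto simp: placed_def\<close>)
  then show ?thesis
  proof (rule run_mono)
    fix s assume s: "agr vertM s0 s \<and> placed g r w q A s p (sz g r w p)"
    have "{(p', x'). p' < p \<and> x' < sz g r w p' \<or> p' = p \<and> x' < sz g r w p} = {(p', x'). p' < Suc p \<and> x' < sz g r w p' \<or> p' = Suc p \<and> x' < 0}"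
      by (auto simp: less_Suc_eq)
    then show "agr vertM s0 s \<and> placed g r w q A s (Suc p) 0" using s by (simp add: placed_def)
  qed simp
qed

lemma run_verts_com:
  assumes c: "s0 xA 0 = A" "s0 zW 0 = w" "s0 zQ 0 = q" and w: "1 \<le> w"
  shows "run (verts_com g r p) s0 (p * ((r + w) * 9 + 2) + 2) (\<lambda>s. agr vertM s0 s \<and> placed g r w q A s p 0)"
proof (induction p)
  case 0
  show ?case by (simp add: placed_def bij_betw_def)
next
  case (Suc p)
  have "sz g r w p \<le> r + w" using w by (simp add: sz_def)
  have "run (verts_com g r (Suc p)) s0 ((p * ((r + w) * 9 + 2) + 2) + (sz g r w p * (7 + 2) + 2)) (\<lambda>s. agr vertM s0 s \<and> placed g r w q A s (Suc p) 0)"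
    unfolding verts_com.simps
  proof (rule run_Sq, rule run_mono[OF Suc le_refl])
    fix s assume s: "agr vertM s0 s \<and> placed g r w q A s p 0"
    show "run (vert_com g r p) s (sz g r w p * (7 + 2) + 2) (\<lambda>s. agr vertM s0 s \<and> placed g r w q A s (Suc p) 0)"
    proof (rule run_mono[OF run_vert_com le_refl])
      show "placed g r w q A s p 0" using s by simp
      show "s xA 0 = A" "s zW 0 = w" "s zQ 0 = q" using s c by (auto simp: agr_def)
    qed (use s in \<open>auto elim: agr_trans\<close>)
  qed
  then show ?case by (rule run_mono) (use \<open>sz g r w p \<le> r + w\<close> in \<open>auto simp: algebra_simps\<close>)
qed

lemma placed_layout: "placed g r w q A s (l + 3) 0 \<Longrightarrow> layout l g r w (s zN 0) (s zPos) (s zIdx)"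
proof -
  assume p: "placed g r w q A s (l + 3) 0"
  have "{(p', x'). p' < l + 3 \<and> x' < sz g r w p' \<or> p' = l + 3 \<and> x' < (0::nat)} = {(p, x). p \<le> l + 2 \<and> x < sz g r w p}"
    by auto
  then show ?thesis using p by (simp add: placed_def layout_def)
qed

lemma layout_size:
  assumes "layout l g r w N pos idx" "1 \<le> w"
  shows "N \<le> (l + 3) * (r + w)"
proof -
  have "N = card {(p, x). p \<le> l + 2 \<and> x < sz g r w p}"
    using bij_betw_same_card assms(1) unfolding layout_def by fastforce
  also have "{(p, x). p \<le> l + 2 \<and> x < sz g r w p} = Sigma {..l + 2} (\<lambda>p. {..<sz g r w p})" by auto
  also have "card \<dots> = (\<Sum>p\<le>l + 2. sz g r w p)" by simp
  also have "\<dots> \<le> (\<Sum>p\<le>l + 2. r + w)" by (rule sum_mono) (use assms(2) in \<open>simp add: sz_def\<close>)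
  finally show ?thesis by (simp add: eval_nat_numeral)
qed

definition lit_row_com :: wcom where
  "lit_row_com = For xI (V xA) (Wr zLit (Pl (Rd zVB (V zV)) (V xI)) (Cn 0)) ;;
     IfC (Rd zT (V zV)) (zY ::= Rd zIdx (V zV) ;; zK ::= Rd zBase (V zV) ;;
       For xJ (V zQ) (zH ::= Hf (V zY) ;;
         IfC (Mi (V zM) (V zK))
           (IfC (Mi (V zH) (Pl (Hf (V zH)) (Hf (V zH)))) (Wr zLit (Pl (Rd zVB (V zV)) (Rd zL2 (V zK))) (Cn 1))
             (IfC (Mi (V zY) (Pl (V zH) (V zH))) (Wr zLit (Pl (Rd zVB (V zV)) (Rd zL1 (V zK))) (Cn 1))
               (Wr zLit (Pl (Rd zVB (V zV)) (Rd zL0 (V zK))) (Cn 1)))) Skp ;;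
         zY ::= Hf (V zH) ;; incr zK)) Skp"

abbreviation (input) "rowM \<equiv> {xI, zLit, zY, zK, xJ, zH}"

lemma mods_lit_row_com [simp]: "mods lit_row_com = rowM"
  by (auto simp: lit_row_com_def)

text \<open>The higher bit of the digit already selects the third literal; the lower bit separates
  the other two.\<close>

lemma base4_digit:
  fixes y :: nat
  shows "lit_of L0 L1 L2 c (y mod 4) = (if y div 2 - (y div 2 div 2 + y div 2 div 2) \<noteq> 0 then L2 c
    else if y - (y div 2 + y div 2) \<noteq> 0 then L1 c else L0 c)"
proof -
  have "y mod 4 = 2 * (y div 2 mod 2) + y mod 2" using mod_mult2_eq[of y 2 2] by simp
  moreover have "y div 2 - (y div 2 div 2 + y div 2 div 2) = y div 2 mod 2" "y - (y div 2 + y div 2) = y mod 2"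
    by (auto simp: minus_mult_div_eq_mod[symmetric] mult_2)
  moreover have "y div 2 mod 2 = 0 \<or> y div 2 mod 2 = 1" "y mod 2 = 0 \<or> y mod 2 = 1" by auto
  ultimately show ?thesis unfolding lit_of_def by auto
qed

lemma run_lit_row_com:
  assumes c: "s0 xA 0 = A" "s0 zQ 0 = q" "s0 zM 0 = M" "s0 zV 0 = v" "s0 zVB v = v * A" "s0 zBase v = i * q"
  shows "run lit_row_com s0 (3 * A + 9 * q + 7) (\<lambda>s. agr rowM s0 s \<and> (\<forall>x<v * A. s zLit x = s0 zLit x) \<and>
    (\<forall>a<A. s zLit (v * A + a) \<noteq> 0 \<longleftrightarrow> s0 zT v \<noteq> 0 \<and> chosen q M (s0 zL0) (s0 zL1) (s0 zL2) i (s0 zIdx v) a))"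
proof -
  let ?c1 = "For xI (V xA) (Wr zLit (Pl (Rd zVB (V zV)) (V xI)) (Cn 0))"
  let ?b = "zH ::= Hf (V zY) ;;
         IfC (Mi (V zM) (V zK))
           (IfC (Mi (V zH) (Pl (Hf (V zH)) (Hf (V zH)))) (Wr zLit (Pl (Rd zVB (V zV)) (Rd zL2 (V zK))) (Cn 1))
             (IfC (Mi (V zY) (Pl (V zH) (V zH))) (Wr zLit (Pl (Rd zVB (V zV)) (Rd zL1 (V zK))) (Cn 1))
               (Wr zLit (Pl (Rd zVB (V zV)) (Rd zL0 (V zK))) (Cn 1)))) Skp ;;
         zY ::= Hf (V zH) ;; incr zK"
  let ?c2 = "IfC (Rd zT (V zV)) (zY ::= Rd zIdx (V zV) ;; zK ::= Rd zBase (V zV) ;; For xJ (V zQ) ?b) Skp"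
  let ?old = "\<lambda>s. \<forall>x<v * A. s zLit x = s0 zLit x"
  let ?lit = "\<lambda>j. lit_of (s0 zL0) (s0 zL1) (s0 zL2) (i * q + j) (dig 4 (s0 zIdx v) j)"
  let ?Q = "\<lambda>s. ?old s \<and> (\<forall>a<A. s zLit (v * A + a) \<noteq> 0 \<longleftrightarrow> s0 zT v \<noteq> 0 \<and> chosen q M (s0 zL0) (s0 zL1) (s0 zL2) i (s0 zIdx v) a)"
  have 1: "run ?c1 s0 (A * (1 + 2) + 2) (\<lambda>s. agr {xI, zLit} s0 s \<and> ?old s \<and> (\<forall>a<A. s zLit (v * A + a) = 0))"
  proof (rule run_for[where I = "\<lambda>i s. ?old s \<and> (\<forall>a<i. s zLit (v * A + a) = 0)"])
    fix i s assume i: "i < A" "agr {xI, zLit} s0 s" "s xI 0 = i" "?old s \<and> (\<forall>a<i. s zLit (v * A + a) = 0)"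
    have "s zV 0 = v" "s zVB v = v * A" using i(2) c by (auto simp: agr_def)
    then show "run (Wr zLit (Pl (Rd zVB (V zV)) (V xI)) (Cn 0)) s 1 (\<lambda>s'. s' xI 0 = i \<and> ?old s' \<and> (\<forall>a<Suc i. s' zLit (v * A + a) = 0))"
      using i by (auto simp: less_Suc_eq)
  qed (use c in \<open>auto simp: agr_def\<close>)
  define J where "J j s \<longleftrightarrow> ?old s \<and> s zY 0 = s0 zIdx v div 4 ^ j \<and> s zK 0 = i * q + j \<and>
    (\<forall>a<A. s zLit (v * A + a) \<noteq> 0 \<longleftrightarrow> (\<exists>j'<j. i * q + j' < M \<and> a = ?lit j'))" for j and s :: st
  have 2: "run (For xJ (V zQ) ?b) s1 (q * (7 + 2) + 2) (\<lambda>s. agr {xJ, zH, zLit, zY, zK} s1 s \<and> J q s)"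
    if s1: "agr {xI, zLit, zY, zK} s0 s1" "J 0 s1" for s1
  proof (rule run_for)
    fix j s assume j: "j < q" "agr {xJ, zH, zLit, zY, zK} s1 s" "s xJ 0 = j" "J j s"
    have e: "s zV 0 = v" "s zVB v = v * A" "s zM 0 = M" "s zL0 = s0 zL0" "s zL1 = s0 zL1" "s zL2 = s0 zL2"
      using j(2) s1(1) c by (auto simp: agr_def)
    have J: "?old s" "s zY 0 = s0 zIdx v div 4 ^ j" "s zK 0 = i * q + j"
      "\<And>a. a < A \<Longrightarrow> s zLit (v * A + a) \<noteq> 0 \<longleftrightarrow> (\<exists>j'<j. i * q + j' < M \<and> a = ?lit j')" using j(4) by (auto simp: J_def)
    let ?y = "s0 zIdx v div 4 ^ j"
    have lit: "?lit j = (if ?y div 2 - (?y div 2 div 2 + ?y div 2 div 2) \<noteq> 0 then s0 zL2 (i * q + j)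
      else if ?y - (?y div 2 + ?y div 2) \<noteq> 0 then s0 zL1 (i * q + j) else s0 zL0 (i * q + j))"
      unfolding dig_def by (rule base4_digit)
    have y4: "?y div 2 div 2 = s0 zIdx v div 4 ^ Suc j" by (simp add: div_mult2_eq[symmetric] mult.commute)
    let ?h = "put s zH 0 (?y div 2)"
    let ?s = "if M - (i * q + j) \<noteq> 0 then put ?h zLit (v * A + ?lit j) 1 else ?h"
    have run: "run ?b s 7 Q" if "Q (put (put ?s zY 0 (?y div 2 div 2)) zK 0 (Suc (i * q + j)))" for Q
      using that unfolding lit by (auto simp: e J(2,3) split: if_splits)
    have "J (Suc j) (put (put ?s zY 0 (?y div 2 div 2)) zK 0 (Suc (i * q + j)))"
      unfolding J_def using J(1,4) by (auto simp: less_Suc_eq y4)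
    then show "run ?b s 7 (\<lambda>s'. s' xJ 0 = j \<and> J (Suc j) s')"
      using j(3) by (intro run) auto
  next
    fix s assume "agr {xJ, zH, zLit, zY, zK} s1 s"
    then show "wval (V zQ) s = q" using s1(1) c by (auto simp: agr_def)
  qed (use s1 in \<open>auto simp: J_def\<close>)
  have "run lit_row_com s0 ((A * (1 + 2) + 2) + (1 + (2 + (q * (7 + 2) + 2)))) ?Q"
    unfolding lit_row_com_def
  proof (rule run_Sq, rule run_mono[OF 1 le_refl])
    fix s assume s: "agr {xI, zLit} s0 s \<and> ?old s \<and> (\<forall>a<A. s zLit (v * A + a) = 0)"
    have e: "s zV 0 = v" "s zT v = s0 zT v" "s zIdx v = s0 zIdx v" "s zBase v = i * q" using s c by (auto simp: agr_def)
    show "run ?c2 s (1 + (2 + (q * (7 + 2) + 2))) ?Q"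
    proof (cases "s0 zT v = 0")
      case True
      then show ?thesis using s e by simp
    next
      case False
      let ?s = "put (put s zY 0 (s0 zIdx v)) zK 0 (i * q)"
      have "agr {xI, zLit, zY, zK} s0 ?s" using s by (auto simp: agr_def)
      moreover have "J 0 ?s" using s by (simp add: J_def)
      ultimately have "run (For xJ (V zQ) ?b) ?s (q * (7 + 2) + 2) (\<lambda>s. agr {xJ, zH, zLit, zY, zK} ?s s \<and> J q s)" by (rule 2)
      then have "run (For xJ (V zQ) ?b) ?s (q * (7 + 2) + 2) ?Q"
        by (rule run_mono) (use False in \<open>auto simp: J_def chosen_def\<close>)
      then show ?thesis using False e by simp
    qed
  qed
  from run_agr[OF this order_refl, unfolded mods_lit_row_com] show ?thesis
    by (rule run_mono) (auto simp: algebra_simps)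
qed

definition lits_com :: wcom where
  "lits_com = For zV (V zN) lit_row_com"

lemma mods_lits_com [simp]: "mods lits_com = insert zV rowM"
  by (simp add: lits_com_def)

lemma run_lits_com:
  assumes p: "placed g r w q A s0 p 0" and c: "s0 xA 0 = A" "s0 zQ 0 = q" "s0 zM 0 = M"
  shows "run lits_com s0 (s0 zN 0 * (3 * A + 9 * q + 9) + 2) (\<lambda>s. agr (insert zV rowM) s0 s \<and>
    (\<forall>v<s0 zN 0. \<forall>a<A. s zLit (v * A + a) \<noteq> 0 \<longleftrightarrow> isT g (s0 zPos v) \<and>
       chosen q M (s0 zL0) (s0 zL1) (s0 zL2) (s0 zPos v div 3) (s0 zIdx v) a))"
proof -
  let ?ok = "\<lambda>v a. isT g (s0 zPos v) \<and> chosen q M (s0 zL0) (s0 zL1) (s0 zL2) (s0 zPos v div 3) (s0 zIdx v) a"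
  have "run lits_com s0 (s0 zN 0 * ((3 * A + 9 * q + 7) + 2) + 2) (\<lambda>s. agr (insert zV rowM) s0 s \<and>
    (\<forall>v<s0 zN 0. \<forall>a<A. s zLit (v * A + a) \<noteq> 0 \<longleftrightarrow> ?ok v a))"
    unfolding lits_com_def
  proof (rule run_for[where I = "\<lambda>v s. \<forall>v'<v. \<forall>a<A. s zLit (v' * A + a) \<noteq> 0 \<longleftrightarrow> ?ok v' a"])
    fix v s assume v: "v < s0 zN 0" "agr (insert zV rowM) s0 s" "s zV 0 = v" "\<forall>v'<v. \<forall>a<A. s zLit (v' * A + a) \<noteq> 0 \<longleftrightarrow> ?ok v' a"
    have e: "s xA 0 = A" "s zQ 0 = q" "s zM 0 = M" "s zVB v = v * A" "s zBase v = s0 zPos v div 3 * q" "s zT v \<noteq> 0 \<longleftrightarrow> isT g (s0 zPos v)"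
      "s zL0 = s0 zL0" "s zL1 = s0 zL1" "s zL2 = s0 zL2" "s zIdx = s0 zIdx"
      using v(1,2) c p by (auto simp: agr_def placed_def)
    from run_lit_row_com[OF e(1-3) v(3) e(4,5)]
    show "run lit_row_com s (3 * A + 9 * q + 7) (\<lambda>s'. s' zV 0 = v \<and> (\<forall>v'<Suc v. \<forall>a<A. s' zLit (v' * A + a) \<noteq> 0 \<longleftrightarrow> ?ok v' a))"
    proof (rule run_mono[OF _ le_refl])
      fix s' assume s': "agr rowM s s' \<and> (\<forall>x<v * A. s' zLit x = s zLit x) \<and>
        (\<forall>a<A. s' zLit (v * A + a) \<noteq> 0 \<longleftrightarrow> s zT v \<noteq> 0 \<and> chosen q M (s zL0) (s zL1) (s zL2) (s0 zPos v div 3) (s zIdx v) a)"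
      have "s' zLit (v' * A + a) = s zLit (v' * A + a)" if "v' < v" "a < A" for v' a
        using s' old_index[OF that] by simp
      then show "s' zV 0 = v \<and> (\<forall>v'<Suc v. \<forall>a<A. s' zLit (v' * A + a) \<noteq> 0 \<longleftrightarrow> ?ok v' a)"
        using s' v(3,4) e by (auto simp: less_Suc_eq agr_def)
    qed
  qed (auto simp: agr_def)
  then show ?thesis by (rule run_mono) auto
qed

definition clashE :: wexp where
  "clashE = w_and (Pl (Rd zLit (Pl (Rd zVB (V zU)) (Pl (V xI) (V xI)))) (Rd zLit (Pl (Rd zVB (V zV)) (Pl (V xI) (V xI)))))
     (Pl (Rd zLit (Pl (Rd zVB (V zU)) (Pl (V xI) (Pl (V xI) (Cn 1))))) (Rd zLit (Pl (Rd zVB (V zV)) (Pl (V xI) (Pl (V xI) (Cn 1))))))"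

definition entry_com :: wcom where
  "entry_com = zCl ::= Cn 0 ;;
     IfC (w_and (Rd zT (V zU)) (Rd zT (V zV)))
       (IfC (w_eq (Rd zPos (V zU)) (Rd zPos (V zV))) (zCl ::= w_not (w_eq (Rd zIdx (V zU)) (Rd zIdx (V zV))))
          (For xI (V xN) (IfC clashE (incr zCl) Skp))) Skp ;;
     IfC (Pl (V zCl) (Pl (w_eq (Rd zPos (V zU)) (Pl (Rd zPos (V zV)) (Cn 1))) (w_eq (Rd zPos (V zV)) (Pl (Rd zPos (V zU)) (Cn 1)))))
       (zCl ::= Cn 1) Skp"

lemma mods_entry_com [simp]: "mods entry_com = {zCl, xI}"
  by (auto simp: entry_com_def)

definition coded :: "nat \<Rightarrow> nat \<Rightarrow> nat \<Rightarrow> nat \<Rightarrow> st \<Rightarrow> bool" where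
  "coded n g q N s \<longleftrightarrow> s xN 0 = n \<and> s zN 0 = N \<and>
     (\<forall>v<N. (s zT v \<noteq> 0 \<longleftrightarrow> isT g (s zPos v)) \<and> s zVB v = v * (2 * n) \<and>
       (\<forall>a<2 * n. s zLit (v * (2 * n) + a) \<noteq> 0 \<longleftrightarrow> isT g (s zPos v) \<and>
          chosen q (s zM 0) (s zL0) (s zL1) (s zL2) (s zPos v div 3) (s zIdx v) a))"

abbreviation (input) "conf_of n q s \<equiv> \<lambda>i x j y. clash n (chosen q (s zM 0) (s zL0) (s zL1) (s zL2) i x) (chosen q (s zM 0) (s zL0) (s zL1) (s zL2) j y)"

lemma run_entry_com:
  assumes c: "coded n g q N s0" and uv: "s0 zU 0 = u" "s0 zV 0 = v" "u < N" "v < N"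
  shows "run entry_com s0 (n * 4 + 7) (\<lambda>s. agr {zCl, xI} s0 s \<and>
    s zCl 0 = (if adjp g (conf_of n q s0) (s0 zPos u) (s0 zIdx u) (s0 zPos v) (s0 zIdx v) then 1 else 0))"
proof -
  let ?c3 = "IfC (Pl (V zCl) (Pl (w_eq (Rd zPos (V zU)) (Pl (Rd zPos (V zV)) (Cn 1))) (w_eq (Rd zPos (V zV)) (Pl (Rd zPos (V zU)) (Cn 1)))))
       (zCl ::= Cn 1) Skp"
  let ?b = "For xI (V xN) (IfC clashE (incr zCl) Skp)"
  let ?cf = "conf_of n q s0 (s0 zPos u div 3) (s0 zIdx u) (s0 zPos v div 3) (s0 zIdx v)"
  let ?Q = "\<lambda>s. s zCl 0 = (if adjp g (conf_of n q s0) (s0 zPos u) (s0 zIdx u) (s0 zPos v) (s0 zIdx v) then 1 else 0)"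
  let ?s = "put s0 zCl 0 0"
  have T: "s0 zT u \<noteq> 0 \<longleftrightarrow> isT g (s0 zPos u)" "s0 zT v \<noteq> 0 \<longleftrightarrow> isT g (s0 zPos v)" using c uv by (auto simp: coded_def)
  have "run entry_com s0 (1 + (1 + (1 + ((n * 4 + 2) + 2)))) ?Q"
  proof (cases "s0 zT u \<noteq> 0 \<and> s0 zT v \<noteq> 0 \<and> s0 zPos u \<noteq> s0 zPos v")
    case False
    then show ?thesis using T uv unfolding entry_com_def by (auto simp: adjp_def)
  next
    case True
    then have t: "isT g (s0 zPos u)" "isT g (s0 zPos v)" using T by auto
    have "run ?b ?s (n * 4 + 2) (\<lambda>s. agr {xI, zCl} ?s s \<and> s zCl 0 = ?s zCl 0 + card {i. i < n \<and>
       (s0 zLit (u * (2 * n) + 2 * i) \<noteq> 0 \<or> s0 zLit (v * (2 * n) + 2 * i) \<noteq> 0) \<and>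
       (s0 zLit (u * (2 * n) + (2 * i + 1)) \<noteq> 0 \<or> s0 zLit (v * (2 * n) + (2 * i + 1)) \<noteq> 0)})"
    proof (rule run_for_count)
      fix s assume "agr {xI, zCl} ?s s"
      then show "wval (V xN) s = n" using c by (auto simp: coded_def agr_def)
    next
      fix i s assume i: "i < n" "agr {xI, zCl} ?s s" "s xI 0 = i"
      have "s zLit = s0 zLit" "s zVB u = u * (2 * n)" "s zVB v = v * (2 * n)" "s zU 0 = u" "s zV 0 = v"
        using i(2) c uv by (auto simp: coded_def agr_def)
      then show "wval clashE s \<noteq> 0 \<longleftrightarrow> (s0 zLit (u * (2 * n) + 2 * i) \<noteq> 0 \<or> s0 zLit (v * (2 * n) + 2 * i) \<noteq> 0) \<and>
         (s0 zLit (u * (2 * n) + (2 * i + 1)) \<noteq> 0 \<or> s0 zLit (v * (2 * n) + (2 * i + 1)) \<noteq> 0)"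
        using i(3) by (simp add: clashE_def mult_2)
    qed auto
    moreover have "card {i. i < n \<and> (s0 zLit (u * (2 * n) + 2 * i) \<noteq> 0 \<or> s0 zLit (v * (2 * n) + 2 * i) \<noteq> 0) \<and>
       (s0 zLit (u * (2 * n) + (2 * i + 1)) \<noteq> 0 \<or> s0 zLit (v * (2 * n) + (2 * i + 1)) \<noteq> 0)} \<noteq> 0 \<longleftrightarrow> ?cf"
    proof -
      have "s0 zLit (u * (2 * n) + a) \<noteq> 0 \<longleftrightarrow> chosen q (s0 zM 0) (s0 zL0) (s0 zL1) (s0 zL2) (s0 zPos u div 3) (s0 zIdx u) a"
        "s0 zLit (v * (2 * n) + a) \<noteq> 0 \<longleftrightarrow> chosen q (s0 zM 0) (s0 zL0) (s0 zL1) (s0 zL2) (s0 zPos v div 3) (s0 zIdx v) a" if "a < 2 * n" for a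
        using c uv t that by (auto simp: coded_def)
      note l = this
      have "((s0 zLit (u * (2 * n) + 2 * i) \<noteq> 0 \<or> s0 zLit (v * (2 * n) + 2 * i) \<noteq> 0) \<and>
         (s0 zLit (u * (2 * n) + (2 * i + 1)) \<noteq> 0 \<or> s0 zLit (v * (2 * n) + (2 * i + 1)) \<noteq> 0)) \<longleftrightarrow>
         (chosen q (s0 zM 0) (s0 zL0) (s0 zL1) (s0 zL2) (s0 zPos u div 3) (s0 zIdx u) (2 * i) \<or>
          chosen q (s0 zM 0) (s0 zL0) (s0 zL1) (s0 zL2) (s0 zPos v div 3) (s0 zIdx v) (2 * i)) \<and>
         (chosen q (s0 zM 0) (s0 zL0) (s0 zL1) (s0 zL2) (s0 zPos u div 3) (s0 zIdx u) (2 * i + 1) \<or>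
          chosen q (s0 zM 0) (s0 zL0) (s0 zL1) (s0 zL2) (s0 zPos v div 3) (s0 zIdx v) (2 * i + 1))" if "i < n" for i
      proof -
        have "2 * i < 2 * n" "2 * i + 1 < 2 * n" using that by auto
        then show ?thesis by (simp only: l)
      qed
      then show ?thesis unfolding clash_def by (subst card_0_eq, simp, blast)
    qed
    ultimately have "run (?b ;; ?c3) ?s ((n * 4 + 2) + 2) ?Q"
    proof (intro run_Sq, elim run_mono[OF _ le_refl])
      fix s assume s: "agr {xI, zCl} ?s s \<and> s zCl 0 = ?s zCl 0 + card {i. i < n \<and>
       (s0 zLit (u * (2 * n) + 2 * i) \<noteq> 0 \<or> s0 zLit (v * (2 * n) + 2 * i) \<noteq> 0) \<and>
       (s0 zLit (u * (2 * n) + (2 * i + 1)) \<noteq> 0 \<or> s0 zLit (v * (2 * n) + (2 * i + 1)) \<noteq> 0)}"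
        and cf: "card {i. i < n \<and> (s0 zLit (u * (2 * n) + 2 * i) \<noteq> 0 \<or> s0 zLit (v * (2 * n) + 2 * i) \<noteq> 0) \<and>
       (s0 zLit (u * (2 * n) + (2 * i + 1)) \<noteq> 0 \<or> s0 zLit (v * (2 * n) + (2 * i + 1)) \<noteq> 0)} \<noteq> 0 \<longleftrightarrow> ?cf"
      have "s zCl 0 \<noteq> 0 \<longleftrightarrow> ?cf" using s cf by simp
      moreover have "s zPos = s0 zPos" "s zU 0 = u" "s zV 0 = v" using s uv by (auto simp: agr_def)
      ultimately show "run ?c3 s 2 ?Q" using True t by (auto simp: adjp_def)
    qed
    then show ?thesis using True uv unfolding entry_com_def by simp
  qed
  from run_agr[OF this order_refl, unfolded mods_entry_com] show ?thesis
    by (rule run_mono) auto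
qed

definition matrix_com :: wcom where
  "matrix_com = For zU (V zN) (For zV (V zN) (entry_com ;; vput (V zK) (V zCl) ;; incr zK))"

abbreviation (input) "matM \<equiv> {zU, zV, zCl, xI, zK, 10, 11}"

lemma mods_matrix_com [simp]: "mods matrix_com = matM"
  by (auto simp: matrix_com_def vput_def)

text \<open>The simulated memory while the graph is written into it. Cells behind the written part
  carry older stamps and so count as zero, as the input convention demands.\<close>

definition stored :: "nat \<Rightarrow> (nat \<Rightarrow> nat \<Rightarrow> bool) \<Rightarrow> nat list \<Rightarrow> nat \<Rightarrow> nat \<Rightarrow> st \<Rightarrow> bool" where
  "stored N R hs ver K s \<longleftrightarrow> s 12 0 = ver \<and> s zK 0 = 3 + K \<and> (\<forall>x<3. s 10 x = hs ! x \<and> s 11 x = ver) \<and>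
     (\<forall>x<K. s 11 (3 + x) = ver \<and> s 10 (3 + x) = (if R (x div N) (x mod N) then 1 else 0)) \<and> (\<forall>x\<ge>3 + K. s 11 x < ver)"

lemma stored_put: "stored N R hs ver K s \<Longrightarrow> x \<notin> {10, 11, 12, zK} \<Longrightarrow> stored N R hs ver K (put s x i a)"
  by (simp add: stored_def)

lemma run_matrix_com:
  assumes c: "coded n g q N s0" and st: "stored N R hs ver 0 s0"
    and R: "\<And>u v. u < N \<Longrightarrow> v < N \<Longrightarrow> R u v \<longleftrightarrow> adjp g (conf_of n q s0) (s0 zPos u) (s0 zIdx u) (s0 zPos v) (s0 zIdx v)"
  shows "run matrix_com s0 (N * (N * (n * 4 + 12) + 4) + 2) (\<lambda>s. agr matM s0 s \<and> stored N R hs ver (N * N) s)"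
proof -
  let ?b = "entry_com ;; vput (V zK) (V zCl) ;; incr zK"
  have "run matrix_com s0 (N * ((N * (((n * 4 + 7) + 3) + 2) + 2) + 2) + 2) (\<lambda>s. agr matM s0 s \<and> stored N R hs ver (N * N) s)"
    unfolding matrix_com_def
  proof (rule run_for[where I = "\<lambda>u s. stored N R hs ver (u * N) s"])
    fix u s assume u: "u < N" "agr matM s0 s" "s zU 0 = u" "stored N R hs ver (u * N) s"
    have "run (For zV (V zN) ?b) s (N * (((n * 4 + 7) + 3) + 2) + 2) (\<lambda>s'. agr {zV, zCl, xI, zK, 10, 11} s s' \<and> stored N R hs ver (u * N + N) s')"
    proof (rule run_for[where I = "\<lambda>v s. stored N R hs ver (u * N + v) s"])
      fix v s1 assume v: "v < N" "agr {zV, zCl, xI, zK, 10, 11} s s1" "s1 zV 0 = v" "stored N R hs ver (u * N + v) s1"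
      have ag: "agr matM s0 s1" by (rule agr_trans[OF u(2) agr_mono[OF v(2)]]) auto
      have c1: "coded n g q N s1" using c ag unfolding coded_def by (auto simp: agr_def)
      have zU: "s1 zU 0 = u" using v(2) u(3) by (auto simp: agr_def)
      have "run entry_com s1 (n * 4 + 7) (\<lambda>s. agr {zCl, xI} s1 s \<and>
        s zCl 0 = (if adjp g (conf_of n q s1) (s1 zPos u) (s1 zIdx u) (s1 zPos v) (s1 zIdx v) then 1 else 0))"
        by (rule run_entry_com[OF c1 zU v(3) u(1) v(1)])
      moreover have "adjp g (conf_of n q s1) (s1 zPos u) (s1 zIdx u) (s1 zPos v) (s1 zIdx v) \<longleftrightarrow> R u v"
        unfolding R[OF u(1) v(1)] using ag by (simp add: agr_def)
      ultimately have en: "run entry_com s1 (n * 4 + 7) (\<lambda>s. agr {zCl, xI} s1 s \<and> s zCl 0 = (if R u v then 1 else 0))" by simp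
      show "run ?b s1 ((n * 4 + 7) + 3) (\<lambda>s'. s' zV 0 = v \<and> stored N R hs ver (u * N + Suc v) s')"
      proof (rule run_Sq, rule run_mono[OF en le_refl])
        fix s2 assume s2: "agr {zCl, xI} s1 s2 \<and> s2 zCl 0 = (if R u v then 1 else 0)"
        then have e: "s2 zK = s1 zK" "s2 10 = s1 10" "s2 11 = s1 11" "s2 12 = s1 12" "s2 zV = s1 zV" by (auto simp: agr_def)
        have dm: "(u * N + v) div N = u" "(u * N + v) mod N = v" using v(1) by auto
        show "run (vput (V zK) (V zCl) ;; incr zK) s2 3 (\<lambda>s'. s' zV 0 = v \<and> stored N R hs ver (u * N + Suc v) s')"
          using v(3,4) s2 e dm unfolding stored_def vput_def by (auto simp: less_Suc_eq)
      qed
    next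
      fix s1 assume "agr {zV, zCl, xI, zK, 10, 11} s s1"
      then show "wval (V zN) s1 = N" using u(2) c by (auto simp: agr_def coded_def)
    qed (use u in \<open>auto simp: vput_def intro!: stored_put\<close>)
    then show "run (For zV (V zN) ?b) s (N * (((n * 4 + 7) + 3) + 2) + 2) (\<lambda>s'. s' zU 0 = u \<and> stored N R hs ver (Suc u * N) s')"
      by (rule run_mono) (use u(3) in \<open>auto simp: agr_def add.commute\<close>)
  next
    fix s1 assume "agr matM s0 s1"
    then show "wval (V zN) s1 = N" using c by (auto simp: agr_def coded_def)
  qed (use st in \<open>auto simp: vput_def intro!: stored_put\<close>)
  then show ?thesis by (rule run_mono) (auto simp: algebra_simps)
qed

text \<open>Increasing the version discards in one step whatever an earlier run of \<open>p\<close>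
  left behind, wherever it was written.\<close>

definition leaf_com :: "instr list \<Rightarrow> nat \<Rightarrow> nat \<Rightarrow> nat \<Rightarrow> nat \<Rightarrow> wcom" where
  "leaf_com p g l k h = power_com g ;; verts_com g (k - l - 2) (l + 3) ;; lits_com ;; incr 12 ;;
     vput (Cn 0) (V zN) ;; vput (Cn 1) (Cn k) ;; vput (Cn 2) (Cn h) ;; zK ::= Cn 3 ;; matrix_com ;;
     13 ::= Cn 0 ;; interp p ;; vget zRes (Cn 0) ;; IfC (V zRes) (xFound ::= Cn 1) Skp"

abbreviation (input) "leafM \<equiv> {10, 11, 12, 13, 14, 15, xFound, zS, zQ, zW, zX, zPos, zIdx, zT, zBase, zVB, zOff, zN,
  zV, xI, zLit, zY, zK, xJ, zH, zU, zCl, zRes}"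

lemma mods_leaf_com: "mods (leaf_com p g l k h) \<subseteq> leafM"
  using mods_verts_com[of g "k - l - 2" "l + 3"] mods_interp[of p] unfolding leaf_com_def vput_def vget_def by auto

text \<open>\<open>Z\<close> bounds literals, clauses and vertices alike, so everything except the
  simulated run is of order \<open>Z * Z * Z\<close>: quadratically many matrix entries, each with a
  scan over the variables.\<close>

lemma run_leaf_com:
  assumes lk: "1 \<le> l" "l + 4 \<le> k" "f k = l" and gl: "3 * g \<le> l + 1" "2 \<le> g"
    and c: "s0 xN 0 = n" "s0 xA 0 = 2 * n" and stamps: "\<And>x. s0 11 x \<le> s0 12 0"
    and lits: "\<And>c. c < s0 zM 0 \<Longrightarrow> s0 zL0 c < 2 * n \<and> s0 zL1 c < 2 * n \<and> s0 zL2 c < 2 * n"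
    and Z: "2 * n \<le> Z" "s0 zM 0 \<le> Z" "\<And>q. g * q < s0 zM 0 + g \<Longrightarrow> (l + 3) * (k - l - 2 + 4 ^ q) \<le> Z"
    and orc: "\<And>N G. 1 \<le> N \<Longrightarrow> N \<le> Z \<Longrightarrow> simple_graph G \<Longrightarrow> verts G = {..<N} \<Longrightarrow>
      \<exists>t pc m. t \<le> T \<and> (step p ^^ t) (0, nth0 ([N, k, h] @ adj_matrix N G)) = (pc, m) \<and> length p \<le> pc \<and>
        m 0 = num_IndSub (Psi f) G k"
  shows "run (leaf_com p g l k h) s0 (100 * (Z * Z * Z) + T * (length p + 9)) (\<lambda>s. agr leafM s0 s \<and> (\<forall>x. s 11 x \<le> s 12 0) \<and>
    (s xFound 0 \<noteq> 0 \<longleftrightarrow> s0 xFound 0 \<noteq> 0 \<or> (\<exists>\<beta>\<in>litass n. \<forall>c<s0 zM 0. \<beta> (s0 zL0 c) \<or> \<beta> (s0 zL1 c) \<or> \<beta> (s0 zL2 c))))"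
proof -
  let ?M = "s0 zM 0"
  let ?found = "\<lambda>s. (\<forall>x. s 11 x \<le> s 12 0) \<and>
    (s xFound 0 \<noteq> 0 \<longleftrightarrow> s0 xFound 0 \<noteq> 0 \<or> (\<exists>\<beta>\<in>litass n. \<forall>c<s0 zM 0. \<beta> (s0 zL0 c) \<or> \<beta> (s0 zL1 c) \<or> \<beta> (s0 zL2 c)))"
  let ?r = "k - l - 2"
  let ?c5 = "13 ::= Cn 0 ;; interp p ;; vget zRes (Cn 0) ;; IfC (V zRes) (xFound ::= Cn 1) Skp"
  let ?c4 = "incr 12 ;; vput (Cn 0) (V zN) ;; vput (Cn 1) (Cn k) ;; vput (Cn 2) (Cn h) ;; zK ::= Cn 3 ;; matrix_com ;; ?c5"
  let ?T5 = "1 + ((T * (length p + 9) + 1) + 4)"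
  let ?T4 = "\<lambda>N. 8 + ((N * (N * (n * 4 + 12) + 4) + 2) + ?T5)"
  let ?T3 = "\<lambda>N q. (N * (3 * (2 * n) + 9 * q + 9) + 2) + ?T4 N"
  let ?B = "1 + (Z * (Z * (2 * Z + 12) + 4) + 2) + (Z * (3 * Z + 9 * Z + 9) + 2) + 8 + (9 * Z + 2 * (l + 3) + 2) + (5 * Z + 4) + ?T5"
  have "run (leaf_com p g l k h) s0 ((5 * ?M + 4) + ((9 * Z + 2 * (l + 3) + 2) + ?T3 Z Z)) ?found"
    unfolding leaf_com_def
  proof (rule run_Sq, rule run_mono[OF run_power_com le_refl])
    fix s1 assume s1: "agr {zS, zQ, zW} s0 s1 \<and> s1 zW 0 = 4 ^ s1 zQ 0 \<and> ?M \<le> g * s1 zQ 0 \<and> g * s1 zQ 0 < ?M + g"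
    define q where "q = s1 zQ 0"
    have q: "s1 zQ 0 = q" "s1 zW 0 = 4 ^ q" "?M \<le> g * q" "g * q < ?M + g" using s1 by (auto simp: q_def)
    have qZ: "q \<le> Z"
    proof -
      \<comment> \<open>Rounding up can exceed the quotient only by less than one, so already
        \<open>g \<ge> 2\<close> keeps \<open>q\<close> below the number of clauses.\<close>
      have "q \<le> ?M"
      proof (rule ccontr)
        assume "\<not> q \<le> ?M"
        then have "g * Suc ?M \<le> g * q" by (intro mult_le_mono2) simp
        moreover have "?M \<le> g * ?M" using gl by simp
        ultimately show False using q(4) by simp
      qed
      then show ?thesis using Z(2) by simp
    qed
    have c1: "s1 xA 0 = 2 * n" using s1 c by (auto simp: agr_def)
    have w1: "1 \<le> (4::nat) ^ q" by simp
    have T2: "(l + 3) * ((?r + 4 ^ q) * 9 + 2) + 2 \<le> 9 * Z + 2 * (l + 3) + 2"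
      using Z(3)[OF q(4)] by (simp add: algebra_simps)
    show "run (verts_com g ?r (l + 3) ;; lits_com ;; ?c4) s1 ((9 * Z + 2 * (l + 3) + 2) + ?T3 Z Z) ?found"
    proof (rule run_Sq, rule run_mono[OF run_verts_com[where ?s0.0 = s1 and q = q, OF c1 q(2) q(1) w1] T2])
      fix s2 assume s2: "agr vertM s1 s2 \<and> placed g ?r (4 ^ q) q (2 * n) s2 (l + 3) 0"
      define N where "N = s2 zN 0"
      have lay: "layout l g ?r (4 ^ q) N (s2 zPos) (s2 zIdx)" using placed_layout[of g ?r "4 ^ q" q "2 * n" s2 l] s2 by (simp only: N_def)
      have NZ: "N \<le> Z" using layout_size[OF lay w1] Z(3)[OF q(4)] by simp
      have N1: "1 \<le> N"
      proof (rule ccontr)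
        assume "\<not> 1 \<le> N"
        then have "{(p, x). p \<le> l + 2 \<and> x < sz g ?r (4 ^ q) p} = {}" using lay by (auto simp: layout_def bij_betw_def)
        moreover have "(1, 0) \<in> {(p, x). p \<le> l + 2 \<and> x < sz g ?r (4 ^ q) p}" by (simp add: sz_def isT_def)
        ultimately show False by blast
      qed
      have e2: "s2 xA 0 = 2 * n" "s2 zQ 0 = q" "s2 zM 0 = ?M" "s2 xN 0 = n" "s2 zL0 = s0 zL0" "s2 zL1 = s0 zL1" "s2 zL2 = s0 zL2"
        "s2 11 = s0 11" "s2 12 = s0 12" "s2 xFound = s0 xFound"
        using s1 s2 c q by (auto simp: agr_def)
      note lc = run_lits_com[where ?s0.0 = s2 and q = q and M = ?M, OF conjunct2[OF s2] e2(1-3), folded N_def]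
      define G where "G = formula_graph n g q ?M (s0 zL0) (s0 zL1) (s0 zL2) N (s2 zPos) (s2 zIdx)"
      note G = formula_graph_correct[where f = f and M = ?M and ?L0.0 = "s0 zL0" and ?L1.0 = "s0 zL1" and ?L2.0 = "s0 zL2", OF lk gl q(3) lits lay, folded G_def]
      have adjG: "adj G u v \<longleftrightarrow> adjp g (conf_of n q s2) (s2 zPos u) (s2 zIdx u) (s2 zPos v) (s2 zIdx v)" if "u < N" "v < N" for u v
      proof -
        interpret reduction l g ?r "4 ^ q" N "conf_of n q s2" "s2 zPos" "s2 zIdx"
          by unfold_locales (use lk gl lay in \<open>auto simp: clash_def\<close>)
        show ?thesis using adj_G[of u v] that unfolding G_def formula_graph_def e2 by simp
      qed
      have T3: "?T3 N q \<le> ?T3 Z Z"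
        using NZ qZ by (intro add_mono mult_le_mono) auto
      have "run (lits_com ;; ?c4) s2 (?T3 N q) ?found"
      proof (rule run_Sq, rule run_mono[OF lc le_refl])
        fix s3 assume s3: "agr (insert zV rowM) s2 s3 \<and> (\<forall>v<N. \<forall>a<2 * n. s3 zLit (v * (2 * n) + a) \<noteq> 0 \<longleftrightarrow> isT g (s2 zPos v) \<and>
          chosen q ?M (s2 zL0) (s2 zL1) (s2 zL2) (s2 zPos v div 3) (s2 zIdx v) a)"
        let ?s = "s3(12 := (s3 12)(0 := Suc (s3 12 0)), 10 := (s3 10)(0 := N, 1 := k, 2 := h),
           11 := (s3 11)(0 := Suc (s3 12 0), 1 := Suc (s3 12 0), 2 := Suc (s3 12 0)), zK := (s3 zK)(0 := 3))"
        let ?R = "adj G"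
        have e3: "s3 zN 0 = N" "s3 xN 0 = n" "s3 zM 0 = ?M" "s3 zL0 = s2 zL0" "s3 zL1 = s2 zL1" "s3 zL2 = s2 zL2" "s3 zPos = s2 zPos"
          "s3 zIdx = s2 zIdx" "s3 zT = s2 zT" "s3 zVB = s2 zVB" "s3 11 = s0 11" "s3 12 = s0 12" "s3 xFound = s0 xFound"
          using s3 e2 N_def by (auto simp: agr_def)
        have cod: "coded n g q N ?s"
          using s3 s2 unfolding coded_def placed_def by (simp add: e3 N_def)
        have sto: "stored N ?R [N, k, h] (Suc (s3 12 0)) 0 ?s"
        proof -
          have "x < 3 \<longleftrightarrow> x = 0 \<or> x = 1 \<or> x = 2" for x :: nat by auto
          then show ?thesis using stamps by (auto simp: stored_def e3 le_imp_less_Suc)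
        qed
        have RR: "?R u v \<longleftrightarrow> adjp g (conf_of n q ?s) (?s zPos u) (?s zIdx u) (?s zPos v) (?s zIdx v)" if "u < N" "v < N" for u v
          using adjG[OF that] by (simp add: e3 e2(3))
        have m: "run (matrix_com ;; ?c5) ?s ((N * (N * (n * 4 + 12) + 4) + 2) + ?T5) ?found"
        proof (rule run_Sq, rule run_mono[OF run_matrix_com[OF cod sto RR] le_refl])
          fix s4 assume s4: "agr matM ?s s4 \<and> stored N ?R [N, k, h] (Suc (s3 12 0)) (N * N) s4"
          let ?s4 = "put s4 13 0 0"
          have xf: "s4 xFound = s0 xFound" using s4 e3 by (auto simp: agr_def)
          have vm: "vmem ?s4 = nth0 ([N, k, h] @ adj_matrix N G)"
          proof
            fix x
            have st: "s4 12 0 = Suc (s3 12 0)" "\<And>x. x < 3 \<Longrightarrow> s4 10 x = [N, k, h] ! x \<and> s4 11 x = Suc (s3 12 0)"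
              "\<And>x. x < N * N \<Longrightarrow> s4 11 (3 + x) = Suc (s3 12 0) \<and> s4 10 (3 + x) = (if adj G (x div N) (x mod N) then 1 else 0)"
              "\<And>x. 3 + N * N \<le> x \<Longrightarrow> s4 11 x < Suc (s3 12 0)" using s4 by (auto simp: stored_def)
            show "vmem ?s4 x = nth0 ([N, k, h] @ adj_matrix N G) x"
              unfolding nth0_input[OF N1]
            proof (cases "x < 3")
              case False
              then obtain y where y: "x = 3 + y" using le_Suc_ex not_less by blast
              show "vmem ?s4 x = (if x < 3 then [N, k, h] ! x else if x < 3 + N * N \<and> adj G ((x - 3) div N) ((x - 3) mod N) then 1 else 0)"
                using st(1) st(3)[of y] st(4)[of x] y by (cases "y < N * N") (auto simp: vmem_def)
            qed (use st in \<open>auto simp: vmem_def\<close>)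
          qed
          obtain t pc m where t: "t \<le> T" "(step p ^^ t) (0, nth0 ([N, k, h] @ adj_matrix N G)) = (pc, m)" "length p \<le> pc"
              "m 0 = num_IndSub (Psi f) G k"
            using orc[OF N1 NZ G(1,2)] by blast
          have "(step p ^^ t) (?s4 13 0, vmem ?s4) = (pc, m)" using t(2) vm by simp
          note ri = run_interp[OF this t(3)]
          have sl: "s4 11 x \<le> s4 12 0" for x
          proof -
            consider "x < 3" | y where "x = 3 + y" "y < N * N" | "3 + N * N \<le> x"
              by (metis add_less_cancel_left le_Suc_ex not_less)
            then show ?thesis using s4 by cases (auto simp: stored_def)
          qed
          have "run (interp p ;; vget zRes (Cn 0) ;; IfC (V zRes) (xFound ::= Cn 1) Skp) ?s4 ((T * (length p + 9) + 1) + 4) ?found"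
          proof (rule run_Sq, rule run_mono[OF ri])
            fix s5 assume s5: "vmem s5 = m \<and> only_interp ?s4 s5"
            have e5: "s5 12 = s4 12" "s5 xFound = s0 xFound" "\<And>x. s5 11 x \<le> s4 12 0"
              using s5 xf sl unfolding only_interp_def by (auto, metis le_refl)
            show "run (vget zRes (Cn 0) ;; IfC (V zRes) (xFound ::= Cn 1) Skp) s5 4 ?found"
              using e5 s5 t(4) G(3) by (auto simp: run_vget_Sq)
          qed (use t(1) in simp)
          then show "run ?c5 s4 ?T5 ?found" by simp
        qed
        have "?s = put (put (put (put (put (put (put (put s3 12 0 (Suc (s3 12 0))) 10 0 N) 11 0 (Suc (s3 12 0))) 10 1 k) 11 1 (Suc (s3 12 0))) 10 2 h) 11 2 (Suc (s3 12 0))) zK 0 3"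
          by (auto simp: fun_eq_iff)
        then have "run ?c4 s3 (8 + ((N * (N * (n * 4 + 12) + 4) + 2) + ?T5)) ?found"
          using m e3(1) by (simp add: vput_def)
        then show "run ?c4 s3 (?T4 N) ?found" .
      qed
      then show "run (lits_com ;; ?c4) s2 (?T3 Z Z) ?found" by (rule run_mono) (use T3 in auto)
    qed
  qed (use gl in simp)
  from run_agr[OF this mods_leaf_com] show ?thesis
  proof (rule run_mono)
    have Zl: "l + 3 \<le> Z"
    proof -
      have "g * 0 < ?M + g" using gl by simp
      from Z(3)[OF this] show ?thesis by (rule le_trans[rotated]) simp
    qed
    have ZZ: "Z \<le> Z * Z" "Z * Z \<le> Z * Z * Z" "1 \<le> Z" using Zl by auto
    have "n * 4 \<le> 2 * Z" using Z(1) by simp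
    then have "Z * (Z * (n * 4 + 12) + 4) + 2 \<le> Z * (Z * (2 * Z + 12) + 4) + 2"
      by (intro add_mono[OF mult_le_mono[OF le_refl add_mono[OF mult_le_mono[OF le_refl add_mono[OF _ le_refl]] le_refl]] le_refl])
    also have "\<dots> = 2 * (Z * Z * Z) + 12 * (Z * Z) + 4 * Z + 2" by (simp add: algebra_simps)
    finally have 1: "Z * (Z * (n * 4 + 12) + 4) + 2 \<le> 2 * (Z * Z * Z) + 12 * (Z * Z) + 4 * Z + 2" .
    have "3 * (2 * n) \<le> 3 * Z" using Z(1) by simp
    then have "Z * (3 * (2 * n) + 9 * Z + 9) + 2 \<le> Z * (3 * Z + 9 * Z + 9) + 2"
      by (intro add_mono[OF mult_le_mono[OF le_refl add_mono[OF add_mono[OF _ le_refl] le_refl]] le_refl])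
    also have "\<dots> = 12 * (Z * Z) + 9 * Z + 2" by (simp add: algebra_simps)
    finally have 2: "Z * (3 * (2 * n) + 9 * Z + 9) + 2 \<le> 12 * (Z * Z) + 9 * Z + 2" .
    have lin: "5 * m + 4 + (9 * Z + 2 * (l + 3) + 2 + (Y + (8 + (X + (1 + (t + 1 + 4)))))) \<le> 100 * c + t"
      if "X \<le> 2 * c + 12 * b + 4 * Z + 2" "Y \<le> 12 * b + 9 * Z + 2" "l + 3 \<le> Z" "Z \<le> b" "b \<le> c" "1 \<le> Z" "m \<le> Z"
      for X Y m t b c :: nat using that by simp
    show "(5 * ?M + 4) + ((9 * Z + 2 * (l + 3) + 2) + ?T3 Z Z) \<le> 100 * (Z * Z * Z) + T * (length p + 9)"
      by (rule lin[OF 1 2 Zl ZZ Z(2)])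
  qed auto
qed

subsection \<open>The branching process\<close>

definition step_com :: "instr list \<Rightarrow> nat \<Rightarrow> nat \<Rightarrow> nat \<Rightarrow> nat \<Rightarrow> nat \<Rightarrow> wcom" where
  "step_com p th g l k h = find_com th ;; IfC (V xTyp) branch_com (list_com ;; leaf_com p g l k h) ;;
     incr xHead ;; xHU ::= Pl (V xHU) (V xA) ;; xHP ::= Pl (V xHP) (V xAA)"

definition work_com :: "instr list \<Rightarrow> nat \<Rightarrow> nat \<Rightarrow> nat \<Rightarrow> nat \<Rightarrow> nat \<Rightarrow> wcom" where
  "work_com p th g l k h = WhileC (Mi (V xTail) (V xHead)) (step_com p th g l k h)"

definition Uof :: "nat \<Rightarrow> st \<Rightarrow> nat \<Rightarrow> nat \<Rightarrow> bool" where
  "Uof A s j a \<longleftrightarrow> a < A \<and> s yU (j * A + a) \<noteq> 0"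

definition Pof :: "nat \<Rightarrow> st \<Rightarrow> nat \<Rightarrow> nat \<Rightarrow> nat \<Rightarrow> bool" where
  "Pof A s j a b \<longleftrightarrow> a < A \<and> b < A \<and> s yP (j * (A * A) + (a * A + b)) \<noteq> 0"

lemma of_upd [simp]: "x \<noteq> yU \<Longrightarrow> Uof A (s(x := g)) j = Uof A s j" "x \<noteq> yP \<Longrightarrow> Pof A (s(x := g)) j = Pof A s j"
  by (simp_all add: Uof_def Pof_def fun_eq_iff)

lemma item_of: "item A s j (Uof A s j) (Pof A s j)"
  by (simp add: item_def Uof_def Pof_def)

lemma of_item: "item A s j U P \<Longrightarrow> wf_state A th U P \<Longrightarrow> Uof A s j = U \<and> Pof A s j = P"
  unfolding item_def wf_state_def Uof_def Pof_def by (auto simp: fun_eq_iff)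

lemma of_agr: "agr M s s' \<Longrightarrow> yU \<notin> M \<Longrightarrow> yP \<notin> M \<Longrightarrow> Uof A s' j = Uof A s j \<and> Pof A s' j = Pof A s j"
  by (simp add: agr_def Uof_def Pof_def fun_eq_iff)

lemma of_same_old:
  assumes "same_old A t s s'" "j < t"
  shows "Uof A s' j = Uof A s j \<and> Pof A s' j = Pof A s j"
proof -
  have "s' yU (j * A + a) = s yU (j * A + a)" if "a < A" for a
    using assms(1) old_index[OF assms(2) that] by (simp add: same_old_def)
  moreover have "s' yP (j * (A * A) + (a * A + b)) = s yP (j * (A * A) + (a * A + b))" if "a < A" "b < A" for a b
    using assms(1) old_index[OF assms(2) pair_index[OF that]] by (simp add: same_old_def)
  ultimately show ?thesis by (auto simp: Uof_def Pof_def fun_eq_iff)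
qed

locale leaf_solver =
  fixes f :: "nat \<Rightarrow> nat" and l k g h th n Z T :: nat and p :: "instr list" and E :: "nat \<Rightarrow> nat \<Rightarrow> nat \<Rightarrow> bool" and x :: real
  assumes lk: "1 \<le> l" "l + 4 \<le> k" "f k = l" and gl: "3 * g \<le> l + 1" "2 \<le> g"
    and n: "1 \<le> n" and E: "sym3 (2 * n) E" and th: "1 \<le> th"
    and x: "1 \<le> x" "x ^ (4 * th * th - 1) + 1 \<le> x ^ (4 * th * th)"
    and Z: "2 * n * (1 + th + 4 * th * th) \<le> Z"
      "\<And>q. g * q < 2 * n * (1 + th + 4 * th * th) + g \<Longrightarrow> (l + 3) * (k - l - 2 + 4 ^ q) \<le> Z"
    and orc: "\<And>N G. 1 \<le> N \<Longrightarrow> N \<le> Z \<Longrightarrow> simple_graph G \<Longrightarrow> verts G = {..<N} \<Longrightarrow>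
      \<exists>t pc m. t \<le> T \<and> (step p ^^ t) (0, nth0 ([N, k, h] @ adj_matrix N G)) = (pc, m) \<and> length p \<le> pc \<and>
        m 0 = num_IndSub (Psi f) G k"
begin

abbreviation "A \<equiv> 2 * n"
abbreviation "U s j \<equiv> Uof A s j"
abbreviation "P s j \<equiv> Pof A s j"

text \<open>\<open>sat\<close> is the answer for the whole formula, fixed in advance. Either a
  satisfiable leaf has been found or the answer is still present among the pending states.\<close>

definition inv :: "bool \<Rightarrow> st \<Rightarrow> bool" where
  "inv sat s \<longleftrightarrow> tables A E s \<and> s xN 0 = n \<and> s xHU 0 = s xHead 0 * A \<and> s xHP 0 = s xHead 0 * (A * A) \<and>
     s xTU 0 = s xTail 0 * A \<and> s xTP 0 = s xTail 0 * (A * A) \<and> (\<forall>x. s 11 x \<le> s 12 0) \<and>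
     (\<forall>j\<in>{s xHead 0..<s xTail 0}. wf_state A th (U s j) (P s j)) \<and>
     (sat \<longleftrightarrow> s xFound 0 \<noteq> 0 \<or> (\<exists>j\<in>{s xHead 0..<s xTail 0}. sat_state (litass n) E (U s j) (P s j)))"

text \<open>The potential of the queue: every step consumes at least one unit of it, so its initial
  value bounds the number of steps.\<close>

definition W :: "st \<Rightarrow> real" where
  "W s = (\<Sum>j\<in>{s xHead 0..<s xTail 0}. weight A th x (U s j) (P s j))"

definition Ts :: nat where
  "Ts = 250 * (Z * Z * Z) + T * (length p + 9)"

text \<open>A branching trades the weight of a state for those of its children, which leaves one
  unit for the step; a solved leaf gives up its own weight of at least one.\<close>

lemma run_step_com:
  assumes inv: "inv sat s" and pending: "s xHead 0 < s xTail 0"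
  shows "run (step_com p th g l k h) s Ts (\<lambda>s'. inv sat s' \<and> W s' + 1 \<le> W s)"
proof -
  define hd t where "hd = s xHead 0" and "t = s xTail 0"
  note I = inv[unfolded inv_def, folded hd_def t_def]
  let ?U = "U s hd" and ?P = "P s hd"
  have ht: "hd < t" using pending by (simp add: hd_def t_def)
  have A1: "1 \<le> A" using n by simp
  have AZ: "A \<le> Z" using Z(1) by (rule le_trans[rotated]) simp
  have wf: "wf_state A th ?U ?P" using I ht by auto
  have v: "view A E ?U ?P hd s" using I item_of by (simp add: view_def)
  let ?c3 = "incr xHead ;; xHU ::= Pl (V xHU) (V xA) ;; xHP ::= Pl (V xHP) (V xAA)"
  let ?Q = "\<lambda>s'. inv sat s' \<and> W s' + 1 \<le> W s"
  let ?TB = "6 * (A * A) + 14 * A + 14" and ?TL = "(7 * (A * A * A) + 11 * (A * A) + 15 * A + 7) + (100 * (Z * Z * Z) + T * (length p + 9))"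
  have split: "{hd..<t} = insert hd {Suc hd..<t}" using ht by auto
  have "run (step_com p th g l k h) s (60 * (A * A * A) + (1 + (?TB + ?TL + 3))) ?Q"
    unfolding step_com_def
  proof (rule run_Sq, rule run_mono[OF run_find_com[OF v A1 th] le_refl])
    fix s1 assume s1: "agr findM s s1 \<and> s1 xHa 0 < A \<and> s1 xHb 0 < A \<and>
      (s1 xTyp 0 = 0 \<and> leaf A th E ?U ?P \<or> s1 xTyp 0 \<noteq> 0 \<and> branch A th E ?U ?P (s1 xTyp 0) (s1 xHa 0) (s1 xHb 0))"
    have v1: "view A E ?U ?P hd s1" by (rule view_agr[OF v, of findM]) (use s1 in auto)
    have e1: "s1 xN = s xN" "s1 xHU = s xHU" "s1 xHP = s xHP" "s1 xTU = s xTU" "s1 xTP = s xTP" "s1 xHead = s xHead" "s1 xTail = s xTail"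
      "s1 11 = s 11" "s1 12 = s 12" "s1 xFound = s xFound" using s1 by (auto simp: agr_def)
    have o1: "U s1 j = U s j" "P s1 j = P s j" for j using s1 of_agr[of findM s s1 A j] by auto
    have tab1: "tables A E s1" using v1 by (simp add: view_def)
    show "run (IfC (V xTyp) branch_com (list_com ;; leaf_com p g l k h) ;; ?c3) s1 (1 + (?TB + ?TL + 3)) ?Q"
    proof (cases "s1 xTyp 0 = 0")
      case False
      then have br: "branch A th E ?U ?P (s1 xTyp 0) (s1 xHa 0) (s1 xHb 0)" using s1 by auto
      define ty ha hb where d1: "ty = s1 xTyp 0" and d2: "ha = s1 xHa 0" and d3: "hb = s1 xHb 0"
      note br = br[folded d1 d2 d3]
      note bw = branch_wf[OF br wf th E]
      have rb: "run branch_com s1 ?TB (\<lambda>s'. agr childM s1 s' \<and> same_old A t s1 s' \<and>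
        item A s' t (U0 ty ha ?U) (P0 ty ha hb ?P) \<and> item A s' (Suc t) (U1 ty ha hb E ?U ?P) (P1 ty ha E ?U ?P) \<and>
        s' xTU 0 = (t + 2) * A \<and> s' xTP 0 = (t + 2) * (A * A) \<and> s' xTail 0 = t + 2)"
        by (rule run_branch_com[OF v1 ht]) (use s1 I e1 in \<open>auto simp: d1 d2 d3 t_def\<close>)
      have "run (branch_com ;; ?c3) s1 (?TB + 3) ?Q"
      proof (rule run_Sq, rule run_mono[OF rb le_refl])
        fix s2 assume s2: "agr childM s1 s2 \<and> same_old A t s1 s2 \<and>
          item A s2 t (U0 ty ha ?U) (P0 ty ha hb ?P) \<and> item A s2 (Suc t) (U1 ty ha hb E ?U ?P) (P1 ty ha E ?U ?P) \<and>
          s2 xTU 0 = (t + 2) * A \<and> s2 xTP 0 = (t + 2) * (A * A) \<and> s2 xTail 0 = t + 2"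
        let ?s = "put (put (put s2 xHead 0 (Suc hd)) xHU 0 (Suc hd * A)) xHP 0 (Suc hd * (A * A))"
        have e2: "s2 xN = s xN" "s2 xHU = s xHU" "s2 xHP = s xHP" "s2 xHead = s xHead" "s2 11 = s 11" "s2 12 = s 12" "s2 xFound = s xFound"
          "s2 xA = s1 xA" "s2 xAA = s1 xAA" "s2 yR = s1 yR" "s2 yRR = s1 yRR" "s2 yE = s1 yE"
          using s2 e1 by (auto simp: agr_def)
        have o2: "U s2 j = U s j" "P s2 j = P s j" if "j < t" for j using of_same_old[of A t s1 s2 j] s2 that o1 by auto
        have ot: "U s2 t = U0 ty ha ?U" "P s2 t = P0 ty ha hb ?P" "U s2 (Suc t) = U1 ty ha hb E ?U ?P" "P s2 (Suc t) = P1 ty ha E ?U ?P"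
          using of_item s2 bw by blast+
        have tab: "tables A E ?s" using tab1 e2 by (simp add: tables_def)
        have rng: "{Suc hd..<t + 2} = insert t (insert (Suc t) {Suc hd..<t})" using ht by auto
        have wfs: "\<forall>j\<in>{Suc hd..<t + 2}. wf_state A th (U s2 j) (P s2 j)"
          unfolding rng using bw ot o2 I by auto
        have ex: "(\<exists>j\<in>{Suc hd..<t + 2}. sat_state (litass n) E (U s2 j) (P s2 j)) \<longleftrightarrow> (\<exists>j\<in>{hd..<t}. sat_state (litass n) E (U s j) (P s j))"
          unfolding rng split using sat_branch[OF br E, of "litass n"] ot o2 by auto
        have inv': "inv sat ?s"
          unfolding inv_def using I s2 e2 tab wfs ex by simp
        have "W ?s = weight A th x (U s2 t) (P s2 t) + weight A th x (U s2 (Suc t)) (P s2 (Suc t)) + (\<Sum>j\<in>{Suc hd..<t}. weight A th x (U s2 j) (P s2 j))"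
        proof -
          have "W ?s = (\<Sum>j\<in>{Suc hd..<t + 2}. weight A th x (U s2 j) (P s2 j))" unfolding W_def using s2 by simp
          then show ?thesis unfolding rng by simp
        qed
        also have "(\<Sum>j\<in>{Suc hd..<t}. weight A th x (U s2 j) (P s2 j)) = (\<Sum>j\<in>{Suc hd..<t}. weight A th x (U s j) (P s j))"
          by (rule sum.cong) (auto simp: o2)
        finally have W1: "W ?s = weight A th x (U0 ty ha ?U) (P0 ty ha hb ?P) + weight A th x (U1 ty ha hb E ?U ?P) (P1 ty ha E ?U ?P) +
          (\<Sum>j\<in>{Suc hd..<t}. weight A th x (U s j) (P s j))" unfolding ot .
        have "W s = weight A th x ?U ?P + (\<Sum>j\<in>{Suc hd..<t}. weight A th x (U s j) (P s j))"
          unfolding W_def hd_def[symmetric] t_def[symmetric] split by simp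
        then have "W ?s + 1 \<le> W s" using W1 weight_branch[OF br wf th E x] by linarith
        then show "run ?c3 s2 3 ?Q" using inv' e2 I tab1 by (simp add: tables_def hd_def[symmetric] add.commute)
      qed
      then have "run (branch_com ;; ?c3) s1 (?TB + ?TL + 3) ?Q" by (rule run_mono) auto
      then show ?thesis using False by simp
    next
      case True
      then have lf: "leaf A th E ?U ?P" using s1 by auto
      have rl: "run (list_com ;; leaf_com p g l k h) s1 ?TL (\<lambda>s'. agr (listM \<union> leafM) s1 s' \<and> (\<forall>x. s' 11 x \<le> s' 12 0) \<and>
         (s' xFound 0 \<noteq> 0 \<longleftrightarrow> s xFound 0 \<noteq> 0 \<or> sat_state (litass n) E ?U ?P))"
      proof (rule run_Sq, rule run_mono[OF run_list_com[OF v1] le_refl])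
        fix s2 assume s2: "agr listM s1 s2 \<and> trips s2 = state_trips A E ?U ?P \<and>
          s2 zM 0 = card {a. a < A \<and> ?U a} + card {(a, b). a < A \<and> b < A \<and> pact ?U ?P a b} +
            (\<Sum>a<A. card {(b, c). b < A \<and> c < A \<and> eact E ?U ?P a b c})"
        have M: "s2 zM 0 \<le> A * (1 + th + 4 * th * th)" using leaf_sparse[OF lf] s2 by simp
        have e2: "s2 xN 0 = n" "s2 xA 0 = A" "s2 11 = s 11" "s2 12 = s 12" "s2 xFound = s xFound"
          using s2 e1 I tab1 by (auto simp: agr_def tables_def)
        have "run (leaf_com p g l k h) s2 (100 * (Z * Z * Z) + T * (length p + 9)) (\<lambda>s. agr leafM s2 s \<and> (\<forall>x. s 11 x \<le> s 12 0) \<and>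
          (s xFound 0 \<noteq> 0 \<longleftrightarrow> s2 xFound 0 \<noteq> 0 \<or> (\<exists>\<beta>\<in>litass n. \<forall>c<s2 zM 0. \<beta> (s2 zL0 c) \<or> \<beta> (s2 zL1 c) \<or> \<beta> (s2 zL2 c))))"
        proof (rule run_leaf_com[where f = f and ?s0.0 = s2 and n = n and Z = Z, OF lk gl e2(1,2) _ _ AZ _ _ orc])
          show "s2 11 x \<le> s2 12 0" for x using I e2 by simp
          show "c < s2 zM 0 \<Longrightarrow> s2 zL0 c < A \<and> s2 zL1 c < A \<and> s2 zL2 c < A" for c using trips_lits s2 by blast
          show "s2 zM 0 \<le> Z" using M Z(1) by simp
          show "g * q < s2 zM 0 + g \<Longrightarrow> (l + 3) * (k - l - 2 + 4 ^ q) \<le> Z" for q using M Z(2)[of q] by simp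
        qed
        then show "run (leaf_com p g l k h) s2 (100 * (Z * Z * Z) + T * (length p + 9)) (\<lambda>s'. agr (listM \<union> leafM) s1 s' \<and> (\<forall>x. s' 11 x \<le> s' 12 0) \<and>
         (s' xFound 0 \<noteq> 0 \<longleftrightarrow> s xFound 0 \<noteq> 0 \<or> sat_state (litass n) E ?U ?P))"
        proof (rule run_mono[OF _ le_refl])
          fix s3 assume s3: "agr leafM s2 s3 \<and> (\<forall>x. s3 11 x \<le> s3 12 0) \<and>
            (s3 xFound 0 \<noteq> 0 \<longleftrightarrow> s2 xFound 0 \<noteq> 0 \<or> (\<exists>\<beta>\<in>litass n. \<forall>c<s2 zM 0. \<beta> (s2 zL0 c) \<or> \<beta> (s2 zL1 c) \<or> \<beta> (s2 zL2 c)))"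
          have "agr (listM \<union> leafM) s1 s3" by (rule agr_trans[OF agr_mono agr_mono]) (use s2 s3 in auto)
          moreover have "sat_state (litass n) E ?U ?P \<longleftrightarrow> (\<exists>\<beta>\<in>litass n. \<forall>c<s2 zM 0. \<beta> (s2 zL0 c) \<or> \<beta> (s2 zL1 c) \<or> \<beta> (s2 zL2 c))"
            using trips_sat[OF _ wf E] s2 by blast
          ultimately show "agr (listM \<union> leafM) s1 s3 \<and> (\<forall>x. s3 11 x \<le> s3 12 0) \<and>
            (s3 xFound 0 \<noteq> 0 \<longleftrightarrow> s xFound 0 \<noteq> 0 \<or> sat_state (litass n) E ?U ?P)" using s3 e2 by simp
        qed
      qed
      have "run ((list_com ;; leaf_com p g l k h) ;; ?c3) s1 (?TL + 3) ?Q"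
      proof (rule run_Sq, rule run_mono[OF rl le_refl])
        fix s2 assume s2: "agr (listM \<union> leafM) s1 s2 \<and> (\<forall>x. s2 11 x \<le> s2 12 0) \<and>
         (s2 xFound 0 \<noteq> 0 \<longleftrightarrow> s xFound 0 \<noteq> 0 \<or> sat_state (litass n) E ?U ?P)"
        let ?s = "put (put (put s2 xHead 0 (Suc hd)) xHU 0 (Suc hd * A)) xHP 0 (Suc hd * (A * A))"
        have e2: "s2 xN = s xN" "s2 xHU = s xHU" "s2 xHP = s xHP" "s2 xTU = s xTU" "s2 xTP = s xTP" "s2 xHead = s xHead" "s2 xTail = s xTail"
          "s2 xA = s1 xA" "s2 xAA = s1 xAA" "s2 yR = s1 yR" "s2 yRR = s1 yRR" "s2 yE = s1 yE" "s2 yU = s1 yU" "s2 yP = s1 yP"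
          using s2 e1 by (auto simp: agr_def)
        have os: "U s2 j = U s j" "P s2 j = P s j" for j using o1 by (auto simp: Uof_def Pof_def fun_eq_iff e2)
        have tab: "tables A E ?s" using tab1 e2 by (simp add: tables_def)
        have inv': "inv sat ?s"
          unfolding inv_def using I s2 e2 tab split t_def by (auto simp: os)
        have "W s = weight A th x ?U ?P + (\<Sum>j\<in>{Suc hd..<t}. weight A th x (U s j) (P s j))"
          unfolding W_def hd_def[symmetric] t_def[symmetric] split by simp
        moreover have "W ?s = (\<Sum>j\<in>{Suc hd..<t}. weight A th x (U s j) (P s j))"
          unfolding W_def using e2 t_def by (simp add: os)
        ultimately have "W ?s + 1 \<le> W s" using weight_ge[OF x(1), of A th ?U ?P] by linarith
        then show "run ?c3 s2 3 ?Q" using inv' e2 I tab1 by (simp add: tables_def hd_def[symmetric] add.commute)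
      qed
      then have "run ((list_com ;; leaf_com p g l k h) ;; ?c3) s1 (?TB + ?TL + 3) ?Q" by (rule run_mono) auto
      then show ?thesis using True by simp
    qed
  qed
  then show ?thesis
  proof (rule run_mono)
    have "A * A * A \<le> Z * Z * Z" "A * A \<le> Z * Z" by (intro mult_le_mono AZ)+
    moreover have "Z \<le> Z * Z" "Z * Z \<le> Z * Z * Z" "1 \<le> Z" using A1 AZ by auto
    moreover have "60 * a + (1 + (6 * b + 14 * A + 14 + (7 * a + 11 * b + 15 * A + 7 + (100 * d + u)) + 3)) \<le> 250 * d + u"
      if "a \<le> d" "b \<le> c" "Z \<le> c" "c \<le> d" "1 \<le> Z" for a b c d u :: nat using that AZ by linarith
    ultimately show "60 * (A * A * A) + (1 + (?TB + ?TL + 3)) \<le> Ts" unfolding Ts_def by blast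
  qed
qed

lemma run_work_com:
  assumes "inv sat s" "W s < real w"
  shows "run (work_com p th g l k h) s (w * (Ts + 1) + 1) (\<lambda>s. sat \<longleftrightarrow> s xFound 0 \<noteq> 0)"
  unfolding work_com_def
proof (rule run_While[where I = "inv sat" and B = "\<lambda>s. nat \<lfloor>W s\<rfloor> * (Ts + 1) + 1"])
  fix s assume s: "inv sat s" "wval (Mi (V xTail) (V xHead)) s \<noteq> 0"
  have "0 \<le> W s" for s unfolding W_def using weight_ge[OF x(1)] by (intro sum_nonneg) (metis order_trans zero_le_one)
  \<comment> \<open>Budgets are natural numbers, and a real decrease by one lowers the floor by
    one.\<close>
  then have fl: "Suc (nat \<lfloor>W s'\<rfloor>) \<le> nat \<lfloor>W s\<rfloor>" if "W s' + 1 \<le> W s" for s'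
    using that[THEN floor_mono] by (smt (verit) Suc_nat_eq_nat_zadd1 floor_add2 nat_mono one_add_floor zero_le_floor)
  show "\<exists>T'. run (step_com p th g l k h) s T' (\<lambda>s'. inv sat s' \<and> nat \<lfloor>W s'\<rfloor> * (Ts + 1) + 1 + T' + 1 \<le> nat \<lfloor>W s\<rfloor> * (Ts + 1) + 1)"
  proof (rule exI[of _ Ts], rule run_mono[OF run_step_com[OF s(1)] le_refl])
    fix s' assume s': "inv sat s' \<and> W s' + 1 \<le> W s"
    have "Suc (nat \<lfloor>W s'\<rfloor>) * (Ts + 1) \<le> nat \<lfloor>W s\<rfloor> * (Ts + 1)" by (rule mult_le_mono1) (use fl s' in blast)
    then show "inv sat s' \<and> nat \<lfloor>W s'\<rfloor> * (Ts + 1) + 1 + Ts + 1 \<le> nat \<lfloor>W s\<rfloor> * (Ts + 1) + 1" using s' by simp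
  qed (use s in simp)
next
  have "nat \<lfloor>W s\<rfloor> \<le> w" using assms(2) by linarith
  then show "nat \<lfloor>W s\<rfloor> * (Ts + 1) + 1 \<le> w * (Ts + 1) + 1" by (intro add_mono mult_le_mono le_refl)
qed (use assms in \<open>auto simp: inv_def\<close>)

end

subsection \<open>The algorithm for satisfiability\<close>

definition lit_code :: "literal \<Rightarrow> nat" where
  "lit_code = (\<lambda>(v, sg). 2 * v + (if sg then 1 else 0))"

definition lit_list :: "clause list \<Rightarrow> nat list" where
  "lit_list F = concat (map (\<lambda>c. map lit_code (clause_lits c)) F)"

lemma cnf_code_lit_list: "cnf_code n F = [n, length F] @ lit_list F"
  by (simp add: cnf_code_def lit_list_def lit_code_def)

lemma length_lit_list [simp]: "length (lit_list F) = 3 * length F"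
  using length_cnf_code[of 0 F] by (simp add: cnf_code_lit_list)

lemma nth_lit_list:
  "i < length F \<Longrightarrow> j < 3 \<Longrightarrow> lit_list F ! (3 * i + j) = lit_code (clause_lits (F ! i) ! j)"
proof (induction F arbitrary: i)
  case (Cons c F)
  have len: "length (clause_lits c) = 3" by (cases c) auto
  show ?case
  proof (cases i)
    case 0
    then show ?thesis using Cons.prems len by (simp add: lit_list_def nth_append)
  next
    case (Suc i')
    have "lit_list (c # F) ! (3 * i + j) = lit_list F ! (3 * i' + j)"
      using len by (simp add: Suc lit_list_def nth_append)
    then show ?thesis using Cons Suc by simp
  qed
qed simp

lemma bex_clause_lits: "(\<exists>x\<in>set (clause_lits c). R x) \<longleftrightarrow> R (clause_lits c ! 0) \<or> R (clause_lits c ! 1) \<or> R (clause_lits c ! 2)"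
  by (cases c) (auto simp: eval_nat_numeral)

text \<open>Sparsification works with a symmetric relation, so each clause is entered in all six
  orders.\<close>

definition perms3 :: "nat \<Rightarrow> nat \<Rightarrow> nat \<Rightarrow> (nat \<times> nat \<times> nat) set" where
  "perms3 x y z = {(x, y, z), (x, z, y), (y, x, z), (y, z, x), (z, x, y), (z, y, x)}"

definition clauses_upto :: "clause list \<Rightarrow> nat \<Rightarrow> (nat \<times> nat \<times> nat) set" where
  "clauses_upto F m = (\<Union>i<m. perms3 (lit_list F ! (3 * i)) (lit_list F ! (3 * i + 1)) (lit_list F ! (3 * i + 2)))"

definition clause_rel :: "clause list \<Rightarrow> nat \<Rightarrow> nat \<Rightarrow> nat \<Rightarrow> bool" where
  "clause_rel F a b c \<longleftrightarrow> (a, b, c) \<in> clauses_upto F (length F)"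

lemma lits_less:
  assumes "cnf3 n F" "i < length F" "j < 3"
  shows "lit_list F ! (3 * i + j) < 2 * n"
proof -
  have "clause_lits (F ! i) ! j \<in> set (clause_lits (F ! i))"
  proof (rule nth_mem)
    show "j < length (clause_lits (F ! i))" using assms(3) by (cases "F ! i") auto
  qed
  then have "fst (clause_lits (F ! i) ! j) < n" using assms(1,2) by (auto simp: cnf3_def)
  then show ?thesis unfolding nth_lit_list[OF assms(2,3)] lit_code_def by (auto split: prod.splits)
qed

lemma sym3_clause_rel: "cnf3 n F \<Longrightarrow> sym3 (2 * n) (clause_rel F)"
proof -
  assume F: "cnf3 n F"
  have p: "(b, a, c) \<in> perms3 x y z \<and> (a, c, b) \<in> perms3 x y z \<and> {a, b, c} \<subseteq> {x, y, z}" if "(a, b, c) \<in> perms3 x y z" for a b c x y z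
    using that by (auto simp: perms3_def)
  have l: "{lit_list F ! (3 * i), lit_list F ! (3 * i + 1), lit_list F ! (3 * i + 2)} \<subseteq> {..<2 * n}" if "i < length F" for i
    using lits_less[OF F that, of 0] lits_less[OF F that, of 1] lits_less[OF F that, of 2] by simp
  show ?thesis unfolding sym3_def
  proof (intro allI impI)
    fix a b c assume "clause_rel F a b c"
    then obtain i where i: "i < length F" "(a, b, c) \<in> perms3 (lit_list F ! (3 * i)) (lit_list F ! (3 * i + 1)) (lit_list F ! (3 * i + 2))"
      unfolding clause_rel_def clauses_upto_def by blast
    have "{a, b, c} \<subseteq> {..<2 * n}" using p[OF i(2)] l[OF i(1)] by (meson order_trans)
    then show "a < 2 * n \<and> b < 2 * n \<and> c < 2 * n \<and> clause_rel F b a c \<and> clause_rel F a c b"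
      using p[OF i(2)] i(1) unfolding clause_rel_def clauses_upto_def by blast
  qed
qed

lemma satisfiable_iff:
  assumes F: "cnf3 n F"
  shows "satisfiable F \<longleftrightarrow> sat_state (litass n) (clause_rel F) (\<lambda>_. False) (\<lambda>_ _. False)"
proof -
  have tri: "(\<forall>a b c. clause_rel F a b c \<longrightarrow> \<beta> a \<or> \<beta> b \<or> \<beta> c) \<longleftrightarrow> (\<forall>i<length F. \<exists>x\<in>set (clause_lits (F ! i)). \<beta> (lit_code x))" for \<beta>
  proof -
    have p: "(\<forall>a b c. (a, b, c) \<in> perms3 x y z \<longrightarrow> \<beta> a \<or> \<beta> b \<or> \<beta> c) \<longleftrightarrow> \<beta> x \<or> \<beta> y \<or> \<beta> z" for x y z
      unfolding perms3_def by blast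
    have "(\<forall>a b c. clause_rel F a b c \<longrightarrow> \<beta> a \<or> \<beta> b \<or> \<beta> c) \<longleftrightarrow> (\<forall>i<length F. \<forall>a b c.
        (a, b, c) \<in> perms3 (lit_list F ! (3 * i)) (lit_list F ! (3 * i + 1)) (lit_list F ! (3 * i + 2)) \<longrightarrow> \<beta> a \<or> \<beta> b \<or> \<beta> c)"
      unfolding clause_rel_def clauses_upto_def by blast
    also have "\<dots> \<longleftrightarrow> (\<forall>i<length F. \<beta> (lit_list F ! (3 * i)) \<or> \<beta> (lit_list F ! (3 * i + 1)) \<or> \<beta> (lit_list F ! (3 * i + 2)))"
      unfolding p ..
    also have "\<dots> \<longleftrightarrow> (\<forall>i<length F. \<exists>x\<in>set (clause_lits (F ! i)). \<beta> (lit_code x))"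
      unfolding bex_clause_lits
    proof (intro all_cong)
      fix i assume "i < length F"
      from nth_lit_list[OF this, of 0] nth_lit_list[OF this, of 1] nth_lit_list[OF this, of 2]
      show "\<beta> (lit_list F ! (3 * i)) \<or> \<beta> (lit_list F ! (3 * i + 1)) \<or> \<beta> (lit_list F ! (3 * i + 2)) \<longleftrightarrow>
        \<beta> (lit_code (clause_lits (F ! i) ! 0)) \<or> \<beta> (lit_code (clause_lits (F ! i) ! 1)) \<or> \<beta> (lit_code (clause_lits (F ! i) ! 2))"
        by simp
    qed
    finally show ?thesis .
  qed
  have sat: "satisfiable F \<longleftrightarrow> (\<exists>\<beta>. \<forall>i<length F. \<exists>x\<in>set (clause_lits (F ! i)). \<beta> (fst x) = snd x)"
    unfolding satisfiable_def by (simp add: all_set_conv_all_nth)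
  show ?thesis
  proof
    assume "satisfiable F"
    then obtain \<beta> where b: "\<forall>i<length F. \<exists>x\<in>set (clause_lits (F ! i)). \<beta> (fst x) = snd x" unfolding sat by blast
    let ?b = "\<lambda>a. \<beta> (a div 2) = odd a"
    have "?b (lit_code x) \<longleftrightarrow> \<beta> (fst x) = snd x" for x by (cases x) (auto simp: lit_code_def)
    then have "\<forall>i<length F. \<exists>x\<in>set (clause_lits (F ! i)). ?b (lit_code x)" using b by (simp only:)
    then have m: "\<forall>a b c. clause_rel F a b c \<longrightarrow> ?b a \<or> ?b b \<or> ?b c" by (rule tri[of ?b, THEN iffD2])
    show "sat_state (litass n) (clause_rel F) (\<lambda>_. False) (\<lambda>_ _. False)"
      unfolding sat_state_def
    proof (rule bexI[of _ ?b], intro conjI)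
      show "?b \<in> litass n" by (auto simp: litass_def)
    qed (use m in simp_all)
  next
    assume "sat_state (litass n) (clause_rel F) (\<lambda>_. False) (\<lambda>_ _. False)"
    then obtain \<beta> where b: "\<beta> \<in> litass n" "\<forall>a b c. clause_rel F a b c \<longrightarrow> \<beta> a \<or> \<beta> b \<or> \<beta> c" unfolding sat_state_def by blast
    have "\<beta> (2 * fst x + 1) = snd x" if "\<beta> (lit_code x)" "fst x < n" for x
      using that b(1) by (cases x) (auto simp: lit_code_def litass_def split: if_splits)
    moreover have "\<forall>i<length F. \<exists>x\<in>set (clause_lits (F ! i)). \<beta> (lit_code x)" using b(2) by (rule tri[THEN iffD1])
    ultimately show "satisfiable F" unfolding sat using F unfolding cnf3_def
      by (intro exI[of _ "\<lambda>v. \<beta> (2 * v + 1)"]) (meson nth_mem)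
  qed
qed

definition mark_com :: "nat \<Rightarrow> nat \<Rightarrow> nat \<Rightarrow> wcom" where
  "mark_com x y z = Wr yE (Pl (Rd yRR (V x)) (Pl (Rd yR (V y)) (V z))) (Cn 1)"

definition marked :: "nat \<Rightarrow> st \<Rightarrow> (nat \<times> nat \<times> nat) set" where
  "marked A s = {(a, b, c). a < A \<and> b < A \<and> c < A \<and> s yE (a * A * A + (b * A + c)) \<noteq> 0}"

lemma marked_upd [simp]: "x \<noteq> yE \<Longrightarrow> marked A (s(x := g)) = marked A s"
  by (simp add: marked_def)

lemma index3_inj:
  assumes "b < (A::nat)" "c < A" "b' < A" "c' < A"
  shows "a * A * A + (b * A + c) = a' * A * A + (b' * A + c') \<longleftrightarrow> a = a' \<and> b = b' \<and> c = c'"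
  using cell_inj'[OF pair_index[OF assms(1,2)] pair_index[OF assms(3,4)], of a a'] cell_inj'[OF assms(2,4), of b b']
  by (simp add: mult.assoc)

lemma run_mark_com:
  assumes "s x 0 < A" "s y 0 < A" "s z 0 < A" "\<forall>a<A. s yR a = a * A" "\<forall>a<A. s yRR a = a * A * A"
  shows "run (mark_com x y z) s 1 (\<lambda>s'. agr {yE} s s' \<and> marked A s' = insert (s x 0, s y 0, s z 0) (marked A s))"
proof -
  have "a * A * A + (b * A + c) = s x 0 * A * A + (s y 0 * A + s z 0) \<longleftrightarrow> (a, b, c) = (s x 0, s y 0, s z 0)"
    if "b < A" "c < A" for a b c using index3_inj[OF that assms(2,3)] by simp
  note key = this
  let ?s = "put s yE (s x 0 * A * A + (s y 0 * A + s z 0)) 1"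
  have "(a, b, c) \<in> marked A ?s \<longleftrightarrow> (a, b, c) \<in> insert (s x 0, s y 0, s z 0) (marked A s)" for a b c
  proof (cases "b < A \<and> c < A")
    case True
    then show ?thesis using key[of b c a] assms(1-3) by (auto simp: marked_def)
  next
    case False
    then show ?thesis using assms(1-3) by (auto simp: marked_def)
  qed
  then have "marked A ?s = insert (s x 0, s y 0, s z 0) (marked A s)" by auto
  then show ?thesis using assms by (simp add: mark_com_def)
qed

primrec marks_com :: "(nat \<times> nat \<times> nat) list \<Rightarrow> wcom" where
  "marks_com [] = Skp"
| "marks_com (t # ts) = (case t of (x, y, z) \<Rightarrow> mark_com x y z) ;; marks_com ts"

lemma mods_marks_com: "mods (marks_com ts) \<subseteq> {yE}"
  by (induction ts) (auto simp: mark_com_def)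

lemma run_marks_com:
  assumes "\<forall>(x, y, z)\<in>set ts. yE \<notin> {x, y, z} \<and> s x 0 < A \<and> s y 0 < A \<and> s z 0 < A"
    and "\<forall>a<A. s yR a = a * A" "\<forall>a<A. s yRR a = a * A * A"
  shows "run (marks_com ts) s (length ts) (\<lambda>s'. agr {yE} s s' \<and>
    marked A s' = marked A s \<union> (\<lambda>(x, y, z). (s x 0, s y 0, s z 0)) ` set ts)"
  using assms
proof (induction ts arbitrary: s)
  case (Cons t ts)
  obtain x y z where t: "t = (x, y, z)" by (cases t)
  let ?im = "\<lambda>s. (\<lambda>(x, y, z). (s x 0, s y 0, s z 0)) ` set ts"
  have "run (marks_com (t # ts)) s (1 + length ts) (\<lambda>s'. agr {yE} s s' \<and> marked A s' = insert (s x 0, s y 0, s z 0) (marked A s) \<union> ?im s)"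
    unfolding marks_com.simps t prod.case
  proof (rule run_Sq, rule run_mono[OF run_mark_com[where A = A] le_refl])
    fix s1 assume s1: "agr {yE} s s1 \<and> marked A s1 = insert (s x 0, s y 0, s z 0) (marked A s)"
    then have e: "s1 j = s j" if "j \<noteq> yE" for j using that by (auto simp: agr_def)
    have im: "?im s1 = ?im s" using Cons.prems(1) e by (intro image_cong) auto
    show "run (marks_com ts) s1 (length ts) (\<lambda>s'. agr {yE} s s' \<and> marked A s' = insert (s x 0, s y 0, s z 0) (marked A s) \<union> ?im s)"
      by (rule run_mono[OF Cons.IH le_refl]) (use Cons.prems e s1 im in \<open>auto intro: agr_trans\<close>)
  qed (use Cons.prems t in auto)
  then show ?case by (rule run_mono) (auto simp: t)
qed simp

definition clause_com :: wcom where
  "clause_com = xHa ::= Rd yL (V xJ) ;; xHb ::= Rd yL (Pl (V xJ) (Cn 1)) ;; xTyp ::= Rd yL (Pl (V xJ) (Cn 2)) ;;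
     xJ ::= Pl (V xJ) (Cn 3) ;; marks_com [(xHa, xHb, xTyp), (xHa, xTyp, xHb), (xHb, xHa, xTyp),
       (xHb, xTyp, xHa), (xTyp, xHa, xHb), (xTyp, xHb, xHa)]"

lemma mods_clause_com [simp]: "mods clause_com = {xHa, xHb, xTyp, xJ, yE}"
  by (auto simp: clause_com_def mark_com_def)

lemma run_clause_com:
  assumes a: "s xJ 0 = j" "a = s yL j" "b = s yL (j + 1)" "c = s yL (j + 2)" "a < A" "b < A" "c < A"
    and R: "\<forall>a<A. s yR a = a * A" "\<forall>a<A. s yRR a = a * A * A"
  shows "run clause_com s 10 (\<lambda>s'. s' xJ 0 = j + 3 \<and> marked A s' = marked A s \<union> perms3 a b c)"
proof -
  let ?ts = "[(xHa, xHb, xTyp), (xHa, xTyp, xHb), (xHb, xHa, xTyp), (xHb, xTyp, xHa), (xTyp, xHa, xHb), (xTyp, xHb, xHa)]"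
  let ?s = "put (put (put (put s xHa 0 a) xHb 0 b) xTyp 0 c) xJ 0 (j + 3)"
  have "run (marks_com ?ts) ?s (length ?ts) (\<lambda>s'. agr {yE} ?s s' \<and>
    marked A s' = marked A ?s \<union> (\<lambda>(x, y, z). (?s x 0, ?s y 0, ?s z 0)) ` set ?ts)"
    by (rule run_marks_com) (use a R in auto)
  then have "run (marks_com ?ts) ?s 6 (\<lambda>s'. s' xJ 0 = j + 3 \<and> marked A s' = marked A s \<union> perms3 a b c)"
    by (rule run_mono) (auto simp: perms3_def agr_def)
  then show ?thesis unfolding clause_com_def using a by (simp del: marks_com.simps)
qed

text \<open>The inverse of the prelude: three halvings recover the number of clauses, and the first
  six literals, whose cells were overwritten, are fetched from their saved copies after the bulk
  copy has put garbage in their place. \<open>xAA\<close> and \<open>xHP\<close> serve as running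
  sums for the tables; the former ends as \<open>A * A\<close>, the latter is reset.\<close>

definition init_com :: wcom where
  "init_com = xN ::= Rd 0 (Pl (V 6) (Cn 1)) ;; xA ::= Pl (V xN) (V xN) ;; xCl ::= Hf (Hf (Hf (V 6))) ;;
     For xI (Pl (V xCl) (Pl (V xCl) (V xCl))) (Wr yL (V xI) (Rd 0 (Pl (V xI) (Cn 2)))) ;;
     Wr yL (Cn 0) (Rd 0 (V 6)) ;; Wr yL (Cn 1) (Rd 0 (Pl (V 6) (Cn 2))) ;; Wr yL (Cn 2) (Rd 0 (Pl (V 6) (Cn 3))) ;;
     Wr yL (Cn 3) (Rd 0 (Pl (V 6) (Cn 4))) ;; Wr yL (Cn 4) (Rd 0 (Pl (V 6) (Cn 5))) ;; Wr yL (Cn 5) (Rd 0 (Pl (V 6) (Cn 6))) ;;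
     For xI (V xA) (Wr yR (V xI) (V xAA) ;; xAA ::= Pl (V xAA) (V xA)) ;;
     For xI (V xA) (Wr yRR (V xI) (V xHP) ;; xHP ::= Pl (V xHP) (V xAA)) ;;
     xHP ::= Cn 0 ;; For xC (V xCl) clause_com ;; xTU ::= V xA ;; xTP ::= V xAA ;; xTail ::= Cn 1"

lemma run_init_com:
  assumes ld: "sat_loaded n F s" and F: "cnf3 n F"
  shows "run init_com s (30 * (length F + n + 1)) (\<lambda>s'. tables (2 * n) (clause_rel F) s' \<and> s' xN 0 = n \<and>
    s' xTU 0 = 2 * n \<and> s' xTP 0 = 2 * n * (2 * n) \<and> s' xTail 0 = 1 \<and> s' xHP 0 = 0 \<and>
    (\<forall>j i. j \<ge> 8 \<and> j \<notin> {xN, xA, xCl, xI, yL, yR, yRR, xAA, xHP, xC, xHa, xHb, xTyp, xJ, yE, xTU, xTP, xTail} \<longrightarrow> s' j i = 0))"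
proof -
  let ?m = "length F" and ?A = "2 * n" and ?xs = "cnf_code n F" and ?E = "8 * length F"
  let ?T = "\<lambda>s'. tables ?A (clause_rel F) s' \<and> s' xN 0 = n \<and> s' xTU 0 = ?A \<and> s' xTP 0 = ?A * ?A \<and> s' xTail 0 = 1 \<and> s' xHP 0 = 0"
  have ld: "s 6 0 = ?E" "\<And>i. 8 \<le> i \<Longrightarrow> i < length ?xs \<Longrightarrow> s 0 i = ?xs ! i" "s 0 ?E = nth0 ?xs 2" "s 0 (?E + 1) = n"
    "\<And>i. i < 5 \<Longrightarrow> s 0 (?E + 2 + i) = nth0 ?xs (3 + i)" "\<And>j i. 8 \<le> j \<Longrightarrow> s j i = 0"
    using ld by (auto simp: sat_loaded_def Let_def)
  have xs: "nth0 ?xs (2 + i) = lit_list F ! i" if "i < 3 * ?m" for i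
    using that by (simp add: nth0_def cnf_code_lit_list)
  let ?mk = "xHP ::= Cn 0 ;; For xC (V xCl) clause_com ;; xTU ::= V xA ;; xTP ::= V xAA ;; xTail ::= Cn 1"
  let ?rr = "For xI (V xA) (Wr yRR (V xI) (V xHP) ;; xHP ::= Pl (V xHP) (V xAA))"
  let ?r = "For xI (V xA) (Wr yR (V xI) (V xAA) ;; xAA ::= Pl (V xAA) (V xA))"
  let ?six = "\<lambda>c. Wr yL (Cn 0) (Rd 0 (V 6)) ;; Wr yL (Cn 1) (Rd 0 (Pl (V 6) (Cn 2))) ;; Wr yL (Cn 2) (Rd 0 (Pl (V 6) (Cn 3))) ;;
     Wr yL (Cn 3) (Rd 0 (Pl (V 6) (Cn 4))) ;; Wr yL (Cn 4) (Rd 0 (Pl (V 6) (Cn 5))) ;; Wr yL (Cn 5) (Rd 0 (Pl (V 6) (Cn 6))) ;; c"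
  let ?cp = "For xI (Pl (V xCl) (Pl (V xCl) (V xCl))) (Wr yL (V xI) (Rd 0 (Pl (V xI) (Cn 2))))"
  let ?s1 = "put (put (put s xN 0 n) xA 0 ?A) xCl 0 ?m"
  let ?M = "{xN, xA, xCl, xI, yL}"
  have 1: "run ?cp ?s1 (3 * ?m * (1 + 2) + 2) (\<lambda>s'. agr {xI, yL} ?s1 s' \<and> (\<forall>i<3 * ?m. s' yL i = s 0 (i + 2)))"
  proof (rule run_for[where I = "\<lambda>i s'. \<forall>i'<i. s' yL i' = s 0 (i' + 2)"])
    fix i s' assume i: "i < 3 * ?m" "agr {xI, yL} ?s1 s'" "s' xI 0 = i" "\<forall>i'<i. s' yL i' = s 0 (i' + 2)"
    have "s' 0 = s 0" using agrD[OF i(2), of 0] by simp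
    then show "run (Wr yL (V xI) (Rd 0 (Pl (V xI) (Cn 2)))) s' 1 (\<lambda>s'. s' xI 0 = i \<and> (\<forall>i'<Suc i. s' yL i' = s 0 (i' + 2)))"
      using i by (auto simp: less_Suc_eq)
  next
    fix s' assume "agr {xI, yL} ?s1 s'"
    then show "wval (Pl (V xCl) (Pl (V xCl) (V xCl))) s' = 3 * ?m" by (simp add: agr_def)
  qed auto
  have "run init_com s (3 + ((3 * ?m * (1 + 2) + 2) + (6 + ((?A * (2 + 2) + 2) + ((?A * (2 + 2) + 2) + (1 + ((?m * (10 + 2) + 2) + 3))))))) ?T"
  proof -
    have "run (?cp ;; ?six (?r ;; ?rr ;; ?mk)) ?s1 ((3 * ?m * (1 + 2) + 2) + (6 + ((?A * (2 + 2) + 2) + ((?A * (2 + 2) + 2) + (1 + ((?m * (10 + 2) + 2) + 3)))))) ?T"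
    proof (rule run_Sq, rule run_mono[OF 1 le_refl])
      fix s2 assume s2: "agr {xI, yL} ?s1 s2 \<and> (\<forall>i<3 * ?m. s2 yL i = s 0 (i + 2))"
      have e2: "s2 6 0 = ?E" "s2 0 = s 0" using s2 ld(1) by (auto simp: agr_def)
      define s3 where "s3 = s2(yL := (s2 yL)(0 := nth0 ?xs 2, 1 := nth0 ?xs 3, 2 := nth0 ?xs 4, 3 := nth0 ?xs 5, 4 := nth0 ?xs 6, 5 := nth0 ?xs 7))"
      have ag3: "agr ?M s s3" unfolding s3_def using s2 by (auto simp: agr_def)
      have e3: "s3 xN 0 = n" "s3 xA 0 = ?A" "s3 xCl 0 = ?m" using s2 by (auto simp: agr_def s3_def)
      have L: "s3 yL i = lit_list F ! i" if i: "i < 3 * ?m" for i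
      proof (cases "i < 6")
        case True
        then have "i = 0 \<or> i = 1 \<or> i = 2 \<or> i = 3 \<or> i = 4 \<or> i = 5" by auto
        then show ?thesis using xs[OF i] by (elim disjE) (simp_all add: s3_def)
      next
        case False
        then have "s3 yL i = s 0 (i + 2)" using s2 i by (simp add: s3_def)
        also have "\<dots> = ?xs ! (i + 2)" by (rule ld(2)) (use False i in \<open>auto simp: length_cnf_code\<close>)
        also have "\<dots> = lit_list F ! i" using i by (simp add: cnf_code_lit_list)
        finally show ?thesis .
      qed
      have R: "run ?r s3 (?A * (2 + 2) + 2) (\<lambda>s'. agr {xI, yR, xAA} s3 s' \<and> s' xAA 0 = ?A * ?A \<and> (\<forall>a<?A. s' yR a = a * ?A))"
      proof (rule run_for[where I = "\<lambda>i s'. s' xAA 0 = i * ?A \<and> (\<forall>a<i. s' yR a = a * ?A)"])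
        fix i s' assume i: "i < ?A" "agr {xI, yR, xAA} s3 s'" "s' xI 0 = i" "s' xAA 0 = i * ?A \<and> (\<forall>a<i. s' yR a = a * ?A)"
        have "s' xA 0 = ?A" using agrD[OF i(2), of xA] e3 by simp
        then show "run (Wr yR (V xI) (V xAA) ;; xAA ::= Pl (V xAA) (V xA)) s' 2
          (\<lambda>s'. s' xI 0 = i \<and> s' xAA 0 = Suc i * ?A \<and> (\<forall>a<Suc i. s' yR a = a * ?A))"
          using i by (auto simp: less_Suc_eq)
      next
        fix s' assume "agr {xI, yR, xAA} s3 s'"
        then show "wval (V xA) s' = ?A" using e3 by (auto simp: agr_def)
      qed (use ag3 ld(6) in \<open>auto simp: agr_def\<close>)
      have "run (?r ;; ?rr ;; ?mk) s3 ((?A * (2 + 2) + 2) + ((?A * (2 + 2) + 2) + (1 + ((?m * (10 + 2) + 2) + 3)))) ?T"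
      proof (rule run_Sq, rule run_mono[OF R le_refl])
        fix s4 assume s4: "agr {xI, yR, xAA} s3 s4 \<and> s4 xAA 0 = ?A * ?A \<and> (\<forall>a<?A. s4 yR a = a * ?A)"
        have RR: "run ?rr s4 (?A * (2 + 2) + 2) (\<lambda>s'. agr {xI, yRR, xHP} s4 s' \<and> s' xHP 0 = ?A * (?A * ?A) \<and> (\<forall>a<?A. s' yRR a = a * (?A * ?A)))"
        proof (rule run_for[where I = "\<lambda>i s'. s' xHP 0 = i * (?A * ?A) \<and> (\<forall>a<i. s' yRR a = a * (?A * ?A))"])
          fix i s' assume i: "i < ?A" "agr {xI, yRR, xHP} s4 s'" "s' xI 0 = i" "s' xHP 0 = i * (?A * ?A) \<and> (\<forall>a<i. s' yRR a = a * (?A * ?A))"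
          have "s' xAA 0 = ?A * ?A" using agrD[OF i(2), of xAA] s4 by simp
          then show "run (Wr yRR (V xI) (V xHP) ;; xHP ::= Pl (V xHP) (V xAA)) s' 2
            (\<lambda>s'. s' xI 0 = i \<and> s' xHP 0 = Suc i * (?A * ?A) \<and> (\<forall>a<Suc i. s' yRR a = a * (?A * ?A)))"
            using i by (auto simp: less_Suc_eq)
        next
          fix s' assume "agr {xI, yRR, xHP} s4 s'"
          then show "wval (V xA) s' = ?A" using e3 s4 by (auto simp: agr_def)
        qed (use ag3 ld(6) s4 in \<open>auto simp: agr_def\<close>)
        show "run (?rr ;; ?mk) s4 ((?A * (2 + 2) + 2) + (1 + ((?m * (10 + 2) + 2) + 3))) ?T"
        proof (rule run_Sq, rule run_mono[OF RR le_refl])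
          fix s5 assume s5: "agr {xI, yRR, xHP} s4 s5 \<and> s5 xHP 0 = ?A * (?A * ?A) \<and> (\<forall>a<?A. s5 yRR a = a * (?A * ?A))"
          let ?s5 = "put s5 xHP 0 0"
          have ag: "agr {xN, xA, xCl, xI, yL, yR, yRR, xAA, xHP} s ?s5" using s4 s5 ag3 by (auto simp: agr_def)
          have e5: "?s5 xN 0 = n" "?s5 xA 0 = ?A" "?s5 xCl 0 = ?m" "?s5 xAA 0 = ?A * ?A" "\<forall>a<?A. ?s5 yR a = a * ?A"
            "\<forall>a<?A. ?s5 yRR a = a * ?A * ?A" "?s5 yL = s3 yL" "?s5 xJ 0 = 0" "marked ?A ?s5 = {}"
            using s4 s5 e3 ag ld(6) by (auto simp: agr_def marked_def)
          have C: "run (For xC (V xCl) clause_com) ?s5 (?m * (10 + 2) + 2) (\<lambda>s'. agr {xC, xHa, xHb, xTyp, xJ, yE} ?s5 s' \<and>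
            s' xJ 0 = 3 * ?m \<and> marked ?A s' = clauses_upto F ?m)"
          proof (rule run_for[where I = "\<lambda>i s'. s' xJ 0 = 3 * i \<and> marked ?A s' = clauses_upto F i"])
            fix i s' assume i: "i < ?m" "agr {xC, xHa, xHb, xTyp, xJ, yE} ?s5 s'" "s' xC 0 = i"
              "s' xJ 0 = 3 * i \<and> marked ?A s' = clauses_upto F i"
            have e: "s' yL = s3 yL" "s' yR = ?s5 yR" "s' yRR = ?s5 yRR" using i(2) e5(7) by (auto simp: agr_def)
            have l: "s' yL (3 * i + j) = lit_list F ! (3 * i + j)" "lit_list F ! (3 * i + j) < ?A" if "j < 3" for j
              using L[of "3 * i + j"] i(1) that e lits_less[OF F i(1) that] by auto
            have "run clause_com s' 10 (\<lambda>s''. s'' xJ 0 = 3 * i + 3 \<and> marked ?A s'' = marked ?A s' \<union>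
              perms3 (lit_list F ! (3 * i)) (lit_list F ! (3 * i + 1)) (lit_list F ! (3 * i + 2)))"
              by (rule run_clause_com) (use i l[of 0] l[of 1] l[of 2] e e5(5,6) in auto)
            then have "run clause_com s' 10 (\<lambda>s''. (s'' xJ 0 = 3 * i + 3 \<and> marked ?A s'' = marked ?A s' \<union>
              perms3 (lit_list F ! (3 * i)) (lit_list F ! (3 * i + 1)) (lit_list F ! (3 * i + 2))) \<and> agr {xHa, xHb, xTyp, xJ, yE} s' s'')"
              by (rule run_agr) auto
            then show "run clause_com s' 10 (\<lambda>s''. s'' xC 0 = i \<and> s'' xJ 0 = 3 * Suc i \<and> marked ?A s'' = clauses_upto F (Suc i))"
            proof (rule run_mono[OF _ le_refl])
              fix s'' assume s'': "(s'' xJ 0 = 3 * i + 3 \<and> marked ?A s'' = marked ?A s' \<union>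
                perms3 (lit_list F ! (3 * i)) (lit_list F ! (3 * i + 1)) (lit_list F ! (3 * i + 2))) \<and> agr {xHa, xHb, xTyp, xJ, yE} s' s''"
              then have "s'' xC 0 = i" using i(3) by (auto simp: agr_def)
              moreover have "clauses_upto F (Suc i) = clauses_upto F i \<union> perms3 (lit_list F ! (3 * i)) (lit_list F ! (3 * i + 1)) (lit_list F ! (3 * i + 2))"
                unfolding clauses_upto_def lessThan_Suc by blast
              ultimately show "s'' xC 0 = i \<and> s'' xJ 0 = 3 * Suc i \<and> marked ?A s'' = clauses_upto F (Suc i)" using s'' i(4) by simp
            qed
          next
            fix s' assume "agr {xC, xHa, xHb, xTyp, xJ, yE} ?s5 s'"
            then show "wval (V xCl) s' = ?m" using e5(3) by (auto simp: agr_def)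
          qed (use e5(8,9) in \<open>auto simp: clauses_upto_def\<close>)
          have "run (For xC (V xCl) clause_com ;; xTU ::= V xA ;; xTP ::= V xAA ;; xTail ::= Cn 1) ?s5 ((?m * (10 + 2) + 2) + 3) ?T"
          proof (rule run_Sq, rule run_mono[OF C le_refl])
            fix s6 assume s6: "agr {xC, xHa, xHb, xTyp, xJ, yE} ?s5 s6 \<and> s6 xJ 0 = 3 * ?m \<and> marked ?A s6 = clauses_upto F ?m"
            have e6: "s6 xN 0 = n" "s6 xA 0 = ?A" "s6 xAA 0 = ?A * ?A" "\<forall>a<?A. s6 yR a = a * ?A" "\<forall>a<?A. s6 yRR a = a * ?A * ?A" "s6 xHP 0 = 0"
              using s6 e5 by (auto simp: agr_def)
            have "s6 yE (a * ?A * ?A + (b * ?A + c)) \<noteq> 0 \<longleftrightarrow> clause_rel F a b c" if "a < ?A" "b < ?A" "c < ?A" for a b c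
            proof -
              have "s6 yE (a * ?A * ?A + (b * ?A + c)) \<noteq> 0 \<longleftrightarrow> (a, b, c) \<in> marked ?A s6" using that by (simp add: marked_def)
              then show ?thesis using s6 by (simp add: clause_rel_def)
            qed
            then have "tables ?A (clause_rel F) s6" unfolding tables_def using e6 by blast
            then have "tables ?A (clause_rel F) (put (put (put s6 xTU 0 ?A) xTP 0 (?A * ?A)) xTail 0 1)" by (simp add: tables_def)
            then show "run (xTU ::= V xA ;; xTP ::= V xAA ;; xTail ::= Cn 1) s6 3 ?T" using e6 by simp
          qed
          then show "run ?mk s5 (1 + ((?m * (10 + 2) + 2) + 3)) ?T" by simp
        qed
      qed
      moreover have "put (put (put (put (put (put s2 yL 0 (nth0 ?xs 2)) yL 1 (nth0 ?xs 3)) yL 2 (nth0 ?xs 4)) yL 3 (nth0 ?xs 5)) yL 4 (nth0 ?xs 6)) yL 5 (nth0 ?xs 7) = s3"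
        unfolding s3_def by (auto simp: fun_eq_iff)
      moreover have "s 0 (?E + 2) = nth0 ?xs 3" "s 0 (?E + 3) = nth0 ?xs 4" "s 0 (?E + 4) = nth0 ?xs 5" "s 0 (?E + 5) = nth0 ?xs 6" "s 0 (?E + 6) = nth0 ?xs 7"
        using ld(5)[of 0] ld(5)[of 1] ld(5)[of 2] ld(5)[of 3] ld(5)[of 4] by (simp_all add: eval_nat_numeral)
      ultimately show "run (?six (?r ;; ?rr ;; ?mk)) s2 (6 + ((?A * (2 + 2) + 2) + ((?A * (2 + 2) + 2) + (1 + ((?m * (10 + 2) + 2) + 3))))) ?T"
        using e2 ld(3) by (simp add: s3_def)
    qed
    then show ?thesis unfolding init_com_def using ld by (simp add: mult_2[symmetric])
  qed
  from run_agr[OF this, of "mods init_com"] show ?thesis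
  proof (rule run_mono)
    fix s' assume s': "?T s' \<and> agr (mods init_com) s s'"
    have "mods init_com = {xN, xA, xCl, xI, yL, yR, yRR, xAA, xHP, xC, xHa, xHb, xTyp, xJ, yE, xTU, xTP, xTail}"
      unfolding init_com_def by auto
    then have "s' j i = 0" if "j \<ge> 8" "j \<notin> {xN, xA, xCl, xI, yL, yR, yRR, xAA, xHP, xC, xHa, xHb, xTyp, xJ, yE, xTU, xTP, xTail}" for j i
      using s' ld(6)[OF that(1), of i] that(2) by (simp add: agr_def)
    then show "tables ?A (clause_rel F) s' \<and> s' xN 0 = n \<and> s' xTU 0 = 2 * n \<and> s' xTP 0 = 2 * n * (2 * n) \<and> s' xTail 0 = 1 \<and> s' xHP 0 = 0 \<and>
      (\<forall>j i. j \<ge> 8 \<and> j \<notin> {xN, xA, xCl, xI, yL, yR, yRR, xAA, xHP, xC, xHa, xHb, xTyp, xJ, yE, xTU, xTP, xTail} \<longrightarrow> s' j i = 0)"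
      using s' by blast
  qed auto
qed

definition sat_com :: "instr list \<Rightarrow> nat \<Rightarrow> nat \<Rightarrow> nat \<Rightarrow> nat \<Rightarrow> nat \<Rightarrow> wcom" where
  "sat_com p th g l k h = init_com ;; work_com p th g l k h ;; IfC (V xFound) (0 ::= Cn 1) (0 ::= Cn 0)"

lemma (in leaf_solver) run_sat_com:
  assumes ld: "sat_loaded n F s" and F: "cnf3 n F" and EF: "E = clause_rel F" and w: "2 * x ^ (10 * th * A) \<le> real w"
  shows "run (sat_com p th g l k h) s (30 * (length F + n + 1) + ((w * (Ts + 1) + 1) + 2)) (\<lambda>s'. s' 0 0 = (if satisfiable F then 1 else 0))"
  unfolding sat_com_def
proof (rule run_Sq, rule run_mono[OF run_init_com[OF ld F] le_refl])
  fix s1 assume s1: "tables (2 * n) (clause_rel F) s1 \<and> s1 xN 0 = n \<and>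
    s1 xTU 0 = 2 * n \<and> s1 xTP 0 = 2 * n * (2 * n) \<and> s1 xTail 0 = 1 \<and> s1 xHP 0 = 0 \<and>
    (\<forall>j i. j \<ge> 8 \<and> j \<notin> {xN, xA, xCl, xI, yL, yR, yRR, xAA, xHP, xC, xHa, xHb, xTyp, xJ, yE, xTU, xTP, xTail} \<longrightarrow> s1 j i = 0)"
  have z: "s1 xHead 0 = 0" "s1 xHU 0 = 0" "s1 11 i = 0" "s1 xFound 0 = 0" "s1 yU i = 0" "s1 yP i = 0" for i using s1 by auto
  have UP: "U s1 0 = (\<lambda>_. False)" "P s1 0 = (\<lambda>_ _. False)" using z by (auto simp: Uof_def Pof_def fun_eq_iff)
  have wf: "wf_state A th (\<lambda>_. False) (\<lambda>_ _. False)" by (simp add: wf_state_def pact_def)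
  have rng: "{s1 xHead 0..<s1 xTail 0} = {0}" using s1 z by auto
  have "inv (satisfiable F) s1"
    unfolding inv_def rng using s1 z UP wf satisfiable_iff[OF F] by (simp add: EF)
  moreover have "W s1 < real w"
    \<comment> \<open>The queue starts with the empty state, which has used up nothing of the
      measure.\<close>
    unfolding W_def rng using w by (simp add: UP weight_def used_def pact_def)
  ultimately have "run (work_com p th g l k h) s1 (w * (Ts + 1) + 1) (\<lambda>s. satisfiable F \<longleftrightarrow> s xFound 0 \<noteq> 0)"
    by (rule run_work_com)
  then show "run (work_com p th g l k h ;; IfC (V xFound) (0 ::= Cn 1) (0 ::= Cn 0)) s1 ((w * (Ts + 1) + 1) + 2)
      (\<lambda>s'. s' 0 0 = (if satisfiable F then 1 else 0))"
    by (intro run_Sq, elim run_mono) auto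
qed

subsection \<open>The running time\<close>

text \<open>Absorbs factors linear in \<open>n\<close> into exponentials with small
  exponent.\<close>

lemma le_two_powr: "y \<le> 2 * 2 powr (y::real)"
proof -
  have "1 + y * ln 2 \<le> 2 powr y" using exp_ge_add_one_self[of "y * ln 2"] by (simp add: powr_def)
  then have "y * ln 2 \<le> 2 powr y" by linarith
  moreover have "1 / 2 \<le> ln (2::real)" using ln_le_minus_one[of "1 / 2 :: real"] by (simp add: ln_div)
  then have "y / 2 \<le> y * ln 2" if "0 \<le> y" using mult_left_mono[of "1 / 2" "ln 2" y] that by simp
  ultimately show ?thesis by (cases "0 \<le> y") (auto intro: order_trans[of y 0])
qed

text \<open>There are \<open>2 * n\<close> literals and the clauses are pairwise different, so the
  input is polynomial in \<open>n\<close>.\<close>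

lemma length_cnf3:
  assumes "cnf3 n F"
  shows "length F \<le> 8 * n ^ 3"
proof -
  let ?L = "{..<n} \<times> (UNIV :: bool set)"
  have "set F \<subseteq> ?L \<times> ?L \<times> ?L" using assms by (force simp: cnf3_def)
  then have "card (set F) \<le> card (?L \<times> ?L \<times> ?L)" by (intro card_mono) auto
  moreover have "length F = card (set F)" using assms by (simp add: cnf3_def distinct_card)
  ultimately show ?thesis by (simp add: card_cartesian_product power3_eq_cube algebra_simps)
qed

text \<open>The exponent \<epsilon> * \<open>n\<close> is split into four quarters, \<open>u\<close>
  standing for one of them. The branching tree has at most \<open>3 * u\<close> nodes. At each leaf,
  the construction takes time of order \<open>Y ^ 3\<close> with exponent
  \<open>24 * D * n / l\<close>, at most \<open>24 * D * \<alpha> * n\<close> because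
  \<open>1 / l \<le> \<alpha>\<close>; the factor 96 makes this a quarter. The algorithm takes time
  of order \<open>Y powr (\<alpha> * l)\<close>, with the smaller exponent
  \<open>8 * D * \<alpha> * n\<close>. The length of the formula is covered by what remains.\<close>

lemma sat_from_IndSub:
  fixes \<epsilon> \<alpha> x :: real
  assumes e: "0 < \<epsilon>" and th: "1 \<le> th"
    and x: "1 \<le> x" "x ^ (4 * th * th - 1) + 1 \<le> x ^ (4 * th * th)" and xA: "\<And>A. x ^ (10 * th * A) \<le> 2 powr (\<epsilon> / 8 * real A)"
    and D: "D = 2 * (1 + th + 4 * th * th)"
    and al: "\<alpha> \<le> 1 / 5" "96 * real D * \<alpha> \<le> \<epsilon>" "1 \<le> \<alpha> * real l"
    and lk: "l + 4 \<le> k" "f k = l"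
    and sol: "IndSub_solvable h (Psi f) {k} (\<lambda>n k. real n powr (\<alpha> * real (f k)))"
  shows "\<exists>p C. \<forall>n F. cnf3 n F \<longrightarrow>
    outputs_within p (cnf_code n F) (if satisfiable F then 1 else 0) (C * 2 powr (\<epsilon> * real n))"
proof -
  obtain p C where p: "\<And>n G. 1 \<le> n \<Longrightarrow> simple_graph G \<Longrightarrow> verts G = {..<n} \<Longrightarrow>
      outputs_within p ([n, k, h k] @ adj_matrix n G) (num_IndSub (Psi f) G k) (C * real n powr (\<alpha> * real l))"
  proof -
    from sol obtain p C where H: "\<forall>k'\<in>{k}. \<forall>n\<ge>1. \<forall>G. simple_graph G \<and> verts G = {..<n} \<longrightarrow>
        outputs_within p ([n, k', h k'] @ adj_matrix n G) (num_IndSub (Psi f) G k') (C * real n powr (\<alpha> * real (f k')))"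
      unfolding IndSub_solvable_def by blast
    show ?thesis by (rule that[of p C]) (use H lk(2) in blast)
  qed
  have al0: "0 < \<alpha>" using al(3) by (metis less_eq_real_def less_trans mult_eq_0_iff mult_nonpos_nonneg not_less of_nat_0_le_iff zero_less_one)
  have l5: "5 \<le> l"
  proof -
    have "\<alpha> * real l \<le> 1 / 5 * real l" using al(1) by (intro mult_right_mono) auto
    then show ?thesis using al(3) by simp
  qed
  define g where "g = (l + 1) div 3"
  \<comment> \<open>\<open>5 \<le> l\<close> makes room for the two cliques that detect
    contradictions and ensures \<open>l \<le> 4 * g\<close>.\<close>
  have g: "3 * g \<le> l + 1" "2 \<le> g" "l \<le> 4 * g" using l5 unfolding g_def by auto
  from sat_program[of "sat_com p th g l k (h k)"]
  obtain P K where PK: "\<forall>n F y T. (F = [] \<longrightarrow> outputs_within P (cnf_code n F) 1 (real K)) \<and>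
     (F \<noteq> [] \<longrightarrow> (\<forall>s. sat_loaded n F s \<longrightarrow> run (sat_com p th g l k (h k)) s T (\<lambda>s'. s' 0 0 = y)) \<longrightarrow>
        outputs_within P (cnf_code n F) y (real (K * (length F + T + 1))))"
    by (elim exE) (rule that)
  define r where "r = k - l - 2"
  define cl where "cl = real l / 4 + real (l + 3) * (real r + 4)"
  define C' where "C' = max C 0"
  define c1 where "c1 = 250 * cl ^ 3 + (C' * cl powr (\<alpha> * real l) + 1) * real (length p + 9)"
  define c2 where "c2 = 248 * (8 / \<epsilon>) ^ 3 + 30 * (8 / \<epsilon>) + 3 * (c1 + 1) + 34"
  have cl1: "0 \<le> cl" unfolding cl_def by simp
  have C0: "C \<le> C'" "0 \<le> C'" unfolding C'_def by auto
  have c1: "0 \<le> c1" unfolding c1_def using cl1 C0 by simp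
  have "outputs_within P (cnf_code n F) (if satisfiable F then 1 else 0) (real K * (c2 + 1) * 2 powr (\<epsilon> * real n))"
    if F: "cnf3 n F" for n F
  proof (cases "F = []")
    case True
    have "1 \<le> 2 powr (\<epsilon> * real n)" using e by (intro ge_one_powr_ge_zero) auto
    then have "1 * 1 \<le> (c2 + 1) * 2 powr (\<epsilon> * real n)" using c1 e by (intro mult_mono) (auto simp: c2_def)
    then have "real K * 1 \<le> real K * ((c2 + 1) * 2 powr (\<epsilon> * real n))" by (intro mult_left_mono) auto
    moreover have "outputs_within P (cnf_code n F) 1 (real K)" using PK True by blast
    moreover have "satisfiable F" using True by (simp add: satisfiable_def)
    ultimately show ?thesis using outputs_within_mono by (simp add: mult.assoc)
  next
    case False
    have n: "1 \<le> n"
    proof (rule ccontr)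
      assume "\<not> 1 \<le> n"
      moreover obtain c where "c \<in> set F" using False hd_in_set by blast
      moreover have "clause_lits c \<noteq> []" by (cases c) auto
      ultimately show False using F unfolding cnf3_def by (metis last_in_set less_one not_less not_less_zero)
    qed
    \<comment> \<open>An upper bound for the group size \<open>q\<close> at every leaf, since
      sparsification leaves at most \<open>D * n\<close> clauses.\<close>
    define Q where "Q = D * n div g + 1"
    define Z where "Z = D * n + (l + 3) * (r + 4 ^ Q)"
    define T where "T = nat \<lceil>C' * real Z powr (\<alpha> * real l)\<rceil>"
    define w where "w = nat \<lceil>2 * x ^ (10 * th * (2 * n))\<rceil>"
    interpret leaf_solver f l k g "h k" th n Z T p "clause_rel F" x
    proof
      fix q assume q: "g * q < 2 * n * (1 + th + 4 * th * th) + g"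
      then have "g * q < D * n + g" unfolding D by (simp add: algebra_simps)
      have "q \<le> Q"
      proof (cases q)
        case (Suc q')
        then have "g * q' \<le> D * n" using \<open>g * q < D * n + g\<close> by simp
        then have "q' \<le> D * n div g" using g(2) by (simp add: less_eq_div_iff_mult_less_eq mult.commute)
        then show ?thesis using Suc by (simp add: Q_def)
      qed simp
      then have "(4::nat) ^ q \<le> 4 ^ Q" by (intro power_increasing) auto
      then have "(l + 3) * (r + 4 ^ q) \<le> (l + 3) * (r + 4 ^ Q)" by (intro mult_le_mono2 add_left_mono)
      then show "(l + 3) * (k - l - 2 + 4 ^ q) \<le> Z" unfolding Z_def r_def by (rule trans_le_add2)
    next
      fix N :: nat and G :: "nat graph" assume N: "1 \<le> N" "N \<le> Z" "simple_graph G" "verts G = {..<N}"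
      obtain t pc m where t: "real t \<le> C * real N powr (\<alpha> * real l)" "(step p ^^ t) (0, nth0 ([N, k, h k] @ adj_matrix N G)) = (pc, m)"
          "length p \<le> pc" "m 0 = num_IndSub (Psi f) G k"
        using outputs_withinE[OF p[OF N(1,3,4)]] by blast
      have "C * real N powr (\<alpha> * real l) \<le> C' * real Z powr (\<alpha> * real l)"
        using N C0 al0 by (intro mult_mono powr_mono2) auto
      then have "real t \<le> C' * real Z powr (\<alpha> * real l)" using t(1) by linarith
      then have "t \<le> T" unfolding T_def by linarith
      then show "\<exists>t pc m. t \<le> T \<and> (step p ^^ t) (0, nth0 ([N, k, h k] @ adj_matrix N G)) = (pc, m) \<and> length p \<le> pc \<and>
        m 0 = num_IndSub (Psi f) G k" using t by blast
    next
      show "2 * n * (1 + th + 4 * th * th) \<le> Z" unfolding Z_def D by (simp add: algebra_simps)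
    qed (use l5 lk g n th x sym3_clause_rel[OF F] in auto)
    have w0: "2 * x ^ (10 * th * (2 * n)) \<le> real w" unfolding w_def by (rule real_nat_ceiling_ge)
    let ?T = "30 * (length F + n + 1) + ((w * (Ts + 1) + 1) + 2)"
    have out: "outputs_within P (cnf_code n F) (if satisfiable F then 1 else 0) (real (K * (length F + ?T + 1)))"
      by (rule PK[rule_format, THEN conjunct2, rule_format, OF False run_sat_com[OF _ F refl w0]])
    txt \<open>Up to a constant, the graph has at most \<open>Y\<close> vertices; the time to be achieved is \<open>u ^ 4\<close>.\<close>
    define Y where "Y = 2 powr (8 * real D * real n / real l)"
    define u where "u = 2 powr (\<epsilon> / 4 * real n)"
    have u: "1 \<le> u" "u ^ 4 = 2 powr (\<epsilon> * real n)" unfolding u_def using e by (auto simp: powr_power intro!: ge_one_powr_ge_zero)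
    have Y1: "1 \<le> Y" unfolding Y_def by (intro ge_one_powr_ge_zero) auto
    have il: "1 / real l \<le> \<alpha>" using al(3) l5 by (simp add: field_simps)
    have exY: "24 * (real D * real n / real l) \<le> \<epsilon> / 4 * real n"
    proof -
      have "24 * (real D * real n) * (1 / real l) \<le> 24 * (real D * real n) * \<alpha>" by (intro mult_left_mono il) auto
      also have "\<dots> = 96 * real D * \<alpha> * (real n / 4)" by simp
      also have "\<dots> \<le> \<epsilon> * (real n / 4)" by (intro mult_right_mono al(2)) auto
      finally show ?thesis by simp
    qed
    have Y3: "Y ^ 3 \<le> u" unfolding Y_def u_def using exY
      by (simp add: powr_power)
    have Yl: "Y powr (\<alpha> * real l) \<le> u"
    proof -
      have "8 * real D * real n / real l * (\<alpha> * real l) = 8 * real D * \<alpha> * real n" using l5 by simp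
      also have "\<dots> \<le> \<epsilon> / 4 * real n"
      proof (rule mult_right_mono)
        have "0 \<le> real D * \<alpha>" using al0 by simp
        then show "8 * real D * \<alpha> \<le> \<epsilon> / 4" using al(2) by simp
      qed simp
      finally show ?thesis unfolding Y_def u_def powr_powr by simp
    qed
    have ZY: "real Z \<le> cl * Y"
    proof -
      have "8 * real D * real n / real l \<le> 2 * Y" unfolding Y_def by (rule le_two_powr)
      then have 1: "real D * real n \<le> real l / 4 * Y" using l5 by (simp add: field_simps)
      have "real Q \<le> real (D * n) / real g + 1" unfolding Q_def using of_nat_div_le_of_nat[of "D * n" g, where ?'a = real] by simp
      also have "real (D * n) / real g \<le> 4 * real D * real n / real l"
      proof -
        have "real l \<le> 4 * real g" using g(3) by linarith
        then have "real D * real n * real l \<le> real D * real n * (4 * real g)" by (intro mult_left_mono) auto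
        then show ?thesis using g(2) l5 by (simp add: field_simps)
      qed
      \<comment> \<open>The exponent 8 in \<open>Y\<close> arises here: base 4 counts twice, and
        \<open>g\<close> is at least a quarter of \<open>l\<close>.\<close>
      finally have "2 * real Q \<le> 8 * real D * real n / real l + 2" by simp
      then have "2 powr (2 * real Q) \<le> 2 powr (8 * real D * real n / real l + 2)" by (intro powr_mono) auto
      moreover have "2 powr (2 * real Q) = 4 ^ Q"
        by (simp add: powr_powr[symmetric] powr_realpow)
      ultimately have "4 ^ Q \<le> 4 * Y" unfolding Y_def by (simp add: powr_add)
      moreover have "real r \<le> real r * Y" using Y1 by (simp add: mult_le_cancel_left1)
      ultimately have "real r + 4 ^ Q \<le> (real r + 4) * Y" by (simp add: algebra_simps)
      then have "real (l + 3) * (real r + 4 ^ Q) \<le> real (l + 3) * ((real r + 4) * Y)" by (intro mult_left_mono) auto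
      then show ?thesis using 1 unfolding Z_def cl_def by (simp add: algebra_simps)
    qed
    have Z3: "real (Z * Z * Z) \<le> cl ^ 3 * u"
    proof -
      have "real Z ^ 3 \<le> (cl * Y) ^ 3" by (intro power_mono ZY) auto
      also have "\<dots> = cl ^ 3 * Y ^ 3" by (rule power_mult_distrib)
      also have "\<dots> \<le> cl ^ 3 * u" by (intro mult_left_mono Y3) (use cl1 in auto)
      finally show ?thesis by (simp add: power3_eq_cube)
    qed
    have Tu: "real T \<le> (C' * cl powr (\<alpha> * real l) + 1) * u"
    proof -
      have "real Z powr (\<alpha> * real l) \<le> (cl * Y) powr (\<alpha> * real l)" using al0 by (intro powr_mono2 ZY) auto
      also have "\<dots> = cl powr (\<alpha> * real l) * Y powr (\<alpha> * real l)" by (simp add: powr_mult)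
      also have "\<dots> \<le> cl powr (\<alpha> * real l) * u" by (intro mult_left_mono Yl) auto
      finally have "C' * real Z powr (\<alpha> * real l) \<le> C' * (cl powr (\<alpha> * real l) * u)" by (intro mult_left_mono C0) auto
      moreover have "real T \<le> C' * real Z powr (\<alpha> * real l) + 1"
      proof -
        have "0 \<le> C' * real Z powr (\<alpha> * real l)" using C0 by simp
        then show ?thesis unfolding T_def by linarith
      qed
      ultimately show ?thesis using u(1) by (simp add: algebra_simps)
    qed
    have Tsu: "real Ts \<le> c1 * u"
    proof -
      have "real T * real (length p + 9) \<le> (C' * cl powr (\<alpha> * real l) + 1) * u * real (length p + 9)"
        by (intro mult_right_mono Tu) auto
      then show ?thesis using Z3 unfolding Ts_def c1_def by (simp add: algebra_simps)
    qed
    have wu: "real w \<le> 3 * u"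
    proof -
      have "x ^ (10 * th * (2 * n)) \<le> u" using xA[of "2 * n"] unfolding u_def by (simp add: algebra_simps)
      moreover have "0 \<le> x ^ (10 * th * (2 * n))" using x(1) by simp
      ultimately show ?thesis unfolding w_def using u(1) by linarith
    qed
    have u24: "u \<le> u ^ 4" "u ^ 2 \<le> u ^ 4" "u ^ 3 \<le> u ^ 4" "1 \<le> u ^ 4"
      using power_increasing[of 1 4 u] power_increasing[of 2 4 u] power_increasing[of 3 4 u] power_increasing[of 0 4 u] u(1) by auto
    have wTs: "real (w * (Ts + 1)) \<le> 3 * (c1 + 1) * u ^ 4"
    proof -
      have "real Ts + 1 \<le> (c1 + 1) * u" using Tsu u(1) by (simp add: algebra_simps)
      then have "real w * (real Ts + 1) \<le> (3 * u) * ((c1 + 1) * u)" by (intro mult_mono wu) (use u(1) in auto)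
      also have "\<dots> = 3 * (c1 + 1) * u ^ 2" by (simp add: power2_eq_square)
      also have "\<dots> \<le> 3 * (c1 + 1) * u ^ 4" by (intro mult_left_mono u24) (use c1 in auto)
      finally show ?thesis by (simp only: of_nat_mult of_nat_add of_nat_1)
    qed
    have nu: "real n \<le> 8 / \<epsilon> * u"
    proof -
      have "\<epsilon> / 4 * real n \<le> 2 * u" unfolding u_def by (rule le_two_powr)
      then show ?thesis using e by (simp add: field_simps)
    qed
    have n1: "real n \<le> 8 / \<epsilon> * u ^ 4"
      using nu mult_left_mono[OF u24(1), of "8 / \<epsilon>"] e by simp
    have m1: "real (length F) \<le> 8 * (8 / \<epsilon>) ^ 3 * u ^ 4"
    proof -
      have "real (length F) \<le> 8 * real n ^ 3" using length_cnf3[OF F] by (metis of_nat_le_iff of_nat_mult of_nat_numeral of_nat_power)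
      also have "\<dots> \<le> 8 * (8 / \<epsilon> * u) ^ 3" by (intro mult_left_mono power_mono nu) auto
      also have "\<dots> = 8 * (8 / \<epsilon>) ^ 3 * u ^ 3" by (simp only: power_mult_distrib mult.assoc)
      also have "\<dots> \<le> 8 * (8 / \<epsilon>) ^ 3 * u ^ 4" by (intro mult_left_mono u24) (use e in auto)
      finally show ?thesis .
    qed
    have "real (length F + ?T + 1) = 31 * real (length F) + 30 * real n + real (w * (Ts + 1)) + 34" by simp
    also have "\<dots> \<le> 31 * (8 * (8 / \<epsilon>) ^ 3 * u ^ 4) + 30 * (8 / \<epsilon> * u ^ 4) + 3 * (c1 + 1) * u ^ 4 + 34 * u ^ 4"
      using m1 n1 wTs u24(4) by linarith
    also have "\<dots> = c2 * u ^ 4" unfolding c2_def by (simp add: algebra_simps)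
    also have "\<dots> \<le> (c2 + 1) * u ^ 4" using u24(4) by (intro mult_right_mono) auto
    finally have "real K * real (length F + ?T + 1) \<le> real K * ((c2 + 1) * u ^ 4)" by (intro mult_left_mono) auto
    then have "real (K * (length F + ?T + 1)) \<le> real K * (c2 + 1) * 2 powr (\<epsilon> * real n)"
      unfolding u(2) of_nat_mult by (simp only: mult.assoc)
    with out show ?thesis by (rule outputs_within_mono)
  qed
  then show ?thesis by blast
qed

lemma IndSub_solvable_subset: "IndSub_solvable h \<Phi> K T \<Longrightarrow> K' \<subseteq> K \<Longrightarrow> IndSub_solvable h \<Phi> K' T"
  unfolding IndSub_solvable_def by blast

text \<open>\<alpha> depends only on the constant \<epsilon> of the hypothesis, through the
  sparsification constant, and so is chosen before \<open>f\<close>, \<open>h\<close> and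
  \<open>k\<close>.\<close>

lemma ETH_lower_bound:
  assumes ETH
  obtains \<alpha> :: real where "0 < \<alpha>"
    "\<And>f h k. 1 \<le> f k \<Longrightarrow> f k + 4 \<le> k \<Longrightarrow> \<not> IndSub_solvable h (Psi f) {k} (\<lambda>n k. real n powr (\<alpha> * real (f k)))"
proof -
  obtain \<epsilon> where e: "0 < \<epsilon>" "\<nexists>p C. \<forall>n F. cnf3 n F \<longrightarrow>
     outputs_within p (cnf_code n F) (if satisfiable F then 1 else 0) (C * 2 powr (\<epsilon> * real n))"
    using assms unfolding ETH_def by blast
  \<comment> \<open>There are \<open>2 * n\<close> literals, so the rate \<epsilon> / 8 yields a
    tree of size \<open>2 powr (\<epsilon> / 4 * n)\<close> up to a constant.\<close>
  obtain th :: nat and x :: real where x: "1 \<le> th" "1 \<le> x" "x ^ (4 * th * th - 1) + 1 \<le> x ^ (4 * th * th)"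
    "\<And>A. x ^ (10 * th * A) \<le> 2 powr (\<epsilon> / 8 * real A)"
    by (rule sparsification_parameters[of "\<epsilon> / 8"]) (use e in auto)
  define D where "D = 2 * (1 + th + 4 * th * th)"
  \<comment> \<open>The bound \<open>1 / 5\<close> forces \<open>5 \<le> l\<close> whenever
    \<open>\<alpha> * l\<close> is at least 1.\<close>
  define \<alpha> where "\<alpha> = min (1 / 5) (\<epsilon> / (96 * real D))"
  have "0 < D" by (simp add: D_def)
  then have D: "0 < real D" by simp
  have a: "0 < \<alpha>" "\<alpha> \<le> 1 / 5" "96 * real D * \<alpha> \<le> \<epsilon>"
  proof -
    have "\<alpha> \<le> \<epsilon> / (96 * real D)" by (simp add: \<alpha>_def)
    then show "96 * real D * \<alpha> \<le> \<epsilon>" using D by (simp add: field_simps)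
  qed (use e D in \<open>auto simp: \<alpha>_def\<close>)
  have "\<not> IndSub_solvable h (Psi f) {k} (\<lambda>n k. real n powr (\<alpha> * real (f k)))" if "1 \<le> f k" "f k + 4 \<le> k" for f h k
  proof (cases "\<alpha> * real (f k) < 1")
    case True
    then show ?thesis using no_sublinear[of f k "f k" \<alpha> h] that by blast
  next
    case False
    then show ?thesis
      using sat_from_IndSub[where f = f and k = k and l = "f k" and \<alpha> = \<alpha>, OF e(1) x D_def a(2,3) _ that(2) refl, of h] e(2) by fastforce
  qed
  with a(1) show ?thesis using that by blast
qed

theorem corollary3p7:
  "\<exists>\<alpha>::real. \<alpha> > 0 \<and>
    (\<forall>f :: nat \<Rightarrow> nat.
       (\<forall>k\<ge>1. f k \<ge> 1) \<and> mono_on {1..} f \<and>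
       (\<forall>k\<ge>6. 1 \<le> f k \<and> real (f k) \<le> (real k - 4) / 2) \<longrightarrow>
         IndSub_solvable f (Psi f) {1..} (\<lambda>n k. real k * real n ^ (f k + 3)) \<and>
         (computable_in_time f (\<lambda>k. real k * real k ^ (f k + 3)) \<longrightarrow>
            IndSub_solvable (\<lambda>_. 0) (Psi f) {1..} (\<lambda>n k. real k * real n ^ (f k + 3))) \<and>
         (ETH \<longrightarrow>
            (\<forall>h. \<not> IndSub_solvable h (Psi f) {1..} (\<lambda>n k. real n powr (\<alpha> * real (f k)))) \<and>
            (\<forall>h. \<forall>k\<ge>6. \<not> IndSub_solvable h (Psi f) {k} (\<lambda>n k. real n powr (\<alpha> * real (f k))))))"
proof -
  obtain \<alpha> :: real where a: "0 < \<alpha>"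
    "\<And>f h k. ETH \<Longrightarrow> 1 \<le> f k \<Longrightarrow> f k + 4 \<le> k \<Longrightarrow> \<not> IndSub_solvable h (Psi f) {k} (\<lambda>n k. real n powr (\<alpha> * real (f k)))"
  proof (cases ETH)
    case True
    then show ?thesis using ETH_lower_bound that by metis
  \<comment> \<open>If the hypothesis fails, nothing has to be excluded and any positive number
    serves.\<close>
  qed (use that[of 1] in auto)
  show ?thesis
  proof (intro exI[of _ \<alpha>] conjI allI impI a(1); elim conjE)
    fix f :: "nat \<Rightarrow> nat" assume f: "\<forall>k\<ge>1. 1 \<le> f k"
    show "IndSub_solvable f (Psi f) {1..} (\<lambda>n k. real k * real n ^ (f k + 3))"
      using f by (intro upper_bound_given) auto
    show "IndSub_solvable (\<lambda>_. 0) (Psi f) {1..} (\<lambda>n k. real k * real n ^ (f k + 3))"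
      if "computable_in_time f (\<lambda>k. real k * real k ^ (f k + 3))"
      using f that by (intro upper_bound_computable) auto
    assume bd: "\<forall>k\<ge>6. 1 \<le> f k \<and> real (f k) \<le> (real k - 4) / 2" and ETH
    have no: "\<not> IndSub_solvable h (Psi f) {k} (\<lambda>n k. real n powr (\<alpha> * real (f k)))" if "6 \<le> k" for h k
    proof (rule a(2)[OF \<open>ETH\<close>])
      show "1 \<le> f k" using bd that by blast
      have "real (f k) \<le> (real k - 4) / 2" using bd that by blast
      \<comment> \<open>As \<open>k - 4\<close> is positive, half of it is at most
        \<open>k - 4\<close>.\<close>
      then have "real (f k + 4) \<le> real k" by (simp add: field_simps)
      then show "f k + 4 \<le> k" by (simp only: of_nat_le_iff)
    qed
    show "\<not> IndSub_solvable h (Psi f) {k} (\<lambda>n k. real n powr (\<alpha> * real (f k)))" if "6 \<le> k" for h k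
      by (rule no[OF that])
    show "\<not> IndSub_solvable h (Psi f) {1..} (\<lambda>n k. real n powr (\<alpha> * real (f k)))" for h
      using no[of 6 h] IndSub_solvable_subset[of h "Psi f" "{1..}" _ "{6}"] by auto
  qed
qed

end
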